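(* Let $\varphi:A\to X$ be a smooth map of smooth spaces. For $k\ge2$ there is a long exact sequence $$\cdots\to H^{k-2}(X;\mathrm U(1))\xrightarrow{j\circ\varphi^*}\widehat H^{k-1}(A;\mathbb Z)\xrightarrow{\breve\imath}\widehat H^k_\varphi(X,A;\mathbb Z)\xrightarrow{\breve p}\widehat H^k(X;\mathbb Z)\xrightarrow{c\circ\varphi^*}H^k(A;\mathbb Z)\to\cdots.$$ The sequence extends to the left and to the right as the mapping cone sequence for singular cohomology with coefficients $\mathrm U(1)$ and $\mathbb Z$, respectively; i.e. it continues to the left as $\cdots\to H^{k-3}(A;\mathrm U(1))\to H^{k-2}_\varphi(X,A;\mathrm U(1))\to H^{k-2}(X;\mathrm U(1))$ and to the right as $H^k(A;\mathbb Z)\to H_\varphi^{k+1}(X,A;\mathbb Z)\to H^{k+1}(X;\mathbb Z)\to\cdots$.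
   Context: **Smooth spaces.** A differential space (Sikorski) is a topological space $X$ with a set $C^\infty(X)$ of continuous real functions such that $X$ carries the initial topology, $C^\infty(X)$ is local and closed under composition with smooth functions of several variables; forms $\Omega^*(X)$, integration over smooth singular chains and Stokes' theorem are available. A *smooth space* is a differential space for which: (i) smooth and continuous singular (co)homology agree; (ii) the de Rham theorem holds; (iii) pushing forward fundamental cycles gives an isomorphism from bordism of oriented $p$-stratifolds (in the sense of Kreck, *Differential Algebraic Topology* ) to integral smooth singular homology. Manifolds are smooth spaces. **Differential characters.** $C_n\supset Z_n$ denote smooth singular chains and cycles. For $k\ge1$, $\widehat H^k(X;\mathbb Z)$ is the abelian group of homomorphisms $h:Z_{k-1}(X;\mathbb Z)\to \mathrm U(1)$ for which there is a (unique) form $\mathrm{curv}(h)\in\Omega^k(X)$ with $h(\partial c)=\exp(2\pi i\int_c\mathrm{curv}(h))$ for all $c\in C_k(X;\mathbb Z)$; it is closed with integral periods. $c(h)\in H^k(X;\mathbb Z)$ is the class of $x\mapsto\int_x\mathrm{curv}(h)-\tilde h(\partial x)$, $\tilde h$ any real-valued homomorphism on $Z_{k-1}(X;\mathbb Z)$ with $h=\exp(2\pi i\tilde h)$. $\varphi^*h:=h\circ\varphi_*$. For $u\in H^{k-1}(X;\mathrm U(1))$, $j(u)\in\widehat H^k(X;\mathbb Z)$ is $j(u)(z):=\langle u,[z]\rangle$. **Relative differential characters.** The mapping cone complex is $C_k^\varphi(X,A;\mathbb Z):=C_k(X;\mathbb Z)\times C_{k-1}(A;\mathbb Z)$ with $\partial_\varphi(s,t):=(\partial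 s+\varphi_*t,-\partial t)$; its cycles are $Z_k^\varphi(X,A;\mathbb Z)$, and $H_\varphi^k(X,A;G)$ is its cohomology with coefficients $G$; the mapping cone sequence is the long exact cohomology sequence induced by $0\to C_*(X;\mathbb Z)\to C_*^\varphi(X,A;\mathbb Z)\to C_{*-1}(A;\mathbb Z)\to0$. For $k\ge1$, $\widehat H^k_\varphi(X,A;\mathbb Z)$ is the group of homomorphisms $f:Z_{k-1}^\varphi(X,A;\mathbb Z)\to\mathrm U(1)$ for which there is a pair $(\omega,\vartheta)\in\Omega^k(X)\times\Omega^{k-1}(A)$ with $f(\partial_\varphi(x,y))=\exp[2\pi i(\int_x\omega+\int_y\vartheta)]$ for all $(x,y)\in C_k^\varphi(X,A;\mathbb Z)$. The maps are $\breve\imath(g)(s,t):=g(t)$ and $\breve p(f)(z):=f(z,0)$. *)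

theory Defs
  imports "HOL-Analysis.Analysis" "HOL-Homology.Homology" "HOL-Combinatorics.Permutations"
begin

section \<open>Smooth functions and differential spaces\<close>

text \<open>Since the number of variables has to vary, a point of n-space is a sequence vanishing from
  index n on, as in \<^const>\<open>Euclidean_space\<close>. A function is smooth iff it is continuous and has
  all first partial derivatives, these being smooth again; the greatest such predicate is the usual
  notion of a function having continuous partial derivatives of every order. Values outside of
  \<^term>\<open>topspace (Euclidean_space n)\<close> are irrelevant.\<close>

coinductive smooth_fun :: "nat \<Rightarrow> ((nat \<Rightarrow> real) \<Rightarrow> real) \<Rightarrow> bool" for n where
  "\<lbrakk> continuous_map (Euclidean_space n) euclideanreal F;
     \<forall>i<n. \<exists>F'. smooth_fun n F' \<and>
       (\<forall>x \<in> topspace (Euclidean_space n).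
          ((\<lambda>s. F (x(i := s))) has_real_derivative F' x) (at (x i))) \<rbrakk>
   \<Longrightarrow> smooth_fun n F"

text \<open>A space together with a set of real functions. Membership of a function in \<open>dfun\<close> only
  depends on its values on the points of the space: this follows from locality.\<close>

record 'a dspace =
  dtop :: "'a topology"
  dfun :: "('a \<Rightarrow> real) set"

abbreviation points :: "'a dspace \<Rightarrow> 'a set" where
  "points X \<equiv> topspace (dtop X)"

definition initial_topology :: "'a set \<Rightarrow> ('a \<Rightarrow> real) set \<Rightarrow> 'a topology" where
  "initial_topology P G =
     topology_generated_by (insert P {{x \<in> P. g x \<in> V} | g V. g \<in> G \<and> open V})"

definition differential_space :: "'a dspace \<Rightarrow> bool" where
  "differential_space X \<longleftrightarrow>
     dtop X = initial_topology (points X) (dfun X) \<and>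
     (\<forall>f \<in> dfun X. continuous_map (dtop X) euclideanreal f) \<and>
     (\<forall>f. (\<forall>x \<in> points X. \<exists>U g. openin (dtop X) U \<and> x \<in> U \<and> g \<in> dfun X \<and> (\<forall>y\<in>U. f y = g y))
          \<longrightarrow> f \<in> dfun X) \<and>
     (\<forall>n F fs. smooth_fun n F \<and> (\<forall>i<n. fs i \<in> dfun X)
          \<longrightarrow> (\<lambda>x. F (\<lambda>i. if i < n then fs i x else 0)) \<in> dfun X)"

definition smooth_map :: "'a dspace \<Rightarrow> 'b dspace \<Rightarrow> ('a \<Rightarrow> 'b) \<Rightarrow> bool" where
  "smooth_map X Y f \<longleftrightarrow> f \<in> points X \<rightarrow> points Y \<and> (\<forall>u \<in> dfun Y. u \<circ> f \<in> dfun X)"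

definition diffeo :: "'a dspace \<Rightarrow> 'b dspace \<Rightarrow> ('a \<Rightarrow> 'b) \<Rightarrow> bool" where
  "diffeo X Y f \<longleftrightarrow> smooth_map X Y f \<and>
     (\<exists>g. smooth_map Y X g \<and> (\<forall>x\<in>points X. g (f x) = x) \<and> (\<forall>y\<in>points Y. f (g y) = y))"

text \<open>The differential structure generated by a set of functions on a set of points.\<close>

definition generated_dspace :: "'a set \<Rightarrow> ('a \<Rightarrow> real) set \<Rightarrow> 'a dspace" where
  "generated_dspace P G =
     \<lparr>dtop = initial_topology P G,
      dfun = {f. \<forall>x\<in>P. \<exists>U n F gs. openin (initial_topology P G) U \<and> x \<in> U \<and>
                   smooth_fun n F \<and> (\<forall>i<n. gs i \<in> G) \<and>
                   (\<forall>y\<in>U. f y = F (\<lambda>i. if i < n then gs i y else 0))}\<rparr>"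

definition sub_dspace :: "'a dspace \<Rightarrow> 'a set \<Rightarrow> 'a dspace" where
  "sub_dspace X S = generated_dspace S (dfun X)"

definition prod_dspace :: "'a dspace \<Rightarrow> 'b dspace \<Rightarrow> ('a \<times> 'b) dspace" where
  "prod_dspace X Y = generated_dspace (points X \<times> points Y)
     ({f \<circ> fst | f. f \<in> dfun X} \<union> {g \<circ> snd | g. g \<in> dfun Y})"

definition euclid_sub :: "nat \<Rightarrow> (nat \<Rightarrow> real) set \<Rightarrow> (nat \<Rightarrow> real) dspace" where
  "euclid_sub n S = generated_dspace S {(\<lambda>x. x i) | i. i < n}"

definition interval_dspace :: "real set \<Rightarrow> real dspace" where
  "interval_dspace I = generated_dspace I {\<lambda>t. t}"


section \<open>Chain complexes, homology and cohomology\<close>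

record 'c cplx =
  cgrp :: "int \<Rightarrow> 'c monoid"
  bd :: "int \<Rightarrow> 'c \<Rightarrow> 'c"

definition cycles :: "'c cplx \<Rightarrow> int \<Rightarrow> 'c set" where
  "cycles K n = {c \<in> carrier (cgrp K n). bd K n c = \<one>\<^bsub>cgrp K (n - 1)\<^esub>}"

definition cycle_group :: "'c cplx \<Rightarrow> int \<Rightarrow> 'c monoid" where
  "cycle_group K n = (cgrp K n)\<lparr>carrier := cycles K n\<rparr>"

definition boundaries :: "'c cplx \<Rightarrow> int \<Rightarrow> 'c set" where
  "boundaries K n = bd K (n + 1) ` carrier (cgrp K (n + 1))"

definition homology :: "'c cplx \<Rightarrow> int \<Rightarrow> 'c set monoid" where
  "homology K n = cycle_group K n Mod boundaries K n"

definition hclass :: "'c cplx \<Rightarrow> int \<Rightarrow> 'c \<Rightarrow> 'c set" where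
  "hclass K n z = boundaries K n #>\<^bsub>cgrp K n\<^esub> z"

definition hom_group :: "'c monoid \<Rightarrow> 'g monoid \<Rightarrow> ('c \<Rightarrow> 'g) monoid" where
  "hom_group C G =
     \<lparr>carrier = hom C G \<inter> extensional (carrier C),
      monoid.mult = (\<lambda>f g. \<lambda>c\<in>carrier C. f c \<otimes>\<^bsub>G\<^esub> g c),
      one = (\<lambda>c\<in>carrier C. \<one>\<^bsub>G\<^esub>)\<rparr>"

definition cochains :: "'c cplx \<Rightarrow> 'g monoid \<Rightarrow> int \<Rightarrow> ('c \<Rightarrow> 'g) monoid" where
  "cochains K G n = hom_group (cgrp K n) G"

definition cobd :: "'c cplx \<Rightarrow> int \<Rightarrow> ('c \<Rightarrow> 'g) \<Rightarrow> 'c \<Rightarrow> 'g" where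
  "cobd K n f = (\<lambda>c\<in>carrier (cgrp K (n + 1)). f (bd K (n + 1) c))"

definition cocycles :: "'c cplx \<Rightarrow> 'g monoid \<Rightarrow> int \<Rightarrow> ('c \<Rightarrow> 'g) set" where
  "cocycles K G n = {f \<in> carrier (cochains K G n). cobd K n f = \<one>\<^bsub>cochains K G (n + 1)\<^esub>}"

definition coboundaries :: "'c cplx \<Rightarrow> 'g monoid \<Rightarrow> int \<Rightarrow> ('c \<Rightarrow> 'g) set" where
  "coboundaries K G n = cobd K (n - 1) ` carrier (cochains K G (n - 1))"

definition cohomology :: "'c cplx \<Rightarrow> 'g monoid \<Rightarrow> int \<Rightarrow> ('c \<Rightarrow> 'g) set monoid" where
  "cohomology K G n = (cochains K G n)\<lparr>carrier := cocycles K G n\<rparr> Mod coboundaries K G n"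

definition cclass :: "'c cplx \<Rightarrow> 'g monoid \<Rightarrow> int \<Rightarrow> ('c \<Rightarrow> 'g) \<Rightarrow> ('c \<Rightarrow> 'g) set" where
  "cclass K G n f = coboundaries K G n #>\<^bsub>cochains K G n\<^esub> f"

text \<open>\<open>coh_pull K G n \<theta>\<close> is the map to the n-th cohomology of \<open>K\<close> induced by precomposing
  cochains with a chain map \<open>\<theta>\<close> out of \<open>K\<close> (possibly shifting degrees).\<close>

definition coh_pull ::
    "'c cplx \<Rightarrow> 'g monoid \<Rightarrow> int \<Rightarrow> ('c \<Rightarrow> 'd) \<Rightarrow> ('d \<Rightarrow> 'g) set \<Rightarrow> ('c \<Rightarrow> 'g) set" where
  "coh_pull K G n \<theta> \<alpha> =
     the_elem ((\<lambda>f. cclass K G n (\<lambda>c\<in>carrier (cgrp K n). f (\<theta> c))) ` \<alpha>)"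

definition real_group :: "real monoid" where
  "real_group = \<lparr>carrier = UNIV, monoid.mult = (+), one = 0\<rparr>"

definition U1 :: "complex monoid" where
  "U1 = \<lparr>carrier = {z. norm z = 1}, monoid.mult = (*), one = 1\<rparr>"

definition expU :: "real \<Rightarrow> complex" where
  "expU r = exp (2 * of_real pi * \<i> * of_real r)"

definition exact_at ::
    "'a monoid \<Rightarrow> ('a \<Rightarrow> 'b) \<Rightarrow> 'b monoid \<Rightarrow> ('b \<Rightarrow> 'c) \<Rightarrow> 'c monoid \<Rightarrow> bool" where
  "exact_at G f H g K \<longleftrightarrow>
     comm_group G \<and> comm_group H \<and> comm_group K \<and> f \<in> hom G H \<and> g \<in> hom H K \<and>
     f ` carrier G = kernel H K g"


section \<open>Smooth singular chains and the mapping cone\<close>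

definition smooth_simplices :: "nat \<Rightarrow> 'a dspace \<Rightarrow> ((nat \<Rightarrow> real) \<Rightarrow> 'a) set" where
  "smooth_simplices p X =
     {\<sigma>. singular_simplex p (dtop X) \<sigma> \<and> smooth_map (euclid_sub (Suc p) (standard_simplex p)) X \<sigma>}"

definition sing_cplx :: "'a topology \<Rightarrow> 'a chain cplx" where
  "sing_cplx T =
     \<lparr>cgrp = (\<lambda>n. free_Abelian_group (if n < 0 then {} else singular_simplex_set (nat n) T)),
      bd = (\<lambda>n. chain_boundary (nat n))\<rparr>"

definition smooth_cplx :: "'a dspace \<Rightarrow> 'a chain cplx" where
  "smooth_cplx X =
     \<lparr>cgrp = (\<lambda>n. free_Abelian_group (if n < 0 then {} else smooth_simplices (nat n) X)),
      bd = (\<lambda>n. chain_boundary (nat n))\<rparr>"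

definition mapping_cone :: "('b \<Rightarrow> 'a) \<Rightarrow> 'a dspace \<Rightarrow> 'b dspace \<Rightarrow> ('a chain \<times> 'b chain) cplx" where
  "mapping_cone \<phi> X A =
     \<lparr>cgrp = (\<lambda>n. cgrp (smooth_cplx X) n \<times>\<times> cgrp (smooth_cplx A) (n - 1)),
      bd = (\<lambda>n (s, t). (bd (smooth_cplx X) n s + chain_map (nat (n - 1)) \<phi> t,
                        - bd (smooth_cplx A) (n - 1) t))\<rparr>"

abbreviation H_smooth :: "'a dspace \<Rightarrow> 'g monoid \<Rightarrow> int \<Rightarrow> ('a chain \<Rightarrow> 'g) set monoid" where
  "H_smooth X G n \<equiv> cohomology (smooth_cplx X) G n"

abbreviation H_rel ::
    "('b \<Rightarrow> 'a) \<Rightarrow> 'a dspace \<Rightarrow> 'b dspace \<Rightarrow> 'g monoid \<Rightarrow> int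
      \<Rightarrow> ('a chain \<times> 'b chain \<Rightarrow> 'g) set monoid" where
  "H_rel \<phi> X A G n \<equiv> cohomology (mapping_cone \<phi> X A) G n"

text \<open>The maps of the mapping cone sequence. The connecting map is the pullback along \<open>\<phi>\<close>: extend
  a cocycle \<open>u\<close> on \<open>X\<close> by \<open>(s, t) \<mapsto> u s\<close>, whose coboundary is \<open>(s, t) \<mapsto> u (\<phi>\<^sub>* t)\<close>.\<close>

definition cone_incl ::
    "('b \<Rightarrow> 'a) \<Rightarrow> 'a dspace \<Rightarrow> 'b dspace \<Rightarrow> 'g monoid \<Rightarrow> int
      \<Rightarrow> ('b chain \<Rightarrow> 'g) set \<Rightarrow> ('a chain \<times> 'b chain \<Rightarrow> 'g) set" where
  "cone_incl \<phi> X A G n = coh_pull (mapping_cone \<phi> X A) G n snd"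

definition cone_restr ::
    "'a dspace \<Rightarrow> 'g monoid \<Rightarrow> int
      \<Rightarrow> ('a chain \<times> 'b chain \<Rightarrow> 'g) set \<Rightarrow> ('a chain \<Rightarrow> 'g) set" where
  "cone_restr X G n = coh_pull (smooth_cplx X) G n (\<lambda>s. (s, 0))"

definition space_pull ::
    "('b \<Rightarrow> 'a) \<Rightarrow> 'b dspace \<Rightarrow> 'g monoid \<Rightarrow> int \<Rightarrow> ('a chain \<Rightarrow> 'g) set \<Rightarrow> ('b chain \<Rightarrow> 'g) set" where
  "space_pull \<phi> A G n = coh_pull (smooth_cplx A) G n (chain_map (nat n) \<phi>)"


section \<open>Differential forms and integration\<close>

text \<open>Forms on a differential space are locally finite sums of expressions
  \<open>f\<^sub>0 df\<^sub>1 \<and> \<dots> \<and> df\<^sub>k\<close> with smooth functions \<open>f\<^sub>i\<close> on the space, two forms being equal iff they have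
  the same pullbacks along smooth simplices. A k-form is determined by its pullbacks along smooth
  k-simplices, and such a pullback by its coefficient with respect to \<open>dt\<^sub>1 \<and> \<dots> \<and> dt\<^sub>k\<close> on the
  interior of the standard simplex. So a k-form is encoded as the function taking \<open>\<sigma>\<close> and \<open>t\<close> to the
  coefficient at \<open>t\<close> of its pullback along \<open>\<sigma>\<close>. Here \<open>t\<^sub>1, \<dots>, t\<^sub>k\<close> are the barycentric coordinates
  other than \<open>t\<^sub>0\<close>, so that the i-th coordinate direction goes from vertex 0 to vertex i.\<close>

type_synonym 'a form = "((nat \<Rightarrow> real) \<Rightarrow> 'a) \<Rightarrow> (nat \<Rightarrow> real) \<Rightarrow> real"

definition open_simplex :: "nat \<Rightarrow> (nat \<Rightarrow> real) set" where
  "open_simplex k = {t \<in> standard_simplex k. \<forall>i\<le>k. 0 < t i}"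

definition simplex_partial :: "nat \<Rightarrow> ((nat \<Rightarrow> real) \<Rightarrow> real) \<Rightarrow> (nat \<Rightarrow> real) \<Rightarrow> real" where
  "simplex_partial i u t =
     deriv (\<lambda>s. u (\<lambda>j. t j + s * (of_bool (j = i) - of_bool (j = 0)))) 0"

text \<open>The pullback along \<open>\<sigma>\<close> of the sum, over the families \<open>fs\<close> in the list, of the expressions
  \<open>f\<^sub>0 df\<^sub>1 \<and> \<dots> \<and> df\<^sub>k\<close>, using the Leibniz formula for the determinant.\<close>

definition local_form :: "nat \<Rightarrow> (nat \<Rightarrow> 'a \<Rightarrow> real) list \<Rightarrow> 'a form" where
  "local_form k Fs \<sigma> t =
     (\<Sum>fs\<leftarrow>Fs. fs 0 (\<sigma> t) *
        (\<Sum>\<pi> | \<pi> permutes {1..k}.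
           of_int (sign \<pi>) * (\<Prod>i=1..k. simplex_partial (\<pi> i) (fs i \<circ> \<sigma>) t)))"

definition represents ::
    "'a dspace \<Rightarrow> nat \<Rightarrow> 'a set \<Rightarrow> (nat \<Rightarrow> 'a \<Rightarrow> real) list \<Rightarrow> 'a form \<Rightarrow> bool" where
  "represents X k U Fs \<omega> \<longleftrightarrow>
     openin (dtop X) U \<and> (\<forall>fs\<in>set Fs. \<forall>i\<le>k. fs i \<in> dfun X) \<and>
     (\<forall>\<sigma> \<in> smooth_simplices k X. \<forall>t \<in> open_simplex k. \<sigma> t \<in> U \<longrightarrow> \<omega> \<sigma> t = local_form k Fs \<sigma> t)"

definition forms :: "'a dspace \<Rightarrow> nat \<Rightarrow> 'a form set" where
  "forms X k =
     {\<omega>. (\<forall>\<sigma> t. \<not> (\<sigma> \<in> smooth_simplices k X \<and> t \<in> open_simplex k) \<longrightarrow> \<omega> \<sigma> t = 0) \<and>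
         (\<forall>x\<in>points X. \<exists>U Fs. x \<in> U \<and> represents X k U Fs \<omega>)}"

text \<open>The exterior derivative replaces \<open>f\<^sub>0 df\<^sub>1 \<and> \<dots> \<and> df\<^sub>k\<close> by \<open>1 df\<^sub>0 \<and> df\<^sub>1 \<and> \<dots> \<and> df\<^sub>k\<close> locally; the
  result does not depend on the local representation.\<close>

definition ext_deriv :: "'a dspace \<Rightarrow> nat \<Rightarrow> 'a form \<Rightarrow> 'a form" where
  "ext_deriv X k \<omega> \<sigma> t =
     (if \<sigma> \<in> smooth_simplices (Suc k) X \<and> t \<in> open_simplex (Suc k)
      then THE v. \<exists>U Fs. \<sigma> t \<in> U \<and> represents X k U Fs \<omega> \<and>
             v = local_form (Suc k) (map (\<lambda>fs. case_nat (\<lambda>_. 1) fs) Fs) \<sigma> t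
      else 0)"

definition closed_forms :: "'a dspace \<Rightarrow> nat \<Rightarrow> 'a form set" where
  "closed_forms X k = {\<omega> \<in> forms X k. ext_deriv X k \<omega> = (\<lambda>_ _. 0)}"

definition exact_forms :: "'a dspace \<Rightarrow> nat \<Rightarrow> 'a form set" where
  "exact_forms X k = (case k of 0 \<Rightarrow> {\<lambda>_ _. 0} | Suc m \<Rightarrow> ext_deriv X m ` forms X m)"

definition de_rham :: "'a dspace \<Rightarrow> nat \<Rightarrow> 'a form set monoid" where
  "de_rham X k =
     \<lparr>carrier = closed_forms X k, monoid.mult = (\<lambda>\<omega> \<eta> \<sigma> t. \<omega> \<sigma> t + \<eta> \<sigma> t), one = (\<lambda>_ _. 0)\<rparr>
       Mod exact_forms X k"

definition barycentric :: "nat \<Rightarrow> (nat \<Rightarrow> real) \<Rightarrow> nat \<Rightarrow> real" where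
  "barycentric k t = (\<lambda>j. if j = 0 then 1 - (\<Sum>i=1..k. t i) else if j \<le> k then t j else 0)"

definition simplex_integral :: "nat \<Rightarrow> ((nat \<Rightarrow> real) \<Rightarrow> real) \<Rightarrow> real" where
  "simplex_integral k u =
     (LINT t|Pi\<^sub>M {1..k} (\<lambda>_. lborel).
        (if barycentric k t \<in> open_simplex k then u (barycentric k t) else 0))"

definition chain_integral :: "nat \<Rightarrow> 'a form \<Rightarrow> 'a chain \<Rightarrow> real" where
  "chain_integral k \<omega> c =
     (\<Sum>\<sigma>\<in>Poly_Mapping.keys c. of_int (Poly_Mapping.lookup c \<sigma>) * simplex_integral k (\<omega> \<sigma>))"

definition integration_cochain :: "'a dspace \<Rightarrow> nat \<Rightarrow> 'a form \<Rightarrow> 'a chain \<Rightarrow> real" where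
  "integration_cochain X k \<omega> = (\<lambda>c\<in>carrier (cgrp (smooth_cplx X) (int k)). chain_integral k \<omega> c)"


section \<open>Stratifolds and bordism\<close>

text \<open>Manifolds and stratifolds are differential spaces. They are second countable and Hausdorff and
  hence have at most continuum many points, so up to diffeomorphism all of them arise with
  points in the following type, whose own topology plays no role here.\<close>

type_synonym pt = "nat \<Rightarrow> real"

definition n_space :: "nat \<Rightarrow> (nat \<Rightarrow> real) set" where
  "n_space n = {x. \<forall>i\<ge>n. x i = 0}"

text \<open>For \<open>n = 0\<close> this is a single point, so that 0-manifolds have no boundary.\<close>

definition half_space :: "nat \<Rightarrow> (nat \<Rightarrow> real) set" where
  "half_space n = {x \<in> n_space n. 0 \<le> x 0}"

definition has_chart :: "nat \<Rightarrow> (nat \<Rightarrow> real) set \<Rightarrow> pt dspace \<Rightarrow> pt \<Rightarrow> bool" where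
  "has_chart n M W x \<longleftrightarrow>
     (\<exists>U V h. openin (dtop W) U \<and> x \<in> U \<and> openin (subtopology (Euclidean_space n) M) V \<and>
        diffeo (sub_dspace W U) (euclid_sub n V) h)"

definition manifold_with_boundary :: "nat \<Rightarrow> pt dspace \<Rightarrow> bool" where
  "manifold_with_boundary n W \<longleftrightarrow>
     differential_space W \<and> Hausdorff_space (dtop W) \<and> second_countable (dtop W) \<and>
     (\<forall>x\<in>points W. has_chart n (half_space n) W x)"

definition mbd :: "nat \<Rightarrow> pt dspace \<Rightarrow> pt set" where
  "mbd n W = {x \<in> points W. \<not> has_chart n (n_space n) W x}"

definition half_open_collar :: "pt dspace \<Rightarrow> pt set \<Rightarrow> real \<Rightarrow> (pt \<times> real) dspace" where
  "half_open_collar W B \<epsilon> = prod_dspace (sub_dspace W B) (interval_dspace {0..<\<epsilon>})"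

definition collared_manifold :: "nat \<Rightarrow> pt dspace \<Rightarrow> real \<Rightarrow> (pt \<times> real \<Rightarrow> pt) \<Rightarrow> bool" where
  "collared_manifold n W \<epsilon> c \<longleftrightarrow>
     manifold_with_boundary n W \<and> 0 < \<epsilon> \<and> (\<forall>x \<in> mbd n W. c (x, 0) = x) \<and>
     openin (dtop W) (c ` (mbd n W \<times> {0..<\<epsilon>})) \<and>
     diffeo (half_open_collar W (mbd n W) \<epsilon>) (sub_dspace W (c ` (mbd n W \<times> {0..<\<epsilon>}))) c"

text \<open>A function is constant along the collar near the boundary.\<close>

definition collar_constant ::
    "pt dspace \<Rightarrow> pt set \<Rightarrow> real \<Rightarrow> (pt \<times> real \<Rightarrow> pt) \<Rightarrow> (pt \<Rightarrow> real) \<Rightarrow> bool" where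
  "collar_constant W B \<epsilon> c g \<longleftrightarrow>
     (\<forall>x\<in>B. \<exists>V \<delta>. openin (subtopology (dtop W) B) V \<and> x \<in> V \<and> 0 < \<delta> \<and> \<delta> \<le> \<epsilon> \<and>
        (\<forall>y\<in>V. \<forall>t\<in>{0..<\<delta>}. g (c (y, t)) = g y))"

text \<open>\<open>S\<close> arises from its subspace \<open>K\<close> by attaching the collared n-manifold \<open>W\<close> along the proper
  smooth map from its boundary to \<open>K\<close> that is the restriction of the canonical map \<open>q\<close> from \<open>W\<close>
  to \<open>S\<close>.\<close>

definition attaching ::
    "nat \<Rightarrow> pt dspace \<Rightarrow> pt set \<Rightarrow> pt dspace \<Rightarrow> real \<Rightarrow> (pt \<times> real \<Rightarrow> pt) \<Rightarrow> (pt \<Rightarrow> pt) \<Rightarrow> bool" where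
  "attaching n S K W \<epsilon> c q \<longleftrightarrow>
     collared_manifold n W \<epsilon> c \<and> K \<subseteq> points S \<and>
     bij_betw q (points W - mbd n W) (points S - K) \<and>
     smooth_map (sub_dspace W (mbd n W)) (sub_dspace S K) q \<and>
     (\<forall>L. compactin (dtop (sub_dspace S K)) L \<longrightarrow> compactin (dtop W) {x \<in> mbd n W. q x \<in> L}) \<and>
     (\<forall>U \<subseteq> points S. openin (dtop S) U \<longleftrightarrow>
        openin (dtop (sub_dspace S K)) (U \<inter> K) \<and> openin (dtop W) {x \<in> points W. q x \<in> U}) \<and>
     dfun S = {g. g \<in> dfun (sub_dspace S K) \<and> g \<circ> q \<in> dfun W \<and>
                  collar_constant W (mbd n W) \<epsilon> c (g \<circ> q)}"

text \<open>\<open>p_stratifold n S str\<close>: \<open>S\<close> is a (parametrized) p-stratifold of dimension \<open>n\<close> with strata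
  \<open>str 0, \<dots>, str n\<close>, obtained from a 0-manifold by successively attaching collared manifolds of
  dimension \<open>1, \<dots>, n\<close>, each of which may be empty.\<close>

primrec p_stratifold :: "nat \<Rightarrow> pt dspace \<Rightarrow> (nat \<Rightarrow> pt set) \<Rightarrow> bool" where
  "p_stratifold 0 S str \<longleftrightarrow> manifold_with_boundary 0 S \<and> str 0 = points S"
| "p_stratifold (Suc n) S str \<longleftrightarrow>
     differential_space S \<and> str (Suc n) \<subseteq> points S \<and>
     p_stratifold n (sub_dspace S (points S - str (Suc n))) str \<and>
     (\<exists>W \<epsilon> c q. attaching (Suc n) S (points S - str (Suc n)) W \<epsilon> c q)"

text \<open>Kreck's stratifolds with boundary (c-stratifolds): the boundary \<open>B\<close> has a collar, and the smooth
  functions are those which are smooth on interior and boundary and constant along the collar near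
  the boundary.\<close>

definition p_stratifold_with_boundary ::
    "nat \<Rightarrow> pt dspace \<Rightarrow> pt set \<Rightarrow> (nat \<Rightarrow> pt set) \<Rightarrow> bool" where
  "p_stratifold_with_boundary n T B str \<longleftrightarrow>
     differential_space T \<and> Hausdorff_space (dtop T) \<and> closedin (dtop T) B \<and>
     p_stratifold n (sub_dspace T (points T - B)) str \<and>
     (\<exists>str'. p_stratifold (n - 1) (sub_dspace T B) str') \<and>
     (\<exists>\<epsilon> c. 0 < \<epsilon> \<and> (\<forall>x\<in>B. c (x, 0) = x) \<and> openin (dtop T) (c ` (B \<times> {0..<\<epsilon>})) \<and>
        homeomorphic_map (dtop (half_open_collar T B \<epsilon>))
          (subtopology (dtop T) (c ` (B \<times> {0..<\<epsilon>}))) c \<and>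
        diffeo (prod_dspace (sub_dspace T B) (interval_dspace {0<..<\<epsilon>}))
          (sub_dspace T (c ` (B \<times> {0..<\<epsilon>}) - B)) c \<and>
        dfun T = {g. continuous_map (dtop T) euclideanreal g \<and>
                     g \<in> dfun (sub_dspace T (points T - B)) \<and> g \<in> dfun (sub_dspace T B) \<and>
                     collar_constant T B \<epsilon> c g})"

text \<open>An orientation of the open subset \<open>P\<close>, an n-manifold, of \<open>S\<close>: a locally consistent choice of
  generators of the local homology groups. By excision these may be computed in \<open>S\<close>.\<close>

definition orientation :: "nat \<Rightarrow> 'a topology \<Rightarrow> 'a set \<Rightarrow> ('a \<Rightarrow> 'a chain set) \<Rightarrow> bool" where
  "orientation n T P ori \<longleftrightarrow>
     (\<forall>x\<in>P. ori x \<in> carrier (relative_homology_group (int n) T (topspace T - {x})) \<and>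
        generate (relative_homology_group (int n) T (topspace T - {x})) {ori x}
          = carrier (relative_homology_group (int n) T (topspace T - {x}))) \<and>
     (\<forall>x\<in>P. \<exists>U a. openin T U \<and> x \<in> U \<and> U \<subseteq> P \<and> singular_relcycle n T (topspace T - U) a \<and>
        (\<forall>y\<in>U. ori y = homologous_rel_set n T (topspace T - {y}) a))"

text \<open>A p-stratifold is oriented if its codimension 1 stratum is empty and its top stratum is
  oriented.\<close>

definition oriented ::
    "nat \<Rightarrow> pt topology \<Rightarrow> (nat \<Rightarrow> pt set) \<Rightarrow> (pt \<Rightarrow> pt chain set) \<Rightarrow> bool" where
  "oriented n T str ori \<longleftrightarrow> (0 < n \<longrightarrow> str (n - 1) = {}) \<and> orientation n T (str n) ori"

record 'a geo =
  gspace :: "pt dspace"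
  gstrata :: "nat \<Rightarrow> pt set"
  gorient :: "pt \<Rightarrow> pt chain set"
  gmap :: "pt \<Rightarrow> 'a"

definition geo_cycles :: "'a dspace \<Rightarrow> nat \<Rightarrow> 'a geo set" where
  "geo_cycles X n =
     {M. p_stratifold n (gspace M) (gstrata M) \<and> compact_space (dtop (gspace M)) \<and>
         oriented n (dtop (gspace M)) (gstrata M) (gorient M) \<and> smooth_map (gspace M) X (gmap M)}"

text \<open>Smooth cycles representing the fundamental class, i.e. the class restricting to the
  orientation at every point of the top stratum.\<close>

definition fundamental_cycle :: "nat \<Rightarrow> 'a geo \<Rightarrow> pt chain \<Rightarrow> bool" where
  "fundamental_cycle n M z \<longleftrightarrow>
     z \<in> cycles (smooth_cplx (gspace M)) (int n) \<and>
     (\<forall>x \<in> gstrata M n.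
        homologous_rel_set n (dtop (gspace M)) (points (gspace M) - {x}) z = gorient M x)"

text \<open>\<open>T\<close> is a bordism with boundary \<open>M\<^sub>0 - M\<^sub>1\<close>, and \<open>G\<close> extends the given maps. The compatibility of
  orientations is expressed by the fundamental chain \<open>w\<close> of \<open>T\<close>.\<close>

definition bordant :: "'a dspace \<Rightarrow> nat \<Rightarrow> 'a geo \<Rightarrow> 'a geo \<Rightarrow> bool" where
  "bordant X n M0 M1 \<longleftrightarrow>
     (\<exists>T B str ori e0 e1 G z0 z1 w.
        p_stratifold_with_boundary (Suc n) T B str \<and> compact_space (dtop T) \<and>
        oriented (Suc n) (dtop T) str ori \<and>
        e0 ` points (gspace M0) \<union> e1 ` points (gspace M1) = B \<and>
        e0 ` points (gspace M0) \<inter> e1 ` points (gspace M1) = {} \<and>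
        diffeo (gspace M0) (sub_dspace T (e0 ` points (gspace M0))) e0 \<and>
        diffeo (gspace M1) (sub_dspace T (e1 ` points (gspace M1))) e1 \<and>
        smooth_map T X G \<and>
        (\<forall>x\<in>points (gspace M0). G (e0 x) = gmap M0 x) \<and>
        (\<forall>x\<in>points (gspace M1). G (e1 x) = gmap M1 x) \<and>
        fundamental_cycle n M0 z0 \<and> fundamental_cycle n M1 z1 \<and>
        singular_chain (Suc n) (dtop T) w \<and>
        (\<forall>x \<in> str (Suc n). homologous_rel_set (Suc n) (dtop T) (points T - {x}) w = ori x) \<and>
        chain_boundary (Suc n) w = chain_map n e0 z0 - chain_map n e1 z1)"

definition disjoint_union :: "nat \<Rightarrow> 'a geo \<Rightarrow> 'a geo \<Rightarrow> 'a geo \<Rightarrow> bool" where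
  "disjoint_union n D M0 M1 \<longleftrightarrow>
     (\<exists>i0 i1 z0 z1.
        openin (dtop (gspace D)) (i0 ` points (gspace M0)) \<and>
        openin (dtop (gspace D)) (i1 ` points (gspace M1)) \<and>
        i0 ` points (gspace M0) \<union> i1 ` points (gspace M1) = points (gspace D) \<and>
        i0 ` points (gspace M0) \<inter> i1 ` points (gspace M1) = {} \<and>
        diffeo (gspace M0) (sub_dspace (gspace D) (i0 ` points (gspace M0))) i0 \<and>
        diffeo (gspace M1) (sub_dspace (gspace D) (i1 ` points (gspace M1))) i1 \<and>
        (\<forall>x\<in>points (gspace M0). gmap D (i0 x) = gmap M0 x) \<and>
        (\<forall>x\<in>points (gspace M1). gmap D (i1 x) = gmap M1 x) \<and>
        fundamental_cycle n M0 z0 \<and> fundamental_cycle n M1 z1 \<and>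
        fundamental_cycle n D (chain_map n i0 z0 + chain_map n i1 z1))"

definition bordism_group :: "'a dspace \<Rightarrow> nat \<Rightarrow> 'a geo set monoid" where
  "bordism_group X n =
     \<lparr>carrier = geo_cycles X n //
        {(M, N). M \<in> geo_cycles X n \<and> N \<in> geo_cycles X n \<and> bordant X n M N},
      monoid.mult = (\<lambda>a b. {N \<in> geo_cycles X n. \<exists>M0\<in>a. \<exists>M1\<in>b. \<exists>D\<in>geo_cycles X n.
                       disjoint_union n D M0 M1 \<and> bordant X n D N}),
      one = {N \<in> geo_cycles X n. \<exists>M\<in>geo_cycles X n. points (gspace M) = {} \<and> bordant X n M N}\<rparr>"

definition push_fundamental :: "'a dspace \<Rightarrow> nat \<Rightarrow> 'a geo set \<Rightarrow> 'a chain set" where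
  "push_fundamental X n \<beta> =
     (THE \<alpha>. \<exists>M\<in>\<beta>. \<exists>z. fundamental_cycle n M z \<and>
        \<alpha> = hclass (smooth_cplx X) (int n) (chain_map n (gmap M) z))"


section \<open>Smooth spaces\<close>

definition smooth_singular_agrees :: "'a dspace \<Rightarrow> bool" where
  "smooth_singular_agrees X \<longleftrightarrow>
     (\<forall>n::nat. (\<lambda>\<alpha>. the_elem ((\<lambda>z. homologous_rel_set n (dtop X) {} z) ` \<alpha>))
        \<in> iso (homology (smooth_cplx X) (int n)) (homology_group (int n) (dtop X))) \<and>
     (\<forall>n. coh_pull (smooth_cplx X) integer_group n (\<lambda>c. c)
        \<in> iso (cohomology (sing_cplx (dtop X)) integer_group n)
              (cohomology (smooth_cplx X) integer_group n)) \<and>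
     (\<forall>n. coh_pull (smooth_cplx X) real_group n (\<lambda>c. c)
        \<in> iso (cohomology (sing_cplx (dtop X)) real_group n)
              (cohomology (smooth_cplx X) real_group n)) \<and>
     (\<forall>n. coh_pull (smooth_cplx X) U1 n (\<lambda>c. c)
        \<in> iso (cohomology (sing_cplx (dtop X)) U1 n) (cohomology (smooth_cplx X) U1 n))"

text \<open>Integration is a morphism of cochain complexes, by Stokes' theorem, and induces
  isomorphisms in cohomology.\<close>

definition de_rham_theorem :: "'a dspace \<Rightarrow> bool" where
  "de_rham_theorem X \<longleftrightarrow>
     (\<forall>k. \<forall>\<omega> \<in> forms X k. \<forall>c \<in> carrier (cgrp (smooth_cplx X) (int (Suc k))).
        chain_integral (Suc k) (ext_deriv X k \<omega>) c = chain_integral k \<omega> (chain_boundary (Suc k) c)) \<and>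
     (\<forall>k. (\<lambda>a. the_elem ((\<lambda>\<omega>. cclass (smooth_cplx X) real_group (int k)
                               (integration_cochain X k \<omega>)) ` a))
        \<in> iso (de_rham X k) (cohomology (smooth_cplx X) real_group (int k)))"

definition smooth_space :: "'a dspace \<Rightarrow> bool" where
  "smooth_space X \<longleftrightarrow>
     differential_space X \<and> smooth_singular_agrees X \<and> de_rham_theorem X \<and>
     (\<forall>n. push_fundamental X n \<in> iso (bordism_group X n) (homology (smooth_cplx X) (int n)))"


section \<open>Differential characters\<close>

definition is_curv :: "'a dspace \<Rightarrow> int \<Rightarrow> ('a chain \<Rightarrow> complex) \<Rightarrow> 'a form \<Rightarrow> bool" where
  "is_curv X k h \<omega> \<longleftrightarrow> \<omega> \<in> forms X (nat k) \<and>
     (\<forall>c \<in> carrier (cgrp (smooth_cplx X) k).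
        h (bd (smooth_cplx X) k c) = expU (chain_integral (nat k) \<omega> c))"

definition diff_char :: "'a dspace \<Rightarrow> int \<Rightarrow> ('a chain \<Rightarrow> complex) monoid" where
  "diff_char X k = (hom_group (cycle_group (smooth_cplx X) (k - 1)) U1)
     \<lparr>carrier := {h \<in> carrier (hom_group (cycle_group (smooth_cplx X) (k - 1)) U1).
                    \<exists>\<omega>. is_curv X k h \<omega>}\<rparr>"

definition curv :: "'a dspace \<Rightarrow> int \<Rightarrow> ('a chain \<Rightarrow> complex) \<Rightarrow> 'a form" where
  "curv X k h = (THE \<omega>. is_curv X k h \<omega>)"

text \<open>The characteristic class. The real lift \<open>h'\<close> of \<open>h\<close> is arbitrary, and \<open>\<mu>\<close> is the resulting
  integral cochain.\<close>

definition char_class :: "'a dspace \<Rightarrow> int \<Rightarrow> ('a chain \<Rightarrow> complex) \<Rightarrow> ('a chain \<Rightarrow> int) set" where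
  "char_class X k h =
     (THE \<alpha>. \<exists>h' \<mu>. h' \<in> hom (cycle_group (smooth_cplx X) (k - 1)) real_group \<and>
        (\<forall>z \<in> cycles (smooth_cplx X) (k - 1). h z = expU (h' z)) \<and>
        \<mu> \<in> carrier (cochains (smooth_cplx X) integer_group k) \<and>
        (\<forall>x \<in> carrier (cgrp (smooth_cplx X) k).
           of_int (\<mu> x) = chain_integral (nat k) (curv X k h) x - h' (bd (smooth_cplx X) k x)) \<and>
        \<alpha> = cclass (smooth_cplx X) integer_group k \<mu>)"

definition char_pull ::
    "('b \<Rightarrow> 'a) \<Rightarrow> 'b dspace \<Rightarrow> int \<Rightarrow> ('a chain \<Rightarrow> complex) \<Rightarrow> 'b chain \<Rightarrow> complex" where
  "char_pull \<phi> A k h = (\<lambda>z\<in>cycles (smooth_cplx A) (k - 1). h (chain_map (nat (k - 1)) \<phi> z))"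

text \<open>The class \<open>u\<close> has degree \<open>k - 1\<close>; it is evaluated on cycles through any representing
  cocycle.\<close>

definition flat_incl :: "'a dspace \<Rightarrow> int \<Rightarrow> ('a chain \<Rightarrow> complex) set \<Rightarrow> 'a chain \<Rightarrow> complex" where
  "flat_incl X k u = the_elem ((\<lambda>f. \<lambda>z\<in>cycles (smooth_cplx X) (k - 1). f z) ` u)"

definition rel_diff_char ::
    "('b \<Rightarrow> 'a) \<Rightarrow> 'a dspace \<Rightarrow> 'b dspace \<Rightarrow> int \<Rightarrow> ('a chain \<times> 'b chain \<Rightarrow> complex) monoid" where
  "rel_diff_char \<phi> X A k = (hom_group (cycle_group (mapping_cone \<phi> X A) (k - 1)) U1)
     \<lparr>carrier := {f \<in> carrier (hom_group (cycle_group (mapping_cone \<phi> X A) (k - 1)) U1).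
        \<exists>\<omega> \<in> forms X (nat k). \<exists>\<theta> \<in> forms A (nat (k - 1)).
          \<forall>(x, y) \<in> carrier (cgrp (mapping_cone \<phi> X A) k).
            f (bd (mapping_cone \<phi> X A) k (x, y))
              = expU (chain_integral (nat k) \<omega> x + chain_integral (nat (k - 1)) \<theta> y)}\<rparr>"

definition i_map ::
    "('b \<Rightarrow> 'a) \<Rightarrow> 'a dspace \<Rightarrow> 'b dspace \<Rightarrow> int
      \<Rightarrow> ('b chain \<Rightarrow> complex) \<Rightarrow> 'a chain \<times> 'b chain \<Rightarrow> complex" where
  "i_map \<phi> X A k g = (\<lambda>(s, t)\<in>cycles (mapping_cone \<phi> X A) (k - 1). g t)"

definition p_map ::
    "'a dspace \<Rightarrow> int \<Rightarrow> ('a chain \<times> 'b chain \<Rightarrow> complex) \<Rightarrow> 'a chain \<Rightarrow> complex" where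
  "p_map X k f = (\<lambda>z\<in>cycles (smooth_cplx X) (k - 1). f (z, 0))"

end

theory Submission imports Defs
begin

text \<open>Exactness of the mapping cone sequence is a diagram chase with cocycles. In the middle part,
  the inclusions of images in kernels are computations on cycles. For the converse inclusions one
  prescribes a character on a subgroup of cycles, checks that it is consistent with the relations and
  extends it to all cycles, the group \<open>U(1)\<close> being divisible. At the absolute characters of \<open>X\<close> one
  first needs a form on \<open>A\<close> integrating to a lift of the pulled back character; it exists by the
  de Rham theorem, since the vanishing of the characteristic class makes the curvature exact and lets
  the remaining real cocycle be represented by a closed form. Surjectivity of the characteristic class
  is again the de Rham theorem.

  Closedness and uniqueness of the curvature rest on one observation: if a cochain of the form
  \<open>c \<mapsto> \<integral>\<^sub>c \<eta> - \<integral>\<^bsub>\<partial>c\<^esub> \<theta>\<close> takes only integer values then it vanishes, because it depends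
  continuously on a simplex and degenerates to 0 when the simplex is contracted to a vertex.\<close>

section \<open>Smooth functions of several variables\<close>

text \<open>A form is known only through its pullbacks to smooth simplices; there are no charts or
  tangent vectors to compute with. Affine simplices inside a given simplex replace them. The
  integral over such a simplex, divided by the k-th power of its size, tends to a positive multiple
  of the coefficient at the limit point, so integrals determine a form. Small affine simplices also
  isolate any k of the available directions, which shows that the exterior derivative does not
  depend on the local expression. Exterior derivative, curvature and characteristic class are
  definite descriptions, and these two facts make them usable.

  Pullbacks are recorded on open simplices, where they could a priori be unbounded; so their local
  continuous extension to the boundary comes before any statement about integrals.

  Contraction to a vertex kills integrals of forms of positive degree, whereas a 0-form keeps its
  value at the vertex. Comparing a k-form on chains with a (k - 1)-form on their boundaries is
  therefore restricted to k \<ge> 2, the range of the theorem.\<close>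

lemma topspace_Euclidean_space_n_space: "topspace (Euclidean_space n) = n_space n"
  by (simp add: topspace_Euclidean_space n_space_def)

lemma continuous_map_Euclidean_space_real:
  "continuous_map (Euclidean_space n) euclideanreal F \<longleftrightarrow> continuous_on (n_space n) F"
  by (simp add: Euclidean_space_def n_space_def euclidean_product_topology)

lemma smooth_fun_continuous_on: "smooth_fun n F \<Longrightarrow> continuous_on (n_space n) F"
  by (erule smooth_fun.cases) (simp add: continuous_map_Euclidean_space_real)

lemma smooth_fun_partialsE:
  assumes "smooth_fun n F"
  obtains P where "\<And>i. i < n \<Longrightarrow> smooth_fun n (P i)"
    "\<And>i x. \<lbrakk>i < n; x \<in> n_space n\<rbrakk>
       \<Longrightarrow> ((\<lambda>s. F (x(i := s))) has_real_derivative P i x) (at (x i))"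
proof -
  have "\<forall>i<n. \<exists>F'. smooth_fun n F' \<and>
       (\<forall>x \<in> n_space n. ((\<lambda>s. F (x(i := s))) has_real_derivative F' x) (at (x i)))"
    using assms by (rule smooth_fun.cases) (simp add: topspace_Euclidean_space_n_space)
  then show ?thesis
    using that by metis
qed

text \<open>Closure properties of smooth functions are proved by exhibiting a class \<open>R\<close>
  of continuous functions that is stable under partial derivatives, built from functions already
  known to be smooth.\<close>

lemma smooth_fun_coinduct:
  assumes "R F"
    and cont: "\<And>F. R F \<Longrightarrow> continuous_on (n_space n) F"
    and partials: "\<And>F i. \<lbrakk>R F; i < n\<rbrakk> \<Longrightarrow> \<exists>F'. R F' \<and>
      (\<forall>x\<in>n_space n. ((\<lambda>s. F (x(i := s))) has_real_derivative F' x) (at (x i)))"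
  shows "smooth_fun n F"
  using assms(1)
proof (coinduction arbitrary: F rule: smooth_fun.coinduct)
  case smooth_fun
  then show ?case
    using cont[OF smooth_fun] partials[OF smooth_fun]
    by (auto simp: continuous_map_Euclidean_space_real topspace_Euclidean_space_n_space)
qed

lemma continuous_on_coordinate: "continuous_on S (\<lambda>x :: nat \<Rightarrow> real. x i)"
  by (rule continuous_on_subset[OF continuous_on_product_coordinates]) simp

lemma n_space_upd: "\<lbrakk>x \<in> n_space n; i < n\<rbrakk> \<Longrightarrow> x(i := s) \<in> n_space n"
  by (auto simp: n_space_def)

lemma n_space_line: "\<lbrakk>x \<in> n_space n; w \<in> n_space n\<rbrakk> \<Longrightarrow> (\<lambda>i. x i + s * w i) \<in> n_space n"
  by (auto simp: n_space_def)

lemma smooth_fun_const: "smooth_fun n (\<lambda>_. c)"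
proof (rule smooth_fun_coinduct[where R = "\<lambda>F. \<exists>c. F = (\<lambda>_. c)"])
  show "\<exists>F'. (\<exists>c. F' = (\<lambda>_. c)) \<and> (\<forall>x\<in>n_space n. ((\<lambda>s. F (x(i := s))) has_real_derivative F' x) (at (x i)))"
    if "\<exists>c. F = (\<lambda>_. c)" for F :: "(nat \<Rightarrow> real) \<Rightarrow> real" and i
    using that by (intro exI[of _ "\<lambda>_. 0"]) auto
qed auto

lemma smooth_fun_lincomb:
  assumes "smooth_fun n F" "smooth_fun n G"
  shows "smooth_fun n (\<lambda>x. a * F x + b * G x)"
proof (rule smooth_fun_coinduct[where
      R = "\<lambda>H. \<exists>F G. smooth_fun n F \<and> smooth_fun n G \<and> H = (\<lambda>x. a * F x + b * G x)"])
  fix H i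
  assume "\<exists>F G. smooth_fun n F \<and> smooth_fun n G \<and> H = (\<lambda>x. a * F x + b * G x)" and "i < n"
  then obtain F G where F: "smooth_fun n F" and G: "smooth_fun n G" and H: "H = (\<lambda>x. a * F x + b * G x)"
    by blast
  obtain P where P: "\<And>i. i < n \<Longrightarrow> smooth_fun n (P i)"
    "\<And>i x. \<lbrakk>i < n; x \<in> n_space n\<rbrakk> \<Longrightarrow> ((\<lambda>s. F (x(i := s))) has_real_derivative P i x) (at (x i))"
    using smooth_fun_partialsE[OF F] by blast
  obtain Q where Q: "\<And>i. i < n \<Longrightarrow> smooth_fun n (Q i)"
    "\<And>i x. \<lbrakk>i < n; x \<in> n_space n\<rbrakk> \<Longrightarrow> ((\<lambda>s. G (x(i := s))) has_real_derivative Q i x) (at (x i))"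
    using smooth_fun_partialsE[OF G] by blast
  have "((\<lambda>s. H (x(i := s))) has_real_derivative a * P i x + b * Q i x) (at (x i))"
    if "x \<in> n_space n" for x
    unfolding H by (intro DERIV_add DERIV_cmult P Q \<open>i < n\<close> that)
  with P(1)[OF \<open>i < n\<close>] Q(1)[OF \<open>i < n\<close>]
  show "\<exists>F'. (\<exists>F G. smooth_fun n F \<and> smooth_fun n G \<and> F' = (\<lambda>x. a * F x + b * G x)) \<and>
      (\<forall>x\<in>n_space n. ((\<lambda>s. H (x(i := s))) has_real_derivative F' x) (at (x i)))"
    by blast
qed (use assms smooth_fun_continuous_on in \<open>auto intro!: continuous_intros\<close>)

lemma smooth_fun_sum:
  assumes "\<And>i. i \<in> I \<Longrightarrow> smooth_fun n (F i)"
  shows "smooth_fun n (\<lambda>x. \<Sum>i\<in>I. c i * F i x)"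
  using assms
proof (induction I rule: infinite_finite_induct)
  case (insert i I)
  then show ?case
    using smooth_fun_lincomb[of n "F i" "\<lambda>x. \<Sum>i\<in>I. c i * F i x" "c i" 1] by simp
qed (auto intro: smooth_fun_const)

text \<open>Partial derivatives at a point of \<open>n_space n\<close> vary only coordinates below
  \<open>n\<close> and never leave \<open>n_space n\<close>, so values elsewhere have no
  influence.\<close>

lemma smooth_fun_cong:
  assumes "smooth_fun n F" "\<And>x. x \<in> n_space n \<Longrightarrow> F x = G x"
  shows "smooth_fun n G"
proof (rule smooth_fun_coinduct[where
      R = "\<lambda>G. \<exists>F. smooth_fun n F \<and> (\<forall>x\<in>n_space n. F x = G x)"])
  fix G i
  assume "\<exists>F. smooth_fun n F \<and> (\<forall>x\<in>n_space n. F x = G x)" and i: "i < n"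
  then obtain F where F: "smooth_fun n F" and eq: "\<And>x. x \<in> n_space n \<Longrightarrow> F x = G x"
    by blast
  obtain P where P: "\<And>i. i < n \<Longrightarrow> smooth_fun n (P i)"
    "\<And>i x. \<lbrakk>i < n; x \<in> n_space n\<rbrakk> \<Longrightarrow> ((\<lambda>s. F (x(i := s))) has_real_derivative P i x) (at (x i))"
    using smooth_fun_partialsE[OF F] by blast
  have "((\<lambda>s. G (x(i := s))) has_real_derivative P i x) (at (x i))" if "x \<in> n_space n" for x
    using P(2)[OF i that] by (simp add: eq n_space_upd[OF that i])
  with P(1)[OF i] show "\<exists>F'. (\<exists>F. smooth_fun n F \<and> (\<forall>x\<in>n_space n. F x = F' x)) \<and>
      (\<forall>x\<in>n_space n. ((\<lambda>s. G (x(i := s))) has_real_derivative F' x) (at (x i)))"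
    by blast
next
  show "continuous_on (n_space n) G" if "\<exists>F. smooth_fun n F \<and> (\<forall>x\<in>n_space n. F x = G x)" for G
    using that smooth_fun_continuous_on continuous_on_cong by (metis (no_types, lifting))
qed (use assms in blast)

text \<open>Chain rule along the diagonal. Continuity is demanded of one of the two partial
  derivatives, which already gives total differentiability; in the induction that follows, the other
  one is the sum provided by the induction hypothesis.\<close>

lemma has_real_derivative_diagonal:
  fixes G :: "real \<Rightarrow> real \<Rightarrow> real"
  assumes Ga: "\<And>a b. ((\<lambda>a. G a b) has_real_derivative Ga a b) (at a)"
    and Gb: "\<And>a b. ((\<lambda>b. G a b) has_real_derivative Gb a b) (at b)"
    and cont: "continuous_on UNIV (\<lambda>(a, b). Gb a b)"
  shows "((\<lambda>s. G s s) has_real_derivative Ga s s + Gb s s) (at s)"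
proof -
  have "((\<lambda>(x, y). G x y) has_derivative (\<lambda>(tx, ty). tx * Ga s s + blinfun_apply (blinfun_scaleR_left (Gb s s)) ty))
          (at (s, s) within UNIV \<times> UNIV)"
  proof (rule has_derivative_partialsI[where fy = "\<lambda>x y. blinfun_scaleR_left (Gb x y)"])
    show "((\<lambda>x. G x s) has_derivative (\<lambda>tx. tx * Ga s s)) (at s within UNIV)"
      using Ga[of s s] by (simp add: has_field_derivative_def mult_commute_abs)
    show "((\<lambda>y. G x y) has_derivative blinfun_apply (blinfun_scaleR_left (Gb x y))) (at y within UNIV)" for x y
      using Gb[of x y] by (simp add: has_field_derivative_def mult_commute_abs)
    have "continuous_on UNIV (\<lambda>(x, y). blinfun_scaleR_left (Gb x y) :: real \<Rightarrow>\<^sub>L real)"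
      using continuous_on_compose2[OF linear_continuous_on[OF bounded_linear_blinfun_scaleR_left] cont subset_UNIV]
      by (simp add: case_prod_unfold)
    then show "continuous (at (s, s) within UNIV \<times> UNIV)
        (\<lambda>(x, y). blinfun_scaleR_left (Gb x y) :: real \<Rightarrow>\<^sub>L real)"
      by (simp add: continuous_on_eq_continuous_within)
  qed auto
  then have D: "((\<lambda>(x, y). G x y) has_derivative (\<lambda>(tx, ty). tx * Ga s s + ty * Gb s s)) (at (s, s))"
    by simp
  have "((\<lambda>s. (s, s)) has_derivative (\<lambda>t. (t, t))) (at s)"
    by (intro derivative_intros)
  from has_derivative_compose[OF this D]
  have "((\<lambda>s. G s s) has_derivative (\<lambda>t. t * Ga s s + t * Gb s s)) (at s)"
    by simp
  moreover have "(\<lambda>t. t * Ga s s + t * Gb s s) = (*) (Ga s s + Gb s s)"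
    by (simp add: fun_eq_iff algebra_simps)
  ultimately show ?thesis
    by (simp only: has_field_derivative_def)
qed

definition dirderiv :: "((nat \<Rightarrow> real) \<Rightarrow> real) \<Rightarrow> (nat \<Rightarrow> real) \<Rightarrow> (nat \<Rightarrow> real) \<Rightarrow> real" where
  "dirderiv F w x = deriv (\<lambda>s. F (\<lambda>i. x i + s * w i)) 0"

text \<open>Coordinates are added to the direction one by one. The direction splits into its part
  \<open>w'\<close> below \<open>m\<close> and its part \<open>e\<close> on the m-th axis; moving
  along both with the same parameter is the diagonal of a function of two parameters.\<close>

lemma smooth_fun_directional_aux:
  assumes P: "\<And>i. i < n \<Longrightarrow> continuous_on (n_space n) (P i)"
    "\<And>i x. \<lbrakk>i < n; x \<in> n_space n\<rbrakk> \<Longrightarrow> ((\<lambda>s. F (x(i := s))) has_real_derivative P i x) (at (x i))"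
    and "m \<le> n" "x \<in> n_space n" "\<And>i. m \<le> i \<Longrightarrow> w i = 0"
  shows "((\<lambda>s. F (\<lambda>i. x i + s * w i)) has_real_derivative (\<Sum>i<m. w i * P i (\<lambda>j. x j + s * w j))) (at s)"
  using assms(3-)
proof (induction m arbitrary: x w s)
  case 0
  then show ?case by simp
next
  case (Suc m)
  define w' where "w' = w(m := 0)"
  define e where "e = (\<lambda>i. if i = m then w m else 0)"
  define y where "y = (\<lambda>a b i. x i + a * w' i + b * e i)"
  have w: "w i = w' i + e i" for i
    by (simp add: w'_def e_def)
  have y: "y a b \<in> n_space n" for a b
    using Suc.prems by (auto simp: y_def w'_def e_def n_space_def)
  have diag: "y s s = (\<lambda>i. x i + s * w i)" for s
    by (auto simp: y_def w algebra_simps)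
  have ya: "y a b = (\<lambda>i. (x i + b * e i) + a * w' i)" for a b
    by (auto simp: y_def)
  have "((\<lambda>s. F (y s s)) has_real_derivative (\<Sum>i<m. w' i * P i (y s s)) + w m * P m (y s s)) (at s)"
  proof (rule has_real_derivative_diagonal[where G = "\<lambda>a b. F (y a b)" and
        Ga = "\<lambda>a b. \<Sum>i<m. w' i * P i (y a b)" and Gb = "\<lambda>a b. w m * P m (y a b)"])
    show "((\<lambda>a. F (y a b)) has_real_derivative (\<Sum>i<m. w' i * P i (y a b))) (at a)" for a b
      unfolding ya
      by (rule Suc.IH) (use Suc.prems in \<open>auto simp: e_def w'_def n_space_def\<close>)
    show "((\<lambda>b. F (y a b)) has_real_derivative w m * P m (y a b)) (at b)" for a b
    proof -
      have 1: "(y a b)(m := x m + c * w m) = y a c" for c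
        by (auto simp: y_def e_def w'_def)
      have 2: "y a b m = x m + b * w m"
        by (simp add: y_def e_def w'_def)
      have D: "((\<lambda>s. F ((y a b)(m := s))) has_real_derivative P m (y a b)) (at (x m + b * w m))"
        using P(2)[of m "y a b"] Suc.prems y 2 by simp
      have "((\<lambda>c. F ((y a b)(m := x m + c * w m))) has_real_derivative P m (y a b) * w m) (at b)"
        by (rule DERIV_chain2[where f = "\<lambda>s. F ((y a b)(m := s))" and g = "\<lambda>c. x m + c * w m", OF D]) (auto intro!: derivative_eq_intros)
      then show ?thesis
        by (simp add: 1 mult.commute)
    qed
    have "continuous_on UNIV (\<lambda>p. P m (y (fst p) (snd p)))"
    proof (rule continuous_on_compose2[OF P(1)])
      show "continuous_on UNIV (\<lambda>p. y (fst p) (snd p))"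
        unfolding y_def by (intro continuous_intros)
    qed (use Suc.prems y in auto)
    then show "continuous_on UNIV (\<lambda>(a, b). w m * P m (y a b))"
      by (auto simp: case_prod_unfold intro!: continuous_intros)
  qed
  moreover have "(\<Sum>i<m. w' i * P i z) = (\<Sum>i<m. w i * P i z)" for z
    by (rule sum.cong) (auto simp: w'_def)
  ultimately show ?case
    by (simp add: diag)
qed

text \<open>On \<open>n_space n\<close> a directional derivative is a linear combination of partial
  derivatives with constant coefficients, hence smooth again. Directions tangent to a simplex are
  not coordinate directions, so directional derivatives have to be available to all orders.\<close>

lemma
  assumes F: "smooth_fun n F" and w: "w \<in> n_space n"
  shows smooth_fun_dirderiv: "smooth_fun n (dirderiv F w)"
    and smooth_fun_has_dirderiv:
      "x \<in> n_space n \<Longrightarrow> ((\<lambda>s. F (\<lambda>i. x i + s * w i)) has_real_derivative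
         dirderiv F w (\<lambda>i. x i + s * w i)) (at s)"
proof -
  obtain P where P: "\<And>i. i < n \<Longrightarrow> smooth_fun n (P i)"
    "\<And>i x. \<lbrakk>i < n; x \<in> n_space n\<rbrakk> \<Longrightarrow> ((\<lambda>s. F (x(i := s))) has_real_derivative P i x) (at (x i))"
    using smooth_fun_partialsE[OF F] by blast
  have D: "((\<lambda>s. F (\<lambda>i. x i + s * w i)) has_real_derivative (\<Sum>i<n. w i * P i (\<lambda>j. x j + s * w j))) (at s)"
    if "x \<in> n_space n" for x s
    by (rule smooth_fun_directional_aux[where n = n])
      (use P(2) that w smooth_fun_continuous_on[OF P(1)] in \<open>simp_all add: n_space_def[of n] del: fun_upd_apply\<close>)
  have eq: "(\<Sum>i<n. w i * P i x) = dirderiv F w x" if "x \<in> n_space n" for x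
    using DERIV_imp_deriv[OF D[OF that, of 0]] by (simp add: dirderiv_def)
  show "smooth_fun n (dirderiv F w)"
    by (rule smooth_fun_cong[OF smooth_fun_sum[of "{..<n}" n P w]]) (auto simp: P eq)
  show "((\<lambda>s. F (\<lambda>i. x i + s * w i)) has_real_derivative
         dirderiv F w (\<lambda>i. x i + s * w i)) (at s)" if "x \<in> n_space n"
    using D[OF that, of s] by (simp add: eq[OF n_space_line[OF that w]])
qed

text \<open>Schwarz's theorem from the second difference
  \<open>f h h - f h 0 - f 0 h + f 0 0\<close>. The mean value theorem, applied twice in either
  order, writes it as the square of h times either mixed derivative at some point of the open
  square; let h tend to 0.\<close>

lemma mixed_partials_commute:
  fixes f :: "real \<Rightarrow> real \<Rightarrow> real"
  assumes fa: "\<And>a b. ((\<lambda>a. f a b) has_real_derivative fa a b) (at a)"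
    and fb: "\<And>a b. ((\<lambda>b. f a b) has_real_derivative fb a b) (at b)"
    and fab: "\<And>a b. ((\<lambda>b. fa a b) has_real_derivative fab a b) (at b)"
    and fba: "\<And>a b. ((\<lambda>a. fb a b) has_real_derivative fba a b) (at a)"
    and cab: "continuous_on UNIV (\<lambda>p. fab (fst p) (snd p))"
    and cba: "continuous_on UNIV (\<lambda>p. fba (fst p) (snd p))"
  shows "fab 0 0 = fba 0 0"
proof -
  have ex: "\<exists>p q. (fst p \<in> {0<..<h} \<and> snd p \<in> {0<..<h} \<and> fst q \<in> {0<..<h} \<and> snd q \<in> {0<..<h}) \<and>
       fab (fst p) (snd p) = fba (fst q) (snd q)" if h: "0 < h" for h
  proof -
    obtain a where a: "0 < a" "a < h"
      "(f h h - f h 0) - (f 0 h - f 0 0) = (h - 0) * (fa a h - fa a 0)"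
      using MVT2[OF h DERIV_diff[OF fa fa]] by blast
    obtain b where b: "0 < b" "b < h" "fa a h - fa a 0 = (h - 0) * fab a b"
      using MVT2[OF h fab] by blast
    obtain b' where b': "0 < b'" "b' < h"
      "(f h h - f 0 h) - (f h 0 - f 0 0) = (h - 0) * (fb h b' - fb 0 b')"
      using MVT2[OF h DERIV_diff[OF fb fb]] by blast
    obtain a' where a': "0 < a'" "a' < h" "fb h b' - fb 0 b' = (h - 0) * fba a' b'"
      using MVT2[OF h fba] by blast
    have "h * (h * fab a b) = (f h h - f h 0) - (f 0 h - f 0 0)"
      using a(3) b(3) by simp
    also have "\<dots> = (f h h - f 0 h) - (f h 0 - f 0 0)"
      by simp
    also have "\<dots> = h * (h * fba a' b')"
      using a'(3) b'(3) by simp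
    finally have "h * (h * fab a b) = h * (h * fba a' b')" .
    then have "fab a b = fba a' b'"
      using h by simp
    then show ?thesis
      using a(1,2) b(1,2) a'(1,2) b'(1,2) by (intro exI[of _ "(a, b)"] exI[of _ "(a', b')"]) simp
  qed
  have "\<forall>m :: nat. \<exists>p q. (fst p \<in> {0<..<1 / Suc m} \<and> snd p \<in> {0<..<1 / Suc m} \<and>
       fst q \<in> {0<..<1 / Suc m} \<and> snd q \<in> {0<..<1 / Suc m}) \<and>
       fab (fst p) (snd p) = fba (fst q) (snd q)"
    by (intro allI ex) simp
  then have "\<exists>p q. \<forall>m :: nat. (fst (p m) \<in> {0<..<1 / Suc m} \<and> snd (p m) \<in> {0<..<1 / Suc m} \<and>
       fst (q m) \<in> {0<..<1 / Suc m} \<and> snd (q m) \<in> {0<..<1 / Suc m}) \<and>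
       fab (fst (p m)) (snd (p m)) = fba (fst (q m)) (snd (q m))"
    by (simp only: choice_iff)
  then obtain p q where pq: "\<And>m. fst (p m) \<in> {0<..<1 / Suc m}" "\<And>m. snd (p m) \<in> {0<..<1 / Suc m}"
       "\<And>m. fst (q m) \<in> {0<..<1 / Suc m}" "\<And>m. snd (q m) \<in> {0<..<1 / Suc m}"
       "\<And>m. fab (fst (p m)) (snd (p m)) = fba (fst (q m)) (snd (q m))"
    by blast
  have lim0: "r \<longlonglongrightarrow> 0" if "\<And>m. r m \<in> {0<..<1 / Suc m}" for r :: "nat \<Rightarrow> real"
    by (rule tendsto_sandwich[OF _ _ tendsto_const LIMSEQ_inverse_real_of_nat])
      (use that in \<open>auto simp: inverse_eq_divide less_imp_le\<close>)
  have p: "p \<longlonglongrightarrow> (0, 0)" and q: "q \<longlonglongrightarrow> (0, 0)"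
    using tendsto_Pair[OF lim0[OF pq(1)] lim0[OF pq(2)]] tendsto_Pair[OF lim0[OF pq(3)] lim0[OF pq(4)]]
    by simp_all
  have "(\<lambda>m. fab (fst (p m)) (snd (p m))) \<longlonglongrightarrow> fab 0 0"
    using continuous_on_tendsto_compose[OF cab p] by simp
  moreover have "(\<lambda>m. fba (fst (q m)) (snd (q m))) \<longlonglongrightarrow> fba 0 0"
    using continuous_on_tendsto_compose[OF cba q] by simp
  ultimately show ?thesis
    using pq(5) LIMSEQ_unique by simp
qed

text \<open>Restriction to the two-parameter family \<open>y\<close> reduces this to mixed partial
  derivatives. The family need not be injective, so linearly dependent directions are
  covered.\<close>

lemma dirderiv_commute:
  assumes F: "smooth_fun n F" and v: "v \<in> n_space n" and w: "w \<in> n_space n" and x: "x \<in> n_space n"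
  shows "dirderiv (dirderiv F v) w x = dirderiv (dirderiv F w) v x"
proof -
  define y where "y = (\<lambda>a b i. x i + a * v i + b * w i)"
  have y: "y a b \<in> n_space n" for a b
    using x v w by (auto simp: n_space_def y_def)
  have ya: "y a b = (\<lambda>i. y 0 b i + a * v i)" and yb: "y a b = (\<lambda>i. y a 0 i + b * w i)" for a b
    by (auto simp: y_def)
  have cont: "continuous_on UNIV (\<lambda>p. G (y (fst p) (snd p)))" if "smooth_fun n G" for G
    by (rule continuous_on_compose2[OF smooth_fun_continuous_on[OF that]])
      (auto simp: y, auto simp: y_def intro!: continuous_intros)
  have da: "((\<lambda>a. G (y a b)) has_real_derivative dirderiv G v (y a b)) (at a)" if "smooth_fun n G" for G a b
    using smooth_fun_has_dirderiv[OF that v y[of 0 b], of a] by (simp flip: ya)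
  have db: "((\<lambda>b. G (y a b)) has_real_derivative dirderiv G w (y a b)) (at b)" if "smooth_fun n G" for G a b
    using smooth_fun_has_dirderiv[OF that w y[of a 0], of b] by (simp flip: yb)
  note S = smooth_fun_dirderiv[OF F v] smooth_fun_dirderiv[OF F w]
  have "dirderiv (dirderiv F v) w (y 0 0) = dirderiv (dirderiv F w) v (y 0 0)"
    by (rule mixed_partials_commute[where f = "\<lambda>a b. F (y a b)" and fa = "\<lambda>a b. dirderiv F v (y a b)"
          and fb = "\<lambda>a b. dirderiv F w (y a b)" and fab = "\<lambda>a b. dirderiv (dirderiv F v) w (y a b)"
          and fba = "\<lambda>a b. dirderiv (dirderiv F w) v (y a b)"])
      (intro da db cont F S smooth_fun_dirderiv v w)+
  moreover have "y 0 0 = x"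
    by (simp add: y_def)
  ultimately show ?thesis
    by simp
qed

text \<open>The class of all smooth \<open>F\<close> composed with the one fixed linear map is
  stable under partial derivatives: the j-th one comes from the directional derivative of
  \<open>F\<close> along the j-th column \<open>w j\<close>.\<close>

lemma smooth_fun_linear_subst:
  assumes F: "smooth_fun n F" and w: "\<And>j. j < m \<Longrightarrow> w j \<in> n_space n"
  shows "smooth_fun m (\<lambda>y. F (\<lambda>i. \<Sum>j<m. w j i * y j))"
proof (rule smooth_fun_coinduct[where
      R = "\<lambda>H. \<exists>F. smooth_fun n F \<and> H = (\<lambda>y. F (\<lambda>i. \<Sum>j<m. w j i * y j))"])
  have ns: "(\<lambda>i. \<Sum>j<m. w j i * y j) \<in> n_space n" for y
    using w by (auto simp: n_space_def)
  {
    fix H assume "\<exists>F. smooth_fun n F \<and> H = (\<lambda>y. F (\<lambda>i. \<Sum>j<m. w j i * y j))"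
    then obtain F where F: "smooth_fun n F" and H: "H = (\<lambda>y. F (\<lambda>i. \<Sum>j<m. w j i * y j))"
      by blast
    show "continuous_on (n_space m) H"
      unfolding H
      by (rule continuous_on_compose2[OF smooth_fun_continuous_on[OF F]])
        (auto intro!: continuous_intros continuous_on_coordinate simp: ns)
    fix j assume j: "j < m"
    have "((\<lambda>s. H (y(j := s))) has_real_derivative dirderiv F (w j) (\<lambda>i. \<Sum>j<m. w j i * y j)) (at (y j))"
      for y
    proof -
      \<comment> \<open>Setting the j-th coordinate to 0 makes the base point independent of the
        varied coordinate, so that \<open>s\<close> itself is the parameter along the line.\<close>
      define x where "x = (\<lambda>i. \<Sum>j'<m. w j' i * (y(j := 0)) j')"
      have eq: "(\<Sum>j'<m. w j' i * (y(j := s)) j') = x i + s * w j i" for s i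
        unfolding x_def using j
        by (simp add: sum.remove[of "{..<m}" j] mult.commute)
      have "(\<lambda>i. \<Sum>j'<m. w j' i * y j') = (\<lambda>i. x i + y j * w j i)"
        using eq[of _ "y j"] by simp
      then show ?thesis
        using smooth_fun_has_dirderiv[OF F w[OF j], of x "y j"] ns[of "y(j := 0)"]
        by (simp add: H eq flip: x_def del: fun_upd_apply)
    qed
    then show "\<exists>F'. (\<exists>F. smooth_fun n F \<and> F' = (\<lambda>y. F (\<lambda>i. \<Sum>j<m. w j i * y j))) \<and>
       (\<forall>x\<in>n_space m. ((\<lambda>s. H (x(j := s))) has_real_derivative F' x) (at (x j)))"
      using smooth_fun_dirderiv[OF F w[OF j]] by blast
  }
qed (use F in auto)

section \<open>Differential spaces and smooth singular chains\<close>

lemma topspace_initial_topology [simp]: "topspace (initial_topology P G) = P"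
  by (auto simp: initial_topology_def topology_generated_by_topspace)

lemma continuous_map_initial_topology:
  "continuous_map T (initial_topology P G) h \<longleftrightarrow>
     h \<in> topspace T \<rightarrow> P \<and> (\<forall>g\<in>G. continuous_map T euclideanreal (g \<circ> h))"
proof (intro iffI conjI ballI)
  assume h: "continuous_map T (initial_topology P G) h"
  show hP: "h \<in> topspace T \<rightarrow> P"
    using continuous_map_funspace[OF h] by simp
  fix g assume "g \<in> G"
  show "continuous_map T euclideanreal (g \<circ> h)"
    unfolding continuous_map_alt
  proof (intro conjI allI impI)
    fix V :: "real set" assume "openin euclideanreal V"
    then have "openin (initial_topology P G) {x \<in> P. g x \<in> V}"
      unfolding initial_topology_def
      by (intro topology_generated_by_Basis) (use \<open>g \<in> G\<close> in auto)
    then have "openin T (h -` {x \<in> P. g x \<in> V} \<inter> topspace T)"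
      using h by (auto simp: continuous_map_alt)
    moreover have "h -` {x \<in> P. g x \<in> V} \<inter> topspace T = (g \<circ> h) -` V \<inter> topspace T"
      using hP by auto
    ultimately show "openin T ((g \<circ> h) -` V \<inter> topspace T)"
      by simp
  qed auto
next
  assume R: "h \<in> topspace T \<rightarrow> P \<and> (\<forall>g\<in>G. continuous_map T euclideanreal (g \<circ> h))"
  then have *: "openin T ((g \<circ> h) -` V \<inter> topspace T)" if "g \<in> G" "open V" for g V
    using that by (auto simp: continuous_map_alt)
  have "h -` {x \<in> P. g x \<in> V} \<inter> topspace T = (g \<circ> h) -` V \<inter> topspace T" for g and V :: "real set"
    using R by auto
  moreover have "h -` P \<inter> topspace T = topspace T"
    using R by auto
  ultimately show "continuous_map T (initial_topology P G) h"
    unfolding initial_topology_def using R *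
    by (intro continuous_on_generated_topo) auto
qed

lemma points_generated_dspace [simp]: "points (generated_dspace P G) = P"
  by (simp add: generated_dspace_def)

lemma points_euclid_sub [simp]: "points (euclid_sub n S) = S"
  by (simp add: euclid_sub_def)

lemma continuous_map_into_euclid_sub:
  "continuous_map T (dtop (euclid_sub n S)) h \<longleftrightarrow>
     h \<in> topspace T \<rightarrow> S \<and> (\<forall>i<n. continuous_map T euclideanreal (\<lambda>y. h y i))"
  by (auto simp: euclid_sub_def generated_dspace_def continuous_map_initial_topology o_def)

lemma openin_euclid_subD:
  assumes "openin (dtop (euclid_sub n S)) U"
  obtains V where "open V" "U = S \<inter> V"
proof -
  have "continuous_map (top_of_set S) (dtop (euclid_sub n S)) (\<lambda>y. y)"
    by (auto simp: continuous_map_into_euclid_sub continuous_on_coordinate)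
  then have "openin (top_of_set S) ((\<lambda>y. y) -` U \<inter> topspace (top_of_set S))"
    using assms by (simp only: continuous_map_alt)
  moreover have "U \<subseteq> S"
    using openin_subset[OF assms] by simp
  ultimately have "openin (top_of_set S) U"
    by (simp add: Int_absorb2)
  then show ?thesis
    using that by (auto simp: openin_open)
qed

text \<open>The generators are coordinate functions, so a local expression amounts to choosing for
  each variable of \<open>F\<close> the coordinate \<open>c i\<close> to be put in; repetitions are
  allowed.\<close>

lemma dfun_euclid_sub_iff:
  "u \<in> dfun (euclid_sub n S) \<longleftrightarrow>
     (\<forall>x\<in>S. \<exists>U m F c. openin (dtop (euclid_sub n S)) U \<and> x \<in> U \<and> smooth_fun m F \<and> (\<forall>i<m. c i < n) \<and>
        (\<forall>y\<in>U. u y = F (\<lambda>i. if i < m then y (c i) else 0)))" (is "_ \<longleftrightarrow> (\<forall>x\<in>S. ?R x)")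
proof -
  have "(\<exists>U m F gs. openin (dtop (euclid_sub n S)) U \<and> x \<in> U \<and> smooth_fun m F \<and>
           (\<forall>i<m. gs i \<in> {(\<lambda>x. x i) | i. i < n}) \<and>
           (\<forall>y\<in>U. u y = F (\<lambda>i. if i < m then gs i y else 0))) \<longleftrightarrow> ?R x" for x
  proof
    assume "\<exists>U m F gs. openin (dtop (euclid_sub n S)) U \<and> x \<in> U \<and> smooth_fun m F \<and>
           (\<forall>i<m. gs i \<in> {(\<lambda>x. x i) | i. i < n}) \<and>
           (\<forall>y\<in>U. u y = F (\<lambda>i. if i < m then gs i y else 0))"
    then obtain U m F gs where *: "openin (dtop (euclid_sub n S)) U" "x \<in> U" "smooth_fun m F"
      "\<forall>i<m. gs i \<in> {(\<lambda>x. x i) | i. i < n}" "\<forall>y\<in>U. u y = F (\<lambda>i. if i < m then gs i y else 0)"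
      by blast
    then have "\<forall>i. i < m \<longrightarrow> (\<exists>j<n. gs i = (\<lambda>x. x j))"
      by blast
    then obtain c where c: "\<And>i. i < m \<Longrightarrow> c i < n \<and> gs i = (\<lambda>x. x (c i))"
      by metis
    then have "(\<lambda>i. if i < m then gs i y else 0) = (\<lambda>i. if i < m then y (c i) else 0)" for y
      by auto
    with * c show "?R x"
      by (intro exI[of _ U] exI[of _ m] exI[of _ F] exI[of _ c]) simp
  next
    assume "?R x"
    then obtain U m F c where *: "openin (dtop (euclid_sub n S)) U" "x \<in> U" "smooth_fun m F"
      "\<forall>i<m. c i < n" "\<forall>y\<in>U. u y = F (\<lambda>i. if i < m then y (c i) else 0)"
      by blast
    then have "\<forall>i<m. (\<lambda>x. x (c i)) \<in> {(\<lambda>x. x i) | i. i < n}"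
      by blast
    with * show "\<exists>U m F gs. openin (dtop (euclid_sub n S)) U \<and> x \<in> U \<and> smooth_fun m F \<and>
           (\<forall>i<m. gs i \<in> {(\<lambda>x. x i) | i. i < n}) \<and>
           (\<forall>y\<in>U. u y = F (\<lambda>i. if i < m then gs i y else 0))"
      by (intro exI[of _ U] exI[of _ m] exI[of _ F] exI[of _ "\<lambda>i x. x (c i)"] conjI)
  qed
  then show ?thesis
    by (simp only: euclid_sub_def generated_dspace_def dspace.simps mem_Collect_eq)
qed

lemma dfun_euclid_subE:
  assumes "u \<in> dfun (euclid_sub n S)" "x \<in> S"
  obtains V m F c where "open V" "x \<in> V" "smooth_fun m F" "\<And>i. i < m \<Longrightarrow> c i < n"
    "\<And>y. y \<in> S \<inter> V \<Longrightarrow> u y = F (\<lambda>i. if i < m then y (c i) else 0)"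
proof -
  obtain U m F c where *: "openin (dtop (euclid_sub n S)) U" "x \<in> U" "smooth_fun m F"
    "\<forall>i<m. c i < n" "\<forall>y\<in>U. u y = F (\<lambda>i. if i < m then y (c i) else 0)"
    using assms(1)[unfolded dfun_euclid_sub_iff, rule_format, OF assms(2)] by (elim exE conjE)
  moreover obtain V where "open V" "U = S \<inter> V"
    using openin_euclid_subD[OF *(1)] by blast
  ultimately show ?thesis
    using that by blast
qed

lemma dfun_euclid_sub_cong:
  assumes u: "u \<in> dfun (euclid_sub n S)" and eq: "\<And>y. y \<in> S \<Longrightarrow> u y = v y"
  shows "v \<in> dfun (euclid_sub n S)"
  unfolding dfun_euclid_sub_iff
proof
  fix x assume x: "x \<in> S"
  obtain U m F c where *: "openin (dtop (euclid_sub n S)) U" "x \<in> U" "smooth_fun m F"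
    "\<forall>i<m. c i < n" "\<forall>y\<in>U. u y = F (\<lambda>i. if i < m then y (c i) else 0)"
    using u[unfolded dfun_euclid_sub_iff, rule_format, OF x] by (elim exE conjE)
  moreover have "U \<subseteq> S"
    using openin_subset[OF *(1)] by simp
  ultimately show "\<exists>U m F c. openin (dtop (euclid_sub n S)) U \<and> x \<in> U \<and> smooth_fun m F \<and>
      (\<forall>i<m. c i < n) \<and> (\<forall>y\<in>U. v y = F (\<lambda>i. if i < m then y (c i) else 0))"
    using eq by (intro exI[of _ U] exI[of _ m] exI[of _ F] exI[of _ c]) (simp add: subset_iff)
qed

section \<open>Affine maps of standard simplices, given by the images \<open>l j\<close> of the
  vertices, and smooth simplices\<close>

definition affine_comb :: "nat \<Rightarrow> (nat \<Rightarrow> nat \<Rightarrow> real) \<Rightarrow> (nat \<Rightarrow> real) \<Rightarrow> nat \<Rightarrow> real" where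
  "affine_comb q l y = (\<lambda>i. \<Sum>j\<le>q. l j i * y j)"

lemma affine_comb_in_standard_simplex:
  assumes l: "\<And>j. j \<le> q \<Longrightarrow> l j \<in> standard_simplex p" and y: "y \<in> standard_simplex q"
  shows "affine_comb q l y \<in> standard_simplex p"
proof -
  have nonneg: "0 \<le> l j i * y j" if "j \<le> q" for i j
    using l[OF that] y by (auto simp: standard_simplex_def)
  have "affine_comb q l y i \<le> (\<Sum>j\<le>q. y j)" for i
    unfolding affine_comb_def
    by (intro sum_mono mult_left_le_one_le) (use l y in \<open>auto simp: standard_simplex_def\<close>)
  moreover have "(\<Sum>i\<le>p. affine_comb q l y i) = 1"
  proof -
    have "(\<Sum>i\<le>p. affine_comb q l y i) = (\<Sum>j\<le>q. (\<Sum>i\<le>p. l j i) * y j)"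
      unfolding affine_comb_def sum_distrib_right by (rule sum.swap)
    also have "\<dots> = (\<Sum>j\<le>q. y j)"
      using l by (intro sum.cong) (auto simp: standard_simplex_def)
    also have "\<dots> = 1"
      using y by (simp add: standard_simplex_def)
    finally show ?thesis .
  qed
  moreover have "affine_comb q l y i = 0" if "p < i" for i
    unfolding affine_comb_def using l that by (intro sum.neutral) (auto simp: standard_simplex_def)
  ultimately show ?thesis
    using nonneg y by (auto simp: standard_simplex_def affine_comb_def intro: sum_nonneg)
qed

lemma affine_comb_affine_comb:
  "affine_comb q l (affine_comb r m y) = affine_comb r (\<lambda>j. affine_comb q l (m j)) y"
proof
  fix i
  have "affine_comb q l (affine_comb r m y) i = (\<Sum>j\<le>q. \<Sum>j'\<le>r. l j i * (m j' j * y j'))"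
    by (simp add: affine_comb_def sum_distrib_left)
  also have "\<dots> = (\<Sum>j'\<le>r. \<Sum>j\<le>q. l j i * (m j' j * y j'))"
    by (rule sum.swap)
  finally show "affine_comb q l (affine_comb r m y) i = affine_comb r (\<lambda>j. affine_comb q l (m j)) y i"
    by (simp add: affine_comb_def sum_distrib_right mult.assoc)
qed

text \<open>In barycentric coordinates the map is linear, so a local representative stays smooth
  after substitution. All q + 1 barycentric coordinates serve as variables of the new
  representative.\<close>

lemma dfun_affine_comb:
  assumes u: "u \<in> dfun (euclid_sub (Suc p) (standard_simplex p))"
    and l: "\<And>j. j \<le> q \<Longrightarrow> l j \<in> standard_simplex p"
  shows "(\<lambda>y. u (affine_comb q l y)) \<in> dfun (euclid_sub (Suc q) (standard_simplex q))"
  unfolding dfun_euclid_sub_iff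
proof
  let ?D = "standard_simplex p" and ?D' = "standard_simplex q"
  fix x assume x: "x \<in> ?D'"
  then have Lx: "affine_comb q l x \<in> ?D"
    using affine_comb_in_standard_simplex l by blast
  obtain U m F c where *: "openin (dtop (euclid_sub (Suc p) ?D)) U" "affine_comb q l x \<in> U"
    "smooth_fun m F" "\<forall>i<m. c i < Suc p" "\<forall>y\<in>U. u y = F (\<lambda>i. if i < m then y (c i) else 0)"
    using u[unfolded dfun_euclid_sub_iff, rule_format, OF Lx] by (elim exE conjE)
  have "continuous_map (dtop (euclid_sub (Suc q) ?D')) (dtop (euclid_sub (Suc p) ?D)) (affine_comb q l)"
  proof -
    have "continuous_map (dtop (euclid_sub (Suc q) ?D')) euclideanreal (\<lambda>y. y j)" if "j \<le> q" for j
      using continuous_map_into_euclid_sub[of "dtop (euclid_sub (Suc q) ?D')" "Suc q" ?D' "\<lambda>y. y"] that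
      by auto
    then show ?thesis
      using affine_comb_in_standard_simplex l
      by (auto simp: continuous_map_into_euclid_sub affine_comb_def
          intro!: continuous_map_sum continuous_map_real_mult_left)
  qed
  then have "openin (dtop (euclid_sub (Suc q) ?D')) {y \<in> ?D'. affine_comb q l y \<in> U}"
    using openin_continuous_map_preimage *(1) by fastforce
  moreover have "smooth_fun (Suc q) (\<lambda>y. F (\<lambda>i. \<Sum>j<Suc q. (if i < m then l j (c i) else 0) * y j))"
    using *(3) by (rule smooth_fun_linear_subst) (auto simp: n_space_def)
  moreover have "u (affine_comb q l y) =
      F (\<lambda>i. \<Sum>j<Suc q. (if i < m then l j (c i) else 0) * (if j < Suc q then y j else 0))"
    if "affine_comb q l y \<in> U" for y
  proof -
    have "(\<lambda>i. if i < m then affine_comb q l y (c i) else 0) =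
      (\<lambda>i. \<Sum>j<Suc q. (if i < m then l j (c i) else 0) * (if j < Suc q then y j else 0))"
      by (auto simp: fun_eq_iff affine_comb_def lessThan_Suc_atMost)
    with that *(5) show ?thesis
      by simp
  qed
  ultimately show "\<exists>U m F c. openin (dtop (euclid_sub (Suc q) ?D')) U \<and> x \<in> U \<and> smooth_fun m F \<and>
      (\<forall>i<m. c i < Suc q) \<and> (\<forall>y\<in>U. u (affine_comb q l y) = F (\<lambda>i. if i < m then y (c i) else 0))"
    using x *(2)
    by (intro exI[of _ "{y \<in> ?D'. affine_comb q l y \<in> U}"] exI[of _ "Suc q"]
        exI[of _ "\<lambda>y. F (\<lambda>i. \<Sum>j<Suc q. (if i < m then l j (c i) else 0) * y j)"] exI[of _ "\<lambda>i. i"]) auto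
qed

text \<open>Restricted because singular simplices are extensional; otherwise simplices with the same
  values would be different generators of the chain groups.\<close>

definition subsimplex ::
    "nat \<Rightarrow> (nat \<Rightarrow> nat \<Rightarrow> real) \<Rightarrow> ((nat \<Rightarrow> real) \<Rightarrow> 'a) \<Rightarrow> (nat \<Rightarrow> real) \<Rightarrow> 'a" where
  "subsimplex q l \<sigma> = restrict (\<sigma> \<circ> affine_comb q l) (standard_simplex q)"

lemma subsimplex_apply: "y \<in> standard_simplex q \<Longrightarrow> subsimplex q l \<sigma> y = \<sigma> (affine_comb q l y)"
  by (simp add: subsimplex_def)

lemma subsimplex_subsimplex:
  assumes "\<And>j. j \<le> r \<Longrightarrow> m j \<in> standard_simplex q"
  shows "subsimplex r m (subsimplex q l \<sigma>) = subsimplex r (\<lambda>j. affine_comb q l (m j)) \<sigma>"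
  using affine_comb_in_standard_simplex[OF assms]
  by (auto simp: subsimplex_def affine_comb_affine_comb)

lemma smooth_simplicesD:
  assumes "\<sigma> \<in> smooth_simplices p X"
  shows "singular_simplex p (dtop X) \<sigma>" "\<And>y. y \<in> standard_simplex p \<Longrightarrow> \<sigma> y \<in> points X"
    "\<And>u. u \<in> dfun X \<Longrightarrow> u \<circ> \<sigma> \<in> dfun (euclid_sub (Suc p) (standard_simplex p))"
  using assms by (auto simp: smooth_simplices_def smooth_map_def)

lemma subsimplex_smooth:
  assumes \<sigma>: "\<sigma> \<in> smooth_simplices p X" and l: "\<And>j. j \<le> q \<Longrightarrow> l j \<in> standard_simplex p"
  shows "subsimplex q l \<sigma> \<in> smooth_simplices q X"
proof -
  note L = affine_comb_in_standard_simplex[OF l]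
  have "continuous_map (top_of_set (standard_simplex q)) (top_of_set (standard_simplex p)) (affine_comb q l)"
    using L by (auto simp: affine_comb_def[abs_def] intro!: continuous_intros continuous_on_coordinate)
  moreover have "continuous_map (top_of_set (standard_simplex p)) (dtop X) \<sigma>"
    using smooth_simplicesD(1)[OF \<sigma>] by (simp add: singular_simplex_def euclidean_product_topology)
  ultimately have "continuous_map (top_of_set (standard_simplex q)) (dtop X) (\<sigma> \<circ> affine_comb q l)"
    by (rule continuous_map_compose)
  then have "continuous_map (top_of_set (standard_simplex q)) (dtop X) (subsimplex q l \<sigma>)"
    by (rule continuous_map_eq) (simp add: subsimplex_def)
  then have "singular_simplex q (dtop X) (subsimplex q l \<sigma>)"
    by (simp add: singular_simplex_def euclidean_product_topology subsimplex_def)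
  moreover have "u \<circ> subsimplex q l \<sigma> \<in> dfun (euclid_sub (Suc q) (standard_simplex q))" if "u \<in> dfun X" for u
    by (rule dfun_euclid_sub_cong[OF dfun_affine_comb[OF smooth_simplicesD(3)[OF \<sigma> that] l]])
      (auto simp: subsimplex_def)
  ultimately show ?thesis
    using L smooth_simplicesD(2)[OF \<sigma>] by (auto simp: smooth_simplices_def smooth_map_def subsimplex_apply)
qed

definition vertex :: "nat \<Rightarrow> nat \<Rightarrow> real" where
  "vertex m = (\<lambda>i. if i = m then 1 else 0)"

lemma vertex_in_standard_simplex [simp]: "vertex m \<in> standard_simplex p \<longleftrightarrow> m \<le> p"
  by (simp add: vertex_def)

lemma affine_comb_vertices:
  assumes "y \<in> standard_simplex q"
  shows "affine_comb q vertex y = y"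
proof
  fix i
  have "affine_comb q vertex y i = (\<Sum>j\<le>q. if j = i then y j else 0)"
    unfolding affine_comb_def vertex_def by (intro sum.cong) auto
  also have "\<dots> = y i"
    using assms by (simp add: standard_simplex_def)
  finally show "affine_comb q vertex y i = y i" .
qed

lemma affine_comb_vertex: "m \<le> q \<Longrightarrow> affine_comb q l (vertex m) = l m"
proof
  fix i assume m: "m \<le> q"
  have "affine_comb q l (vertex m) i = (\<Sum>j\<le>q. if j = m then l j i else 0)"
    unfolding affine_comb_def vertex_def by (intro sum.cong) auto
  then show "affine_comb q l (vertex m) i = l m i"
    using m by simp
qed

lemma subsimplex_vertices:
  assumes "\<sigma> \<in> smooth_simplices p X"
  shows "subsimplex p vertex \<sigma> = \<sigma>"
proof -
  have "\<sigma> \<in> extensional (standard_simplex p)"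
    using smooth_simplicesD(1)[OF assms] unfolding singular_simplex_def by blast
  then have "restrict \<sigma> (standard_simplex p) = \<sigma>"
    by (rule extensional_restrict)
  moreover have "subsimplex p vertex \<sigma> = restrict \<sigma> (standard_simplex p)"
    unfolding subsimplex_def by (rule restrict_ext) (simp add: affine_comb_vertices)
  ultimately show ?thesis
    by simp
qed

text \<open>Treating faces as subsimplices gives their smoothness and lets a contraction of the
  whole simplex be followed on its faces.\<close>

lemma singular_face_eq_subsimplex:
  assumes "1 \<le> p" "k \<le> p"
  shows "singular_face p k \<sigma> = subsimplex (p - 1) (\<lambda>j. vertex (if j < k then j else Suc j)) \<sigma>"
proof -
  have "simplical_face k y = affine_comb (p - 1) (\<lambda>j. vertex (if j < k then j else Suc j)) y"
    if y: "y \<in> standard_simplex (p - 1)" for y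
  proof
    fix i
    have "affine_comb (p - 1) (\<lambda>j. vertex (if j < k then j else Suc j)) y i =
        (\<Sum>j\<le>p - 1. if j = (if i < k then i else i - 1) \<and> i \<noteq> k then y j else 0)"
      unfolding affine_comb_def vertex_def by (intro sum.cong) (auto split: if_splits)
    also have "\<dots> = simplical_face k y i"
      using y assms by (auto simp: simplical_face_def standard_simplex_def)
    finally show "simplical_face k y i = affine_comb (p - 1) (\<lambda>j. vertex (if j < k then j else Suc j)) y i"
      by simp
  qed
  then show ?thesis
    by (auto simp: singular_face_def subsimplex_def)
qed

lemma singular_face_smooth:
  assumes "\<sigma> \<in> smooth_simplices p X" "1 \<le> p" "k \<le> p"
  shows "singular_face p k \<sigma> \<in> smooth_simplices (p - 1) X"
  unfolding singular_face_eq_subsimplex[OF assms(2,3)]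
  by (rule subsimplex_smooth[OF assms(1)]) (use assms in auto)

lemma differential_spaceD:
  assumes "differential_space X"
  shows "dtop X = initial_topology (points X) (dfun X)"
    and "f \<in> dfun X \<Longrightarrow> continuous_map (dtop X) euclideanreal f"
    and "\<lbrakk>smooth_fun n F; \<And>i. i < n \<Longrightarrow> fs i \<in> dfun X\<rbrakk>
      \<Longrightarrow> (\<lambda>x. F (\<lambda>i. if i < n then fs i x else 0)) \<in> dfun X"
proof -
  note D = assms[unfolded differential_space_def]
  show "dtop X = initial_topology (points X) (dfun X)"
    by (rule D[THEN conjunct1])
  show "f \<in> dfun X \<Longrightarrow> continuous_map (dtop X) euclideanreal f"
    by (rule D[THEN conjunct2, THEN conjunct1, rule_format])
  show "\<lbrakk>smooth_fun n F; \<And>i. i < n \<Longrightarrow> fs i \<in> dfun X\<rbrakk>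
      \<Longrightarrow> (\<lambda>x. F (\<lambda>i. if i < n then fs i x else 0)) \<in> dfun X"
    using D[THEN conjunct2, THEN conjunct2, THEN conjunct2, THEN spec, THEN spec, THEN spec] by blast
qed

text \<open>The topology of X is initial for its smooth functions, so continuity into X is tested on
  them, and there smoothness of \<phi> applies.\<close>

lemma differential_space_continuous_map:
  assumes "differential_space A" "differential_space X" "smooth_map A X \<phi>"
  shows "continuous_map (dtop A) (dtop X) \<phi>"
proof -
  note X = differential_spaceD(1)[OF assms(2)]
  have "continuous_map (dtop A) euclideanreal (u \<circ> \<phi>)" if "u \<in> dfun X" for u
    using differential_spaceD(2)[OF assms(1)] assms(3) that by (simp add: smooth_map_def)
  then have "continuous_map (dtop A) (initial_topology (points X) (dfun X)) \<phi>"
    using assms(3) by (simp add: continuous_map_initial_topology smooth_map_def)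
  then show ?thesis
    by (subst X)
qed

lemma simplex_map_smooth:
  assumes "differential_space A" "differential_space X" "smooth_map A X \<phi>" "\<sigma> \<in> smooth_simplices p A"
  shows "simplex_map p \<phi> \<sigma> \<in> smooth_simplices p X"
proof -
  have "u \<circ> simplex_map p \<phi> \<sigma> \<in> dfun (euclid_sub (Suc p) (standard_simplex p))" if "u \<in> dfun X" for u
  proof (rule dfun_euclid_sub_cong)
    show "(u \<circ> \<phi>) \<circ> \<sigma> \<in> dfun (euclid_sub (Suc p) (standard_simplex p))"
      using assms(3) that by (intro smooth_simplicesD(3)[OF assms(4)]) (auto simp: smooth_map_def)
  qed (simp add: simplex_map_def)
  moreover have "singular_simplex p (dtop X) (simplex_map p \<phi> \<sigma>)"
    using singular_simplex_simplex_map[OF smooth_simplicesD(1)[OF assms(4)]]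
      differential_space_continuous_map[OF assms(1-3)] by blast
  ultimately show ?thesis
    using assms(3) smooth_simplicesD(2)[OF assms(4)]
    by (auto simp: smooth_simplices_def smooth_map_def simplex_map_def)
qed

section \<open>The complex of smooth singular chains, indexed by the integers\<close>

lemma cgrp_smooth_cplx:
  "cgrp (smooth_cplx X) n = free_Abelian_group (if n < 0 then {} else smooth_simplices (nat n) X)"
  by (simp add: smooth_cplx_def)

lemma carrier_smooth_cplx:
  "c \<in> carrier (cgrp (smooth_cplx X) n) \<longleftrightarrow>
     (if n < 0 then c = 0 else Poly_Mapping.keys c \<subseteq> smooth_simplices (nat n) X)"
  by (simp add: cgrp_smooth_cplx)

lemma bd_smooth_cplx: "bd (smooth_cplx X) n = chain_boundary (nat n)"
  by (simp add: smooth_cplx_def)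

lemma smooth_cplx_singular_chain:
  "c \<in> carrier (cgrp (smooth_cplx X) n) \<Longrightarrow> singular_chain (nat n) (dtop X) c"
  by (fastforce simp: carrier_smooth_cplx singular_chain_def smooth_simplices_def split: if_splits)

lemma chain_boundary_smooth:
  assumes "c \<in> carrier (cgrp (smooth_cplx X) n)"
  shows "chain_boundary (nat n) c \<in> carrier (cgrp (smooth_cplx X) (n - 1))"
proof (cases "n \<le> 0")
  \<comment> \<open>The chain group is 0 in negative degrees and the boundary of a 0-chain is 0 by
    convention, which makes the truncation by \<open>nat\<close> harmless.\<close>
  case True
  then show ?thesis
    using assms by (simp add: carrier_smooth_cplx chain_boundary_def)
next
  case False
  have "Poly_Mapping.keys c \<subseteq> smooth_simplices (nat n) X"
    using assms False by (simp add: carrier_smooth_cplx)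
  then have "chain_boundary (nat n) c \<in> carrier (free_Abelian_group (smooth_simplices (nat n - 1) X))"
  proof (induction c rule: frag_induction)
    case (one \<sigma>)
    then show ?case
      using False unfolding chain_boundary_of
      by (auto intro!: sum_closed_free_Abelian_group singular_face_smooth
          simp del: carrier_free_Abelian_group_iff) (auto intro!: singular_face_smooth[unfolded One_nat_def])
  qed (auto simp: chain_boundary_diff dest: subsetD[OF keys_diff])
  moreover have "nat (n - 1) = nat n - 1"
    using False by simp
  ultimately show ?thesis
    using False by (simp add: cgrp_smooth_cplx)
qed

lemma chain_boundary_boundary_smooth:
  assumes "c \<in> carrier (cgrp (smooth_cplx X) n)"
  shows "chain_boundary (nat (n - 1)) (chain_boundary (nat n) c) = 0"
  using chain_boundary_boundary[OF smooth_cplx_singular_chain[OF assms]]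
  by (cases "n \<le> 0") (auto simp: chain_boundary_def nat_diff_distrib)

lemma chain_map_smooth:
  assumes "differential_space A" "differential_space X" "smooth_map A X \<phi>"
    and c: "c \<in> carrier (cgrp (smooth_cplx A) n)"
  shows "chain_map (nat n) \<phi> c \<in> carrier (cgrp (smooth_cplx X) n)"
proof (cases "n < 0")
  case True
  then show ?thesis
    using c by (simp add: carrier_smooth_cplx)
next
  case False
  have "Poly_Mapping.keys c \<subseteq> smooth_simplices (nat n) A"
    using c False by (simp add: carrier_smooth_cplx)
  then have "Poly_Mapping.keys (chain_map (nat n) \<phi> c) \<subseteq> smooth_simplices (nat n) X"
    by (induction c rule: frag_induction)
      (auto simp: chain_map_diff simplex_map_smooth[OF assms(1-3)] dest: subsetD[OF keys_diff])
  then show ?thesis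
    using False by (simp add: carrier_smooth_cplx)
qed

lemma chain_boundary_chain_map_smooth:
  assumes "c \<in> carrier (cgrp (smooth_cplx A) n)"
  shows "chain_boundary (nat n) (chain_map (nat n) \<phi> c) = chain_map (nat (n - 1)) \<phi> (chain_boundary (nat n) c)"
  using chain_boundary_chain_map[OF smooth_cplx_singular_chain[OF assms], of \<phi>]
  by (cases "n \<le> 0") (auto simp: chain_boundary_def nat_diff_distrib)

section \<open>Integration over simplices\<close>

lemma compact_standard_simplex: "compact (standard_simplex p)"
  using compactin_standard_simplex[of p] by (simp add: euclidean_product_topology)

lemma open_simplex_iff:
  "t \<in> open_simplex k \<longleftrightarrow> (\<forall>i\<le>k. 0 < t i) \<and> (\<forall>i>k. t i = 0) \<and> (\<Sum>i\<le>k. t i) = 1"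
proof
  assume R: "(\<forall>i\<le>k. 0 < t i) \<and> (\<forall>i>k. t i = 0) \<and> (\<Sum>i\<le>k. t i) = 1"
  then have "t i \<le> 1" if "i \<le> k" for i
    using member_le_sum[of i "{..k}" t] that by (auto intro: less_imp_le)
  with R have "0 \<le> t i \<and> t i \<le> 1" for i
    by (cases "i \<le> k") (auto intro: less_imp_le)
  with R show "t \<in> open_simplex k"
    by (simp add: open_simplex_def standard_simplex_def)
qed (simp add: open_simplex_def standard_simplex_def)

lemma open_simplex_subset: "open_simplex k \<subseteq> standard_simplex k"
  by (auto simp: open_simplex_def)

lemma eventually_line_in_open:
  fixes x w :: "nat \<Rightarrow> real"
  assumes "open V" "x \<in> V"
  shows "\<forall>\<^sub>F s in nhds 0. (\<lambda>j. x j + s * w j) \<in> V"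
proof -
  have "continuous_on UNIV (\<lambda>s::real. (\<lambda>j. x j + s * w j))"
    by (intro continuous_intros)
  then have "open ((\<lambda>s::real. (\<lambda>j. x j + s * w j)) -` V)"
    using assms(1) by (simp add: open_vimage)
  then show ?thesis
    using assms(2) by (auto simp: eventually_nhds)
qed

text \<open>Positivity of finitely many coordinates is an open condition, and a direction with
  coordinate sum 0 preserves the remaining equations.\<close>

lemma eventually_line_in_open_simplex:
  assumes t: "t \<in> open_simplex k" and w: "\<And>j. k < j \<Longrightarrow> w j = 0" "(\<Sum>j\<le>k. w j) = 0"
  shows "\<forall>\<^sub>F s in nhds 0. (\<lambda>j. t j + s * w j) \<in> open_simplex k"
proof -
  have "open (\<Inter>j\<in>{..k}. {y :: nat \<Rightarrow> real. 0 < y j})"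
    by (intro open_INT ballI open_Collect_less continuous_on_coordinate) auto
  moreover have "(\<Inter>j\<in>{..k}. {y :: nat \<Rightarrow> real. 0 < y j}) = {y. \<forall>j\<le>k. 0 < y j}"
    by auto
  ultimately have "open {y :: nat \<Rightarrow> real. \<forall>j\<le>k. 0 < y j}"
    by simp
  then have "\<forall>\<^sub>F s in nhds 0. (\<lambda>j. t j + s * w j) \<in> {y. \<forall>j\<le>k. 0 < y j}"
    by (rule eventually_line_in_open) (use t in \<open>auto simp: open_simplex_iff\<close>)
  then show ?thesis
    by (rule eventually_mono)
      (use t w in \<open>auto simp: open_simplex_iff sum.distrib simp flip: sum_distrib_left\<close>)
qed

text \<open>The vector from vertex 0 to vertex i, hence the zero vector for \<open>i = 0\<close>;
  these are the directions of \<open>simplex_partial\<close>.\<close>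

definition edge :: "nat \<Rightarrow> nat \<Rightarrow> real" where
  "edge i = (\<lambda>j. of_bool (j = i) - of_bool (j = 0))"

lemma edge_outside: "\<lbrakk>i \<le> k; k < j\<rbrakk> \<Longrightarrow> edge i j = 0"
  by (auto simp: edge_def)

lemma sum_edge: "i \<le> k \<Longrightarrow> (\<Sum>j\<le>k. edge i j) = 0"
  by (simp add: edge_def sum_subtractf of_bool_def)

lemma eventually_edge_in_open_simplex:
  "\<lbrakk>t \<in> open_simplex k; i \<le> k\<rbrakk> \<Longrightarrow> \<forall>\<^sub>F s in nhds 0. (\<lambda>j. t j + s * edge i j) \<in> open_simplex k"
  by (rule eventually_line_in_open_simplex) (auto simp: edge_outside sum_edge)

lemma simplex_partial_edge: "simplex_partial i u t = deriv (\<lambda>s. u (\<lambda>j. t j + s * edge i j)) 0"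
  by (simp add: simplex_partial_def edge_def)

lemma affine_comb_line:
  "affine_comb q l (\<lambda>j. y j + s * w j) = (\<lambda>a. affine_comb q l y a + s * affine_comb q l w a)"
  by (simp add: affine_comb_def fun_eq_iff sum.distrib sum_distrib_left algebra_simps)

lemma affine_comb_edge:
  assumes "i \<le> q"
  shows "affine_comb q l (edge i) = (\<lambda>a. l i a - l 0 a)"
proof
  fix a
  have "affine_comb q l (edge i) a = (\<Sum>j\<le>q. (if j = i then l j a else 0) - (if j = 0 then l j a else 0))"
    unfolding affine_comb_def edge_def by (intro sum.cong) auto
  then show "affine_comb q l (edge i) a = l i a - l 0 a"
    using assms by (simp add: sum_subtractf)
qed

text \<open>The argument handed to \<open>F\<close> in the local representatives of smooth functions
  on a simplex.\<close>

definition coords :: "nat \<Rightarrow> (nat \<Rightarrow> nat) \<Rightarrow> (nat \<Rightarrow> real) \<Rightarrow> nat \<Rightarrow> real" where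
  "coords m c x = (\<lambda>a. if a < m then x (c a) else 0)"

lemma coords_in_n_space: "coords m c x \<in> n_space m"
  by (auto simp: coords_def n_space_def)

lemma coords_line: "coords m c (\<lambda>j. x j + s * w j) = (\<lambda>a. coords m c x a + s * coords m c w a)"
  by (auto simp: coords_def)

lemma continuous_on_coords: "continuous_on K h \<Longrightarrow> continuous_on K (\<lambda>z. coords m c (h z))"
proof (rule continuous_on_coordinatewise_then_product)
  fix a assume "continuous_on K h"
  then show "continuous_on K (\<lambda>z. coords m c (h z) a)"
    by (cases "a < m") (auto simp: coords_def intro: continuous_on_product_then_coordinatewise)
qed

lemma dfun_has_line_derivative:
  assumes V: "open V" and F: "smooth_fun m F"
    and u: "\<And>y. y \<in> standard_simplex p \<inter> V \<Longrightarrow> u y = F (coords m c y)"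
    and x: "x \<in> V" and ev: "\<forall>\<^sub>F s in nhds 0. (\<lambda>j. x j + s * w j) \<in> standard_simplex p"
  shows "((\<lambda>s. u (\<lambda>j. x j + s * w j)) has_real_derivative dirderiv F (coords m c w) (coords m c x)) (at 0)"
proof -
  have "((\<lambda>s. F (\<lambda>a. coords m c x a + s * coords m c w a)) has_real_derivative
      dirderiv F (coords m c w) (coords m c x)) (at 0)"
    using smooth_fun_has_dirderiv[OF F coords_in_n_space coords_in_n_space, where s = 0] by simp
  moreover have "\<forall>\<^sub>F s in nhds 0. u (\<lambda>j. x j + s * w j) = F (\<lambda>a. coords m c x a + s * coords m c w a)"
    using ev eventually_line_in_open[OF V x, of w]
    by eventually_elim (simp add: u coords_line)
  ultimately show ?thesis
    by (subst DERIV_cong_ev[OF refl _ refl]) auto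
qed

text \<open>Chain rule for an affine map of simplices, the edge from vertex 0 to vertex i being sent
  to the difference of \<open>l i\<close> and \<open>l 0\<close>. The image point may lie on the
  boundary of the larger simplex, where \<open>u\<close> cannot be differentiated in every
  direction; the derivative is therefore expressed by the representative \<open>F\<close>, which is
  defined on both sides of the boundary.\<close>

lemma
  assumes rep: "open V" "smooth_fun m F"
      "\<And>x. x \<in> standard_simplex p \<inter> V \<Longrightarrow> u x = F (coords m c x)"
    and l: "\<And>j. j \<le> q \<Longrightarrow> l j \<in> standard_simplex p"
    and g: "\<And>y. y \<in> standard_simplex q \<Longrightarrow> g y = u (affine_comb q l y)"
    and y: "y \<in> open_simplex q" "affine_comb q l y \<in> V" and i: "i \<le> q"
  shows has_simplex_partial_affine:
      "((\<lambda>s. g (\<lambda>j. y j + s * edge i j)) has_real_derivative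
        dirderiv F (coords m c (\<lambda>a. l i a - l 0 a)) (coords m c (affine_comb q l y))) (at 0)"
    and simplex_partial_affine: "simplex_partial i g y =
      dirderiv F (coords m c (\<lambda>a. l i a - l 0 a)) (coords m c (affine_comb q l y))"
proof -
  have ev: "\<forall>\<^sub>F s in nhds 0. (\<lambda>j. y j + s * edge i j) \<in> standard_simplex q"
    using eventually_edge_in_open_simplex[OF y(1) i]
    by eventually_elim (use open_simplex_subset in auto)
  have eq: "affine_comb q l (\<lambda>j. y j + s * edge i j) = (\<lambda>a. affine_comb q l y a + s * (l i a - l 0 a))" for s
    by (simp add: affine_comb_line affine_comb_edge[OF i])
  have ev': "\<forall>\<^sub>F s in nhds 0. (\<lambda>a. affine_comb q l y a + s * (l i a - l 0 a)) \<in> standard_simplex p"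
    using ev by eventually_elim (simp add: affine_comb_in_standard_simplex[OF l] flip: eq)
  have "((\<lambda>s. u (\<lambda>a. affine_comb q l y a + s * (l i a - l 0 a))) has_real_derivative
        dirderiv F (coords m c (\<lambda>a. l i a - l 0 a)) (coords m c (affine_comb q l y))) (at 0)"
    using rep y(2) ev' by (rule dfun_has_line_derivative)
  moreover have "\<forall>\<^sub>F s in nhds 0. g (\<lambda>j. y j + s * edge i j) = u (\<lambda>a. affine_comb q l y a + s * (l i a - l 0 a))"
    using ev by eventually_elim (simp add: g eq)
  ultimately show "((\<lambda>s. g (\<lambda>j. y j + s * edge i j)) has_real_derivative
        dirderiv F (coords m c (\<lambda>a. l i a - l 0 a)) (coords m c (affine_comb q l y))) (at 0)"
    by (subst DERIV_cong_ev[OF refl _ refl]) auto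
  then show "simplex_partial i g y =
      dirderiv F (coords m c (\<lambda>a. l i a - l 0 a)) (coords m c (affine_comb q l y))"
    by (simp add: simplex_partial_edge DERIV_imp_deriv)
qed

lemma vertex_in_n_space: "a < m \<Longrightarrow> vertex a \<in> n_space m"
  by (auto simp: vertex_def n_space_def)

text \<open>Linearity in the direction. Once the direction is expanded, its dependence on a
  parameter or a scale sits in the coefficients alone.\<close>

lemma dirderiv_eq_sum:
  assumes F: "smooth_fun m F" and w: "w \<in> n_space m" and x: "x \<in> n_space m"
  shows "dirderiv F w x = (\<Sum>a<m. w a * dirderiv F (vertex a) x)"
proof -
  obtain P where P: "\<And>i. i < m \<Longrightarrow> smooth_fun m (P i)"
    "\<And>i x. \<lbrakk>i < m; x \<in> n_space m\<rbrakk> \<Longrightarrow> ((\<lambda>s. F (x(i := s))) has_real_derivative P i x) (at (x i))"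
    using smooth_fun_partialsE[OF F] by blast
  have D: "dirderiv F w x = (\<Sum>a<m. w a * P a x)" if w: "w \<in> n_space m" for w
  proof -
    have "((\<lambda>s. F (\<lambda>i. x i + s * w i)) has_real_derivative (\<Sum>i<m. w i * P i (\<lambda>j. x j + 0 * w j))) (at 0)"
    proof (rule smooth_fun_directional_aux[where n = m])
      show "continuous_on (n_space m) (P i)" if "i < m" for i
        by (rule smooth_fun_continuous_on[OF P(1)[OF that]])
      show "w i = 0" if "m \<le> i" for i
        using w that by (simp add: n_space_def)
    qed (use P(2) x in blast)+
    then show ?thesis
      by (simp add: dirderiv_def DERIV_imp_deriv)
  qed
  have "dirderiv F (vertex a) x = P a x" if "a < m" for a
  proof -
    have "dirderiv F (vertex a) x = (\<Sum>b<m. vertex a b * P b x)"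
      by (rule D[OF vertex_in_n_space[OF that]])
    also have "\<dots> = (\<Sum>b<m. if b = a then P b x else 0)"
      unfolding vertex_def by (intro sum.cong) auto
    finally have "dirderiv F (vertex a) x = (\<Sum>b<m. if b = a then P b x else 0)" .
    with that show ?thesis
      by simp
  qed
  then show ?thesis
    by (simp add: D[OF w])
qed

text \<open>Pullbacks of forms are a priori only defined on the interior of a simplex, but locally they
  extend continuously to the boundary. This makes them bounded and integrals depend continuously on
  parameters.\<close>

definition tame_on :: "'p::topological_space set \<Rightarrow> 'p set \<Rightarrow> ('p \<Rightarrow> real) \<Rightarrow> bool" where
  "tame_on K K0 w \<longleftrightarrow>
     (\<forall>x\<in>K. \<exists>V g. open V \<and> x \<in> V \<and> continuous_on (V \<inter> K) g \<and> (\<forall>y\<in>V \<inter> K0. w y = g y))"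

lemma tame_onI_continuous: "\<lbrakk>K0 \<subseteq> K; continuous_on K w\<rbrakk> \<Longrightarrow> tame_on K K0 w"
  by (auto simp: tame_on_def intro!: exI[of _ UNIV])

lemma tame_on_binop:
  assumes op: "\<And>S f g. \<lbrakk>continuous_on S f; continuous_on S g\<rbrakk>
      \<Longrightarrow> continuous_on (S :: 'p::topological_space set) (\<lambda>x. h (f x) (g x) :: real)"
    and w: "tame_on (K :: 'p set) K0 w" and w': "tame_on K K0 w'"
  shows "tame_on K K0 (\<lambda>x. h (w x) (w' x))"
  unfolding tame_on_def
proof
  fix x assume x: "x \<in> K"
  obtain V g where V: "open V" "x \<in> V" "continuous_on (V \<inter> K) g" "\<forall>y\<in>V \<inter> K0. w y = g y"
    using w x unfolding tame_on_def by meson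
  obtain V' g' where V': "open V'" "x \<in> V'" "continuous_on (V' \<inter> K) g'" "\<forall>y\<in>V' \<inter> K0. w' y = g' y"
    using w' x unfolding tame_on_def by meson
  have "continuous_on (V \<inter> V' \<inter> K) (\<lambda>x. h (g x) (g' x))"
    by (intro op continuous_on_subset[OF V(3)] continuous_on_subset[OF V'(3)]) auto
  with V V' show "\<exists>V g. open V \<and> x \<in> V \<and> continuous_on (V \<inter> K) g \<and> (\<forall>y\<in>V \<inter> K0. h (w y) (w' y) = g y)"
    by (intro exI[of _ "V \<inter> V'"] exI[of _ "\<lambda>x. h (g x) (g' x)"]) (auto intro: open_Int)
qed

lemma tame_on_add: "\<lbrakk>tame_on K K0 w; tame_on K K0 w'\<rbrakk> \<Longrightarrow> tame_on K K0 (\<lambda>x. w x + w' x)"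
  by (rule tame_on_binop) (intro continuous_intros)

lemma tame_on_mult: "\<lbrakk>tame_on K K0 w; tame_on K K0 w'\<rbrakk> \<Longrightarrow> tame_on K K0 (\<lambda>x. w x * w' x)"
  by (rule tame_on_binop) (intro continuous_intros)

lemma tame_on_const: "K0 \<subseteq> K \<Longrightarrow> tame_on K K0 (\<lambda>_. a)"
  by (rule tame_onI_continuous) auto

lemma tame_on_sum:
  "\<lbrakk>K0 \<subseteq> K; \<And>i. i \<in> I \<Longrightarrow> tame_on K K0 (w i)\<rbrakk> \<Longrightarrow> tame_on K K0 (\<lambda>x. \<Sum>i\<in>I. w i x)"
  by (induction I rule: infinite_finite_induct) (auto intro: tame_on_const tame_on_add)

lemma tame_on_prod:
  "\<lbrakk>K0 \<subseteq> K; \<And>i. i \<in> I \<Longrightarrow> tame_on K K0 (w i)\<rbrakk> \<Longrightarrow> tame_on K K0 (\<lambda>x. \<Prod>i\<in>I. w i x)"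
  by (induction I rule: infinite_finite_induct) (auto intro: tame_on_const tame_on_mult)

lemma tame_on_sum_list:
  "\<lbrakk>K0 \<subseteq> K; \<And>i. i \<in> set is \<Longrightarrow> tame_on K K0 (w i)\<rbrakk> \<Longrightarrow> tame_on K K0 (\<lambda>x. \<Sum>i\<leftarrow>is. w i x)"
  by (induction "is") (auto intro: tame_on_const tame_on_add)

lemma tame_on_local:
  assumes "\<And>x. x \<in> K \<Longrightarrow> \<exists>V w'. open V \<and> x \<in> V \<and> tame_on K K0 w' \<and> (\<forall>y\<in>V \<inter> K0. w y = w' y)"
  shows "tame_on K K0 w"
  unfolding tame_on_def
proof
  fix x assume x: "x \<in> K"
  obtain V w' where V: "open V" "x \<in> V" "tame_on K K0 w'" "\<forall>y\<in>V \<inter> K0. w y = w' y"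
    using assms[OF x] by meson
  obtain V' g where V': "open V'" "x \<in> V'" "continuous_on (V' \<inter> K) g" "\<forall>y\<in>V' \<inter> K0. w' y = g y"
    using V(3) x unfolding tame_on_def by meson
  have "continuous_on (V \<inter> V' \<inter> K) g"
    by (rule continuous_on_subset[OF V'(3)]) auto
  with V V' show "\<exists>V g. open V \<and> x \<in> V \<and> continuous_on (V \<inter> K) g \<and> (\<forall>y\<in>V \<inter> K0. w y = g y)"
    by (intro exI[of _ "V \<inter> V'"] exI[of _ g]) (auto intro: open_Int)
qed

lemma tame_on_continuous_on:
  assumes "tame_on K K0 w" "K0 \<subseteq> K"
  shows "continuous_on K0 w"
  unfolding continuous_on_def
proof
  fix x assume x: "x \<in> K0"
  then obtain V g where V: "open V" "x \<in> V" "continuous_on (V \<inter> K) g" "\<forall>y\<in>V \<inter> K0. w y = g y"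
    using assms unfolding tame_on_def by (meson subsetD)
  have "(g \<longlongrightarrow> g x) (at x within V \<inter> K0)"
    using continuous_on_subset[OF V(3), of "V \<inter> K0"] V(2) x assms(2) by (auto simp: continuous_on_def)
  then have "(w \<longlongrightarrow> w x) (at x within V \<inter> K0)"
    using V(2,4) x by (subst Lim_cong_within[OF refl _ refl, where g = g]) auto
  moreover have "at x within V \<inter> K0 = at x within K0"
    by (rule at_within_nhd[OF V(2,1)]) auto
  ultimately show "(w \<longlongrightarrow> w x) (at x within K0)"
    by simp
qed

text \<open>The local extensions \<open>g\<close> are not patched together; a finite subcover by
  sets on which an extension stays within distance 1 of its value at the centre suffices.\<close>

lemma tame_on_bounded:
  assumes "tame_on K K0 w" "compact K" "K0 \<subseteq> K"
  obtains B where "\<And>y. y \<in> K0 \<Longrightarrow> \<bar>w y\<bar> \<le> B"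
proof -
  have "\<exists>V b. open V \<and> x \<in> V \<and> (\<forall>y\<in>V \<inter> K0. \<bar>w y\<bar> \<le> b)" if x: "x \<in> K" for x
  proof -
    obtain V g where V: "open V" "x \<in> V" "continuous_on (V \<inter> K) g" "\<forall>y\<in>V \<inter> K0. w y = g y"
      using assms(1) x unfolding tame_on_def by meson
    have "open {g x - 1<..<g x + 1}"
      by simp
    then obtain A where A: "open A" "A \<inter> (V \<inter> K) = g -` {g x - 1<..<g x + 1} \<inter> (V \<inter> K)"
      using V(3) unfolding continuous_on_open_invariant by meson
    have "x \<in> A"
      using A(2) V(2) x by auto
    moreover have "\<bar>w y\<bar> \<le> \<bar>g x\<bar> + 1" if "y \<in> (V \<inter> A) \<inter> K0" for y
    proof -
      have "y \<in> A \<inter> (V \<inter> K)"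
        using that assms(3) by blast
      then have "g y \<in> {g x - 1<..<g x + 1}"
        using A(2) by blast
      moreover have "w y = g y"
        using V(4) that by blast
      ultimately show ?thesis
        by auto
    qed
    ultimately show ?thesis
      using V(1,2) A(1) by (intro exI[of _ "V \<inter> A"] exI[of _ "\<bar>g x\<bar> + 1"]) (auto intro: open_Int)
  qed
  then obtain V b where Vb: "\<And>x. x \<in> K \<Longrightarrow> open (V x) \<and> x \<in> V x \<and> (\<forall>y\<in>V x \<inter> K0. \<bar>w y\<bar> \<le> b x)"
    by metis
  obtain C where C: "C \<subseteq> K" "finite C" "K \<subseteq> (\<Union>x\<in>C. V x)"
    by (rule compactE_image[OF assms(2), of K V]) (use Vb in blast)+
  have "\<bar>w y\<bar> \<le> Max (insert 0 (b ` C))" if y: "y \<in> K0" for y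
  proof -
    obtain x where x: "x \<in> C" "y \<in> V x"
      using C(3) y assms(3) by blast
    then have "\<bar>w y\<bar> \<le> b x"
      using Vb C(1) y by blast
    also have "\<dots> \<le> Max (insert 0 (b ` C))"
      using C(2) x(1) by simp
    finally show ?thesis .
  qed
  then show ?thesis
    by (rule that)
qed

lemma continuous_on_affine_comb:
  assumes "\<And>j a. j \<le> q \<Longrightarrow> continuous_on E (\<lambda>e. l e j a)"
  shows "continuous_on (E \<times> S) (\<lambda>z. affine_comb q (l (fst z)) (snd z))"
  unfolding affine_comb_def
proof (intro continuous_intros)
  fix a j assume j: "j \<in> {..q}"
  show "continuous_on (E \<times> S) (\<lambda>z. l (fst z) j a)"
    by (rule continuous_on_compose2[OF assms continuous_on_fst]) (use j in \<open>auto intro: continuous_on_id\<close>)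
  show "continuous_on (E \<times> S) (\<lambda>z. snd z j)"
    by (rule continuous_on_compose2[OF continuous_on_coordinate continuous_on_snd]) (auto intro: continuous_on_id)
qed

text \<open>A path of affine q-simplices in the p-simplex. Instances are the constant path, the
  contraction towards a vertex, and the shrinking of a small simplex to a point.\<close>

locale affine_family =
  fixes p q :: nat and l :: "real \<Rightarrow> nat \<Rightarrow> nat \<Rightarrow> real"
  assumes vertices: "\<And>e j. \<lbrakk>e \<in> {0..1}; j \<le> q\<rbrakk> \<Longrightarrow> l e j \<in> standard_simplex p"
    and continuous: "\<And>j a. j \<le> q \<Longrightarrow> continuous_on {0..1} (\<lambda>e. l e j a)"
begin

abbreviation "K \<equiv> {0..1 :: real} \<times> standard_simplex q"
abbreviation "K0 \<equiv> {0..1 :: real} \<times> open_simplex q"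
abbreviation "L z \<equiv> affine_comb q (l (fst z)) (snd z)"

lemma K0_subset: "K0 \<subseteq> K"
  using open_simplex_subset by blast

lemma L_in: "z \<in> K \<Longrightarrow> L z \<in> standard_simplex p"
  by (auto intro!: affine_comb_in_standard_simplex vertices)

lemma continuous_on_L: "continuous_on K L"
  by (rule continuous_on_affine_comb[OF continuous])

lemma L_preimage_openE:
  assumes "open V"
  obtains W where "open W" "\<And>z. z \<in> K \<Longrightarrow> z \<in> W \<longleftrightarrow> L z \<in> V"
proof -
  obtain W where "open W" "W \<inter> K = L -` V \<inter> K"
    using continuous_on_L assms unfolding continuous_on_open_invariant by meson
  then show ?thesis
    by (intro that[of W]) auto
qed

text \<open>The partial derivative is controlled at interior points only, but its expression by the
  representative \<open>F\<close> is continuous up to the boundary and in the parameter.\<close>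

lemma tame_on_simplex_partial:
  assumes u: "u \<in> dfun (euclid_sub (Suc p) (standard_simplex p))" and i: "i \<le> q"
    and g: "\<And>e y. \<lbrakk>e \<in> {0..1}; y \<in> standard_simplex q\<rbrakk> \<Longrightarrow> g e y = u (L (e, y))"
  shows "tame_on K K0 (\<lambda>z. simplex_partial i (g (fst z)) (snd z))"
  unfolding tame_on_def
proof
  fix z0 assume z0: "z0 \<in> K"
  obtain V m F c where V: "open V" "L z0 \<in> V" "smooth_fun m F"
    "\<And>y. y \<in> standard_simplex p \<inter> V \<Longrightarrow> u y = F (\<lambda>i. if i < m then y (c i) else 0)"
    by (rule dfun_euclid_subE[OF u L_in[OF z0]]) blast
  then have rep: "\<And>y. y \<in> standard_simplex p \<inter> V \<Longrightarrow> u y = F (coords m c y)"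
    by (simp add: coords_def)
  obtain W where W: "open W" "\<And>z. z \<in> K \<Longrightarrow> z \<in> W \<longleftrightarrow> L z \<in> V"
    using L_preimage_openE[OF V(1)] by blast
  define w where "w = (\<lambda>z :: real \<times> (nat \<Rightarrow> real). coords m c (\<lambda>a. l (fst z) i a - l (fst z) 0 a))"
  \<comment> \<open>The direction depends on the parameter, while \<open>dirderiv F\<close> is known
    to be continuous for a fixed direction; hence the expansion along the coordinate axes.\<close>
  define G where "G = (\<lambda>z :: real \<times> (nat \<Rightarrow> real). \<Sum>a<m. w z a * dirderiv F (vertex a) (coords m c (L z)))"
  have "continuous_on K (\<lambda>z. w z a)" for a
  proof -
    have *: "continuous_on K (\<lambda>z. l (fst z) j b)" if "j \<le> q" for j b
      by (rule continuous_on_compose2[OF continuous[OF that] continuous_on_fst]) (auto intro: continuous_on_id)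
    show ?thesis
      by (cases "a < m") (auto simp: w_def coords_def intro!: continuous_intros * i)
  qed
  moreover have "continuous_on K (\<lambda>z. dirderiv F (vertex a) (coords m c (L z)))" if "a < m" for a
    by (rule continuous_on_compose2[OF smooth_fun_continuous_on[OF
            smooth_fun_dirderiv[OF V(3) vertex_in_n_space[OF that]]] continuous_on_coords[OF continuous_on_L]])
      (auto intro: coords_in_n_space)
  ultimately have "continuous_on K G"
    unfolding G_def by (intro continuous_intros) auto
  then have "continuous_on (W \<inter> K) G"
    by (rule continuous_on_subset) auto
  moreover have "simplex_partial i (g (fst z)) (snd z) = G z" if z: "z \<in> W \<inter> K0" for z
  proof -
    have e: "fst z \<in> {0..1}" and y: "snd z \<in> open_simplex q" and LV: "L z \<in> V"
      using z W K0_subset by auto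
    have "simplex_partial i (g (fst z)) (snd z) =
        dirderiv F (coords m c (\<lambda>a. l (fst z) i a - l (fst z) 0 a)) (coords m c (L z))"
      using V(1,3) rep vertices[OF e] _ y LV i
      by (rule simplex_partial_affine) (use g[OF e] in auto)
    also have "\<dots> = G z"
      unfolding G_def w_def
      by (rule dirderiv_eq_sum[OF V(3) coords_in_n_space coords_in_n_space])
    finally show ?thesis .
  qed
  ultimately show "\<exists>V G. open V \<and> z0 \<in> V \<and> continuous_on (V \<inter> K) G \<and>
      (\<forall>z\<in>V \<inter> K0. simplex_partial i (g (fst z)) (snd z) = G z)"
    using W z0 V(2) by blast
qed

lemma tame_on_local_form:
  assumes X: "differential_space X" and \<sigma>: "\<sigma> \<in> smooth_simplices p X"
    and Fs: "\<forall>fs\<in>set Fs. \<forall>i\<le>q. fs i \<in> dfun X"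
  shows "tame_on K K0 (\<lambda>z. local_form q Fs (subsimplex q (l (fst z)) \<sigma>) (snd z))"
proof -
  have \<sigma>cont: "continuous_map (top_of_set (standard_simplex p)) (dtop X) \<sigma>"
    using smooth_simplicesD(1)[OF \<sigma>] by (simp add: singular_simplex_def euclidean_product_topology)
  have 1: "tame_on K K0 (\<lambda>z. f (subsimplex q (l (fst z)) \<sigma> (snd z)))" if f: "f \<in> dfun X" for f
  proof -
    have "continuous_map (top_of_set (standard_simplex p)) euclideanreal (f \<circ> \<sigma>)"
      by (rule continuous_map_compose[OF \<sigma>cont differential_spaceD(2)[OF X f]])
    then have "continuous_on (standard_simplex p) (f \<circ> \<sigma>)"
      by simp
    then have "continuous_on K (\<lambda>z. (f \<circ> \<sigma>) (L z))"
      by (rule continuous_on_compose2[OF _ continuous_on_L]) (use L_in in blast)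
    then have "continuous_on K (\<lambda>z. f (subsimplex q (l (fst z)) \<sigma> (snd z)))"
      by (rule continuous_on_eq) (auto simp: subsimplex_apply)
    then show ?thesis
      by (rule tame_onI_continuous[OF K0_subset])
  qed
  have 2: "tame_on K K0 (\<lambda>z. simplex_partial i (f \<circ> subsimplex q (l (fst z)) \<sigma>) (snd z))"
    if f: "f \<in> dfun X" and i: "i \<le> q" for f i
    by (rule tame_on_simplex_partial[OF smooth_simplicesD(3)[OF \<sigma> f] i]) (simp add: subsimplex_apply)
  have perm: "\<pi> i \<le> q" if "\<pi> permutes {1..q}" "i \<in> {1..q}" for \<pi> i
    using permutes_in_image[OF that(1), of i] that(2) by auto
  show ?thesis
    unfolding local_form_def
    by (intro tame_on_sum_list tame_on_mult tame_on_sum tame_on_prod tame_on_const 1 2 K0_subset)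
      (use Fs perm in auto)
qed

text \<open>Local expressions of a form live on open sets of the space; their preimages under the
  family are the neighbourhoods on which extensions are built.\<close>

lemma tame_on_form:
  assumes X: "differential_space X" and \<sigma>: "\<sigma> \<in> smooth_simplices p X" and \<omega>: "\<omega> \<in> forms X q"
  shows "tame_on K K0 (\<lambda>z. \<omega> (subsimplex q (l (fst z)) \<sigma>) (snd z))"
proof (rule tame_on_local)
  fix z0 assume z0: "z0 \<in> K"
  have "\<sigma> (L z0) \<in> points X"
    using smooth_simplicesD(2)[OF \<sigma> L_in[OF z0]] .
  then obtain U Fs where U: "\<sigma> (L z0) \<in> U" "represents X q U Fs \<omega>"
    using \<omega> unfolding forms_def by blast
  then have Fs: "\<forall>fs\<in>set Fs. \<forall>i\<le>q. fs i \<in> dfun X" and "openin (dtop X) U"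
    and rep: "\<And>\<tau> t. \<lbrakk>\<tau> \<in> smooth_simplices q X; t \<in> open_simplex q; \<tau> t \<in> U\<rbrakk> \<Longrightarrow> \<omega> \<tau> t = local_form q Fs \<tau> t"
    by (auto simp: represents_def)
  have "continuous_map (top_of_set (standard_simplex p)) (dtop X) \<sigma>"
    using smooth_simplicesD(1)[OF \<sigma>] by (simp add: singular_simplex_def euclidean_product_topology)
  then have "openin (top_of_set (standard_simplex p)) {x \<in> standard_simplex p. \<sigma> x \<in> U}"
    using openin_continuous_map_preimage[OF _ \<open>openin (dtop X) U\<close>] by fastforce
  then obtain V where V: "open V" "{x \<in> standard_simplex p. \<sigma> x \<in> U} = standard_simplex p \<inter> V"
    by (auto simp: openin_open)
  obtain W where W: "open W" "\<And>z. z \<in> K \<Longrightarrow> z \<in> W \<longleftrightarrow> L z \<in> V"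
    using L_preimage_openE[OF V(1)] by blast
  have WU: "z \<in> W \<longleftrightarrow> \<sigma> (L z) \<in> U" if "z \<in> K" for z
    using W(2)[OF that] V(2) L_in[OF that] by blast
  have "\<omega> (subsimplex q (l (fst z)) \<sigma>) (snd z) = local_form q Fs (subsimplex q (l (fst z)) \<sigma>) (snd z)"
    if z: "z \<in> W \<inter> K0" for z
  proof (rule rep)
    have zK: "z \<in> K"
      using z K0_subset by blast
    then show "subsimplex q (l (fst z)) \<sigma> \<in> smooth_simplices q X"
      by (auto intro!: subsimplex_smooth[OF \<sigma>] vertices)
    show "snd z \<in> open_simplex q"
      using z by auto
    show "subsimplex q (l (fst z)) \<sigma> (snd z) \<in> U"
      using WU[OF zK] z zK by (auto simp: subsimplex_apply)
  qed
  then show "\<exists>V w'. open V \<and> z0 \<in> V \<and> tame_on K K0 w' \<and>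
      (\<forall>z\<in>V \<inter> K0. \<omega> (subsimplex q (l (fst z)) \<sigma>) (snd z) = w' z)"
    using W(1) WU[OF z0] U(1) tame_on_local_form[OF X \<sigma> Fs] by blast
qed

end

section \<open>Measurability, integrability and continuity of integrals over simplices\<close>

abbreviation cube_measure :: "nat \<Rightarrow> (nat \<Rightarrow> real) measure" where
  "cube_measure k \<equiv> Pi\<^sub>M {1..k} (\<lambda>_. lborel)"

definition simplex_integrand :: "nat \<Rightarrow> ((nat \<Rightarrow> real) \<Rightarrow> real) \<Rightarrow> (nat \<Rightarrow> real) \<Rightarrow> real" where
  "simplex_integrand k u t = (if barycentric k t \<in> open_simplex k then u (barycentric k t) else 0)"

lemma simplex_integral_eq: "simplex_integral k u = (LINT t|cube_measure k. simplex_integrand k u t)"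
  by (simp add: simplex_integral_def simplex_integrand_def)

lemma simplex_integral_cong:
  assumes "\<And>t. t \<in> open_simplex k \<Longrightarrow> u t = v t"
  shows "simplex_integral k u = simplex_integral k v"
proof -
  have "simplex_integrand k u = simplex_integrand k v"
    using assms by (auto simp: simplex_integrand_def)
  then show ?thesis
    by (simp add: simplex_integral_eq)
qed

lemma borel_measurable_barycentric: "barycentric k \<in> borel_measurable (cube_measure k)"
proof (rule measurable_coordinatewise_then_product)
  fix j
  have *: "(\<lambda>t. t i) \<in> borel_measurable (cube_measure k)" if "i \<in> {1..k}" for i
    using measurable_component_singleton[OF that, of "\<lambda>_. lborel :: real measure"] by simp
  have "(\<lambda>t. 1 - (\<Sum>i = 1..k. t i)) \<in> borel_measurable (cube_measure k)"
    by (intro borel_measurable_diff borel_measurable_const borel_measurable_sum *)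
  then show "(\<lambda>t. barycentric k t j) \<in> borel_measurable (cube_measure k)"
    unfolding barycentric_def using * by (cases "j = 0"; cases "j \<le> k") auto
qed

lemma open_simplex_borel: "open_simplex k \<in> sets borel"
proof -
  have "open (\<Inter>i\<in>{..k}. {y :: nat \<Rightarrow> real. 0 < y i})"
    by (intro open_INT ballI open_Collect_less continuous_on_coordinate) auto
  moreover have "closed (standard_simplex k)"
    by (rule compact_imp_closed[OF compact_standard_simplex])
  moreover have "open_simplex k = standard_simplex k \<inter> (\<Inter>i\<in>{..k}. {y. 0 < y i})"
    by (auto simp: open_simplex_def)
  ultimately show ?thesis
    by auto
qed

lemma borel_measurable_simplex_integrand:
  assumes "continuous_on (open_simplex k) u"
  shows "simplex_integrand k u \<in> borel_measurable (cube_measure k)"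
proof -
  have "(\<lambda>y. if y \<in> open_simplex k then u y else 0) \<in> borel_measurable borel"
    by (rule borel_measurable_continuous_on_if[OF open_simplex_borel assms continuous_on_const])
  from measurable_compose[OF borel_measurable_barycentric this] show ?thesis
    by (simp add: simplex_integrand_def[abs_def])
qed

abbreviation unit_cube :: "nat \<Rightarrow> (nat \<Rightarrow> real) set" where
  "unit_cube k \<equiv> Pi\<^sub>E {1..k} (\<lambda>_. {0..1})"

lemma emeasure_box:
  assumes "a \<le> b"
  shows "emeasure (cube_measure k) (Pi\<^sub>E {1..k} (\<lambda>_. {a..b})) = ennreal ((b - a) ^ k)"
proof -
  interpret product_sigma_finite "\<lambda>_ :: nat. lborel :: real measure"
    by unfold_locales
  show ?thesis
    using assms by (subst emeasure_PiM) (auto simp: prod_ennreal ennreal_power)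
qed

lemma fmeasurable_unit_cube: "unit_cube k \<in> fmeasurable (cube_measure k)"
  by (rule fmeasurableI) (auto simp del: One_nat_def simp: emeasure_box intro: sets_PiM_I_finite)

lemma barycentric_open_simplexD:
  assumes "barycentric k t \<in> open_simplex k" "t \<in> space (cube_measure k)"
  shows "t \<in> unit_cube k"
proof -
  have "0 \<le> t i \<and> t i \<le> 1" if "i \<in> {1..k}" for i
  proof -
    have "barycentric k t \<in> standard_simplex k"
      using assms(1) open_simplex_subset by blast
    then have "0 \<le> barycentric k t i \<and> barycentric k t i \<le> 1"
      by (simp add: standard_simplex_def)
    then show ?thesis
      using that by (simp add: barycentric_def)
  qed
  then show ?thesis
    using assms(2) by (auto simp: space_PiM PiE_def)
qed

lemma integrable_simplex_integrand:
  assumes "continuous_on (open_simplex k) u" and B: "\<And>y. y \<in> open_simplex k \<Longrightarrow> \<bar>u y\<bar> \<le> B"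
  shows "integrable (cube_measure k) (simplex_integrand k u)"
proof (rule Bochner_Integration.integrable_bound)
  show "integrable (cube_measure k) (\<lambda>t. B * indicator (unit_cube k) t)"
    using fmeasurable_unit_cube[of k] by (auto simp: fmeasurable_def less_top)
  show "AE t in cube_measure k. norm (simplex_integrand k u t) \<le> norm (B * indicator (unit_cube k) t)"
  proof (rule AE_I2)
    fix t assume t: "t \<in> space (cube_measure k)"
    show "norm (simplex_integrand k u t) \<le> norm (B * indicator (unit_cube k) t)"
    proof (cases "barycentric k t \<in> open_simplex k")
      case True
      then show ?thesis
        using B[OF True] barycentric_open_simplexD[OF True t] by (simp add: simplex_integrand_def)
    qed (simp add: simplex_integrand_def)
  qed
qed (rule borel_measurable_simplex_integrand[OF assms(1)])

text \<open>Dominated convergence: tameness gives pointwise convergence on the open simplex and one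
  bound for all parameters, which is integrable because the coordinates stay in the unit
  cube.\<close>

lemma simplex_integral_continuous_on:
  assumes w: "tame_on ({0..1} \<times> standard_simplex k) ({0..1} \<times> open_simplex k) w"
  shows "continuous_on {0..1::real} (\<lambda>e. simplex_integral k (\<lambda>y. w (e, y)))"
proof -
  let ?K = "{0..1::real} \<times> standard_simplex k" and ?O = "{0..1::real} \<times> open_simplex k"
  have sub: "?O \<subseteq> ?K"
    using open_simplex_subset by blast
  have cont: "continuous_on ?O w"
    by (rule tame_on_continuous_on[OF w sub])
  obtain B where B: "\<And>y. y \<in> ?O \<Longrightarrow> \<bar>w y\<bar> \<le> B"
    using tame_on_bounded[OF w _ sub] compact_Times[OF compact_Icc compact_standard_simplex] by blast
  have slice: "continuous_on (open_simplex k) (\<lambda>y. w (e, y))" if "e \<in> {0..1}" for e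
    by (rule continuous_on_compose2[OF cont]) (use that in \<open>auto intro!: continuous_intros\<close>)
  show ?thesis
    unfolding continuous_on_sequentially o_def
  proof (intro allI ballI impI)
    fix x :: "nat \<Rightarrow> real" and a
    assume a: "a \<in> {0..1}" and x: "(\<forall>n. x n \<in> {0..1}) \<and> x \<longlonglongrightarrow> a"
    show "(\<lambda>n. simplex_integral k (\<lambda>y. w (x n, y))) \<longlonglongrightarrow> simplex_integral k (\<lambda>y. w (a, y))"
      unfolding simplex_integral_eq
    proof (rule integral_dominated_convergence)
      show "integrable (cube_measure k) (\<lambda>t. B * indicator (unit_cube k) t)"
        using fmeasurable_unit_cube[of k] by (auto simp: fmeasurable_def less_top)
      show "AE t in cube_measure k. (\<lambda>n. simplex_integrand k (\<lambda>y. w (x n, y)) t)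
          \<longlonglongrightarrow> simplex_integrand k (\<lambda>y. w (a, y)) t"
      proof (rule AE_I2)
        fix t
        show "(\<lambda>n. simplex_integrand k (\<lambda>y. w (x n, y)) t) \<longlonglongrightarrow> simplex_integrand k (\<lambda>y. w (a, y)) t"
        proof (cases "barycentric k t \<in> open_simplex k")
          case True
          have "(\<lambda>n. (x n, barycentric k t)) \<longlonglongrightarrow> (a, barycentric k t)"
            using x by (intro tendsto_intros) auto
          then have "(\<lambda>n. w (x n, barycentric k t)) \<longlonglongrightarrow> w (a, barycentric k t)"
            by (rule continuous_on_tendsto_compose[OF cont]) (use a x True in auto)
          then show ?thesis
            using True by (simp add: simplex_integrand_def)
        qed (simp add: simplex_integrand_def)
      qed
      show "AE t in cube_measure k. norm (simplex_integrand k (\<lambda>y. w (x n, y)) t)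
          \<le> B * indicator (unit_cube k) t" for n
      proof (rule AE_I2)
        fix t assume t: "t \<in> space (cube_measure k)"
        have B0: "0 \<le> B" if "y \<in> open_simplex k" for y
          using B[of "(0, y)"] that abs_ge_zero[of "w (0, y)"] by auto
        show "norm (simplex_integrand k (\<lambda>y. w (x n, y)) t) \<le> B * indicator (unit_cube k) t"
        proof (cases "barycentric k t \<in> open_simplex k")
          case True
          then show ?thesis
            using B[of "(x n, barycentric k t)"] x barycentric_open_simplexD[OF True t]
            by (simp add: simplex_integrand_def)
        next
          case False
          \<comment> \<open>The majorant must be nonnegative also where the integrand vanishes; an
            interior point, here the barycentre, shows that \<open>B\<close> bounds an absolute
            value.\<close>
          have "vertex_mean \<in> open_simplex k" if "vertex_mean = (\<lambda>j. if j \<le> k then 1 / real (Suc k) else 0)" for vertex_mean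
            using that by (simp add: open_simplex_iff)
          then have "0 \<le> B"
            using B0 by blast
          then show ?thesis
            using False by (simp add: simplex_integrand_def)
        qed
      qed
    qed (use slice a x borel_measurable_simplex_integrand in auto)
  qed
qed

lemma simplex_integral_add:
  assumes "integrable (cube_measure k) (simplex_integrand k u)" "integrable (cube_measure k) (simplex_integrand k v)"
  shows "simplex_integral k (\<lambda>t. u t + v t) = simplex_integral k u + simplex_integral k v"
proof -
  have "simplex_integrand k (\<lambda>t. u t + v t) = (\<lambda>t. simplex_integrand k u t + simplex_integrand k v t)"
    by (auto simp: simplex_integrand_def)
  then show ?thesis
    using assms by (simp add: simplex_integral_eq)
qed

lemma simplex_integral_cmult: "simplex_integral k (\<lambda>t. a * u t) = a * simplex_integral k u"
proof -
  have "simplex_integrand k (\<lambda>t. a * u t) = (\<lambda>t. a * simplex_integrand k u t)"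
    by (auto simp: simplex_integrand_def)
  then show ?thesis
    by (simp add: simplex_integral_eq)
qed

lemma simplex_integral_uminus: "simplex_integral k (\<lambda>t. - u t) = - simplex_integral k u"
  using simplex_integral_cmult[of k "-1" u] by simp

lemma simplex_integral_0 [simp]: "simplex_integral k (\<lambda>t. 0) = 0"
  using simplex_integral_cmult[of k 0 "\<lambda>_. 0"] by simp

text \<open>Allows a constant to be recovered from its integral over the simplex.\<close>

lemma simplex_volume_pos: "0 < simplex_integral k (\<lambda>_. 1)"
proof -
  \<comment> \<open>The k coordinates are to lie between 2 and 3 times the fraction 1/(4(k + 1)).
    They are then positive with sum below 3/4, so that the cube lies in the open simplex, and the
    cube has positive volume.\<close>
  define a :: real where "a = 2 / (4 * Suc k)"
  define b :: real where "b = 3 / (4 * Suc k)"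
  have ab: "0 < a" "a < b"
    unfolding a_def b_def by (auto intro!: divide_strict_right_mono)
  let ?B = "Pi\<^sub>E {1..k} (\<lambda>_. {a..b})"
  have B: "barycentric k t \<in> open_simplex k" if t: "t \<in> ?B" for t
  proof -
    have tb: "a \<le> t i \<and> t i \<le> b" if "i \<in> {1..k}" for i
      using t that by (auto simp: PiE_def Pi_def)
    have "(\<Sum>i = 1..k. t i) \<le> k * b"
      using sum_bounded_above[of "{1..k}" t b] tb by simp
    also have "\<dots> < 1"
      by (simp add: b_def field_simps)
    finally have "(\<Sum>i = 1..k. t i) < 1" .
    moreover have "(\<Sum>i\<le>k. barycentric k t i) = barycentric k t 0 + (\<Sum>i = 1..k. barycentric k t i)"
      by (simp add: sum.atLeast_Suc_atMost flip: atLeast0AtMost)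
    moreover have "(\<Sum>i = 1..k. barycentric k t i) = (\<Sum>i = 1..k. t i)"
      by (rule sum.cong) (auto simp: barycentric_def)
    moreover have "0 < t i" if "i \<in> {1..k}" for i
      using tb[OF that] ab by linarith
    ultimately show ?thesis
      by (auto simp: open_simplex_iff barycentric_def)
  qed
  have int: "integrable (cube_measure k) (simplex_integrand k (\<lambda>_. 1))"
    by (rule integrable_simplex_integrand[where B = 1]) (auto intro: continuous_on_const)
  have fB: "?B \<in> fmeasurable (cube_measure k)"
    using ab by (intro fmeasurableI) (auto simp del: One_nat_def simp: emeasure_box intro: sets_PiM_I_finite)
  then have "integrable (cube_measure k) (indicator ?B :: _ \<Rightarrow> real)"
    by (auto simp: fmeasurable_def less_top)
  then have "(LINT t|cube_measure k. indicator ?B t) \<le> simplex_integral k (\<lambda>_. 1)"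
    unfolding simplex_integral_eq
    by (rule integral_mono[OF _ int]) (use B in \<open>auto simp: simplex_integrand_def indicator_def\<close>)
  moreover have "(LINT t|cube_measure k. indicator ?B t) = measure (cube_measure k) ?B"
    using sets.sets_into_space[OF fmeasurableD[OF fB]] by (simp add: Int_absorb2)
  moreover have "0 < measure (cube_measure k) ?B"
    using ab emeasure_box[of a b k] by (simp add: measure_def)
  ultimately show ?thesis
    by simp
qed

section \<open>Integrals over chains, additivity in the chain and in the form\<close>

lemma chain_integral_superset:
  assumes "finite S" "Poly_Mapping.keys c \<subseteq> S"
  shows "chain_integral k \<omega> c = (\<Sum>\<sigma>\<in>S. of_int (Poly_Mapping.lookup c \<sigma>) * simplex_integral k (\<omega> \<sigma>))"
  unfolding chain_integral_def
  by (rule sum.mono_neutral_left[OF assms]) (auto simp: in_keys_iff)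

lemma chain_integral_chain_add: "chain_integral k \<omega> (c + d) = chain_integral k \<omega> c + chain_integral k \<omega> d"
proof -
  let ?S = "Poly_Mapping.keys c \<union> Poly_Mapping.keys d"
  have S: "finite ?S"
    by simp
  show ?thesis
    unfolding chain_integral_superset[OF S keys_add] chain_integral_superset[OF S Un_upper1]
      chain_integral_superset[OF S Un_upper2]
    by (simp add: lookup_add algebra_simps sum.distrib)
qed

lemma chain_integral_chain_0 [simp]: "chain_integral k \<omega> 0 = 0"
  by (simp add: chain_integral_def)

lemma chain_integral_chain_uminus: "chain_integral k \<omega> (- c) = - chain_integral k \<omega> c"
  using chain_integral_chain_add[of k \<omega> c "- c"] by simp

lemma chain_integral_chain_diff: "chain_integral k \<omega> (c - d) = chain_integral k \<omega> c - chain_integral k \<omega> d"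
  using chain_integral_chain_add[of k \<omega> c "- d"] by (simp add: chain_integral_chain_uminus)

lemma chain_integral_frag_of: "chain_integral k \<omega> (frag_of \<sigma>) = simplex_integral k (\<omega> \<sigma>)"
  by (simp add: chain_integral_def)

lemma chain_integral_frag_cmul: "chain_integral k \<omega> (frag_cmul a c) = of_int a * chain_integral k \<omega> c"
  by (subst chain_integral_superset[OF finite_keys keys_cmul])
    (simp add: chain_integral_def sum_distrib_left mult.assoc)

lemma chain_integral_chain_sum:
  "chain_integral k \<omega> (\<Sum>i\<in>I. c i) = (\<Sum>i\<in>I. chain_integral k \<omega> (c i))"
  by (induction I rule: infinite_finite_induct) (auto simp: chain_integral_chain_add)

lemma affine_family_vertex: "affine_family q q (\<lambda>_. vertex)"
  by unfold_locales (auto intro: continuous_on_const)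

text \<open>The parameter interval is a dummy: through the constant family, the results on families
  of simplices apply to a single one.\<close>

lemma form_tame_on_simplex:
  assumes "differential_space X" "\<sigma> \<in> smooth_simplices k X" "\<omega> \<in> forms X k"
  shows "tame_on ({0..1::real} \<times> standard_simplex k) ({0..1} \<times> open_simplex k) (\<lambda>z. \<omega> \<sigma> (snd z))"
  using affine_family.tame_on_form[OF affine_family_vertex assms] subsimplex_vertices[OF assms(2)] by simp

lemma
  assumes "differential_space X" "\<sigma> \<in> smooth_simplices k X" "\<omega> \<in> forms X k"
  shows form_continuous_on: "continuous_on (open_simplex k) (\<omega> \<sigma>)"
    and form_integrable: "integrable (cube_measure k) (simplex_integrand k (\<omega> \<sigma>))"
proof -
  let ?K = "{0..1::real} \<times> standard_simplex k" and ?O = "{0..1::real} \<times> open_simplex k"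
  have sub: "?O \<subseteq> ?K"
    using open_simplex_subset by blast
  note w = form_tame_on_simplex[OF assms]
  have "continuous_on (open_simplex k) (\<lambda>y. (\<lambda>z. \<omega> \<sigma> (snd z)) (0::real, y))"
    by (rule continuous_on_compose2[OF tame_on_continuous_on[OF w sub]]) (auto intro!: continuous_intros)
  then show c: "continuous_on (open_simplex k) (\<omega> \<sigma>)"
    by simp
  obtain B where B: "\<And>z. z \<in> ?O \<Longrightarrow> \<bar>\<omega> \<sigma> (snd z)\<bar> \<le> B"
    using tame_on_bounded[OF w _ sub] compact_Times[OF compact_Icc compact_standard_simplex] by blast
  show "integrable (cube_measure k) (simplex_integrand k (\<omega> \<sigma>))"
    by (rule integrable_simplex_integrand[OF c, of B]) (use B[of "(0, _)"] in auto)
qed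

text \<open>The integral of a non-integrable function is 0 by convention, so additivity in the form
  rests on the integrability of its pullbacks.\<close>

lemma chain_integral_form_add:
  assumes X: "differential_space X" and \<omega>: "\<omega> \<in> forms X k" and \<eta>: "\<eta> \<in> forms X k"
    and c: "Poly_Mapping.keys c \<subseteq> smooth_simplices k X"
  shows "chain_integral k (\<lambda>\<sigma> t. \<omega> \<sigma> t + \<eta> \<sigma> t) c = chain_integral k \<omega> c + chain_integral k \<eta> c"
proof -
  have "simplex_integral k (\<lambda>t. \<omega> \<sigma> t + \<eta> \<sigma> t) = simplex_integral k (\<omega> \<sigma>) + simplex_integral k (\<eta> \<sigma>)"
    if "\<sigma> \<in> Poly_Mapping.keys c" for \<sigma>
    using that c by (intro simplex_integral_add form_integrable[OF X] \<omega> \<eta>) auto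
  then show ?thesis
    by (simp add: chain_integral_def algebra_simps sum.distrib)
qed

lemma chain_integral_form_uminus: "chain_integral k (\<lambda>\<sigma> t. - \<omega> \<sigma> t) c = - chain_integral k \<omega> c"
  by (simp add: chain_integral_def simplex_integral_uminus sum_negf)

lemma chain_integral_form_0 [simp]: "chain_integral k (\<lambda>\<sigma> t. 0) c = 0"
  by (simp add: chain_integral_def)

section \<open>Sums, negatives and pullbacks of forms\<close>

lemma local_form_append: "local_form k (Fs @ Gs) \<sigma> t = local_form k Fs \<sigma> t + local_form k Gs \<sigma> t"
  by (simp add: local_form_def)

definition negate_rep :: "(nat \<Rightarrow> 'a \<Rightarrow> real) \<Rightarrow> nat \<Rightarrow> 'a \<Rightarrow> real" where
  "negate_rep fs = fs(0 := (\<lambda>x. - fs 0 x))"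

lemma local_form_negate: "local_form k (map negate_rep Fs) \<sigma> t = - local_form k Fs \<sigma> t"
proof -
  let ?D = "\<lambda>fs. \<Sum>\<pi> | \<pi> permutes {1..k}.
      of_int (sign \<pi>) * (\<Prod>i=1..k. simplex_partial (\<pi> i) (fs i \<circ> \<sigma>) t)"
  have "?D (negate_rep fs) = ?D fs" for fs
    by (intro sum.cong refl arg_cong2[where f = "(*)"] prod.cong) (auto simp: negate_rep_def)
  then have "negate_rep fs 0 (\<sigma> t) * ?D (negate_rep fs) = - (fs 0 (\<sigma> t) * ?D fs)" for fs
    by (simp only: negate_rep_def fun_upd_same mult_minus_left)
  then show ?thesis
    by (simp only: local_form_def map_map uminus_sum_list_map o_def)
qed

lemma smooth_fun_uminus: "smooth_fun (Suc 0) (\<lambda>x. - x 0)"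
proof (rule smooth_fun.intros)
  show "continuous_map (Euclidean_space (Suc 0)) euclideanreal (\<lambda>x. - x 0)"
    by (auto simp: continuous_map_Euclidean_space_real intro!: continuous_intros continuous_on_coordinate)
  have "((\<lambda>s. - (x(0 := s)) 0) has_real_derivative -1) (at (x 0))" for x :: "nat \<Rightarrow> real"
    by (auto intro!: derivative_eq_intros)
  then show "\<forall>i<Suc 0. \<exists>F'. smooth_fun (Suc 0) F' \<and>
       (\<forall>x\<in>topspace (Euclidean_space (Suc 0)).
           ((\<lambda>s. - (x(i := s)) 0) has_real_derivative F' x) (at (x i)))"
    using smooth_fun_const by (metis less_Suc0)
qed

lemma dfun_uminus:
  assumes X: "differential_space X" and f: "f \<in> dfun X"
  shows "(\<lambda>x. - f x) \<in> dfun X"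
  using differential_spaceD(3)[OF X smooth_fun_uminus, of "\<lambda>_. f"] f by simp

lemma dfun_const: "differential_space X \<Longrightarrow> (\<lambda>x. a) \<in> dfun X"
  using differential_spaceD(3)[OF _ smooth_fun_const[of 0 a]] by simp

lemma represents_negate:
  assumes "differential_space X" "represents X k U Fs \<omega>"
  shows "represents X k U (map negate_rep Fs) (\<lambda>\<sigma> t. - \<omega> \<sigma> t)"
  using assms by (auto simp: represents_def local_form_negate negate_rep_def intro: dfun_uminus)

lemma represents_add:
  assumes "represents X k U Fs \<omega>" "represents X k V Gs \<eta>"
  shows "represents X k (U \<inter> V) (Fs @ Gs) (\<lambda>\<sigma> t. \<omega> \<sigma> t + \<eta> \<sigma> t)"
  using assms by (auto simp: represents_def local_form_append)

lemma forms_0: "(\<lambda>_ _. 0) \<in> forms X k"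
  by (auto simp: forms_def represents_def local_form_def intro!: exI[of _ "points X"] exI[of _ "[]"])

lemma forms_outside: "\<lbrakk>\<omega> \<in> forms X k; \<not> (\<sigma> \<in> smooth_simplices k X \<and> t \<in> open_simplex k)\<rbrakk> \<Longrightarrow> \<omega> \<sigma> t = 0"
  by (auto simp: forms_def)

lemma forms_representsE:
  assumes "\<omega> \<in> forms X k" "x \<in> points X"
  obtains U Fs where "x \<in> U" "represents X k U Fs \<omega>"
  using assms unfolding forms_def by blast

lemma forms_add: "\<lbrakk>\<omega> \<in> forms X k; \<eta> \<in> forms X k\<rbrakk> \<Longrightarrow> (\<lambda>\<sigma> t. \<omega> \<sigma> t + \<eta> \<sigma> t) \<in> forms X k"
proof -
  assume \<omega>: "\<omega> \<in> forms X k" and \<eta>: "\<eta> \<in> forms X k"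
  have "\<exists>U Fs. x \<in> U \<and> represents X k U Fs (\<lambda>\<sigma> t. \<omega> \<sigma> t + \<eta> \<sigma> t)" if x: "x \<in> points X" for x
  proof -
    obtain U Fs where U: "x \<in> U" "represents X k U Fs \<omega>"
      using forms_representsE[OF \<omega> x] by blast
    obtain V Gs where V: "x \<in> V" "represents X k V Gs \<eta>"
      using forms_representsE[OF \<eta> x] by blast
    show ?thesis
      using represents_add[OF U(2) V(2)] U(1) V(1) by blast
  qed
  then show ?thesis
    using forms_outside[OF \<omega>] forms_outside[OF \<eta>] by (simp add: forms_def)
qed

lemma forms_uminus: "\<lbrakk>differential_space X; \<omega> \<in> forms X k\<rbrakk> \<Longrightarrow> (\<lambda>\<sigma> t. - \<omega> \<sigma> t) \<in> forms X k"
proof -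
  assume X: "differential_space X" and \<omega>: "\<omega> \<in> forms X k"
  have "\<exists>U Fs. x \<in> U \<and> represents X k U Fs (\<lambda>\<sigma> t. - \<omega> \<sigma> t)" if x: "x \<in> points X" for x
  proof -
    obtain U Fs where "x \<in> U" "represents X k U Fs \<omega>"
      using forms_representsE[OF \<omega> x] by blast
    then show ?thesis
      using represents_negate[OF X] by blast
  qed
  then show ?thesis
    using forms_outside[OF \<omega>] by (simp add: forms_def)
qed

lemma representsD:
  assumes "represents X k U Fs \<omega>"
  shows "openin (dtop X) U" "\<And>fs i. \<lbrakk>fs \<in> set Fs; i \<le> k\<rbrakk> \<Longrightarrow> fs i \<in> dfun X"
    "\<And>\<sigma> t. \<lbrakk>\<sigma> \<in> smooth_simplices k X; t \<in> open_simplex k; \<sigma> t \<in> U\<rbrakk> \<Longrightarrow> \<omega> \<sigma> t = local_form k Fs \<sigma> t"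
  using assms by (auto simp: represents_def)

lemma simplex_partial_cong:
  assumes "\<And>y. y \<in> standard_simplex k \<Longrightarrow> u y = v y" "t \<in> open_simplex k" "i \<le> k"
  shows "simplex_partial i u t = simplex_partial i v t"
  unfolding simplex_partial_edge
proof (rule deriv_cong_ev)
  show "\<forall>\<^sub>F s in nhds 0. u (\<lambda>j. t j + s * edge i j) = v (\<lambda>j. t j + s * edge i j)"
    using eventually_edge_in_open_simplex[OF assms(2,3)]
    by eventually_elim (use assms(1) open_simplex_subset in blast)
qed simp

lemma permutes_atLeastAtMost_le: "\<lbrakk>\<pi> permutes {1..k}; i \<in> {1..k}\<rbrakk> \<Longrightarrow> \<pi> i \<in> {1..k}"
  by (simp only: permutes_in_image)

lemma local_form_cong:
  assumes "\<And>y fs i. \<lbrakk>y \<in> standard_simplex k; fs \<in> set Fs; i \<le> k\<rbrakk> \<Longrightarrow> fs i (\<sigma> y) = g fs i (\<tau> y)"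
    and t: "t \<in> open_simplex k"
  shows "local_form k Fs \<sigma> t = local_form k (map g Fs) \<tau> t"
proof -
  have "simplex_partial (\<pi> i) (fs i \<circ> \<sigma>) t = simplex_partial (\<pi> i) (g fs i \<circ> \<tau>) t"
    if "fs \<in> set Fs" "\<pi> permutes {1..k}" "i \<in> {1..k}" for fs \<pi> i
    using assms(1) that permutes_atLeastAtMost_le[OF that(2,3)]
    by (intro simplex_partial_cong[OF _ t]) auto
  moreover have "fs 0 (\<sigma> t) = g fs 0 (\<tau> t)" if "fs \<in> set Fs" for fs
    using assms that open_simplex_subset by blast
  ultimately show ?thesis
    by (auto simp: local_form_def o_def intro!: arg_cong[where f = sum_list] map_cong arg_cong2[where f = "(*)"]
        sum.cong prod.cong)
qed

text \<open>A form is evaluated on simplices, so its pullback composes the simplex with the map. The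
  value 0 elsewhere is the normalization demanded by \<open>forms\<close>.\<close>

definition form_pull :: "('b \<Rightarrow> 'a) \<Rightarrow> 'b dspace \<Rightarrow> nat \<Rightarrow> 'a form \<Rightarrow> 'b form" where
  "form_pull \<phi> A k \<omega> \<sigma> t =
     (if \<sigma> \<in> smooth_simplices k A \<and> t \<in> open_simplex k then \<omega> (simplex_map k \<phi> \<sigma>) t else 0)"

text \<open>Each local expression is pulled back by composing its functions with \<phi>, over the
  preimage of the open set on which it is valid.\<close>

lemma form_pull_in_forms:
  assumes A: "differential_space A" and X: "differential_space X" and \<phi>: "smooth_map A X \<phi>"
    and \<omega>: "\<omega> \<in> forms X k"
  shows "form_pull \<phi> A k \<omega> \<in> forms A k"
proof -
  have "\<exists>U Fs. x \<in> U \<and> represents A k U Fs (form_pull \<phi> A k \<omega>)" if x: "x \<in> points A" for x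
  proof -
    have \<phi>x: "\<phi> x \<in> points X"
      using \<phi> x by (auto simp: smooth_map_def)
    obtain U Fs where U: "\<phi> x \<in> U" "represents X k U Fs \<omega>"
      using forms_representsE[OF \<omega> \<phi>x] by blast
    let ?V = "{x \<in> points A. \<phi> x \<in> U}" and ?Gs = "map (\<lambda>fs i. fs i \<circ> \<phi>) Fs"
    have "represents A k ?V ?Gs (form_pull \<phi> A k \<omega>)"
      unfolding represents_def
    proof (intro conjI ballI allI impI)
      show "openin (dtop A) ?V"
        by (rule openin_continuous_map_preimage[OF differential_space_continuous_map[OF A X \<phi>] representsD(1)[OF U(2)]])
      show "gs i \<in> dfun A" if gs: "gs \<in> set ?Gs" and i: "i \<le> k" for gs i
      proof -
        obtain fs where fs: "gs = (\<lambda>i. fs i \<circ> \<phi>)" "fs \<in> set Fs"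
          using gs unfolding set_map by (elim imageE)
        have "fs i \<circ> \<phi> \<in> dfun A"
          using representsD(2)[OF U(2) fs(2) i] \<phi> unfolding smooth_map_def by blast
        then show ?thesis
          unfolding fs(1) .
      qed
      fix \<sigma> t assume *: "\<sigma> \<in> smooth_simplices k A" "t \<in> open_simplex k" "\<sigma> t \<in> ?V"
      have t: "t \<in> standard_simplex k"
        using *(2) open_simplex_subset by blast
      have "\<omega> (simplex_map k \<phi> \<sigma>) t = local_form k Fs (simplex_map k \<phi> \<sigma>) t"
        using * t simplex_map_smooth[OF A X \<phi> *(1)]
        by (intro representsD(3)[OF U(2)]) (auto simp: simplex_map_def)
      also have "\<dots> = local_form k ?Gs \<sigma> t"
        using *(2) by (rule local_form_cong[rotated]) (simp add: simplex_map_def)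
      finally show "form_pull \<phi> A k \<omega> \<sigma> t = local_form k ?Gs \<sigma> t"
        using * by (simp add: form_pull_def)
    qed
    moreover have "x \<in> ?V"
      using x U(1) by simp
    ultimately show ?thesis
      by (intro exI conjI)
  qed
  moreover have "form_pull \<phi> A k \<omega> \<sigma> t = 0"
    if "\<not> (\<sigma> \<in> smooth_simplices k A \<and> t \<in> open_simplex k)" for \<sigma> t
    using that unfolding form_pull_def by (rule if_not_P)
  ultimately show ?thesis
    unfolding forms_def by simp
qed

lemma chain_integral_form_pull:
  assumes "Poly_Mapping.keys c \<subseteq> smooth_simplices k A"
  shows "chain_integral k (form_pull \<phi> A k \<omega>) c = chain_integral k \<omega> (chain_map k \<phi> c)"
  using assms
proof (induction c rule: frag_induction)
  case (one \<sigma>)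
  then have "simplex_integral k (form_pull \<phi> A k \<omega> \<sigma>) = simplex_integral k (\<omega> (simplex_map k \<phi> \<sigma>))"
    by (intro simplex_integral_cong) (simp add: form_pull_def)
  then show ?case
    by (simp add: chain_integral_frag_of)
qed (auto simp: chain_map_diff chain_integral_chain_diff)

section \<open>Cochains given by integrals of forms\<close>

text \<open>Otherwise the absolute value would rise from 0 to at least 1 and pass through
  1/2.\<close>

lemma continuous_Ints_zero:
  fixes f :: "real \<Rightarrow> real"
  assumes "continuous_on {0..1} f" and Z: "\<And>e. e \<in> {0..1} \<Longrightarrow> f e \<in> \<int>" and "f 0 = 0"
  shows "f 1 = 0"
proof (rule ccontr)
  assume "f 1 \<noteq> 0"
  then have "1 \<le> \<bar>f 1\<bar>"
    using Z[of 1] Ints_nonzero_abs_ge1 by auto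
  then obtain x where x: "0 \<le> x" "x \<le> 1" "\<bar>f x\<bar> = 1 / 2"
    using IVT'[of "\<lambda>x. \<bar>f x\<bar>" 0 "1 / 2" 1] assms by (auto intro: continuous_intros)
  then have "f x \<in> \<int>" "f x \<noteq> 0"
    using Z[of x] by auto
  then show False
    using x(3) Ints_nonzero_abs_ge1[of "f x"] by simp
qed

text \<open>Every differential in a local expression vanishes along a constant simplex, and
  positivity of \<open>k\<close> provides at least one. For \<open>k = 0\<close> the value of the
  function would remain.\<close>

lemma form_const_simplex:
  assumes \<omega>: "\<omega> \<in> forms X k" and k: "0 < k" and \<tau>: "\<tau> \<in> smooth_simplices k X"
    and const: "\<And>y. y \<in> standard_simplex k \<Longrightarrow> \<tau> y = x" and t: "t \<in> open_simplex k"
  shows "\<omega> \<tau> t = 0"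
proof -
  have t': "t \<in> standard_simplex k"
    using t open_simplex_subset by blast
  obtain U Fs where U: "\<tau> t \<in> U" "represents X k U Fs \<omega>"
    using forms_representsE[OF \<omega> smooth_simplicesD(2)[OF \<tau> t']] by blast
  have *: "(\<Prod>i=1..k. simplex_partial (\<pi> i) (fs i \<circ> \<tau>) t) = 0" if \<pi>: "\<pi> permutes {1..k}" for \<pi> and fs :: "nat \<Rightarrow> 'a \<Rightarrow> real"
  proof (rule prod_zero)
    have "\<pi> 1 \<le> k"
      using permutes_atLeastAtMost_le[OF \<pi>, of 1] k by simp
    then have "simplex_partial (\<pi> 1) (fs 1 \<circ> \<tau>) t = simplex_partial (\<pi> 1) (\<lambda>_. fs 1 x) t"
      by (intro simplex_partial_cong[OF _ t]) (simp_all add: const)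
    also have "\<dots> = 0"
      by (simp add: simplex_partial_edge)
    finally show "\<exists>i\<in>{1..k}. simplex_partial (\<pi> i) (fs i \<circ> \<tau>) t = 0"
      using k by (intro bexI[of _ 1]) auto
  qed simp
  have "(\<Sum>\<pi> | \<pi> permutes {1..k}.
           of_int (sign \<pi>) * (\<Prod>i=1..k. simplex_partial (\<pi> i) (fs i \<circ> \<tau>) t)) = 0" for fs
    by (intro sum.neutral ballI) (simp only: mem_Collect_eq * mult_zero_right)
  then have "local_form k Fs \<tau> t = 0"
    by (simp only: local_form_def mult_zero_right sum_list_0)
  then show ?thesis
    using representsD(3)[OF U(2) \<tau> t U(1)] by simp
qed

text \<open>Vertex j travels from vertex 0 of the ambient simplex at \<open>e = 0\<close> to its
  vertex \<open>m j\<close> at \<open>e = 1\<close>. The map \<open>m\<close> allows for faces,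
  which use only some of the vertices.\<close>

definition contract :: "real \<Rightarrow> (nat \<Rightarrow> nat) \<Rightarrow> nat \<Rightarrow> nat \<Rightarrow> real" where
  "contract e m = (\<lambda>j a. (1 - e) * vertex 0 a + e * vertex (m j) a)"

lemma contract_in_standard_simplex:
  "\<lbrakk>e \<in> {0..1}; m j \<le> p\<rbrakk> \<Longrightarrow> contract e m j \<in> standard_simplex p"
  unfolding contract_def by (rule convex_standard_simplex) auto

lemma affine_family_contract:
  assumes "\<And>j. j \<le> q \<Longrightarrow> m j \<le> p"
  shows "affine_family p q (\<lambda>e. contract e m)"
proof
  show "contract e m j \<in> standard_simplex p" if "e \<in> {0..1}" "j \<le> q" for e j
    using that by (intro contract_in_standard_simplex assms)
  show "continuous_on {0..1} (\<lambda>e. contract e m j a)" for j a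
    unfolding contract_def by (intro continuous_intros)
qed

lemma contract_1: "contract 1 m = (\<lambda>j. vertex (m j))"
  by (simp add: contract_def)

lemma affine_comb_contract_0:
  assumes "y \<in> standard_simplex q"
  shows "affine_comb q (contract 0 m) y = vertex 0"
proof
  fix a
  have "affine_comb q (contract 0 m) y a = vertex 0 a * (\<Sum>j\<le>q. y j)"
    by (simp add: affine_comb_def contract_def sum_distrib_left)
  then show "affine_comb q (contract 0 m) y a = vertex 0 a"
    using assms by (simp add: standard_simplex_def)
qed

lemma
  assumes X: "differential_space X" and \<omega>: "\<omega> \<in> forms X q" and \<sigma>: "\<sigma> \<in> smooth_simplices p X"
    and m: "\<And>j. j \<le> q \<Longrightarrow> m j \<le> p"
  shows contract_integral_continuous:
      "continuous_on {0..1} (\<lambda>e. simplex_integral q (\<omega> (subsimplex q (contract e m) \<sigma>)))"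
    and contract_integral_0: "0 < q \<Longrightarrow> simplex_integral q (\<omega> (subsimplex q (contract 0 m) \<sigma>)) = 0"
proof -
  show "continuous_on {0..1} (\<lambda>e. simplex_integral q (\<omega> (subsimplex q (contract e m) \<sigma>)))"
    using simplex_integral_continuous_on[OF affine_family.tame_on_form[OF affine_family_contract[OF m] X \<sigma> \<omega>]]
    by simp
  assume q: "0 < q"
  have \<tau>: "subsimplex q (contract 0 m) \<sigma> \<in> smooth_simplices q X"
    by (rule subsimplex_smooth[OF \<sigma> contract_in_standard_simplex]) (simp_all add: m)
  have "\<omega> (subsimplex q (contract 0 m) \<sigma>) t = 0" if "t \<in> open_simplex q" for t
    by (rule form_const_simplex[OF \<omega> q \<tau> _ that]) (simp add: subsimplex_apply affine_comb_contract_0)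
  then have "simplex_integral q (\<omega> (subsimplex q (contract 0 m) \<sigma>)) = simplex_integral q (\<lambda>_. 0)"
    by (rule simplex_integral_cong)
  then show "simplex_integral q (\<omega> (subsimplex q (contract 0 m) \<sigma>)) = 0"
    by simp
qed

text \<open>Contracting a simplex to a vertex deforms the value of a cochain given by integrals to 0, so
  an integer value has to be 0.\<close>

lemma integral_cochain_zero:
  assumes X: "differential_space X" and \<eta>: "\<eta> \<in> forms X (Suc m)" and \<theta>: "\<theta> \<in> forms X m" and m: "0 < m"
    and Z: "\<And>\<tau>. \<tau> \<in> smooth_simplices (Suc m) X \<Longrightarrow>
      chain_integral (Suc m) \<eta> (frag_of \<tau>) - chain_integral m \<theta> (chain_boundary (Suc m) (frag_of \<tau>)) \<in> \<int>"
    and c: "Poly_Mapping.keys c \<subseteq> smooth_simplices (Suc m) X"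
  shows "chain_integral (Suc m) \<eta> c = chain_integral m \<theta> (chain_boundary (Suc m) c)"
  using c
proof (induction c rule: frag_induction)
  case (one \<sigma>)
  \<comment> \<open>\<open>f j\<close> lists the vertices of the j-th face in order.\<close>
  define f where "f = (\<lambda>j i. if i < j then i else Suc i :: nat)"
  define \<tau> where "\<tau> = (\<lambda>e. subsimplex (Suc m) (contract e (\<lambda>i. i)) \<sigma>)"
  define J where "J = (\<lambda>e. simplex_integral (Suc m) (\<eta> (\<tau> e)) -
      (\<Sum>j\<le>Suc m. (- 1) ^ j * simplex_integral m (\<theta> (subsimplex m (contract e (f j)) \<sigma>))))"
  have f: "f j i \<le> Suc m" if "i \<le> m" for i j
    using that by (simp add: f_def)
  have \<tau>: "\<tau> e \<in> smooth_simplices (Suc m) X" if "e \<in> {0..1}" for e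
    unfolding \<tau>_def by (rule subsimplex_smooth[OF one contract_in_standard_simplex[OF that]])
  \<comment> \<open>All faces are contracted towards vertex 0 of the whole simplex, also the one
    opposite to it. Only so do the faces of the contracted simplex agree with the contracted
    faces.\<close>
  have face: "singular_face (Suc m) j (\<tau> e) = subsimplex m (contract e (f j)) \<sigma>"
    if j: "j \<le> Suc m" and e: "e \<in> {0..1}" for j e
  proof -
    have "singular_face (Suc m) j (\<tau> e) = subsimplex m (\<lambda>i. vertex (f j i)) (\<tau> e)"
      using singular_face_eq_subsimplex[of "Suc m" j "\<tau> e"] j by (simp add: f_def)
    also have "\<dots> = subsimplex m (\<lambda>i. affine_comb (Suc m) (contract e (\<lambda>i. i)) (vertex (f j i))) \<sigma>"
      unfolding \<tau>_def by (rule subsimplex_subsimplex) (simp add: f)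
    also have "\<dots> = subsimplex m (contract e (f j)) \<sigma>"
      by (auto simp: subsimplex_def affine_comb_def[of m] affine_comb_vertex[OF f] contract_def fun_eq_iff
          restrict_def intro!: arg_cong[where f = \<sigma>] sum.cong)
    finally show ?thesis .
  qed
  have J: "J e = chain_integral (Suc m) \<eta> (frag_of (\<tau> e)) -
      chain_integral m \<theta> (chain_boundary (Suc m) (frag_of (\<tau> e)))" if "e \<in> {0..1}" for e
    by (simp add: J_def chain_integral_frag_of chain_boundary_of chain_integral_chain_sum
        chain_integral_frag_cmul face[OF _ that] del: sum.atMost_Suc)
  have "J 1 = 0"
  proof (rule continuous_Ints_zero)
    show "continuous_on {0..1} J"
      unfolding J_def \<tau>_def
      by (intro continuous_intros contract_integral_continuous[OF X _ one] \<eta> \<theta> f)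
    show "J e \<in> \<int>" if "e \<in> {0..1}" for e
      unfolding J[OF that] by (rule Z[OF \<tau>[OF that]])
    have "simplex_integral (Suc m) (\<eta> (\<tau> 0)) = 0"
      unfolding \<tau>_def by (rule contract_integral_0[OF X \<eta> one]) auto
    moreover have "simplex_integral m (\<theta> (subsimplex m (contract 0 (f j)) \<sigma>)) = 0" for j
      by (rule contract_integral_0[OF X \<theta> one f m])
    ultimately show "J 0 = 0"
      by (simp add: J_def del: sum.atMost_Suc)
  qed
  moreover have "\<tau> 1 = \<sigma>"
    unfolding \<tau>_def contract_1 by (rule subsimplex_vertices[OF one])
  ultimately show ?case
    using J[of 1] by simp
qed (auto simp: chain_integral_chain_diff chain_boundary_diff)

text \<open>A small k-simplex whose edges from vertex 0 are \<open>\<epsilon> * edge (r j)\<close>.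
  Subtracting the mean of the vertices puts its barycentre at \<open>t\<close>, so that an interior
  point is mapped to \<open>t\<close> exactly.\<close>

definition spread :: "nat \<Rightarrow> (nat \<Rightarrow> nat) \<Rightarrow> (nat \<Rightarrow> real) \<Rightarrow> real \<Rightarrow> nat \<Rightarrow> nat \<Rightarrow> real" where
  "spread k r t \<epsilon> = (\<lambda>j a. t a + \<epsilon> * ((if j = 0 then 0 else edge (r j) a) - (\<Sum>i=1..k. edge (r i) a) / Suc k))"

lemma spread_shift: "spread k r (\<lambda>a. t a + s * w a) \<epsilon> j = (\<lambda>a. spread k r t \<epsilon> j a + s * w a)"
  by (simp add: spread_def fun_eq_iff algebra_simps)

lemma spread_edge: "0 < i \<Longrightarrow> spread k r t \<epsilon> i a - spread k r t \<epsilon> 0 a = \<epsilon> * edge (r i) a"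
  by (simp add: spread_def algebra_simps)

definition barycenter :: "nat \<Rightarrow> nat \<Rightarrow> real" where
  "barycenter k = (\<lambda>j. if j \<le> k then 1 / Suc k else 0)"

lemma barycenter_in_open_simplex: "barycenter k \<in> open_simplex k"
  by (simp add: barycenter_def open_simplex_iff)

lemma affine_comb_spread_barycenter: "affine_comb k (spread k r t \<epsilon>) (barycenter k) = t"
proof
  fix a
  let ?S = "\<Sum>i=1..k. edge (r i) a"
  have "(\<Sum>j\<le>k. if j = 0 then 0 else edge (r j) a) = ?S"
    by (simp add: sum.atLeast_Suc_atMost flip: atLeast0AtMost)
  then have "(\<Sum>j\<le>k. (if j = 0 then 0 else edge (r j) a) - ?S / Suc k) = 0"
    by (simp only: sum_subtractf) simp
  moreover have "(\<Sum>j\<le>k. spread k r t \<epsilon> j a) = Suc k * t a +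
      \<epsilon> * (\<Sum>j\<le>k. (if j = 0 then 0 else edge (r j) a) - ?S / Suc k)"
    unfolding spread_def sum.distrib sum_distrib_left[symmetric] by simp
  moreover have "affine_comb k (spread k r t \<epsilon>) (barycenter k) a = (\<Sum>j\<le>k. spread k r t \<epsilon> j a) / Suc k"
    unfolding affine_comb_def barycenter_def sum_divide_distrib by (rule sum.cong) auto
  ultimately show "affine_comb k (spread k r t \<epsilon>) (barycenter k) a = t a"
    by (simp del: of_nat_Suc)
qed

lemma eventually_spread_in_open_simplex:
  assumes t: "t \<in> open_simplex N" and r: "\<And>i. i \<in> {1..k} \<Longrightarrow> r i \<le> N"
  shows "\<forall>\<^sub>F \<epsilon> in nhds 0. \<forall>j\<in>{..k}. spread k r t \<epsilon> j \<in> open_simplex N"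
proof (intro eventually_ball_finite ballI)
  fix j assume j: "j \<in> {..k}"
  have r': "j \<noteq> 0 \<Longrightarrow> r j \<le> N"
    using r j by auto
  let ?w = "\<lambda>a. (if j = 0 then 0 else edge (r j) a) - (\<Sum>i=1..k. edge (r i) a) / Suc k"
  have "\<forall>\<^sub>F \<epsilon> in nhds 0. (\<lambda>a. t a + \<epsilon> * ?w a) \<in> open_simplex N"
  proof (rule eventually_line_in_open_simplex[OF t])
    show "?w a = 0" if "N < a" for a
      using edge_outside[OF r' that] edge_outside[OF r that] by simp
    have "(\<Sum>a\<le>N. \<Sum>i=1..k. edge (r i) a) = (\<Sum>i=1..k. \<Sum>a\<le>N. edge (r i) a)"
      by (rule sum.swap)
    also have "\<dots> = 0"
      by (rule sum.neutral) (simp add: sum_edge r)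
    finally show "(\<Sum>a\<le>N. ?w a) = 0"
      using r' by (cases "j = 0") (simp_all add: sum_subtractf sum_negf sum_edge flip: sum_divide_distrib)
  qed
  then show "\<forall>\<^sub>F \<epsilon> in nhds 0. spread k r t \<epsilon> j \<in> open_simplex N"
    by (simp add: spread_def)
qed simp

lemma affine_comb_in_open_simplex:
  assumes l: "\<And>j. j \<le> k \<Longrightarrow> l j \<in> open_simplex N" and y: "y \<in> standard_simplex k"
  shows "affine_comb k l y \<in> open_simplex N"
proof -
  have "affine_comb k l y \<in> standard_simplex N"
    by (rule affine_comb_in_standard_simplex[OF _ y]) (use l open_simplex_subset in blast)
  moreover have "0 < affine_comb k l y i" if i: "i \<le> N" for i
  proof -
    have y0: "0 \<le> y j" for j
      using y by (simp add: standard_simplex_def)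
    have li: "0 < l j i" if "j \<le> k" for j
      using l[OF that] i by (simp add: open_simplex_def)
    have "\<exists>j\<in>{..k}. y j \<noteq> 0"
    proof (rule ccontr)
      assume "\<not> (\<exists>j\<in>{..k}. y j \<noteq> 0)"
      then have "(\<Sum>j\<le>k. y j) = 0"
        by (intro sum.neutral) blast
      then show False
        using y by (simp add: standard_simplex_def)
    qed
    then obtain j where j: "j \<in> {..k}" "y j \<noteq> 0"
      by blast
    show ?thesis
      unfolding affine_comb_def
    proof (rule sum_pos2[OF _ j(1)])
      show "0 < l j i * y j"
        using li[of j] j y0[of j] by (intro mult_pos_pos) auto
      show "0 \<le> l j' i * y j'" if "j' \<in> {..k}" for j'
        using li[of j'] y0[of j'] that by (intro mult_nonneg_nonneg) auto
    qed simp
  qed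
  ultimately show ?thesis
    by (simp add: open_simplex_def)
qed

lemma vertex_edge: "(\<lambda>a. vertex i a - vertex 0 a) = edge i"
  by (simp add: vertex_def edge_def of_bool_def fun_eq_iff)

lemma simplex_partial_eq_dirderiv:
  assumes "open V" "smooth_fun m F" "\<And>x. x \<in> standard_simplex N \<inter> V \<Longrightarrow> u x = F (coords m c x)"
    and x: "x \<in> open_simplex N" "x \<in> V" and i: "i \<le> N"
  shows "simplex_partial i u x = dirderiv F (coords m c (edge i)) (coords m c x)"
proof -
  have x': "affine_comb N vertex x = x"
    using x(1) open_simplex_subset by (intro affine_comb_vertices) blast
  have "simplex_partial i u x =
      dirderiv F (coords m c (\<lambda>a. vertex i a - vertex 0 a)) (coords m c (affine_comb N vertex x))"
    by (rule simplex_partial_affine[OF assms(1-3)]) (use x i x' in \<open>simp_all add: affine_comb_vertices\<close>)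
  then show ?thesis
    by (simp only: x' vertex_edge)
qed

text \<open>The edges of the small simplex are \<epsilon> times those selected by \<open>r\<close>,
  so its partial derivatives are \<epsilon> times the partial derivatives of \<open>u\<close> in the
  selected directions, taken at interior points.\<close>

lemma simplex_partial_spread:
  assumes u: "u \<in> dfun (euclid_sub (Suc N) (standard_simplex N))"
    and l: "\<And>j. j \<le> k \<Longrightarrow> spread k r t \<epsilon> j \<in> standard_simplex N"
    and g: "\<And>y. y \<in> standard_simplex k \<Longrightarrow> g y = u (affine_comb k (spread k r t \<epsilon>) y)"
    and y: "y \<in> open_simplex k" "affine_comb k (spread k r t \<epsilon>) y \<in> open_simplex N"
    and i: "i \<in> {1..k}" "r i \<le> N"
  shows "simplex_partial i g y = \<epsilon> * simplex_partial (r i) u (affine_comb k (spread k r t \<epsilon>) y)"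
proof -
  let ?x = "affine_comb k (spread k r t \<epsilon>) y"
  have x: "?x \<in> standard_simplex N"
    using y(2) open_simplex_subset by blast
  obtain V m F c where V: "open V" "?x \<in> V" "smooth_fun m F"
    "\<And>y. y \<in> standard_simplex N \<inter> V \<Longrightarrow> u y = F (\<lambda>i. if i < m then y (c i) else 0)"
    by (rule dfun_euclid_subE[OF u x]) blast
  then have rep: "\<And>y. y \<in> standard_simplex N \<inter> V \<Longrightarrow> u y = F (coords m c y)"
    by (simp add: coords_def)
  have i': "i \<le> k" "0 < i"
    using i(1) by auto
  have "simplex_partial i g y =
      dirderiv F (coords m c (\<lambda>a. spread k r t \<epsilon> i a - spread k r t \<epsilon> 0 a)) (coords m c ?x)"
    by (rule simplex_partial_affine[OF V(1,3) rep l g y(1) V(2) i'(1)])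
  also have "coords m c (\<lambda>a. spread k r t \<epsilon> i a - spread k r t \<epsilon> 0 a) = (\<lambda>a. \<epsilon> * coords m c (edge (r i)) a)"
    unfolding spread_edge[OF i'(2)] by (auto simp: coords_def)
  also have "dirderiv F (\<lambda>a. \<epsilon> * coords m c (edge (r i)) a) (coords m c ?x) =
      (\<Sum>a<m. \<epsilon> * coords m c (edge (r i)) a * dirderiv F (vertex a) (coords m c ?x))"
    by (rule dirderiv_eq_sum[OF V(3) _ coords_in_n_space]) (simp add: coords_def n_space_def)
  also have "\<dots> = \<epsilon> * dirderiv F (coords m c (edge (r i))) (coords m c ?x)"
    unfolding dirderiv_eq_sum[OF V(3) coords_in_n_space coords_in_n_space] sum_distrib_left
    by (simp only: mult.assoc)
  also have "dirderiv F (coords m c (edge (r i))) (coords m c ?x) = simplex_partial (r i) u ?x"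
    by (rule simplex_partial_eq_dirderiv[OF V(1,3) rep y(2) V(2) i(2), symmetric])
  finally show ?thesis .
qed

text \<open>Each of the k differentials contributes a factor \<epsilon>. The map \<open>r\<close>
  picks k of the \<open>N\<close> directions: with the identity one gets the coefficient of the form
  itself, and k out of k + 1 directions occur for the exterior derivative.\<close>

lemma local_form_spread:
  assumes \<sigma>: "\<sigma> \<in> smooth_simplices N X"
    and l: "\<And>j. j \<le> k \<Longrightarrow> spread k r t \<epsilon> j \<in> open_simplex N"
    and Fs: "\<And>fs i. \<lbrakk>fs \<in> set Fs; i \<le> k\<rbrakk> \<Longrightarrow> fs i \<in> dfun X"
    and y: "y \<in> open_simplex k" and r: "\<And>i. i \<in> {1..k} \<Longrightarrow> r i \<le> N"
  shows "local_form k Fs (subsimplex k (spread k r t \<epsilon>) \<sigma>) y = \<epsilon> ^ k *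
     (\<Sum>fs\<leftarrow>Fs. fs 0 (\<sigma> (affine_comb k (spread k r t \<epsilon>) y)) * (\<Sum>\<pi> | \<pi> permutes {1..k}.
        of_int (sign \<pi>) * (\<Prod>i=1..k. simplex_partial (r (\<pi> i)) (fs i \<circ> \<sigma>) (affine_comb k (spread k r t \<epsilon>) y))))"
proof -
  let ?x = "affine_comb k (spread k r t \<epsilon>) y" and ?\<tau> = "subsimplex k (spread k r t \<epsilon>) \<sigma>"
  have y': "y \<in> standard_simplex k"
    using y open_simplex_subset by blast
  have x: "?x \<in> open_simplex N"
    by (rule affine_comb_in_open_simplex[OF l y'])
  have l': "spread k r t \<epsilon> j \<in> standard_simplex N" if "j \<le> k" for j
    using l[OF that] open_simplex_subset by blast
  have partial: "simplex_partial (\<pi> i) (fs i \<circ> ?\<tau>) y = \<epsilon> * simplex_partial (r (\<pi> i)) (fs i \<circ> \<sigma>) ?x"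
    if fs: "fs \<in> set Fs" and \<pi>: "\<pi> permutes {1..k}" and i: "i \<in> {1..k}" for fs \<pi> i
  proof -
    have \<pi>i: "\<pi> i \<in> {1..k}"
      by (rule permutes_atLeastAtMost_le[OF \<pi> i])
    have fi: "fs i \<in> dfun X"
      using Fs[OF fs, of i] i by simp
    show ?thesis
      by (rule simplex_partial_spread[OF smooth_simplicesD(3)[OF \<sigma> fi] l' _ y x \<pi>i r[OF \<pi>i]])
        (simp_all add: subsimplex_apply)
  qed
  have "(\<Sum>\<pi> | \<pi> permutes {1..k}. of_int (sign \<pi>) * (\<Prod>i=1..k. simplex_partial (\<pi> i) (fs i \<circ> ?\<tau>) y)) =
     \<epsilon> ^ k * (\<Sum>\<pi> | \<pi> permutes {1..k}. of_int (sign \<pi>) *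
        (\<Prod>i=1..k. simplex_partial (r (\<pi> i)) (fs i \<circ> \<sigma>) ?x))" if fs: "fs \<in> set Fs" for fs
    unfolding sum_distrib_left
  proof (rule sum.cong[OF refl])
    fix \<pi> assume "\<pi> \<in> {\<pi>. \<pi> permutes {1..k}}"
    then have "(\<Prod>i=1..k. simplex_partial (\<pi> i) (fs i \<circ> ?\<tau>) y) =
        (\<Prod>i=1..k. \<epsilon> * simplex_partial (r (\<pi> i)) (fs i \<circ> \<sigma>) ?x)"
      by (intro prod.cong refl partial fs) auto
    then show "of_int (sign \<pi>) * (\<Prod>i=1..k. simplex_partial (\<pi> i) (fs i \<circ> ?\<tau>) y) =
      \<epsilon> ^ k * (of_int (sign \<pi>) * (\<Prod>i=1..k. simplex_partial (r (\<pi> i)) (fs i \<circ> \<sigma>) ?x))"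
      by (simp add: prod.distrib)
  qed
  then show ?thesis
    unfolding local_form_def sum_list_const_mult[symmetric]
    by (intro arg_cong[where f = sum_list] map_cong refl) (simp add: subsimplex_apply[OF y'])
qed

text \<open>The integral over a simplex shrinking to \<open>t\<close>, divided by the k-th power of
  its size, only involves values of \<omega> near \<open>t\<close>. These normalized integrals
  vanish at positive size, and continuity carries this to size 0.\<close>

lemma form_eq_zero:
  assumes X: "differential_space X" and \<omega>: "\<omega> \<in> forms X k"
    and zero: "\<And>\<tau>. \<tau> \<in> smooth_simplices k X \<Longrightarrow> simplex_integral k (\<omega> \<tau>) = 0"
  shows "\<omega> = (\<lambda>_ _. 0)"
proof (intro ext)
  fix \<sigma> t
  show "\<omega> \<sigma> t = 0"
  proof (cases "\<sigma> \<in> smooth_simplices k X \<and> t \<in> open_simplex k")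
    case False
    then show ?thesis
      by (rule forms_outside[OF \<omega>])
  next
    case True
    then have \<sigma>: "\<sigma> \<in> smooth_simplices k X" and t: "t \<in> open_simplex k"
      by blast+
    have "\<forall>\<^sub>F \<epsilon> in nhds 0. \<forall>j\<in>{..k}. spread k (\<lambda>i. i) t \<epsilon> j \<in> open_simplex k"
      by (rule eventually_spread_in_open_simplex[OF t]) simp
    then obtain d where d: "0 < d" "\<And>\<epsilon> j. \<lbrakk>dist \<epsilon> 0 < d; j \<le> k\<rbrakk> \<Longrightarrow> spread k (\<lambda>i. i) t \<epsilon> j \<in> open_simplex k"
      unfolding eventually_nhds_metric by (auto simp: Ball_def)
    \<comment> \<open>Scaling by \<open>d / 2\<close> keeps the size below the admissible
      \<open>d\<close> for all parameters up to 1.\<close>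
    define l where "l = (\<lambda>e. spread k (\<lambda>i. i) t (e * (d / 2)))"
    have l: "l e j \<in> open_simplex k" if "e \<in> {0..1}" "j \<le> k" for e j
      unfolding l_def using d(1) that by (intro d(2)) (auto simp: abs_mult field_simps)
    interpret affine_family k k l
    proof
      show "l e j \<in> standard_simplex k" if "e \<in> {0..1}" "j \<le> k" for e j
        using l[OF that] open_simplex_subset by blast
      show "continuous_on {0..1} (\<lambda>e. l e j a)" for j a
        unfolding l_def spread_def by (intro continuous_intros)
    qed
    have L: "L z \<in> open_simplex k" if "z \<in> K" for z
      using that l by (intro affine_comb_in_open_simplex) auto
    \<comment> \<open>The integral with the power of the size divided out. At parameter 0, where the
      simplex degenerates to \<open>t\<close>, its value is the coefficient at \<open>t\<close>
      times the volume of the standard simplex.\<close>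
    define I where "I = (\<lambda>e. simplex_integral k (\<lambda>y. \<omega> \<sigma> (L (e, y))))"
    have "continuous_on K (\<lambda>z. \<omega> \<sigma> (L z))"
      by (rule continuous_on_compose2[OF form_continuous_on[OF X \<sigma> \<omega>] continuous_on_L]) (use L in blast)
    then have "continuous_on {0..1} I"
      unfolding I_def by (intro simplex_integral_continuous_on tame_onI_continuous K0_subset)
    moreover have "(\<lambda>n. inverse (real (Suc n))) \<longlonglongrightarrow> 0"
      by (rule LIMSEQ_inverse_real_of_nat)
    ultimately have "(\<lambda>n. I (inverse (real (Suc n)))) \<longlonglongrightarrow> I 0"
      by (rule continuous_on_tendsto_compose) (auto simp: field_simps)
    moreover have "I e = 0" if e: "0 < e" "e \<le> 1" for e
    proof -
      have e': "e \<in> {0..1}"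
        using e by simp
      have \<tau>: "subsimplex k (l e) \<sigma> \<in> smooth_simplices k X"
        by (rule subsimplex_smooth[OF \<sigma> vertices[OF e']])
      have "\<omega> (subsimplex k (l e) \<sigma>) y = (e * (d / 2)) ^ k * \<omega> \<sigma> (L (e, y))" if y: "y \<in> open_simplex k" for y
      proof -
        have y': "y \<in> standard_simplex k"
          using y open_simplex_subset by blast
        have x: "L (e, y) \<in> open_simplex k"
          using L[of "(e, y)"] e' y' by blast
        then have "\<sigma> (L (e, y)) \<in> points X"
          using open_simplex_subset by (intro smooth_simplicesD(2)[OF \<sigma>]) blast
        then obtain U Fs where U: "\<sigma> (L (e, y)) \<in> U" "represents X k U Fs \<omega>"
          by (rule forms_representsE[OF \<omega>])
        have "\<omega> (subsimplex k (l e) \<sigma>) y = local_form k Fs (subsimplex k (l e) \<sigma>) y"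
          using U(1) y' by (intro representsD(3)[OF U(2) \<tau> y]) (simp add: subsimplex_apply)
        also have "\<dots> = (e * (d / 2)) ^ k * local_form k Fs \<sigma> (L (e, y))"
          unfolding local_form_def[of k Fs \<sigma>] l_def fst_conv snd_conv
          by (rule local_form_spread[OF \<sigma>])
            (use l[OF e'] representsD(2)[OF U(2)] y in \<open>auto simp: l_def\<close>)
        also have "local_form k Fs \<sigma> (L (e, y)) = \<omega> \<sigma> (L (e, y))"
          by (rule representsD(3)[OF U(2) \<sigma> x U(1), symmetric])
        finally show ?thesis .
      qed
      then have "simplex_integral k (\<omega> (subsimplex k (l e) \<sigma>)) =
          simplex_integral k (\<lambda>y. (e * (d / 2)) ^ k * \<omega> \<sigma> (L (e, y)))"
        by (rule simplex_integral_cong)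
      then have "0 = (e * (d / 2)) ^ k * I e"
        unfolding zero[OF \<tau>] simplex_integral_cmult I_def .
      then show ?thesis
        using e(1) d(1) by simp
    qed
    then have "(\<lambda>n. I (inverse (real (Suc n)))) = (\<lambda>n. 0)"
      by (intro ext) (simp add: field_simps)
    ultimately have "I 0 = 0"
      using LIMSEQ_unique[OF _ tendsto_const] by metis
    moreover have "L (0, y) = t" if "y \<in> standard_simplex k" for y
    proof
      fix a
      have "affine_comb k (\<lambda>_. t) y a = t a * (\<Sum>j\<le>k. y j)"
        by (simp add: affine_comb_def sum_distrib_left)
      moreover have "l 0 = (\<lambda>_. t)"
        by (simp add: l_def spread_def)
      ultimately show "L (0, y) a = t a"
        using that by (simp add: standard_simplex_def)
    qed
    then have "I 0 = simplex_integral k (\<lambda>y. \<omega> \<sigma> t * 1)"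
      unfolding I_def by (intro simplex_integral_cong) (use open_simplex_subset in auto)
    ultimately show ?thesis
      unfolding simplex_integral_cmult using simplex_volume_pos[of k] by simp
  qed
qed

section \<open>The exterior derivative\<close>

text \<open>Transports a permutation of \<open>{1..k}\<close> to \<open>{2..Suc k}\<close>, leaving
  the index 1 for the direction in which one differentiates.\<close>

definition lift_perm :: "(nat \<Rightarrow> nat) \<Rightarrow> nat \<Rightarrow> nat" where
  "lift_perm \<pi> = (\<lambda>i. case i of 0 \<Rightarrow> 0 | Suc j \<Rightarrow> Suc (\<pi> j))"

lemma lift_perm_Suc [simp]: "lift_perm \<pi> (Suc j) = Suc (\<pi> j)"
  by (simp add: lift_perm_def)

lemma
  assumes \<pi>: "\<pi> permutes {1..k}"
  shows lift_perm_permutes: "lift_perm \<pi> permutes {1..Suc k}"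
    and sign_lift_perm: "sign (lift_perm \<pi>) = sign \<pi>"
    and lift_perm_1: "lift_perm \<pi> (Suc 0) = Suc 0"
proof -
  have inj: "inj_on Suc {1..k}"
    by simp
  have "map_permutation {1..k} Suc \<pi> = lift_perm \<pi>"
  proof
    fix i
    show "map_permutation {1..k} Suc \<pi> i = lift_perm \<pi> i"
    proof (cases i)
      case 0
      then show ?thesis
        by (simp add: map_permutation_def lift_perm_def restrict_id_def)
    next
      case (Suc j)
      show ?thesis
      proof (cases "j \<in> {1..k}")
        case True
        then show ?thesis
          using map_permutation_apply[OF inj True, of \<pi>] Suc by simp
      next
        case False
        then have "\<pi> j = j"
          by (rule permutes_not_in[OF \<pi>])
        then show ?thesis
          using False Suc by (auto simp: map_permutation_def restrict_id_def)
      qed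
    qed
  qed
  moreover have "map_permutation {1..k} Suc \<pi> permutes {1..Suc k}"
  proof (rule permutes_subset)
    show "map_permutation {1..k} Suc \<pi> permutes {2..Suc k}"
      by (rule map_permutation_permutes[OF _ \<pi>]) (auto simp: bij_betw_def)
  qed auto
  ultimately show "lift_perm \<pi> permutes {1..Suc k}" and "sign (lift_perm \<pi>) = sign \<pi>"
    using sign_map_permutation[OF inj \<pi>] by simp_all
  have "\<pi> 0 = 0"
    by (rule permutes_not_in[OF \<pi>]) simp
  then show "lift_perm \<pi> (Suc 0) = Suc 0"
    by simp
qed

text \<open>Reindexing by \<open>\<rho> \<mapsto> \<rho> \<circ> lift_perm \<pi>\<close> turns the signed sum of the hypotheses into \<open>k!\<close> times the
  sum in question.\<close>

lemma alternating_sum_lift_zero: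
  fixes T :: "(nat \<Rightarrow> nat) \<Rightarrow> real"
  assumes zero: "\<And>\<rho>. \<rho> permutes {1..Suc k} \<Longrightarrow>
      (\<Sum>\<pi> | \<pi> permutes {1..k}. of_int (sign \<pi>) * T (\<rho> \<circ> lift_perm \<pi>)) = 0"
  shows "(\<Sum>\<rho> | \<rho> permutes {1..Suc k}. of_int (sign \<rho>) * T \<rho>) = 0"
proof -
  let ?S = "\<Sum>\<rho> | \<rho> permutes {1..Suc k}. of_int (sign \<rho>) * T \<rho>"
  have "(\<Sum>\<rho> | \<rho> permutes {1..Suc k}. of_int (sign \<rho> * sign \<pi>) * T (\<rho> \<circ> lift_perm \<pi>)) = ?S"
    (is "?R \<pi> = _") if \<pi>: "\<pi> permutes {1..k}" for \<pi>
  proof -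
    have "?S = (\<Sum>\<rho> | \<rho> permutes {1..Suc k}. of_int (sign (\<rho> \<circ> lift_perm \<pi>)) * T (\<rho> \<circ> lift_perm \<pi>))"
      by (rule sum_permutations_compose_right[OF lift_perm_permutes[OF \<pi>]])
    also have "\<dots> = (\<Sum>\<rho> | \<rho> permutes {1..Suc k}. of_int (sign \<rho> * sign \<pi>) * T (\<rho> \<circ> lift_perm \<pi>))"
    proof (rule sum.cong[OF refl])
      fix \<rho> assume "\<rho> \<in> {\<rho>. \<rho> permutes {1..Suc k}}"
      then have \<rho>: "permutation \<rho>"
        using permutes_imp_permutation[of "{1..Suc k}"] by blast
      have "permutation (lift_perm \<pi>)"
        using permutes_imp_permutation[OF _ lift_perm_permutes[OF \<pi>]] by blast
      then show "of_int (sign (\<rho> \<circ> lift_perm \<pi>)) * T (\<rho> \<circ> lift_perm \<pi>) =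
          of_int (sign \<rho> * sign \<pi>) * T (\<rho> \<circ> lift_perm \<pi>)"
        by (simp add: sign_compose[OF \<rho>] sign_lift_perm[OF \<pi>])
    qed
    finally show ?thesis ..
  qed
  then have "?S = ?R \<pi>" if "\<pi> \<in> {\<pi>. \<pi> permutes {1..k}}" for \<pi>
    using that by (simp only: mem_Collect_eq)
  then have "(\<Sum>\<pi> | \<pi> permutes {1..k}. ?S) = (\<Sum>\<pi> | \<pi> permutes {1..k}. ?R \<pi>)"
    by (rule sum.cong[OF refl])
  also have "\<dots> = (\<Sum>\<rho> | \<rho> permutes {1..Suc k}. \<Sum>\<pi> | \<pi> permutes {1..k}.
      of_int (sign \<rho> * sign \<pi>) * T (\<rho> \<circ> lift_perm \<pi>))"
    by (rule sum.swap)
  also have "\<dots> = 0"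
  proof (rule sum.neutral, rule ballI)
    fix \<rho> assume "\<rho> \<in> {\<rho>. \<rho> permutes {1..Suc k}}"
    then have "(\<Sum>\<pi> | \<pi> permutes {1..k}. of_int (sign \<pi>) * T (\<rho> \<circ> lift_perm \<pi>)) = 0"
      by (intro zero) simp
    then have "of_int (sign \<rho>) * (\<Sum>\<pi> | \<pi> permutes {1..k}. of_int (sign \<pi>) * T (\<rho> \<circ> lift_perm \<pi>)) = 0"
      by simp
    then show "(\<Sum>\<pi> | \<pi> permutes {1..k}. of_int (sign \<rho> * sign \<pi>) * T (\<rho> \<circ> lift_perm \<pi>)) = 0"
      by (simp only: sum_distrib_left of_int_mult mult.assoc)
  qed
  finally have "fact k * ?S = 0"
    using card_permutations[of "{1..k}" k] by simp
  then show ?thesis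
    by simp
qed

text \<open>Composition with the transposition of 1 and \<open>Suc m\<close> reverses the sign and
  preserves the term by symmetry of \<open>H\<close>, as the other factors do not see these two
  positions. So the sum equals its negative.\<close>

lemma alternating_sum_symmetric_zero:
  fixes H :: "nat \<Rightarrow> nat \<Rightarrow> real"
  assumes m: "m \<in> {1..k}" and sym: "\<And>i j. \<lbrakk>i \<in> {1..Suc k}; j \<in> {1..Suc k}\<rbrakk> \<Longrightarrow> H i j = H j i"
  shows "(\<Sum>\<rho> | \<rho> permutes {1..Suc k}. of_int (sign \<rho>) *
      (H (\<rho> 1) (\<rho> (Suc m)) * (\<Prod>i\<in>{1..k} - {m}. P i (\<rho> (Suc i))))) = 0" (is "?S = 0")
proof -
  let ?q = "Transposition.transpose 1 (Suc m)"
  let ?f = "\<lambda>\<rho>. of_int (sign \<rho>) * (H (\<rho> 1) (\<rho> (Suc m)) * (\<Prod>i\<in>{1..k} - {m}. P i (\<rho> (Suc i)))) :: real"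
  have q: "?q permutes {1..Suc k}"
    using m by (intro permutes_swap_id) auto
  have "?S = (\<Sum>\<rho> | \<rho> permutes {1..Suc k}. ?f (\<rho> \<circ> ?q))"
    by (rule sum_permutations_compose_right[OF q])
  also have "\<dots> = (\<Sum>\<rho> | \<rho> permutes {1..Suc k}. - ?f \<rho>)"
  proof (rule sum.cong[OF refl])
    fix \<rho> assume "\<rho> \<in> {\<rho>. \<rho> permutes {1..Suc k}}"
    then have \<rho>: "\<rho> permutes {1..Suc k}"
      by simp
    have "sign (\<rho> \<circ> ?q) = - sign \<rho>"
      using m sign_compose[OF permutes_imp_permutation[OF _ \<rho>] permutation_swap_id[of 1 "Suc m"]]
      by (simp add: sign_swap_id)
    moreover have "(\<rho> \<circ> ?q) 1 = \<rho> (Suc m)" "(\<rho> \<circ> ?q) (Suc m) = \<rho> 1"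
      by simp_all
    moreover have "H (\<rho> (Suc m)) (\<rho> 1) = H (\<rho> 1) (\<rho> (Suc m))"
      using m by (intro sym permutes_atLeastAtMost_le[OF \<rho>]) auto
    moreover have "(\<Prod>i\<in>{1..k} - {m}. P i ((\<rho> \<circ> ?q) (Suc i))) = (\<Prod>i\<in>{1..k} - {m}. P i (\<rho> (Suc i)))"
      by (intro prod.cong refl) (auto simp: transpose_def)
    ultimately show "?f (\<rho> \<circ> ?q) = - ?f \<rho>"
      by (simp only: of_int_minus mult_minus_left)
  qed
  also have "\<dots> = - ?S"
    by (rule sum_negf)
  finally show ?thesis
    by simp
qed

text \<open>Near \<open>t\<close> the first derivatives of \<open>u\<close> are directional
  derivatives of a smooth representative, so they can be differentiated once more, in any order.
  \<open>H\<close> is the Hessian at \<open>t\<close> in the edge directions.\<close>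

lemma second_partials:
  assumes u: "u \<in> dfun (euclid_sub (Suc N) (standard_simplex N))" and t: "t \<in> open_simplex N"
  obtains H where "\<And>i j. \<lbrakk>i \<le> N; j \<le> N\<rbrakk> \<Longrightarrow> H i j = H j i"
    "\<And>i j. \<lbrakk>i \<le> N; j \<le> N\<rbrakk> \<Longrightarrow>
      ((\<lambda>s. simplex_partial j u (\<lambda>a. t a + s * edge i a)) has_real_derivative H i j) (at 0)"
    "\<And>i. i \<le> N \<Longrightarrow> ((\<lambda>s. u (\<lambda>a. t a + s * edge i a)) has_real_derivative simplex_partial i u t) (at 0)"
proof -
  have t': "t \<in> standard_simplex N"
    using t open_simplex_subset by blast
  obtain V m F c where V: "open V" "t \<in> V" "smooth_fun m F"
    "\<And>y. y \<in> standard_simplex N \<inter> V \<Longrightarrow> u y = F (\<lambda>i. if i < m then y (c i) else 0)"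
    by (rule dfun_euclid_subE[OF u t']) blast
  then have rep: "\<And>y. y \<in> standard_simplex N \<inter> V \<Longrightarrow> u y = F (coords m c y)"
    by (simp add: coords_def)
  have partial: "simplex_partial i u x = dirderiv F (coords m c (edge i)) (coords m c x)"
    if "x \<in> open_simplex N" "x \<in> V" "i \<le> N" for x i
    by (rule simplex_partial_eq_dirderiv[OF V(1,3) rep that])
  note cs = coords_in_n_space
  define H where "H = (\<lambda>i j. dirderiv (dirderiv F (coords m c (edge j))) (coords m c (edge i)) (coords m c t))"
  show ?thesis
  proof (rule that)
    show "H i j = H j i" if "i \<le> N" "j \<le> N" for i j
      unfolding H_def by (rule dirderiv_commute[OF V(3) cs cs cs])
    show "((\<lambda>s. simplex_partial j u (\<lambda>a. t a + s * edge i a)) has_real_derivative H i j) (at 0)"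
      if i: "i \<le> N" and j: "j \<le> N" for i j
    proof -
      have "((\<lambda>s. dirderiv F (coords m c (edge j)) (\<lambda>a. coords m c t a + s * coords m c (edge i) a))
          has_real_derivative H i j) (at 0)"
        using smooth_fun_has_dirderiv[OF smooth_fun_dirderiv[OF V(3) cs] cs cs, where s = 0]
        by (simp add: H_def)
      moreover have "\<forall>\<^sub>F s in nhds 0. simplex_partial j u (\<lambda>a. t a + s * edge i a) =
          dirderiv F (coords m c (edge j)) (\<lambda>a. coords m c t a + s * coords m c (edge i) a)"
        using eventually_edge_in_open_simplex[OF t i] eventually_line_in_open[OF V(1,2), of "edge i"]
        by eventually_elim (simp only: partial[OF _ _ j] coords_line)
      ultimately show ?thesis
        by (subst DERIV_cong_ev[OF refl _ refl]) auto
    qed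
    show "((\<lambda>s. u (\<lambda>a. t a + s * edge i a)) has_real_derivative simplex_partial i u t) (at 0)"
      if i: "i \<le> N" for i
      unfolding partial[OF t V(2) i]
    proof (rule dfun_has_line_derivative[OF V(1,3) rep V(2)])
      show "\<forall>\<^sub>F s in nhds 0. (\<lambda>j. t j + s * edge i j) \<in> standard_simplex N"
        using eventually_edge_in_open_simplex[OF t i]
        by eventually_elim (use open_simplex_subset in blast)
    qed
  qed
qed

lemma DERIV_sum_list:
  assumes "\<And>x. x \<in> set xs \<Longrightarrow> (f x has_field_derivative f' x) (at z within S)"
  shows "((\<lambda>u. \<Sum>x\<leftarrow>xs. f x u) has_field_derivative (\<Sum>x\<leftarrow>xs. f' x)) (at z within S)"
  using assms by (induction xs) (auto intro: DERIV_add)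

lemma sum_list_sum_swap: "(\<Sum>x\<leftarrow>xs. \<Sum>i\<in>I. f x i) = (\<Sum>i\<in>I. \<Sum>x\<leftarrow>xs. f x i)"
  by (induction xs) (simp_all add: sum.distrib)

lemma prod_atLeastAtMost_Suc_shift: "(\<Prod>i=1..Suc k. f i) = f 1 * (\<Prod>i=1..k. f (Suc i))"
  using prod.atLeast_Suc_atMost[of 1 "Suc k" f] prod.shift_bounds_cl_Suc_ivl[of f 1 k] by simp

text \<open>Restrict the form to the affine k-simplices spanned by all but one coordinate direction, differentiate in the remaining direction,
  and sum over all permutations of the coordinate directions; the second derivatives cancel.\<close>

lemma local_form_deriv_zero:
  assumes X: "differential_space X" and U: "openin (dtop X) U"
    and Gs: "\<And>gs i. \<lbrakk>gs \<in> set Gs; i \<le> k\<rbrakk> \<Longrightarrow> gs i \<in> dfun X"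
    and zero: "\<And>\<tau> s. \<lbrakk>\<tau> \<in> smooth_simplices k X; s \<in> open_simplex k; \<tau> s \<in> U\<rbrakk> \<Longrightarrow> local_form k Gs \<tau> s = 0"
    and \<sigma>: "\<sigma> \<in> smooth_simplices (Suc k) X" and t: "t \<in> open_simplex (Suc k)" "\<sigma> t \<in> U"
  shows "local_form (Suc k) (map (\<lambda>fs. case_nat (\<lambda>_. 1) fs) Gs) \<sigma> t = 0"
proof -
  let ?N = "Suc k"
  define P where "P = (\<lambda>(gs :: nat \<Rightarrow> 'a \<Rightarrow> real) i j. simplex_partial j (gs i \<circ> \<sigma>) t)"
  define Q where "Q = (\<lambda>gs m H. (\<forall>i\<le>?N. \<forall>j\<le>?N. H i j = H j i) \<and>
      (\<forall>i\<le>?N. \<forall>j\<le>?N. ((\<lambda>s. simplex_partial j (gs m \<circ> \<sigma>) (\<lambda>a. t a + s * edge i a)) has_real_derivative H i j) (at 0)) \<and>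
      (\<forall>i\<le>?N. ((\<lambda>s. (gs m \<circ> \<sigma>) (\<lambda>a. t a + s * edge i a)) has_real_derivative P gs m i) (at 0)))"
  define H where "H = (\<lambda>gs m. SOME H. Q gs m H)"
  have Q: "Q gs m (H gs m)" if gs: "gs \<in> set Gs" and m: "m \<le> k" for gs m
  proof -
    obtain H where "\<And>i j. \<lbrakk>i \<le> ?N; j \<le> ?N\<rbrakk> \<Longrightarrow> H i j = H j i"
      "\<And>i j. \<lbrakk>i \<le> ?N; j \<le> ?N\<rbrakk> \<Longrightarrow>
        ((\<lambda>s. simplex_partial j (gs m \<circ> \<sigma>) (\<lambda>a. t a + s * edge i a)) has_real_derivative H i j) (at 0)"
      "\<And>i. i \<le> ?N \<Longrightarrow> ((\<lambda>s. (gs m \<circ> \<sigma>) (\<lambda>a. t a + s * edge i a)) has_real_derivative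
        simplex_partial i (gs m \<circ> \<sigma>) t) (at 0)"
      using second_partials[OF smooth_simplicesD(3)[OF \<sigma> Gs[OF gs m]] t(1)] by blast
    then have "Q gs m H"
      unfolding Q_def P_def by (intro conjI allI impI)
    then show ?thesis
      unfolding H_def by (rule someI[where P = "Q gs m"])
  qed
  have H_sym: "H gs m i j = H gs m j i" and
    H: "((\<lambda>s. simplex_partial j (gs m \<circ> \<sigma>) (\<lambda>a. t a + s * edge i a)) has_real_derivative H gs m i j) (at 0)" and
    P: "((\<lambda>s. (gs m \<circ> \<sigma>) (\<lambda>a. t a + s * edge i a)) has_real_derivative P gs m i) (at 0)"
    if "gs \<in> set Gs" "m \<le> k" "i \<le> ?N" "j \<le> ?N" for gs m i j
    using Q[OF that(1,2), unfolded Q_def] that(3,4) by blast+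
  \<comment> \<open>In the product rule, \<open>T0\<close> is the wanted term, where the coefficient
    function is differentiated, and \<open>T1 gs m\<close> the term where the m-th differential is
    differentiated once more.\<close>
  define T0 where "T0 = (\<lambda>gs \<rho>. P gs 0 (\<rho> 1) * (\<Prod>i=1..k. P gs i (\<rho> (Suc i))))"
  define T1 where "T1 = (\<lambda>gs m \<rho>. gs 0 (\<sigma> t) * (H gs m (\<rho> 1) (\<rho> (Suc m)) *
      (\<Prod>i\<in>{1..k} - {m}. P gs i (\<rho> (Suc i)))))"
  have deriv0: "(\<Sum>\<pi> | \<pi> permutes {1..k}. of_int (sign \<pi>) *
      (\<Sum>gs\<leftarrow>Gs. T0 gs (\<rho> \<circ> lift_perm \<pi>) + (\<Sum>m=1..k. T1 gs m (\<rho> \<circ> lift_perm \<pi>)))) = 0"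
    if \<rho>: "\<rho> permutes {1..?N}" for \<rho>
  proof -
    \<comment> \<open>The permutation \<rho> assigns the roles: \<open>\<rho> 1\<close> is the
      direction to differentiate in, and \<open>\<rho> 2\<close> to \<open>\<rho> (Suc k)\<close>
      span the small k-simplex.\<close>
    define ts where "ts = (\<lambda>s a. t a + s * edge (\<rho> 1) a)"
    define r where "r = (\<lambda>i. \<rho> (Suc i))"
    define \<Phi> where "\<Phi> = (\<lambda>s. \<Sum>gs\<leftarrow>Gs. gs 0 (\<sigma> (ts s)) * (\<Sum>\<pi> | \<pi> permutes {1..k}.
        of_int (sign \<pi>) * (\<Prod>i=1..k. simplex_partial (r (\<pi> i)) (gs i \<circ> \<sigma>) (ts s))))"
    have ts0: "ts 0 = t"
      by (simp add: ts_def)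
    have \<rho>le: "\<rho> i \<le> ?N" if "i \<in> {1..?N}" for i
      using permutes_atLeastAtMost_le[OF \<rho> that] by simp
    have \<rho>1: "\<rho> 1 \<le> ?N"
      by (rule \<rho>le) simp
    have r: "r i \<le> ?N" if "i \<in> {1..k}" for i
      unfolding r_def using that by (intro \<rho>le) auto
    have r\<pi>: "r (\<pi> i) \<le> ?N" if "\<pi> permutes {1..k}" "i \<in> {1..k}" for \<pi> i
      by (rule r[OF permutes_atLeastAtMost_le[OF that]])
    \<comment> \<open>Up to the factor \<open>\<epsilon> ^ k\<close>, \<open>\<Phi> s\<close> is the
      value of the local expression at the barycentre of a small simplex centred at
      \<open>ts s\<close>, where it vanishes by hypothesis. The size \<epsilon> stays fixed while
      \<open>s\<close> varies.\<close>
    have "\<forall>\<^sub>F s in nhds 0. \<Phi> s = 0"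
    proof -
      have "\<forall>\<^sub>F \<epsilon> in nhds 0. \<forall>j\<in>{..k}. spread k r t \<epsilon> j \<in> open_simplex ?N"
        by (rule eventually_spread_in_open_simplex[OF t(1) r])
      then obtain d where d: "0 < d" "\<And>\<epsilon>. dist \<epsilon> 0 < d \<Longrightarrow> \<forall>j\<in>{..k}. spread k r t \<epsilon> j \<in> open_simplex ?N"
        unfolding eventually_nhds_metric by blast
      define \<epsilon> where "\<epsilon> = d / 2"
      have \<epsilon>: "\<epsilon> \<noteq> 0" "\<And>j. j \<in> {..k} \<Longrightarrow> spread k r t \<epsilon> j \<in> open_simplex ?N"
        using d(1) d(2)[of \<epsilon>] by (auto simp: \<epsilon>_def)
      have ev1: "\<forall>\<^sub>F s in nhds 0. \<forall>j\<in>{..k}. spread k r (ts s) \<epsilon> j \<in> open_simplex ?N"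
        unfolding ts_def spread_shift
        by (intro eventually_ball_finite ballI eventually_edge_in_open_simplex \<epsilon>(2) \<rho>1 finite_atMost)
      have "continuous_map (top_of_set (standard_simplex ?N)) (dtop X) \<sigma>"
        using smooth_simplicesD(1)[OF \<sigma>] by (simp add: singular_simplex_def euclidean_product_topology)
      then have "openin (top_of_set (standard_simplex ?N)) {x \<in> standard_simplex ?N. \<sigma> x \<in> U}"
        using openin_continuous_map_preimage[OF _ U] by fastforce
      then obtain V where V: "open V" "{x \<in> standard_simplex ?N. \<sigma> x \<in> U} = standard_simplex ?N \<inter> V"
        by (auto simp: openin_open)
      have tV: "t \<in> V"
        using V(2) t open_simplex_subset by blast
      have ev2: "\<forall>\<^sub>F s in nhds 0. ts s \<in> V"
        unfolding ts_def by (rule eventually_line_in_open[OF V(1) tV])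
      show ?thesis
        using ev1 ev2
      proof eventually_elim
        case (elim s)
        let ?\<tau> = "subsimplex k (spread k r (ts s) \<epsilon>) \<sigma>"
        have l: "spread k r (ts s) \<epsilon> j \<in> open_simplex ?N" if "j \<le> k" for j
          using elim(1) that by simp
        have b': "barycenter k \<in> standard_simplex k"
          using barycenter_in_open_simplex open_simplex_subset by blast
        have \<tau>: "?\<tau> \<in> smooth_simplices k X"
          by (rule subsimplex_smooth[OF \<sigma>]) (use l open_simplex_subset in blast)
        have "affine_comb k (spread k r (ts s) \<epsilon>) (barycenter k) \<in> open_simplex ?N"
          by (rule affine_comb_in_open_simplex[OF _ b']) (rule l)
        then have "ts s \<in> open_simplex ?N"
          by (simp only: affine_comb_spread_barycenter)
        then have "\<sigma> (ts s) \<in> U"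
          using V(2) elim(2) open_simplex_subset by blast
        then have "?\<tau> (barycenter k) \<in> U"
          by (simp only: subsimplex_apply[OF b'] affine_comb_spread_barycenter)
        then have "local_form k Gs ?\<tau> (barycenter k) = 0"
          by (rule zero[OF \<tau> barycenter_in_open_simplex])
        moreover have "local_form k Gs ?\<tau> (barycenter k) = \<epsilon> ^ k * \<Phi> s"
        proof -
          have "local_form k Gs ?\<tau> (barycenter k) = \<epsilon> ^ k * (\<Sum>gs\<leftarrow>Gs.
              gs 0 (\<sigma> (affine_comb k (spread k r (ts s) \<epsilon>) (barycenter k))) * (\<Sum>\<pi> | \<pi> permutes {1..k}.
                of_int (sign \<pi>) * (\<Prod>i=1..k. simplex_partial (r (\<pi> i)) (gs i \<circ> \<sigma>)
                  (affine_comb k (spread k r (ts s) \<epsilon>) (barycenter k)))))"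
            by (rule local_form_spread[OF \<sigma> _ _ barycenter_in_open_simplex]) (fact l Gs r)+
          then show ?thesis
            unfolding affine_comb_spread_barycenter \<Phi>_def .
        qed
        ultimately show "\<Phi> s = 0"
          using \<epsilon>(1) by simp
      qed
    qed
    then have D0: "(\<Phi> has_real_derivative 0) (at 0)"
      by (subst DERIV_cong_ev[OF refl _ refl, where g = "\<lambda>_. 0"]) auto
    have "(\<Phi> has_real_derivative (\<Sum>gs\<leftarrow>Gs.
        P gs 0 (\<rho> 1) * (\<Sum>\<pi> | \<pi> permutes {1..k}. of_int (sign \<pi>) * (\<Prod>i=1..k. P gs i (r (\<pi> i)))) +
        (\<Sum>\<pi> | \<pi> permutes {1..k}. of_int (sign \<pi>) *
           (\<Sum>m=1..k. H gs m (\<rho> 1) (r (\<pi> m)) * (\<Prod>i\<in>{1..k} - {m}. P gs i (r (\<pi> i))))) * gs 0 (\<sigma> t))) (at 0)"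
      unfolding \<Phi>_def
    proof (rule DERIV_sum_list)
      fix gs assume gs: "gs \<in> set Gs"
      have A: "((\<lambda>s. gs 0 (\<sigma> (ts s))) has_real_derivative P gs 0 (\<rho> 1)) (at 0)"
        using P[OF gs _ \<rho>1 \<rho>1, of 0] by (simp add: ts_def)
      have C: "((\<lambda>s. simplex_partial (r (\<pi> i)) (gs i \<circ> \<sigma>) (ts s)) has_real_derivative H gs i (\<rho> 1) (r (\<pi> i))) (at 0)"
        if "\<pi> permutes {1..k}" "i \<in> {1..k}" for \<pi> i
        unfolding ts_def using that by (intro H gs \<rho>1 r\<pi>) auto
      have "((\<lambda>s. \<Sum>\<pi> | \<pi> permutes {1..k}.
            of_int (sign \<pi>) * (\<Prod>i=1..k. simplex_partial (r (\<pi> i)) (gs i \<circ> \<sigma>) (ts s))) has_real_derivative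
          (\<Sum>\<pi> | \<pi> permutes {1..k}. of_int (sign \<pi>) * (\<Sum>m=1..k. H gs m (\<rho> 1) (r (\<pi> m)) *
             (\<Prod>i\<in>{1..k} - {m}. simplex_partial (r (\<pi> i)) (gs i \<circ> \<sigma>) (ts 0))))) (at 0)"
        by (intro DERIV_sum DERIV_cmult has_field_derivative_prod C) auto
      from DERIV_mult[OF A this]
      show "((\<lambda>s. gs 0 (\<sigma> (ts s)) * (\<Sum>\<pi> | \<pi> permutes {1..k}.
            of_int (sign \<pi>) * (\<Prod>i=1..k. simplex_partial (r (\<pi> i)) (gs i \<circ> \<sigma>) (ts s)))) has_real_derivative
          P gs 0 (\<rho> 1) * (\<Sum>\<pi> | \<pi> permutes {1..k}. of_int (sign \<pi>) * (\<Prod>i=1..k. P gs i (r (\<pi> i)))) +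
          (\<Sum>\<pi> | \<pi> permutes {1..k}. of_int (sign \<pi>) * (\<Sum>m=1..k. H gs m (\<rho> 1) (r (\<pi> m)) *
             (\<Prod>i\<in>{1..k} - {m}. P gs i (r (\<pi> i))))) * gs 0 (\<sigma> t)) (at 0)"
        unfolding ts0 P_def .
    qed
    from DERIV_unique[OF this D0]
    have "0 = (\<Sum>gs\<leftarrow>Gs.
        P gs 0 (\<rho> 1) * (\<Sum>\<pi> | \<pi> permutes {1..k}. of_int (sign \<pi>) * (\<Prod>i=1..k. P gs i (r (\<pi> i)))) +
        (\<Sum>\<pi> | \<pi> permutes {1..k}. of_int (sign \<pi>) *
           (\<Sum>m=1..k. H gs m (\<rho> 1) (r (\<pi> m)) * (\<Prod>i\<in>{1..k} - {m}. P gs i (r (\<pi> i))))) * gs 0 (\<sigma> t))" ..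
    also have "\<dots> = (\<Sum>gs\<leftarrow>Gs. \<Sum>\<pi> | \<pi> permutes {1..k}. of_int (sign \<pi>) *
      (T0 gs (\<rho> \<circ> lift_perm \<pi>) + (\<Sum>m=1..k. T1 gs m (\<rho> \<circ> lift_perm \<pi>))))"
    proof (intro arg_cong[where f = sum_list] map_cong refl)
      fix gs
      have l1: "(\<rho> \<circ> lift_perm \<pi>) 1 = \<rho> 1" if "\<pi> \<in> {\<pi>. \<pi> permutes {1..k}}" for \<pi>
        using lift_perm_1[of \<pi> k] that by simp
      have l2: "(\<rho> \<circ> lift_perm \<pi>) (Suc i) = r (\<pi> i)" for \<pi> i
        by (simp add: r_def)
      have "P gs 0 (\<rho> 1) * (\<Sum>\<pi> | \<pi> permutes {1..k}. of_int (sign \<pi>) * (\<Prod>i=1..k. P gs i (r (\<pi> i)))) =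
          (\<Sum>\<pi> | \<pi> permutes {1..k}. of_int (sign \<pi>) * T0 gs (\<rho> \<circ> lift_perm \<pi>))"
        unfolding sum_distrib_left T0_def l2
        by (intro sum.cong refl) (simp only: l1 mult.left_commute)
      moreover have "(\<Sum>\<pi> | \<pi> permutes {1..k}. of_int (sign \<pi>) *
           (\<Sum>m=1..k. H gs m (\<rho> 1) (r (\<pi> m)) * (\<Prod>i\<in>{1..k} - {m}. P gs i (r (\<pi> i))))) * gs 0 (\<sigma> t) =
          (\<Sum>\<pi> | \<pi> permutes {1..k}. of_int (sign \<pi>) * (\<Sum>m=1..k. T1 gs m (\<rho> \<circ> lift_perm \<pi>)))"
        unfolding sum_distrib_right T1_def l2 sum_distrib_left[of "gs 0 (\<sigma> t)", symmetric]
        by (intro sum.cong refl) (simp only: l1 ac_simps)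
      ultimately show "P gs 0 (\<rho> 1) * (\<Sum>\<pi> | \<pi> permutes {1..k}. of_int (sign \<pi>) * (\<Prod>i=1..k. P gs i (r (\<pi> i)))) +
        (\<Sum>\<pi> | \<pi> permutes {1..k}. of_int (sign \<pi>) *
           (\<Sum>m=1..k. H gs m (\<rho> 1) (r (\<pi> m)) * (\<Prod>i\<in>{1..k} - {m}. P gs i (r (\<pi> i))))) * gs 0 (\<sigma> t) =
        (\<Sum>\<pi> | \<pi> permutes {1..k}. of_int (sign \<pi>) *
          (T0 gs (\<rho> \<circ> lift_perm \<pi>) + (\<Sum>m=1..k. T1 gs m (\<rho> \<circ> lift_perm \<pi>))))"
        by (simp only: distrib_left sum.distrib)
    qed
    finally show ?thesis
      by (simp only: sum_list_sum_swap sum_list_const_mult)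
  qed
  have "0 = (\<Sum>\<rho> | \<rho> permutes {1..?N}. of_int (sign \<rho>) *
      (\<Sum>gs\<leftarrow>Gs. T0 gs \<rho> + (\<Sum>m=1..k. T1 gs m \<rho>)))"
    by (rule alternating_sum_lift_zero[symmetric]) (rule deriv0)
  also have "\<dots> = (\<Sum>gs\<leftarrow>Gs. \<Sum>\<rho> | \<rho> permutes {1..?N}. of_int (sign \<rho>) * (T0 gs \<rho> + (\<Sum>m=1..k. T1 gs m \<rho>)))"
    by (simp only: sum_list_sum_swap sum_list_const_mult)
  also have "\<dots> = (\<Sum>gs\<leftarrow>Gs. \<Sum>\<rho> | \<rho> permutes {1..?N}. of_int (sign \<rho>) * T0 gs \<rho>)"
  proof (intro arg_cong[where f = sum_list] map_cong refl)
    fix gs assume gs: "gs \<in> set Gs"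
    have "(\<Sum>\<rho> | \<rho> permutes {1..?N}. of_int (sign \<rho>) * (\<Sum>m=1..k. T1 gs m \<rho>)) =
        (\<Sum>m=1..k. \<Sum>\<rho> | \<rho> permutes {1..?N}. of_int (sign \<rho>) * T1 gs m \<rho>)"
      unfolding sum_distrib_left by (rule sum.swap)
    also have "\<dots> = 0"
    proof (rule sum.neutral, rule ballI)
      fix m assume m: "m \<in> {1..k}"
      have "(\<Sum>\<rho> | \<rho> permutes {1..?N}. of_int (sign \<rho>) * (H gs m (\<rho> 1) (\<rho> (Suc m)) *
          (\<Prod>i\<in>{1..k} - {m}. P gs i (\<rho> (Suc i))))) = 0"
        by (rule alternating_sum_symmetric_zero[OF m H_sym[OF gs]]) (use m in auto)
      then have "gs 0 (\<sigma> t) * (\<Sum>\<rho> | \<rho> permutes {1..?N}. of_int (sign \<rho>) * (H gs m (\<rho> 1) (\<rho> (Suc m)) *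
          (\<Prod>i\<in>{1..k} - {m}. P gs i (\<rho> (Suc i))))) = 0"
        by (simp only: mult_zero_right)
      then show "(\<Sum>\<rho> | \<rho> permutes {1..?N}. of_int (sign \<rho>) * T1 gs m \<rho>) = 0"
        unfolding T1_def sum_distrib_left by (simp only: mult.left_commute)
    qed
    finally show "(\<Sum>\<rho> | \<rho> permutes {1..?N}. of_int (sign \<rho>) * (T0 gs \<rho> + (\<Sum>m=1..k. T1 gs m \<rho>))) =
        (\<Sum>\<rho> | \<rho> permutes {1..?N}. of_int (sign \<rho>) * T0 gs \<rho>)"
      by (simp only: distrib_left sum.distrib add_0_right)
  qed
  also have "\<dots> = local_form ?N (map (\<lambda>fs. case_nat (\<lambda>_. 1) fs) Gs) \<sigma> t"
    unfolding local_form_def map_map T0_def P_def prod_atLeastAtMost_Suc_shift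
    by (intro arg_cong[where f = sum_list] map_cong refl) simp
  finally show ?thesis ..
qed

abbreviation deriv_rep :: "(nat \<Rightarrow> 'a \<Rightarrow> real) \<Rightarrow> nat \<Rightarrow> 'a \<Rightarrow> real" where
  "deriv_rep fs \<equiv> case_nat (\<lambda>_. 1) fs"

lemma simplex_partial_uminus:
  assumes "u \<in> dfun (euclid_sub (Suc N) (standard_simplex N))" "t \<in> open_simplex N" "i \<le> N"
  shows "simplex_partial i (\<lambda>y. - u y) t = - simplex_partial i u t"
proof -
  obtain H where "\<And>i. i \<le> N \<Longrightarrow>
      ((\<lambda>s. u (\<lambda>a. t a + s * edge i a)) has_real_derivative simplex_partial i u t) (at 0)"
    using second_partials[OF assms(1,2)] by blast
  from DERIV_minus[OF this[OF assms(3)]] show ?thesis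
    unfolding simplex_partial_edge[of i "\<lambda>y. - u y"] by (rule DERIV_imp_deriv)
qed

text \<open>After differentiation the coefficient function has become the first differential, so the
  sign now comes out of the first factor of the product and no longer out of the
  coefficient.\<close>

lemma local_form_deriv_negate:
  assumes \<sigma>: "\<sigma> \<in> smooth_simplices (Suc k) X" and t: "t \<in> open_simplex (Suc k)"
    and Fs: "\<And>fs i. \<lbrakk>fs \<in> set Fs; i \<le> k\<rbrakk> \<Longrightarrow> fs i \<in> dfun X"
  shows "local_form (Suc k) (map deriv_rep (map negate_rep Fs)) \<sigma> t = - local_form (Suc k) (map deriv_rep Fs) \<sigma> t"
  unfolding local_form_def map_map uminus_sum_list_map
proof (intro arg_cong[where f = sum_list] map_cong refl)
  fix fs assume fs: "fs \<in> set Fs"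
  have "(\<Prod>i=1..Suc k. simplex_partial (\<pi> i) (deriv_rep (negate_rep fs) i \<circ> \<sigma>) t) =
      - (\<Prod>i=1..Suc k. simplex_partial (\<pi> i) (deriv_rep fs i \<circ> \<sigma>) t)" if \<pi>: "\<pi> permutes {1..Suc k}" for \<pi>
  proof -
    have "\<pi> 1 \<le> Suc k"
      using permutes_atLeastAtMost_le[OF \<pi>, of 1] by simp
    then have "simplex_partial (\<pi> 1) (\<lambda>y. - (fs 0 \<circ> \<sigma>) y) t = - simplex_partial (\<pi> 1) (fs 0 \<circ> \<sigma>) t"
      by (intro simplex_partial_uminus[OF smooth_simplicesD(3)[OF \<sigma> Fs[OF fs]] t]) simp
    moreover have "negate_rep fs 0 \<circ> \<sigma> = (\<lambda>y. - (fs 0 \<circ> \<sigma>) y)"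
      by (simp add: negate_rep_def fun_eq_iff)
    moreover have "(\<Prod>i=1..k. simplex_partial (\<pi> (Suc i)) (negate_rep fs i \<circ> \<sigma>) t) =
        (\<Prod>i=1..k. simplex_partial (\<pi> (Suc i)) (fs i \<circ> \<sigma>) t)"
      by (intro prod.cong refl) (simp add: negate_rep_def)
    ultimately show ?thesis
      unfolding prod_atLeastAtMost_Suc_shift by simp
  qed
  then have "(\<Sum>\<pi> | \<pi> permutes {1..Suc k}. of_int (sign \<pi>) *
        (\<Prod>i=1..Suc k. simplex_partial (\<pi> i) (deriv_rep (negate_rep fs) i \<circ> \<sigma>) t)) =
      (\<Sum>\<pi> | \<pi> permutes {1..Suc k}. - (of_int (sign \<pi>) *
        (\<Prod>i=1..Suc k. simplex_partial (\<pi> i) (deriv_rep fs i \<circ> \<sigma>) t)))"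
    by (intro sum.cong[OF refl]) (simp only: mem_Collect_eq mult_minus_right)
  then show "((\<lambda>fs. fs 0 (\<sigma> t) * (\<Sum>\<pi> | \<pi> permutes {1..Suc k}. of_int (sign \<pi>) *
        (\<Prod>i=1..Suc k. simplex_partial (\<pi> i) (fs i \<circ> \<sigma>) t))) \<circ> (deriv_rep \<circ> negate_rep)) fs =
      (uminus \<circ> ((\<lambda>fs. fs 0 (\<sigma> t) * (\<Sum>\<pi> | \<pi> permutes {1..Suc k}. of_int (sign \<pi>) *
        (\<Prod>i=1..Suc k. simplex_partial (\<pi> i) (fs i \<circ> \<sigma>) t))) \<circ> deriv_rep)) fs"
    by (simp only: comp_apply sum_negf mult_minus_right old.nat.case)
qed

text \<open>The difference of two local expressions for the same form represents 0 on the common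
  domain, so the two candidate values agree by \<open>local_form_deriv_zero\<close>. This justifies
  the definite description.\<close>

lemma ext_deriv_eq:
  assumes X: "differential_space X" and U: "represents X k U Fs \<omega>" "\<sigma> t \<in> U"
    and \<sigma>: "\<sigma> \<in> smooth_simplices (Suc k) X" and t: "t \<in> open_simplex (Suc k)"
  shows "ext_deriv X k \<omega> \<sigma> t = local_form (Suc k) (map deriv_rep Fs) \<sigma> t"
proof -
  let ?P = "\<lambda>v. \<exists>U Fs. \<sigma> t \<in> U \<and> represents X k U Fs \<omega> \<and> v = local_form (Suc k) (map deriv_rep Fs) \<sigma> t"
  have "(THE v. ?P v) = local_form (Suc k) (map deriv_rep Fs) \<sigma> t"
  proof (rule the_equality)
    show "?P (local_form (Suc k) (map deriv_rep Fs) \<sigma> t)"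
      using U by (intro exI[of _ U] exI[of _ Fs]) simp
    fix v assume "?P v"
    then obtain V Gs where V: "\<sigma> t \<in> V" "represents X k V Gs \<omega>" and
      v: "v = local_form (Suc k) (map deriv_rep Gs) \<sigma> t"
      by (elim exE conjE)
    have rep: "represents X k (V \<inter> U) (Gs @ map negate_rep Fs) (\<lambda>\<sigma> t. \<omega> \<sigma> t + - \<omega> \<sigma> t)"
      by (rule represents_add[OF V(2) represents_negate[OF X U(1)]])
    have "local_form k (Gs @ map negate_rep Fs) \<tau> s = 0"
      if "\<tau> \<in> smooth_simplices k X" "s \<in> open_simplex k" "\<tau> s \<in> V \<inter> U" for \<tau> s
      using representsD(3)[OF rep that] by simp
    note zero = this
    have "local_form (Suc k) (map deriv_rep (Gs @ map negate_rep Fs)) \<sigma> t = 0"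
    proof (rule local_form_deriv_zero[OF X representsD(1)[OF rep] _ _ \<sigma> t])
      show "fs i \<in> dfun X" if "fs \<in> set (Gs @ map negate_rep Fs)" "i \<le> k" for fs i
        by (rule representsD(2)[OF rep that])
    qed (use V(1) U(2) zero in blast)+
    moreover have "local_form (Suc k) (map deriv_rep (map negate_rep Fs)) \<sigma> t =
        - local_form (Suc k) (map deriv_rep Fs) \<sigma> t"
      by (rule local_form_deriv_negate[OF \<sigma> t]) (rule representsD(2)[OF U(1)])
    ultimately show "v = local_form (Suc k) (map deriv_rep Fs) \<sigma> t"
      unfolding map_append local_form_append v by linarith
  qed
  then show ?thesis
    using \<sigma> t by (simp only: ext_deriv_def simp_thms if_True)
qed

lemma ext_deriv_in_forms:
  assumes X: "differential_space X" and \<omega>: "\<omega> \<in> forms X k"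
  shows "ext_deriv X k \<omega> \<in> forms X (Suc k)"
proof -
  have "\<exists>U Fs. x \<in> U \<and> represents X (Suc k) U Fs (ext_deriv X k \<omega>)" if x: "x \<in> points X" for x
  proof -
    obtain U Fs where U: "x \<in> U" "represents X k U Fs \<omega>"
      using forms_representsE[OF \<omega> x] by blast
    have "represents X (Suc k) U (map deriv_rep Fs) (ext_deriv X k \<omega>)"
      unfolding represents_def
    proof (intro conjI ballI allI impI)
      show "openin (dtop X) U"
        by (rule representsD(1)[OF U(2)])
      show "gs i \<in> dfun X" if gs: "gs \<in> set (map deriv_rep Fs)" and i: "i \<le> Suc k" for gs i
      proof -
        obtain fs where fs: "gs = deriv_rep fs" "fs \<in> set Fs"
          using gs unfolding set_map by (elim imageE)
        show ?thesis
          unfolding fs(1) using representsD(2)[OF U(2) fs(2)] dfun_const[OF X] i by (cases i) simp_all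
      qed
      show "ext_deriv X k \<omega> \<sigma> t = local_form (Suc k) (map deriv_rep Fs) \<sigma> t"
        if "\<sigma> \<in> smooth_simplices (Suc k) X" "t \<in> open_simplex (Suc k)" "\<sigma> t \<in> U" for \<sigma> t
        by (rule ext_deriv_eq[OF X U(2) that(3,1,2)])
    qed
    then show ?thesis
      using U(1) by (intro exI conjI)
  qed
  moreover have "ext_deriv X k \<omega> \<sigma> t = 0"
    if "\<not> (\<sigma> \<in> smooth_simplices (Suc k) X \<and> t \<in> open_simplex (Suc k))" for \<sigma> t
    using that unfolding ext_deriv_def by (rule if_not_P)
  ultimately show ?thesis
    unfolding forms_def by simp
qed

lemma ext_deriv_0:
  assumes X: "differential_space X"
  shows "ext_deriv X k (\<lambda>_ _. 0) = (\<lambda>_ _. 0)"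
proof (intro ext)
  fix \<sigma> t
  show "ext_deriv X k (\<lambda>_ _. 0) \<sigma> t = 0"
  proof (cases "\<sigma> \<in> smooth_simplices (Suc k) X \<and> t \<in> open_simplex (Suc k)")
    case True
    have rep: "represents X k (points X) [] (\<lambda>_ _. 0)"
      by (simp add: represents_def local_form_def)
    have "\<sigma> t \<in> points X"
      using True open_simplex_subset by (intro smooth_simplicesD(2)) blast+
    then show ?thesis
      using ext_deriv_eq[OF X rep] True by (simp add: local_form_def)
  next
    case False
    then show ?thesis
      unfolding ext_deriv_def by (rule if_not_P)
  qed
qed

section \<open>Divisible groups\<close>

definition divisible_group :: "('a, 'm) monoid_scheme \<Rightarrow> bool" where
  "divisible_group D \<longleftrightarrow> comm_group D \<and>
     (\<forall>d\<in>carrier D. \<forall>n>0. \<exists>e\<in>carrier D. e [^]\<^bsub>D\<^esub> (n::nat) = d)"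

text \<open>The graph of a homomorphism to \<open>D\<close> defined on a subgroup of \<open>G\<close>.\<close>

definition partial_hom ::
    "('a, 'm) monoid_scheme \<Rightarrow> ('d, 'n) monoid_scheme \<Rightarrow> ('a \<times> 'd) set \<Rightarrow> bool" where
  "partial_hom G D M \<longleftrightarrow> M \<subseteq> carrier G \<times> carrier D \<and> (\<one>\<^bsub>G\<^esub>, \<one>\<^bsub>D\<^esub>) \<in> M \<and>
     (\<forall>g d g' d'. (g, d) \<in> M \<and> (g', d') \<in> M \<longrightarrow> (g \<otimes>\<^bsub>G\<^esub> g', d \<otimes>\<^bsub>D\<^esub> d') \<in> M) \<and>
     (\<forall>g d. (g, d) \<in> M \<longrightarrow> (inv\<^bsub>G\<^esub> g, inv\<^bsub>D\<^esub> d) \<in> M) \<and>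
     (\<forall>d. (\<one>\<^bsub>G\<^esub>, d) \<in> M \<longrightarrow> d = \<one>\<^bsub>D\<^esub>)"

lemma partial_homD:
  assumes "partial_hom G D M"
  shows "(g, d) \<in> M \<Longrightarrow> g \<in> carrier G" "(g, d) \<in> M \<Longrightarrow> d \<in> carrier D"
    "(\<one>\<^bsub>G\<^esub>, \<one>\<^bsub>D\<^esub>) \<in> M"
    "\<lbrakk>(g, d) \<in> M; (g', d') \<in> M\<rbrakk> \<Longrightarrow> (g \<otimes>\<^bsub>G\<^esub> g', d \<otimes>\<^bsub>D\<^esub> d') \<in> M"
    "(g, d) \<in> M \<Longrightarrow> (inv\<^bsub>G\<^esub> g, inv\<^bsub>D\<^esub> d) \<in> M"
    "(\<one>\<^bsub>G\<^esub>, d) \<in> M \<Longrightarrow> d = \<one>\<^bsub>D\<^esub>"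
  using assms unfolding partial_hom_def by blast+

locale partial_hom_setting = G: comm_group G + D: comm_group D
  for G :: "('a, 'm) monoid_scheme" and D :: "('d, 'n) monoid_scheme"

lemma (in partial_hom_setting) partial_hom_unique:
  assumes M: "partial_hom G D M" and "(g, d) \<in> M" "(g, d') \<in> M"
  shows "d = d'"
proof -
  have "(g \<otimes>\<^bsub>G\<^esub> inv\<^bsub>G\<^esub> g, d \<otimes>\<^bsub>D\<^esub> inv\<^bsub>D\<^esub> d') \<in> M"
    using assms partial_homD(4,5)[OF M] by blast
  then have "d \<otimes>\<^bsub>D\<^esub> inv\<^bsub>D\<^esub> d' = \<one>\<^bsub>D\<^esub>"
    using partial_homD(1,6)[OF M] assms(2) by simp
  then show ?thesis
    using partial_homD(2)[OF M] assms(2,3) D.inv_solve_right' by fastforce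
qed

lemma (in partial_hom_setting) partial_hom_nat_pow:
  assumes M: "partial_hom G D M" and "(g, d) \<in> M"
  shows "(g [^]\<^bsub>G\<^esub> (n::nat), d [^]\<^bsub>D\<^esub> n) \<in> M"
  by (induction n) (use assms partial_homD(3,4)[OF M] in auto)

lemma (in partial_hom_setting) partial_hom_int_pow:
  assumes M: "partial_hom G D M" and gd: "(g, d) \<in> M"
  shows "(g [^]\<^bsub>G\<^esub> (n::int), d [^]\<^bsub>D\<^esub> n) \<in> M"
proof (cases n rule: int_cases2)
  case (nonneg m)
  then show ?thesis
    using partial_hom_nat_pow[OF assms, of m] by (simp add: int_pow_int)
next
  case (nonpos m)
  then show ?thesis
    using partial_homD(5)[OF M partial_hom_nat_pow[OF assms, of m]] partial_homD(1,2)[OF M gd]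
    by (simp add: G.int_pow_neg D.int_pow_neg int_pow_int)
qed

text \<open>If some positive power of \<open>x\<close> lies in the domain, let m be the least such
  exponent and take for \<open>e\<close> an m-th root of the prescribed value. Otherwise there is no
  condition on \<open>e\<close>, and the unit is taken.\<close>

lemma (in partial_hom_setting) partial_hom_extend1:
  assumes M: "partial_hom G D M" and x: "x \<in> carrier G" and div: "divisible_group D"
  shows "\<exists>M' e. partial_hom G D M' \<and> M \<subseteq> M' \<and> (x, e) \<in> M'"
proof -
  have "\<exists>e\<in>carrier D. \<forall>(n::int) d. (x [^]\<^bsub>G\<^esub> n, d) \<in> M \<longrightarrow> d = e [^]\<^bsub>D\<^esub> n"
  proof (cases "\<exists>n::nat. 0 < n \<and> (\<exists>d. (x [^]\<^bsub>G\<^esub> n, d) \<in> M)")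
    case True
    define m where "m = (LEAST n::nat. 0 < n \<and> (\<exists>d. (x [^]\<^bsub>G\<^esub> n, d) \<in> M))"
    have "0 < m \<and> (\<exists>d. (x [^]\<^bsub>G\<^esub> m, d) \<in> M)"
      unfolding m_def using True by (rule LeastI_ex)
    then obtain y where m: "0 < m" and y: "(x [^]\<^bsub>G\<^esub> m, y) \<in> M"
      by blast
    have least: "\<not> (0 < n \<and> (\<exists>d. (x [^]\<^bsub>G\<^esub> n, d) \<in> M))" if "n < m" for n
      using that unfolding m_def by (rule not_less_Least)
    have "y \<in> carrier D"
      by (rule partial_homD(2)[OF M y])
    then obtain e where e: "e \<in> carrier D" "e [^]\<^bsub>D\<^esub> m = y"
      using div m unfolding divisible_group_def by blast
    show ?thesis
    proof (intro bexI[OF _ e(1)] allI impI)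
      fix n :: int and d assume n: "(x [^]\<^bsub>G\<^esub> n, d) \<in> M"
      \<comment> \<open>Division with remainder by the least exponent: the remainder is again an
        exponent with power in the domain, hence 0.\<close>
      define q where "q = n div int m"
      define r where "r = nat (n mod int m)"
      have nqr: "n = int r + int m * q" and r: "r < m"
        using m by (auto simp: q_def r_def mult.commute nat_less_iff)
      have "((x [^]\<^bsub>G\<^esub> m) [^]\<^bsub>G\<^esub> (- q), y [^]\<^bsub>D\<^esub> (- q)) \<in> M"
        by (rule partial_hom_int_pow[OF M y])
      with n have "(x [^]\<^bsub>G\<^esub> n \<otimes>\<^bsub>G\<^esub> (x [^]\<^bsub>G\<^esub> m) [^]\<^bsub>G\<^esub> (- q), d \<otimes>\<^bsub>D\<^esub> y [^]\<^bsub>D\<^esub> (- q)) \<in> M"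
        by (rule partial_homD(4)[OF M])
      moreover have "x [^]\<^bsub>G\<^esub> n \<otimes>\<^bsub>G\<^esub> (x [^]\<^bsub>G\<^esub> m) [^]\<^bsub>G\<^esub> (- q) = x [^]\<^bsub>G\<^esub> r"
      proof -
        have "(x [^]\<^bsub>G\<^esub> m) [^]\<^bsub>G\<^esub> (- q) = x [^]\<^bsub>G\<^esub> (int m * (- q))"
          using G.int_pow_pow[OF x, of "int m" "- q"] by (simp add: int_pow_int)
        then show ?thesis
          using G.int_pow_mult[OF x, of n "int m * (- q)"] nqr
          by (simp add: int_pow_int)
      qed
      ultimately have *: "(x [^]\<^bsub>G\<^esub> r, d \<otimes>\<^bsub>D\<^esub> y [^]\<^bsub>D\<^esub> (- q)) \<in> M"
        by simp
      then have "r = 0"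
        using least[OF r] by auto
      then have "d \<otimes>\<^bsub>D\<^esub> y [^]\<^bsub>D\<^esub> (- q) = \<one>\<^bsub>D\<^esub>"
        using partial_homD(6)[OF M] * by simp
      then have "d = y [^]\<^bsub>D\<^esub> q"
        using \<open>y \<in> carrier D\<close> partial_homD(2)[OF M n] D.inv_solve_right'
        by (simp add: D.int_pow_neg)
      also have "\<dots> = e [^]\<^bsub>D\<^esub> (int m * q)"
        using D.int_pow_pow[OF e(1), of "int m" q] e(2) by (simp add: int_pow_int)
      finally show "d = e [^]\<^bsub>D\<^esub> n"
        using nqr \<open>r = 0\<close> by simp
    qed
  next
    case False
    show ?thesis
    proof (intro bexI[of _ "\<one>\<^bsub>D\<^esub>"] allI impI)
      fix n :: int and d assume n: "(x [^]\<^bsub>G\<^esub> n, d) \<in> M"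
      have "n = 0"
      proof (cases n rule: int_cases2)
        case (nonneg m)
        then show ?thesis
          using False n by (auto simp: int_pow_int)
      next
        case (nonpos m)
        have "x [^]\<^bsub>G\<^esub> m = inv\<^bsub>G\<^esub> (x [^]\<^bsub>G\<^esub> n)"
          using x nonpos by (simp add: G.int_pow_neg int_pow_int)
        then have "(x [^]\<^bsub>G\<^esub> m, inv\<^bsub>D\<^esub> d) \<in> M"
          using partial_homD(5)[OF M n] by simp
        then show ?thesis
          using False nonpos by auto
      qed
      then show "d = \<one>\<^bsub>D\<^esub> [^]\<^bsub>D\<^esub> n"
        using partial_homD(6)[OF M, of d] n by simp
    qed simp
  qed
  then obtain e where e: "e \<in> carrier D" and eq: "\<And>(n::int) d. (x [^]\<^bsub>G\<^esub> n, d) \<in> M \<Longrightarrow> d = e [^]\<^bsub>D\<^esub> n"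
    by blast
  define M' where "M' = {(g \<otimes>\<^bsub>G\<^esub> x [^]\<^bsub>G\<^esub> n, d \<otimes>\<^bsub>D\<^esub> e [^]\<^bsub>D\<^esub> n) | g d (n::int). (g, d) \<in> M}"
  have M'I: "(g \<otimes>\<^bsub>G\<^esub> x [^]\<^bsub>G\<^esub> n, d \<otimes>\<^bsub>D\<^esub> e [^]\<^bsub>D\<^esub> n) \<in> M'" if "(g, d) \<in> M" for g d and n :: int
    unfolding M'_def using that by blast
  note MG = partial_homD(1)[OF M] and MD = partial_homD(2)[OF M]
  have sub: "M \<subseteq> M'"
  proof
    fix p assume p: "p \<in> M"
    obtain g d where gd: "p = (g, d)"
      by (cases p)
    then show "p \<in> M'"
      using M'I[of g d 0] p MG[of g d] MD[of g d] by simp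
  qed
  have "partial_hom G D M'"
    unfolding partial_hom_def
  proof (intro conjI allI impI)
    show "M' \<subseteq> carrier G \<times> carrier D"
      using MG MD x e by (auto simp: M'_def)
    show "(\<one>\<^bsub>G\<^esub>, \<one>\<^bsub>D\<^esub>) \<in> M'"
      using sub partial_homD(3)[OF M] by blast
    fix g d
    {
      fix g' d' assume "(g, d) \<in> M' \<and> (g', d') \<in> M'"
      then obtain g1 d1 n1 g2 d2 n2 where *: "(g1, d1) \<in> M" "(g2, d2) \<in> M"
        "g = g1 \<otimes>\<^bsub>G\<^esub> x [^]\<^bsub>G\<^esub> (n1::int)" "d = d1 \<otimes>\<^bsub>D\<^esub> e [^]\<^bsub>D\<^esub> n1"
        "g' = g2 \<otimes>\<^bsub>G\<^esub> x [^]\<^bsub>G\<^esub> (n2::int)" "d' = d2 \<otimes>\<^bsub>D\<^esub> e [^]\<^bsub>D\<^esub> n2"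
        unfolding M'_def by blast
      have "g \<otimes>\<^bsub>G\<^esub> g' = (g1 \<otimes>\<^bsub>G\<^esub> g2) \<otimes>\<^bsub>G\<^esub> x [^]\<^bsub>G\<^esub> (n1 + n2)"
        using * MG x by (simp add: G.int_pow_mult G.m_ac)
      moreover have "d \<otimes>\<^bsub>D\<^esub> d' = (d1 \<otimes>\<^bsub>D\<^esub> d2) \<otimes>\<^bsub>D\<^esub> e [^]\<^bsub>D\<^esub> (n1 + n2)"
        using * MD e by (simp add: D.int_pow_mult D.m_ac)
      ultimately show "(g \<otimes>\<^bsub>G\<^esub> g', d \<otimes>\<^bsub>D\<^esub> d') \<in> M'"
        using M'I[OF partial_homD(4)[OF M *(1,2)]] by simp
    }
    assume "(g, d) \<in> M'"
    then obtain g1 d1 n1 where *: "(g1, d1) \<in> M"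
      "g = g1 \<otimes>\<^bsub>G\<^esub> x [^]\<^bsub>G\<^esub> (n1::int)" "d = d1 \<otimes>\<^bsub>D\<^esub> e [^]\<^bsub>D\<^esub> n1"
      unfolding M'_def by blast
    have "inv\<^bsub>G\<^esub> g = inv\<^bsub>G\<^esub> g1 \<otimes>\<^bsub>G\<^esub> x [^]\<^bsub>G\<^esub> (- n1)"
      using * MG x by (simp add: G.int_pow_neg G.inv_mult)
    moreover have "inv\<^bsub>D\<^esub> d = inv\<^bsub>D\<^esub> d1 \<otimes>\<^bsub>D\<^esub> e [^]\<^bsub>D\<^esub> (- n1)"
      using * MD e by (simp add: D.int_pow_neg D.inv_mult)
    ultimately show "(inv\<^bsub>G\<^esub> g, inv\<^bsub>D\<^esub> d) \<in> M'"
      using M'I[OF partial_homD(5)[OF M *(1)]] by simp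
  next
    fix d assume "(\<one>\<^bsub>G\<^esub>, d) \<in> M'"
    then obtain g1 d1 n1 where *: "(g1, d1) \<in> M"
      "\<one>\<^bsub>G\<^esub> = g1 \<otimes>\<^bsub>G\<^esub> x [^]\<^bsub>G\<^esub> (n1::int)" "d = d1 \<otimes>\<^bsub>D\<^esub> e [^]\<^bsub>D\<^esub> n1"
      unfolding M'_def by blast
    have "g1 = inv\<^bsub>G\<^esub> (x [^]\<^bsub>G\<^esub> n1)"
      by (rule G.inv_equality[symmetric]) (use * MG x in auto)
    then have "(x [^]\<^bsub>G\<^esub> (- n1), d1) \<in> M"
      using *(1) x by (simp add: G.int_pow_neg)
    then have "d1 = e [^]\<^bsub>D\<^esub> (- n1)"
      by (rule eq)
    then show "d = \<one>\<^bsub>D\<^esub>"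
      using *(3) e by (simp add: D.int_pow_neg)
  qed
  moreover have "(x, e) \<in> M'"
    using M'I[OF partial_homD(3)[OF M], of 1] x e by simp
  ultimately show ?thesis
    using sub by blast
qed

text \<open>Zorn's lemma on graphs. The conditions of \<open>partial_hom\<close> involve finitely
  many pairs at a time, so they pass to unions of chains; a maximal graph is total by the
  one-element extension.\<close>

lemma (in partial_hom_setting) partial_hom_total_extension:
  assumes M: "partial_hom G D M" and div: "divisible_group D"
  shows "\<exists>f\<in>hom G D. \<forall>(g, d)\<in>M. f g = d"
proof -
  let ?A = "{N. partial_hom G D N \<and> M \<subseteq> N}"
  have "\<exists>N\<in>?A. \<forall>N'\<in>?A. N \<subseteq> N' \<longrightarrow> N' = N"
  proof (rule subset_Zorn_nonempty)
    show "?A \<noteq> {}"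
      using M by blast
    fix C assume C: "C \<noteq> {}" "subset.chain ?A C"
    then have CA: "\<And>N. N \<in> C \<Longrightarrow> partial_hom G D N \<and> M \<subseteq> N"
      and lin: "\<And>N N'. \<lbrakk>N \<in> C; N' \<in> C\<rbrakk> \<Longrightarrow> N \<subseteq> N' \<or> N' \<subseteq> N"
      unfolding subset.chain_def by blast+
    obtain N0 where N0: "N0 \<in> C"
      using C(1) by blast
    have "partial_hom G D (\<Union>C)"
      unfolding partial_hom_def
    proof (intro conjI allI impI)
      show "\<Union>C \<subseteq> carrier G \<times> carrier D"
        using CA unfolding partial_hom_def by blast
      show "(\<one>\<^bsub>G\<^esub>, \<one>\<^bsub>D\<^esub>) \<in> \<Union>C"
        by (rule UnionI[OF N0 partial_homD(3)[OF conjunct1[OF CA[OF N0]]]])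
      fix g d
      {
        fix g' d' assume "(g, d) \<in> \<Union>C \<and> (g', d') \<in> \<Union>C"
        then obtain N N' where "N \<in> C" "N' \<in> C" "(g, d) \<in> N" "(g', d') \<in> N'"
          by blast
        then obtain N'' where N'': "N'' \<in> C" "(g, d) \<in> N''" "(g', d') \<in> N''"
          using lin by blast
        have "(g \<otimes>\<^bsub>G\<^esub> g', d \<otimes>\<^bsub>D\<^esub> d') \<in> N''"
          by (rule partial_homD(4)[OF conjunct1[OF CA[OF N''(1)]] N''(2,3)])
        then show "(g \<otimes>\<^bsub>G\<^esub> g', d \<otimes>\<^bsub>D\<^esub> d') \<in> \<Union>C"
          by (rule UnionI[OF N''(1)])
      }
      assume "(g, d) \<in> \<Union>C"
      then obtain N' where N': "N' \<in> C" "(g, d) \<in> N'"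
        by blast
      show "(inv\<^bsub>G\<^esub> g, inv\<^bsub>D\<^esub> d) \<in> \<Union>C"
        by (rule UnionI[OF N'(1) partial_homD(5)[OF conjunct1[OF CA[OF N'(1)]] N'(2)]])
    next
      fix d assume "(\<one>\<^bsub>G\<^esub>, d) \<in> \<Union>C"
      then obtain N' where N': "N' \<in> C" "(\<one>\<^bsub>G\<^esub>, d) \<in> N'"
        by blast
      show "d = \<one>\<^bsub>D\<^esub>"
        by (rule partial_homD(6)[OF conjunct1[OF CA[OF N'(1)]] N'(2)])
    qed
    then show "\<Union>C \<in> ?A"
      using N0 CA by blast
  qed
  then obtain N where NA: "N \<in> ?A" and maxA: "\<forall>N'\<in>?A. N \<subseteq> N' \<longrightarrow> N' = N"
    by (rule bexE)
  then have N: "partial_hom G D N" "M \<subseteq> N"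
    by simp_all
  have max: "N' = N" if "partial_hom G D N'" "N \<subseteq> N'" for N'
    using maxA that N(2) by simp
  have total: "\<exists>d. (x, d) \<in> N" if x: "x \<in> carrier G" for x
  proof -
    obtain M' e where "partial_hom G D M'" "N \<subseteq> M'" "(x, e) \<in> M'"
      using partial_hom_extend1[OF N(1) x div] by (elim exE conjE)
    then show ?thesis
      using max[of M'] by auto
  qed
  define f where "f x = (THE d. (x, d) \<in> N)" for x
  have f: "f x = d" if d: "(x, d) \<in> N" for x d
    unfolding f_def
    by (rule the_equality[where P = "\<lambda>d. (x, d) \<in> N", OF d]) (rule partial_hom_unique[OF N(1) _ d])
  have "f \<in> hom G D"
  proof (rule homI)
    fix x y assume "x \<in> carrier G" "y \<in> carrier G"
    then obtain d d' where d: "(x, d) \<in> N" "(y, d') \<in> N"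
      using total[of x] total[of y] by auto
    then show "f (x \<otimes>\<^bsub>G\<^esub> y) = f x \<otimes>\<^bsub>D\<^esub> f y"
      using f partial_homD(4)[OF N(1) d] by simp
  next
    fix x assume "x \<in> carrier G"
    then obtain d where d: "(x, d) \<in> N"
      using total by auto
    then show "f x \<in> carrier D"
      using f[OF d] partial_homD(2)[OF N(1) d] by simp
  qed
  moreover have "\<forall>(g, d)\<in>M. f g = d"
    using f N(2) by auto
  ultimately show ?thesis
    by (intro bexI[of _ f])
qed

text \<open>Prescribes \<open>f\<close> on the image of \<open>a\<close>, consistently because the
  kernel of \<open>a\<close> lies in that of \<open>b\<close>. With a direct product for
  \<open>P\<close> this handles prescriptions on a sum of subgroups; with a boundary operator for
  \<open>a\<close> it factors a cochain through the boundaries.\<close>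

lemma divisible_group_extension:
  assumes G: "comm_group G" and div: "divisible_group D" and P: "group P"
    and a: "a \<in> hom P G" and b: "b \<in> hom P D"
    and ker: "\<And>p. \<lbrakk>p \<in> carrier P; a p = \<one>\<^bsub>G\<^esub>\<rbrakk> \<Longrightarrow> b p = \<one>\<^bsub>D\<^esub>"
  obtains f where "f \<in> hom G D" "\<And>p. p \<in> carrier P \<Longrightarrow> f (a p) = b p"
proof -
  have D: "comm_group D"
    using div by (simp add: divisible_group_def)
  interpret partial_hom_setting G D
    using G D by (simp add: partial_hom_setting_def)
  interpret a: group_hom P G a
    using P a G.is_group by (simp add: group_hom_def group_hom_axioms_def)
  interpret b: group_hom P D b
    using P b D.is_group by (simp add: group_hom_def group_hom_axioms_def)
  let ?M = "(\<lambda>p. (a p, b p)) ` carrier P"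
  have "partial_hom G D ?M"
    unfolding partial_hom_def
  proof (intro conjI allI impI)
    show "(\<one>\<^bsub>G\<^esub>, \<one>\<^bsub>D\<^esub>) \<in> ?M"
      by (rule image_eqI[of _ _ "\<one>\<^bsub>P\<^esub>"]) auto
    show "(g \<otimes>\<^bsub>G\<^esub> g', d \<otimes>\<^bsub>D\<^esub> d') \<in> ?M" if "(g, d) \<in> ?M \<and> (g', d') \<in> ?M" for g d g' d'
    proof -
      obtain p p' where "p \<in> carrier P" "p' \<in> carrier P" "g = a p" "d = b p" "g' = a p'" "d' = b p'"
        using \<open>(g, d) \<in> ?M \<and> (g', d') \<in> ?M\<close> by blast
      then show ?thesis
        by (intro image_eqI[of _ _ "p \<otimes>\<^bsub>P\<^esub> p'"]) auto
    qed
    show "(inv\<^bsub>G\<^esub> g, inv\<^bsub>D\<^esub> d) \<in> ?M" if "(g, d) \<in> ?M" for g d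
    proof -
      obtain p where "p \<in> carrier P" "g = a p" "d = b p"
        using \<open>(g, d) \<in> ?M\<close> by blast
      then show ?thesis
        by (intro image_eqI[of _ _ "inv\<^bsub>P\<^esub> p"]) auto
    qed
    show "d = \<one>\<^bsub>D\<^esub>" if "(\<one>\<^bsub>G\<^esub>, d) \<in> ?M" for d
      using that ker by auto
  qed auto
  from partial_hom_total_extension[OF this div] show ?thesis
    using that by auto
qed

section \<open>The groups U(1) and R and the exponential map between them\<close>

lemma carrier_U1 [simp]: "carrier U1 = {z. norm z = 1}"
  and mult_U1 [simp]: "z \<otimes>\<^bsub>U1\<^esub> w = z * w"
  and one_U1 [simp]: "\<one>\<^bsub>U1\<^esub> = 1"
  by (simp_all add: U1_def)

lemma comm_group_U1: "comm_group U1"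
proof (rule comm_groupI)
  show "\<exists>y\<in>carrier U1. y \<otimes>\<^bsub>U1\<^esub> x = \<one>\<^bsub>U1\<^esub>" if "x \<in> carrier U1" for x
    using that by (intro bexI[of _ "inverse x"]) (auto simp: norm_inverse intro: left_inverse)
qed (auto simp: norm_mult)

lemma group_U1: "group U1"
  by (rule comm_group.axioms(2)[OF comm_group_U1])

lemma inv_U1: "norm z = 1 \<Longrightarrow> inv\<^bsub>U1\<^esub> z = inverse z"
  by (rule group.inv_equality[OF group_U1]) (auto simp: norm_inverse intro: left_inverse)

lemma nat_pow_U1: "z [^]\<^bsub>U1\<^esub> (n::nat) = z ^ n"
  by (induction n) (simp_all add: nat_pow_def U1_def mult.commute)

lemma carrier_real_group [simp]: "carrier real_group = UNIV"
  and mult_real_group [simp]: "r \<otimes>\<^bsub>real_group\<^esub> s = r + s"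
  and one_real_group [simp]: "\<one>\<^bsub>real_group\<^esub> = 0"
  by (simp_all add: real_group_def)

lemma comm_group_real_group: "comm_group real_group"
  by (rule comm_groupI) (auto intro: exI[of _ "- _"])

lemma inv_real_group [simp]: "inv\<^bsub>real_group\<^esub> r = - r"
  by (rule group.inv_equality[OF comm_group.axioms(2)[OF comm_group_real_group]]) auto

lemma nat_pow_real_group: "r [^]\<^bsub>real_group\<^esub> (n::nat) = of_nat n * r"
  by (induction n) (simp_all add: nat_pow_def real_group_def algebra_simps)

lemma expU_eq_cis: "expU r = cis (2 * pi * r)"
  by (simp add: expU_def cis_conv_exp mult_ac)

lemma norm_expU [simp]: "norm (expU r) = 1"
  by (simp add: expU_eq_cis)

lemma expU_add: "expU (r + s) = expU r * expU s"
  by (simp add: expU_eq_cis cis_mult distrib_left)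

lemma expU_0 [simp]: "expU 0 = 1"
  by (simp add: expU_eq_cis)

lemma expU_uminus: "expU (- r) = inverse (expU r)"
  by (simp add: expU_eq_cis)

lemma expU_diff: "expU (r - s) = expU r / expU s"
  using expU_add[of r "- s"] by (simp add: expU_uminus divide_inverse)

lemma expU_eq_1_iff: "expU r = 1 \<longleftrightarrow> r \<in> \<int>"
proof -
  have "expU r = 1 \<longleftrightarrow> exp (\<i> * complex_of_real (2 * pi * r)) = 1"
    by (simp add: expU_eq_cis cis_conv_exp)
  also have "\<dots> \<longleftrightarrow> (\<exists>n::int. 2 * pi * r = of_int (2 * n) * pi)"
    by (simp add: exp_eq_1)
  also have "\<dots> \<longleftrightarrow> (\<exists>n::int. r = of_int n)"
    by auto
  finally show ?thesis
    by (auto simp: Ints_def)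
qed

lemma expU_of_int: "expU (of_int n) = 1"
  by (simp add: expU_eq_1_iff)

lemma expU_surj: "norm z = 1 \<Longrightarrow> \<exists>r. z = expU r"
proof -
  assume "norm z = 1"
  then have "z \<noteq> 0"
    by auto
  with \<open>norm z = 1\<close> have "z = cis (Arg z)"
    using cis_Arg[of z] by (simp add: sgn_eq)
  then have "z = expU (Arg z / (2 * pi))"
    by (simp add: expU_eq_cis)
  then show ?thesis ..
qed

lemma divisible_group_U1: "divisible_group U1"
  unfolding divisible_group_def
proof (intro conjI ballI allI impI comm_group_U1)
  fix d and n :: nat assume d: "d \<in> carrier U1" and n: "0 < n"
  obtain r where r: "d = expU r"
    using expU_surj d by auto
  have "expU (r / n) ^ n = cis (of_nat n * (2 * pi * (r / n)))"
    unfolding expU_eq_cis by (rule Complex.DeMoivre)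
  also have "of_nat n * (2 * pi * (r / n)) = 2 * pi * r"
    using n by simp
  finally have "expU (r / n) ^ n = d"
    by (simp add: r expU_eq_cis)
  then show "\<exists>e\<in>carrier U1. e [^]\<^bsub>U1\<^esub> n = d"
    by (intro bexI[of _ "expU (r / n)"]) (simp_all add: nat_pow_U1)
qed

lemma divisible_group_real: "divisible_group real_group"
  unfolding divisible_group_def
proof (intro conjI ballI allI impI comm_group_real_group)
  fix d and n :: nat assume "0 < n"
  then show "\<exists>e\<in>carrier real_group. e [^]\<^bsub>real_group\<^esub> n = d"
    by (intro bexI[of _ "d / n"]) (simp_all add: nat_pow_real_group)
qed

lemma hom_expU: "h \<in> hom G real_group \<Longrightarrow> (\<lambda>c. expU (h c)) \<in> hom G U1"
  by (auto simp: hom_def expU_add)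

text \<open>By freeness a logarithm can be chosen generator by generator. A character on cycles is
  first extended to the free group of chains.\<close>

lemma free_Abelian_group_lift:
  assumes h: "h \<in> hom (free_Abelian_group S) U1"
  obtains H where "H \<in> hom (free_Abelian_group S) real_group"
    "\<And>c. c \<in> carrier (free_Abelian_group S) \<Longrightarrow> h c = expU (H c)"
proof -
  interpret R: comm_group real_group
    by (rule comm_group_real_group)
  have "\<forall>x\<in>S. \<exists>r. h (frag_of x) = expU r"
    using hom_in_carrier[OF h] by (intro ballI expU_surj) auto
  then obtain r where r: "\<And>x. x \<in> S \<Longrightarrow> h (frag_of x) = expU (r x)"
    by metis
  obtain H where H: "H \<in> hom (free_Abelian_group S) real_group" "\<And>x. x \<in> S \<Longrightarrow> H (frag_of x) = r x"
    using R.free_Abelian_group_universal[of r S] by auto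
  interpret h: group_hom "free_Abelian_group S" U1 h
    using h group_U1 by (simp add: group_hom_def group_hom_axioms_def)
  interpret H: group_hom "free_Abelian_group S" real_group H
    using H(1) R.is_group by (simp add: group_hom_def group_hom_axioms_def)
  have diff: "h (a - b) = expU (H (a - b))"
    if ab: "Poly_Mapping.keys a \<subseteq> S" "Poly_Mapping.keys b \<subseteq> S" "h a = expU (H a)" "h b = expU (H b)" for a b
  proof -
    have eq: "a - b = a \<otimes>\<^bsub>free_Abelian_group S\<^esub> inv\<^bsub>free_Abelian_group S\<^esub> b"
      using ab by simp
    have carr: "a \<in> carrier (free_Abelian_group S)" "b \<in> carrier (free_Abelian_group S)"
      using ab by simp_all
    have "h (a - b) = h a \<otimes>\<^bsub>U1\<^esub> inv\<^bsub>U1\<^esub> h b"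
      unfolding eq h.hom_mult[OF carr(1) h.G.inv_closed[OF carr(2)]] h.hom_inv[OF carr(2)] ..
    moreover have "H (a - b) = H a - H b"
      unfolding eq H.hom_mult[OF carr(1) h.G.inv_closed[OF carr(2)]] H.hom_inv[OF carr(2)] by simp
    ultimately show ?thesis
      unfolding ab(3,4) by (simp add: expU_diff divide_inverse inv_U1)
  qed
  have "h c = expU (H c)" if "Poly_Mapping.keys c \<subseteq> S" for c
    using that
  proof (rule free_Abelian_group_induct)
    show "h 0 = expU (H 0)"
      using h.hom_one H.hom_one by simp
    show "h (frag_of x) = expU (H (frag_of x))" if "x \<in> S" for x
      using r[OF that] H(2)[OF that] by simp
  qed (rule diff)
  with H(1) show ?thesis
    by (intro that) auto
qed

section \<open>Cohomology of chain complexes\<close>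

lemma comm_group_hom_group:
  assumes C: "group C" and G: "comm_group G"
  shows "comm_group (hom_group C G)"
proof -
  interpret C: group C by fact
  interpret G: comm_group G by fact
  have hom_closed: "f c \<in> carrier G" if "f \<in> hom C G" "c \<in> carrier C" for f c
    using that by (rule hom_in_carrier)
  have mult: "(\<lambda>c\<in>carrier C. f c \<otimes>\<^bsub>G\<^esub> g c) \<in> hom C G" if "f \<in> hom C G" "g \<in> hom C G" for f g
    using that by (intro homI) (simp_all add: hom_closed hom_mult G.m_ac)
  show ?thesis
  proof (rule comm_groupI)
    show "f \<otimes>\<^bsub>hom_group C G\<^esub> g \<in> carrier (hom_group C G)"
      if "f \<in> carrier (hom_group C G)" "g \<in> carrier (hom_group C G)" for f g
      using that mult by (simp add: hom_group_def)
    show "\<one>\<^bsub>hom_group C G\<^esub> \<in> carrier (hom_group C G)"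
      by (simp add: hom_group_def) (intro homI, simp_all)
    show "f \<otimes>\<^bsub>hom_group C G\<^esub> g \<otimes>\<^bsub>hom_group C G\<^esub> h = f \<otimes>\<^bsub>hom_group C G\<^esub> (g \<otimes>\<^bsub>hom_group C G\<^esub> h)"
      if "f \<in> carrier (hom_group C G)" "g \<in> carrier (hom_group C G)" "h \<in> carrier (hom_group C G)" for f g h
      using that by (auto simp: hom_group_def hom_closed G.m_assoc)
    show "f \<otimes>\<^bsub>hom_group C G\<^esub> g = g \<otimes>\<^bsub>hom_group C G\<^esub> f"
      if "f \<in> carrier (hom_group C G)" "g \<in> carrier (hom_group C G)" for f g
      using that by (auto simp: hom_group_def hom_closed intro!: restrict_ext G.m_comm)
    show "\<one>\<^bsub>hom_group C G\<^esub> \<otimes>\<^bsub>hom_group C G\<^esub> f = f" if "f \<in> carrier (hom_group C G)" for f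
    proof (rule extensionalityI[of _ "carrier C"])
      show "f \<in> extensional (carrier C)"
        using that by (simp add: hom_group_def)
    qed (use that in \<open>simp_all add: hom_group_def hom_closed\<close>)
    show "\<exists>g\<in>carrier (hom_group C G). g \<otimes>\<^bsub>hom_group C G\<^esub> f = \<one>\<^bsub>hom_group C G\<^esub>"
      if f: "f \<in> carrier (hom_group C G)" for f
    proof (rule bexI)
      have fh: "f \<in> hom C G"
        using f by (simp add: hom_group_def)
      show "(\<lambda>c\<in>carrier C. inv\<^bsub>G\<^esub> f c) \<otimes>\<^bsub>hom_group C G\<^esub> f = \<one>\<^bsub>hom_group C G\<^esub>"
        by (auto simp: hom_group_def hom_closed[OF fh])
      have "(\<lambda>c\<in>carrier C. inv\<^bsub>G\<^esub> f c) \<in> hom C G"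
        using fh by (intro homI) (simp_all add: hom_closed[OF fh] hom_mult[OF fh] G.inv_mult)
      then show "(\<lambda>c\<in>carrier C. inv\<^bsub>G\<^esub> f c) \<in> carrier (hom_group C G)"
        by (simp add: hom_group_def)
    qed
  qed
qed

lemma inv_hom_group:
  assumes C: "group C" and G: "comm_group G" and f: "f \<in> carrier (hom_group C G)"
  shows "inv\<^bsub>hom_group C G\<^esub> f = (\<lambda>c\<in>carrier C. inv\<^bsub>G\<^esub> f c)"
proof -
  interpret C: group C by fact
  interpret G: comm_group G by fact
  interpret H: comm_group "hom_group C G"
    by (rule comm_group_hom_group[OF C G])
  have fh: "f \<in> hom C G"
    using f by (simp add: hom_group_def)
  have fc: "f c \<in> carrier G" if "c \<in> carrier C" for c
    using hom_in_carrier[OF fh that] .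
  show ?thesis
  proof (rule H.inv_equality[OF _ f])
    show "(\<lambda>c\<in>carrier C. inv\<^bsub>G\<^esub> f c) \<otimes>\<^bsub>hom_group C G\<^esub> f = \<one>\<^bsub>hom_group C G\<^esub>"
      by (auto simp: hom_group_def fc)
    have "(\<lambda>c\<in>carrier C. inv\<^bsub>G\<^esub> f c) \<in> hom C G"
      by (intro homI) (simp_all add: fc hom_mult[OF fh] G.inv_mult)
    then show "(\<lambda>c\<in>carrier C. inv\<^bsub>G\<^esub> f c) \<in> carrier (hom_group C G)"
      by (simp add: hom_group_def)
  qed
qed

locale comm_quotient = comm_group Z for Z :: "('a, 'm) monoid_scheme" (structure) + fixes B :: "'a set"
  assumes B: "subgroup B Z"

lemma (in comm_quotient) quotient_mult:
  assumes "x \<in> carrier Z" "y \<in> carrier Z"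
  shows "(B #> x) \<otimes>\<^bsub>Z Mod B\<^esub> (B #> y) = B #> (x \<otimes> y)"
  using normal.rcos_sum[OF subgroup_imp_normal[OF B] assms] by simp

lemma (in comm_quotient) quotient_eq_iff:
  assumes x: "x \<in> carrier Z" and y: "y \<in> carrier Z"
  shows "B #> x = B #> y \<longleftrightarrow> (\<exists>b\<in>B. x = b \<otimes> y)"
proof
  assume "B #> x = B #> y"
  then have "x \<in> B #> y"
    using rcos_self[OF x B] by simp
  then show "\<exists>b\<in>B. x = b \<otimes> y"
    by (auto simp: r_coset_def)
next
  assume "\<exists>b\<in>B. x = b \<otimes> y"
  then have "x \<in> B #> y"
    by (auto simp: r_coset_def)
  then show "B #> x = B #> y"
    using repr_independence[OF _ y B] by simp
qed

section \<open>Chain complexes, cocycles and cohomology classes\<close>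

locale chain_cplx =
  fixes K :: "'c cplx"
  assumes grp: "comm_group (cgrp K n)"
    and bd_hom: "bd K n \<in> hom (cgrp K n) (cgrp K (n - 1))"
    and bd_bd: "c \<in> carrier (cgrp K n) \<Longrightarrow> bd K (n - 1) (bd K n c) = \<one>\<^bsub>cgrp K (n - 1 - 1)\<^esub>"

lemma (in chain_cplx) group_cgrp: "group (cgrp K n)"
  by (rule comm_group.axioms(2)[OF grp])

lemma (in chain_cplx) bd_in: "c \<in> carrier (cgrp K n) \<Longrightarrow> bd K n c \<in> carrier (cgrp K (n - 1))"
  by (rule hom_in_carrier[OF bd_hom])

lemma (in chain_cplx) bd_in_Suc: "c \<in> carrier (cgrp K (n + 1)) \<Longrightarrow> bd K (n + 1) c \<in> carrier (cgrp K n)"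
  using bd_in[of c "n + 1"] by simp

lemma (in chain_cplx) bd_bd_Suc:
  "c \<in> carrier (cgrp K (n + 1)) \<Longrightarrow> bd K n (bd K (n + 1) c) = \<one>\<^bsub>cgrp K (n - 1)\<^esub>"
  using bd_bd[of c "n + 1"] by simp

lemma (in chain_cplx) cycles_subgroup: "subgroup (cycles K n) (cgrp K n)"
proof -
  interpret h: group_hom "cgrp K n" "cgrp K (n - 1)" "bd K n"
    using bd_hom group_cgrp by (simp add: group_hom_def group_hom_axioms_def)
  have "cycles K n = kernel (cgrp K n) (cgrp K (n - 1)) (bd K n)"
    by (simp add: cycles_def kernel_def)
  then show ?thesis
    using h.subgroup_kernel by simp
qed

lemma (in chain_cplx) group_cycle_group: "group (cycle_group K n)"
  unfolding cycle_group_def by (rule subgroup.subgroup_is_group[OF cycles_subgroup group_cgrp])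

lemma carrier_cycle_group [simp]: "carrier (cycle_group K n) = cycles K n"
  and mult_cycle_group [simp]: "x \<otimes>\<^bsub>cycle_group K n\<^esub> y = x \<otimes>\<^bsub>cgrp K n\<^esub> y"
  and one_cycle_group [simp]: "\<one>\<^bsub>cycle_group K n\<^esub> = \<one>\<^bsub>cgrp K n\<^esub>"
  by (simp_all add: cycle_group_def)

lemma (in chain_cplx) cycles_carrier: "z \<in> cycles K n \<Longrightarrow> z \<in> carrier (cgrp K n)"
  by (simp add: cycles_def)

lemma (in chain_cplx) bd_in_cycles: "c \<in> carrier (cgrp K (n + 1)) \<Longrightarrow> bd K (n + 1) c \<in> cycles K n"
  by (simp add: cycles_def bd_in_Suc bd_bd_Suc)

lemma (in chain_cplx) hom_cycle_group_restrict:
  "f \<in> hom (cgrp K n) G \<Longrightarrow> f \<in> hom (cycle_group K n) G"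
  using cycles_carrier by (auto simp: hom_def)

locale cochain_cplx = chain_cplx K + G: comm_group G
  for K :: "'c cplx" and G :: "'g monoid"

lemma cochains_carrier_iff:
  "f \<in> carrier (cochains K G n) \<longleftrightarrow> f \<in> hom (cgrp K n) G \<and> f \<in> extensional (carrier (cgrp K n))"
  by (simp add: cochains_def hom_group_def)

lemma cochains_mult: "f \<otimes>\<^bsub>cochains K G n\<^esub> g = (\<lambda>c\<in>carrier (cgrp K n). f c \<otimes>\<^bsub>G\<^esub> g c)"
  by (simp add: cochains_def hom_group_def)

lemma cochains_one: "\<one>\<^bsub>cochains K G n\<^esub> = (\<lambda>c\<in>carrier (cgrp K n). \<one>\<^bsub>G\<^esub>)"
  by (simp add: cochains_def hom_group_def)

lemma (in group) hom_restrict: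
  "f \<in> hom G H \<Longrightarrow> restrict f (carrier G) \<in> hom G H"
  by (simp add: hom_def Pi_iff)

lemma (in cochain_cplx) comm_group_cochains: "comm_group (cochains K G n)"
  unfolding cochains_def by (rule comm_group_hom_group[OF group_cgrp G.comm_group_axioms])

lemma (in cochain_cplx) cochain_in: "\<lbrakk>f \<in> carrier (cochains K G n); c \<in> carrier (cgrp K n)\<rbrakk> \<Longrightarrow> f c \<in> carrier G"
  using hom_in_carrier by (auto simp: cochains_carrier_iff)

lemma (in cochain_cplx) cochain_restrict: "f \<in> hom (cgrp K n) G \<Longrightarrow> (\<lambda>c\<in>carrier (cgrp K n). f c) \<in> carrier (cochains K G n)"
  using group.hom_restrict[OF group_cgrp] by (simp add: cochains_carrier_iff)

lemma (in cochain_cplx) inv_cochains: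
  "f \<in> carrier (cochains K G n) \<Longrightarrow> inv\<^bsub>cochains K G n\<^esub> f = (\<lambda>c\<in>carrier (cgrp K n). inv\<^bsub>G\<^esub> f c)"
  unfolding cochains_def by (rule inv_hom_group[OF group_cgrp G.comm_group_axioms])

lemma (in cochain_cplx) cocycle_iff:
  "f \<in> cocycles K G n \<longleftrightarrow> f \<in> carrier (cochains K G n) \<and>
     (\<forall>c\<in>carrier (cgrp K (n + 1)). f (bd K (n + 1) c) = \<one>\<^bsub>G\<^esub>)"
  by (auto simp: cocycles_def cobd_def cochains_one fun_eq_iff restrict_def)

lemma (in cochain_cplx) cocycleD:
  assumes "f \<in> cocycles K G n"
  shows "f \<in> carrier (cochains K G n)" "f \<in> hom (cgrp K n) G" "f \<in> extensional (carrier (cgrp K n))"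
    "c \<in> carrier (cgrp K n) \<Longrightarrow> f c \<in> carrier G"
    "c \<in> carrier (cgrp K (n + 1)) \<Longrightarrow> f (bd K (n + 1) c) = \<one>\<^bsub>G\<^esub>"
  using assms cochain_in by (auto simp: cocycle_iff cochains_carrier_iff)

lemma (in cochain_cplx) coboundary_iff:
  "b \<in> coboundaries K G n \<longleftrightarrow>
     (\<exists>u\<in>carrier (cochains K G (n - 1)). b = (\<lambda>c\<in>carrier (cgrp K n). u (bd K n c)))"
  by (auto simp: coboundaries_def cobd_def)

lemma (in cochain_cplx) coboundary_cocycle:
  assumes u: "u \<in> hom (cgrp K (n - 1)) G"
  shows "(\<lambda>c\<in>carrier (cgrp K n). u (bd K n c)) \<in> cocycles K G n"
proof -
  interpret u: group_hom "cgrp K (n - 1)" G u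
    using u group_cgrp G.is_group by (simp add: group_hom_def group_hom_axioms_def)
  have "u \<circ> bd K n \<in> hom (cgrp K n) G"
    by (rule hom_compose[OF bd_hom u])
  then have "(\<lambda>c\<in>carrier (cgrp K n). u (bd K n c)) \<in> carrier (cochains K G n)"
    using cochain_restrict[of "u \<circ> bd K n" n] by simp
  moreover have "u (bd K n (bd K (n + 1) c)) = \<one>\<^bsub>G\<^esub>" if "c \<in> carrier (cgrp K (n + 1))" for c
    using bd_bd_Suc[OF that] u.hom_one by simp
  ultimately show ?thesis
    using bd_in_Suc by (simp add: cocycle_iff)
qed

lemma (in cochain_cplx) cocycles_subgroup: "subgroup (cocycles K G n) (cochains K G n)"
proof -
  interpret C: comm_group "cochains K G n"
    by (rule comm_group_cochains)
  show ?thesis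
  proof (rule C.subgroupI)
    show "cocycles K G n \<subseteq> carrier (cochains K G n)"
      by (auto simp: cocycle_iff)
    have "\<one>\<^bsub>cochains K G n\<^esub> \<in> cocycles K G n"
      using C.one_closed bd_in_Suc by (simp add: cocycle_iff cochains_one)
    then show "cocycles K G n \<noteq> {}"
      by blast
    show "inv\<^bsub>cochains K G n\<^esub> f \<in> cocycles K G n" if "f \<in> cocycles K G n" for f
      using that C.inv_closed[of f] bd_in_Suc by (simp add: cocycle_iff inv_cochains)
    show "f \<otimes>\<^bsub>cochains K G n\<^esub> g \<in> cocycles K G n" if "f \<in> cocycles K G n" "g \<in> cocycles K G n" for f g
      using that C.m_closed[of f g] bd_in_Suc by (simp add: cocycle_iff cochains_mult)
  qed
qed

abbreviation (in cochain_cplx) "Z n \<equiv> (cochains K G n)\<lparr>carrier := cocycles K G n\<rparr>"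

lemma (in cochain_cplx) comm_group_cocycles: "comm_group (Z n)"
proof -
  interpret C: comm_group "cochains K G n"
    by (rule comm_group_cochains)
  have "group (Z n)"
    by (rule subgroup.subgroup_is_group[OF cocycles_subgroup C.is_group])
  then show ?thesis
    by (rule group.group_comm_groupI) (use subgroup.mem_carrier[OF cocycles_subgroup] C.m_comm in auto)
qed

lemma (in cochain_cplx) coboundaries_subgroup: "subgroup (coboundaries K G n) (Z n)"
proof -
  interpret Z: comm_group "Z n"
    by (rule comm_group_cocycles)
  interpret C: comm_group "cochains K G n"
    by (rule comm_group_cochains)
  interpret C1: comm_group "cochains K G (n - 1)"
    by (rule comm_group_cochains)
  have sub: "b \<in> cocycles K G n" if "b \<in> coboundaries K G n" for b
    using that coboundary_cocycle by (auto simp: coboundary_iff cochains_carrier_iff)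
  show ?thesis
  proof (rule Z.subgroupI)
    show "coboundaries K G n \<subseteq> carrier (Z n)"
      using sub by auto
    show "coboundaries K G n \<noteq> {}"
      using C1.one_closed unfolding coboundaries_def by blast
    show "inv\<^bsub>Z n\<^esub> b \<in> coboundaries K G n" if b: "b \<in> coboundaries K G n" for b
    proof -
      obtain u where u: "u \<in> carrier (cochains K G (n - 1))" "b = (\<lambda>c\<in>carrier (cgrp K n). u (bd K n c))"
        using b unfolding coboundary_iff by blast
      have "inv\<^bsub>Z n\<^esub> b = inv\<^bsub>cochains K G n\<^esub> b"
        using C.m_inv_consistent[OF cocycles_subgroup sub[OF b]] .
      also have "\<dots> = (\<lambda>c\<in>carrier (cgrp K n). inv\<^bsub>G\<^esub> b c)"
        by (rule inv_cochains[OF cocycleD(1)[OF sub[OF b]]])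
      also have "\<dots> = (\<lambda>c\<in>carrier (cgrp K n). (inv\<^bsub>cochains K G (n - 1)\<^esub> u) (bd K n c))"
        using u bd_in by (auto simp: inv_cochains)
      finally show ?thesis
        unfolding coboundary_iff using C1.inv_closed[OF u(1)] by blast
    qed
    show "b \<otimes>\<^bsub>Z n\<^esub> b' \<in> coboundaries K G n"
      if b: "b \<in> coboundaries K G n" and b': "b' \<in> coboundaries K G n" for b b'
    proof -
      obtain u where u: "u \<in> carrier (cochains K G (n - 1))" "b = (\<lambda>c\<in>carrier (cgrp K n). u (bd K n c))"
        using b unfolding coboundary_iff by blast
      obtain u' where u': "u' \<in> carrier (cochains K G (n - 1))" "b' = (\<lambda>c\<in>carrier (cgrp K n). u' (bd K n c))"
        using b' unfolding coboundary_iff by blast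
      have "b \<otimes>\<^bsub>Z n\<^esub> b' = (\<lambda>c\<in>carrier (cgrp K n). (u \<otimes>\<^bsub>cochains K G (n - 1)\<^esub> u') (bd K n c))"
        using u u' bd_in by (auto simp: cochains_mult)
      then show ?thesis
        unfolding coboundary_iff using C1.m_closed[OF u(1) u'(1)] by blast
    qed
  qed
qed

lemma (in cochain_cplx) comm_quotient_cocycles: "comm_quotient (Z n) (coboundaries K G n)"
  by (simp add: comm_quotient_def comm_quotient_axioms_def comm_group_cocycles coboundaries_subgroup)

lemma (in cochain_cplx) cclass_eq_coset: "cclass K G n f = coboundaries K G n #>\<^bsub>Z n\<^esub> f"
  by (simp add: cclass_def r_coset_def)

lemma (in cochain_cplx) comm_group_cohomology: "comm_group (cohomology K G n)"
  unfolding cohomology_def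
  by (rule comm_group.abelian_FactGroup[OF comm_group_cocycles coboundaries_subgroup])

lemma (in cochain_cplx) carrier_cohomology: "carrier (cohomology K G n) = cclass K G n ` cocycles K G n"
  unfolding cohomology_def carrier_FactGroup cclass_eq_coset[abs_def] by simp

lemma (in cochain_cplx) cclass_in: "f \<in> cocycles K G n \<Longrightarrow> cclass K G n f \<in> carrier (cohomology K G n)"
  by (simp add: carrier_cohomology)

lemma (in cochain_cplx) cclass_mult:
  "\<lbrakk>f \<in> cocycles K G n; g \<in> cocycles K G n\<rbrakk> \<Longrightarrow>
     cclass K G n f \<otimes>\<^bsub>cohomology K G n\<^esub> cclass K G n g = cclass K G n (f \<otimes>\<^bsub>cochains K G n\<^esub> g)"
  using comm_quotient.quotient_mult[OF comm_quotient_cocycles, of f n g]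
  by (simp add: cohomology_def cclass_eq_coset)

text \<open>Cochains are extensional, so the relation between two representatives can be stated by
  their values on chains.\<close>

lemma (in cochain_cplx) cclass_eq_iff:
  assumes f: "f \<in> cocycles K G n" and g: "g \<in> cocycles K G n"
  shows "cclass K G n f = cclass K G n g \<longleftrightarrow>
    (\<exists>u\<in>carrier (cochains K G (n - 1)). \<forall>c\<in>carrier (cgrp K n). f c = u (bd K n c) \<otimes>\<^bsub>G\<^esub> g c)"
proof -
  have "cclass K G n f = cclass K G n g \<longleftrightarrow> (\<exists>b\<in>coboundaries K G n. f = b \<otimes>\<^bsub>cochains K G n\<^esub> g)"
    using comm_quotient.quotient_eq_iff[OF comm_quotient_cocycles, of f n g] f g
    by (simp add: cclass_eq_coset)
  also have "\<dots> \<longleftrightarrow> (\<exists>u\<in>carrier (cochains K G (n - 1)).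
      f = (\<lambda>c\<in>carrier (cgrp K n). u (bd K n c)) \<otimes>\<^bsub>cochains K G n\<^esub> g)"
    unfolding coboundaries_def by (simp add: cobd_def)
  also have "\<dots> \<longleftrightarrow> (\<exists>u\<in>carrier (cochains K G (n - 1)). \<forall>c\<in>carrier (cgrp K n). f c = u (bd K n c) \<otimes>\<^bsub>G\<^esub> g c)"
  proof (rule bex_cong[OF refl])
    fix u
    show "f = (\<lambda>c\<in>carrier (cgrp K n). u (bd K n c)) \<otimes>\<^bsub>cochains K G n\<^esub> g \<longleftrightarrow>
        (\<forall>c\<in>carrier (cgrp K n). f c = u (bd K n c) \<otimes>\<^bsub>G\<^esub> g c)" (is "?L \<longleftrightarrow> ?R")
    proof
      assume L: ?L
      have "f c = u (bd K n c) \<otimes>\<^bsub>G\<^esub> g c" if "c \<in> carrier (cgrp K n)" for c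
        using fun_cong[OF L, of c] that by (simp add: cochains_mult)
      then show ?R
        by blast
    next
      assume R: ?R
      show ?L
        by (rule extensionalityI[OF cocycleD(3)[OF f]]) (use R in \<open>simp_all add: cochains_mult\<close>)
    qed
  qed
  finally show ?thesis .
qed

lemma (in cochain_cplx) one_cocycle: "(\<lambda>c\<in>carrier (cgrp K n). \<one>\<^bsub>G\<^esub>) \<in> cocycles K G n"
  using subgroup.one_closed[OF cocycles_subgroup] by (simp add: cochains_one)

lemma (in cochain_cplx) cclass_one: "cclass K G n (\<lambda>c\<in>carrier (cgrp K n). \<one>\<^bsub>G\<^esub>) = \<one>\<^bsub>cohomology K G n\<^esub>"
proof -
  interpret Z: comm_group "Z n"
    by (rule comm_group_cocycles)
  have "coboundaries K G n #>\<^bsub>Z n\<^esub> \<one>\<^bsub>Z n\<^esub> = coboundaries K G n"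
    using Z.coset_mult_one[of "coboundaries K G n"] subgroup.subset[OF coboundaries_subgroup] by simp
  then show ?thesis
    by (simp add: cclass_eq_coset cohomology_def cochains_one)
qed

lemma (in cochain_cplx) cclass_eq_one_iff:
  assumes f: "f \<in> cocycles K G n"
  shows "cclass K G n f = \<one>\<^bsub>cohomology K G n\<^esub> \<longleftrightarrow>
    (\<exists>u\<in>carrier (cochains K G (n - 1)). \<forall>c\<in>carrier (cgrp K n). f c = u (bd K n c))"
proof -
  have "u (bd K n c) \<otimes>\<^bsub>G\<^esub> \<one>\<^bsub>G\<^esub> = u (bd K n c)"
    if "u \<in> carrier (cochains K G (n - 1))" "c \<in> carrier (cgrp K n)" for u c
    using cochain_in[OF that(1) bd_in[OF that(2)]] by simp
  then show ?thesis
    unfolding cclass_one[symmetric] cclass_eq_iff[OF f one_cocycle] by simp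
qed

lemma (in cochain_cplx) cclass_self: "f \<in> cocycles K G n \<Longrightarrow> f \<in> cclass K G n f"
  using group.rcos_self[OF comm_group.axioms(2)[OF comm_group_cocycles] _ coboundaries_subgroup, of f n]
  by (simp add: cclass_eq_coset)

lemma (in cochain_cplx) cclass_memD:
  assumes f: "f \<in> cocycles K G n" and g: "g \<in> cclass K G n f"
  shows "g \<in> cocycles K G n" and "cclass K G n g = cclass K G n f"
proof -
  interpret Z: comm_group "Z n"
    by (rule comm_group_cocycles)
  show "g \<in> cocycles K G n"
    using Z.r_coset_subset_G[OF subgroup.subset[OF coboundaries_subgroup], of f] f g
    by (auto simp: cclass_eq_coset)
  show "cclass K G n g = cclass K G n f"
    using Z.repr_independence[OF _ _ coboundaries_subgroup, of g f] f g by (simp add: cclass_eq_coset)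
qed

text \<open>Maps on cohomology are defined by applying \<open>F\<close> to all representatives at
  once; independence of the representative makes the image a singleton.\<close>

lemma (in cochain_cplx) the_elem_cclass:
  assumes f: "f \<in> cocycles K G n"
    and F: "\<And>g. \<lbrakk>g \<in> cocycles K G n; cclass K G n g = cclass K G n f\<rbrakk> \<Longrightarrow> F g = F f"
  shows "the_elem (F ` cclass K G n f) = F f"
proof -
  have F': "F g = F f" if "g \<in> cclass K G n f" for g
    by (rule F[OF cclass_memD[OF f that]])
  have "F ` cclass K G n f = {F f}"
  proof (rule equalityI)
    show "F ` cclass K G n f \<subseteq> {F f}"
      by (rule image_subsetI) (simp add: F')
    show "{F f} \<subseteq> F ` cclass K G n f"
      using imageI[OF cclass_self[OF f], of F] by simp
  qed
  then show ?thesis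
    by simp
qed

lemma (in cochain_cplx) cohomology_homI:
  assumes F: "\<And>f. f \<in> cocycles K G n \<Longrightarrow> F (cclass K G n f) = F' f"
    and closed: "\<And>f. f \<in> cocycles K G n \<Longrightarrow> F' f \<in> carrier H"
    and mult: "\<And>f g. \<lbrakk>f \<in> cocycles K G n; g \<in> cocycles K G n\<rbrakk>
      \<Longrightarrow> F' (f \<otimes>\<^bsub>cochains K G n\<^esub> g) = F' f \<otimes>\<^bsub>H\<^esub> F' g"
  shows "F \<in> hom (cohomology K G n) H"
proof (rule homI)
  show "F \<alpha> \<in> carrier H" if "\<alpha> \<in> carrier (cohomology K G n)" for \<alpha>
    using that F closed by (auto simp: carrier_cohomology)
  fix \<alpha> \<beta> assume "\<alpha> \<in> carrier (cohomology K G n)" "\<beta> \<in> carrier (cohomology K G n)"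
  then obtain f g where f: "f \<in> cocycles K G n" "\<alpha> = cclass K G n f" and g: "g \<in> cocycles K G n" "\<beta> = cclass K G n g"
    by (auto simp: carrier_cohomology)
  have "f \<otimes>\<^bsub>cochains K G n\<^esub> g \<in> cocycles K G n"
    by (rule subgroup.m_closed[OF cocycles_subgroup f(1) g(1)])
  then show "F (\<alpha> \<otimes>\<^bsub>cohomology K G n\<^esub> \<beta>) = F \<alpha> \<otimes>\<^bsub>H\<^esub> F \<beta>"
    using f g by (simp add: cclass_mult F mult)
qed

text \<open>A chain map \<open>\<theta>\<close> from degree \<open>n\<close> of \<open>K\<close> to degree \<open>m\<close> of \<open>L\<close>; the maps \<open>\<theta>'\<close> and \<open>\<theta>''\<close> are
  its components in the adjacent degrees, up to sign.\<close>

locale chain_map_at = K: cochain_cplx K G + L: cochain_cplx L G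
  for K :: "'c cplx" and L :: "'d cplx" and G :: "'g monoid" +
  fixes n m :: int and \<theta> \<theta>' \<theta>'' :: "'c \<Rightarrow> 'd"
  assumes \<theta>: "\<theta> \<in> hom (cgrp K n) (cgrp L m)"
    and \<theta>': "\<theta>' \<in> hom (cgrp K (n - 1)) (cgrp L (m - 1))"
    and bd_\<theta>: "c \<in> carrier (cgrp K n) \<Longrightarrow> bd L m (\<theta> c) = \<theta>' (bd K n c)"
    and \<theta>'': "c \<in> carrier (cgrp K (n + 1)) \<Longrightarrow> \<theta>'' c \<in> carrier (cgrp L (m + 1))"
    and bd_\<theta>'': "c \<in> carrier (cgrp K (n + 1)) \<Longrightarrow> \<theta> (bd K (n + 1) c) = bd L (m + 1) (\<theta>'' c)"

lemma (in chain_map_at) pull_cocycle: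
  assumes f: "f \<in> cocycles L G m"
  shows "(\<lambda>c\<in>carrier (cgrp K n). f (\<theta> c)) \<in> cocycles K G n"
proof -
  have "f \<circ> \<theta> \<in> hom (cgrp K n) G"
    by (rule hom_compose[OF \<theta> L.cocycleD(2)[OF f]])
  then have "(\<lambda>c\<in>carrier (cgrp K n). f (\<theta> c)) \<in> carrier (cochains K G n)"
    using K.cochain_restrict[of "f \<circ> \<theta>" n] by simp
  moreover have "f (\<theta> (bd K (n + 1) c)) = \<one>\<^bsub>G\<^esub>" if "c \<in> carrier (cgrp K (n + 1))" for c
    unfolding bd_\<theta>''[OF that] by (rule L.cocycleD(5)[OF f \<theta>''[OF that]])
  ultimately show ?thesis
    using K.bd_in_Suc by (simp add: K.cocycle_iff)
qed

text \<open>The coboundary of \<open>u\<close> pulls back to the coboundary of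
  \<open>u \<circ> \<theta>'\<close>, so the class does not depend on the representative.\<close>

lemma (in chain_map_at) coh_pull_cclass:
  assumes f: "f \<in> cocycles L G m"
  shows "coh_pull K G n \<theta> (cclass L G m f) = cclass K G n (\<lambda>c\<in>carrier (cgrp K n). f (\<theta> c))"
  unfolding coh_pull_def
proof (rule L.the_elem_cclass[OF f])
  fix g assume g: "g \<in> cocycles L G m" "cclass L G m g = cclass L G m f"
  then obtain u where u: "u \<in> carrier (cochains L G (m - 1))"
    "\<And>c. c \<in> carrier (cgrp L m) \<Longrightarrow> g c = u (bd L m c) \<otimes>\<^bsub>G\<^esub> f c"
    unfolding L.cclass_eq_iff[OF g(1) f] by blast
  have "u \<circ> \<theta>' \<in> hom (cgrp K (n - 1)) G"
    using u(1) by (intro hom_compose[OF \<theta>']) (simp add: cochains_carrier_iff)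
  then have v: "(\<lambda>c\<in>carrier (cgrp K (n - 1)). (u \<circ> \<theta>') c) \<in> carrier (cochains K G (n - 1))"
    by (rule K.cochain_restrict)
  have "(\<lambda>c\<in>carrier (cgrp K n). g (\<theta> c)) c =
      (\<lambda>c\<in>carrier (cgrp K (n - 1)). (u \<circ> \<theta>') c) (bd K n c) \<otimes>\<^bsub>G\<^esub> (\<lambda>c\<in>carrier (cgrp K n). f (\<theta> c)) c"
    if c: "c \<in> carrier (cgrp K n)" for c
    using c K.bd_in[OF c] u(2)[OF hom_in_carrier[OF \<theta> c]] bd_\<theta>[OF c] by simp
  with v show "cclass K G n (\<lambda>c\<in>carrier (cgrp K n). g (\<theta> c)) = cclass K G n (\<lambda>c\<in>carrier (cgrp K n). f (\<theta> c))"
    unfolding K.cclass_eq_iff[OF pull_cocycle[OF g(1)] pull_cocycle[OF f]] by (intro bexI ballI)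
qed

lemma (in chain_map_at) coh_pull_hom: "coh_pull K G n \<theta> \<in> hom (cohomology L G m) (cohomology K G n)"
proof (rule L.cohomology_homI[where F' = "\<lambda>f. cclass K G n (\<lambda>c\<in>carrier (cgrp K n). f (\<theta> c))"])
  show "coh_pull K G n \<theta> (cclass L G m f) = cclass K G n (\<lambda>c\<in>carrier (cgrp K n). f (\<theta> c))"
    if "f \<in> cocycles L G m" for f
    by (rule coh_pull_cclass[OF that])
  show "cclass K G n (\<lambda>c\<in>carrier (cgrp K n). f (\<theta> c)) \<in> carrier (cohomology K G n)"
    if "f \<in> cocycles L G m" for f
    by (rule K.cclass_in[OF pull_cocycle[OF that]])
  fix f g assume f: "f \<in> cocycles L G m" and g: "g \<in> cocycles L G m"
  have "(\<lambda>c\<in>carrier (cgrp K n). (f \<otimes>\<^bsub>cochains L G m\<^esub> g) (\<theta> c)) =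
      (\<lambda>c\<in>carrier (cgrp K n). f (\<theta> c)) \<otimes>\<^bsub>cochains K G n\<^esub> (\<lambda>c\<in>carrier (cgrp K n). g (\<theta> c))"
    using hom_in_carrier[OF \<theta>] by (auto simp: cochains_mult)
  then show "cclass K G n (\<lambda>c\<in>carrier (cgrp K n). (f \<otimes>\<^bsub>cochains L G m\<^esub> g) (\<theta> c)) =
      cclass K G n (\<lambda>c\<in>carrier (cgrp K n). f (\<theta> c)) \<otimes>\<^bsub>cohomology K G n\<^esub>
      cclass K G n (\<lambda>c\<in>carrier (cgrp K n). g (\<theta> c))"
    by (simp add: K.cclass_mult[OF pull_cocycle[OF f] pull_cocycle[OF g]])
qed

section \<open>The mapping cone sequence\<close>

lemma mult_smooth_cplx [simp]: "c \<otimes>\<^bsub>cgrp (smooth_cplx X) n\<^esub> d = c + d"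
  and one_smooth_cplx [simp]: "\<one>\<^bsub>cgrp (smooth_cplx X) n\<^esub> = 0"
  by (simp_all add: cgrp_smooth_cplx)

lemma inv_smooth_cplx: "c \<in> carrier (cgrp (smooth_cplx X) n) \<Longrightarrow> inv\<^bsub>cgrp (smooth_cplx X) n\<^esub> c = - c"
  unfolding cgrp_smooth_cplx by (rule inv_free_Abelian_group) (simp only: carrier_free_Abelian_group_iff)

lemma zero_smooth_cplx [simp]: "0 \<in> carrier (cgrp (smooth_cplx X) n)"
  by (simp add: carrier_smooth_cplx)

lemma comm_group_smooth_cplx: "comm_group (cgrp (smooth_cplx X) n)"
  unfolding cgrp_smooth_cplx by (rule abelian_free_Abelian_group)

lemma group_smooth_cplx: "group (cgrp (smooth_cplx X) n)"
  by (rule comm_group.axioms(2)[OF comm_group_smooth_cplx])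

lemma add_smooth_cplx:
  "\<lbrakk>c \<in> carrier (cgrp (smooth_cplx X) n); d \<in> carrier (cgrp (smooth_cplx X) n)\<rbrakk>
     \<Longrightarrow> c + d \<in> carrier (cgrp (smooth_cplx X) n)"
  using group.is_monoid[OF group_smooth_cplx, THEN monoid.m_closed] by fastforce

lemma uminus_smooth_cplx:
  "c \<in> carrier (cgrp (smooth_cplx X) n) \<Longrightarrow> - c \<in> carrier (cgrp (smooth_cplx X) n)"
  by (simp add: carrier_smooth_cplx)

lemma chain_cplx_smooth: "chain_cplx (smooth_cplx X)"
proof (rule chain_cplx.intro)
  show "comm_group (cgrp (smooth_cplx X) n)" for n
    by (rule comm_group_smooth_cplx)
  show "bd (smooth_cplx X) n \<in> hom (cgrp (smooth_cplx X) n) (cgrp (smooth_cplx X) (n - 1))" for n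
    by (intro homI) (simp_all add: bd_smooth_cplx chain_boundary_smooth chain_boundary_add)
  show "bd (smooth_cplx X) (n - 1) (bd (smooth_cplx X) n c) = \<one>\<^bsub>cgrp (smooth_cplx X) (n - 1 - 1)\<^esub>"
    if "c \<in> carrier (cgrp (smooth_cplx X) n)" for c n
    by (simp add: bd_smooth_cplx chain_boundary_boundary_smooth[OF that])
qed

lemma carrier_mapping_cone:
  "carrier (cgrp (mapping_cone \<phi> X A) n) =
     carrier (cgrp (smooth_cplx X) n) \<times> carrier (cgrp (smooth_cplx A) (n - 1))"
  by (simp add: mapping_cone_def)

lemma mult_mapping_cone [simp]:
  "(s, t) \<otimes>\<^bsub>cgrp (mapping_cone \<phi> X A) n\<^esub> (s', t') = (s + s', t + t')"
  and one_mapping_cone [simp]: "\<one>\<^bsub>cgrp (mapping_cone \<phi> X A) n\<^esub> = (0, 0)"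
  by (simp_all add: mapping_cone_def)

lemma bd_mapping_cone:
  "bd (mapping_cone \<phi> X A) n (s, t) =
     (bd (smooth_cplx X) n s + chain_map (nat (n - 1)) \<phi> t, - bd (smooth_cplx A) (n - 1) t)"
  by (simp add: mapping_cone_def)

lemma hom_smooth_cplx:
  assumes f: "f \<in> hom (cgrp (smooth_cplx X) n) G" and G: "group G"
  shows "\<lbrakk>c \<in> carrier (cgrp (smooth_cplx X) n); d \<in> carrier (cgrp (smooth_cplx X) n)\<rbrakk>
      \<Longrightarrow> f (c + d) = f c \<otimes>\<^bsub>G\<^esub> f d"
    and "f 0 = \<one>\<^bsub>G\<^esub>"
    and "c \<in> carrier (cgrp (smooth_cplx X) n) \<Longrightarrow> f (- c) = inv\<^bsub>G\<^esub> f c"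
    and "c \<in> carrier (cgrp (smooth_cplx X) n) \<Longrightarrow> f c \<in> carrier G"
proof -
  interpret f: group_hom "cgrp (smooth_cplx X) n" G f
    using f G group_smooth_cplx by (simp add: group_hom_def group_hom_axioms_def)
  show "\<lbrakk>c \<in> carrier (cgrp (smooth_cplx X) n); d \<in> carrier (cgrp (smooth_cplx X) n)\<rbrakk>
      \<Longrightarrow> f (c + d) = f c \<otimes>\<^bsub>G\<^esub> f d"
    using f.hom_mult by simp
  show "f 0 = \<one>\<^bsub>G\<^esub>"
    using f.hom_one by simp
  show "c \<in> carrier (cgrp (smooth_cplx X) n) \<Longrightarrow> f (- c) = inv\<^bsub>G\<^esub> f c"
    using f.hom_inv[of c] by (simp add: inv_smooth_cplx)
  show "c \<in> carrier (cgrp (smooth_cplx X) n) \<Longrightarrow> f c \<in> carrier G"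
    by (rule f.hom_closed)
qed

locale smooth_mapping =
  fixes X :: "'a dspace" and A :: "'b dspace" and \<phi> :: "'b \<Rightarrow> 'a"
  assumes X: "differential_space X" and A: "differential_space A" and \<phi>: "smooth_map A X \<phi>"
begin

abbreviation "CX n \<equiv> carrier (cgrp (smooth_cplx X) n)"
abbreviation "CA n \<equiv> carrier (cgrp (smooth_cplx A) n)"
abbreviation "dX \<equiv> bd (smooth_cplx X)"
abbreviation "dA \<equiv> bd (smooth_cplx A)"
abbreviation "ps n \<equiv> chain_map (nat n) \<phi>"
abbreviation "mcone \<equiv> mapping_cone \<phi> X A"

end

lemma (in smooth_mapping) ps_in: "t \<in> CA n \<Longrightarrow> ps n t \<in> CX n"
  by (rule chain_map_smooth[OF A X \<phi>])

lemma (in smooth_mapping) ps_add: "ps n (t + t') = ps n t + ps n t'"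
  by (rule chain_map_add)

lemma (in smooth_mapping) ps_uminus: "ps n (- t) = - ps n t"
  by (rule chain_map_minus)

lemma (in smooth_mapping) dX_ps: "t \<in> CA n \<Longrightarrow> dX n (ps n t) = ps (n - 1) (dA n t)"
  unfolding bd_smooth_cplx by (rule chain_boundary_chain_map_smooth)

lemma (in smooth_mapping) ps_hom: "ps n \<in> hom (cgrp (smooth_cplx A) n) (cgrp (smooth_cplx X) n)"
  by (intro homI) (simp_all add: ps_in ps_add)

lemma d_smooth:
  shows d_smooth_add: "bd (smooth_cplx X) n (s + s') = bd (smooth_cplx X) n s + bd (smooth_cplx X) n s'"
    and d_smooth_uminus: "bd (smooth_cplx X) n (- s) = - bd (smooth_cplx X) n s"
    and d_smooth_0 [simp]: "bd (smooth_cplx X) n 0 = 0"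
    and d_smooth_in: "s \<in> carrier (cgrp (smooth_cplx X) n) \<Longrightarrow> bd (smooth_cplx X) n s \<in> carrier (cgrp (smooth_cplx X) (n - 1))"
    and d_smooth_d: "s \<in> carrier (cgrp (smooth_cplx X) n) \<Longrightarrow> bd (smooth_cplx X) (n - 1) (bd (smooth_cplx X) n s) = 0"
  by (simp_all add: bd_smooth_cplx chain_boundary_add chain_boundary_minus chain_boundary_smooth
      chain_boundary_boundary_smooth)

text \<open>In the square of the boundary, the image under \<phi> of the boundary of
  \<open>t\<close> occurs twice; the minus sign in the second component makes the two
  cancel.\<close>

lemma (in smooth_mapping) chain_cplx_cone: "chain_cplx mcone"
proof (rule chain_cplx.intro)
  show "comm_group (cgrp mcone n)" for n
    unfolding mapping_cone_def cplx.simps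
    by (rule group.group_comm_groupI[OF DirProd_group[OF group_smooth_cplx group_smooth_cplx]])
      (auto simp: add.commute)
  show "bd mcone n \<in> hom (cgrp mcone n) (cgrp mcone (n - 1))" for n
  proof (rule homI)
    fix c assume c: "c \<in> carrier (cgrp mcone n)"
    obtain s t where st: "c = (s, t)"
      by (cases c)
    have s: "s \<in> CX n" and t: "t \<in> CA (n - 1)"
      using c st by (simp_all add: carrier_mapping_cone)
    show "bd mcone n c \<in> carrier (cgrp mcone (n - 1))"
      using add_smooth_cplx[OF d_smooth_in[OF s] ps_in[OF t]] uminus_smooth_cplx[OF d_smooth_in[OF t]]
      by (simp add: st carrier_mapping_cone bd_mapping_cone)
  next
    fix c c' assume "c \<in> carrier (cgrp mcone n)" "c' \<in> carrier (cgrp mcone n)"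
    then show "bd mcone n (c \<otimes>\<^bsub>cgrp mcone n\<^esub> c') = bd mcone n c \<otimes>\<^bsub>cgrp mcone (n - 1)\<^esub> bd mcone n c'"
      by (cases c; cases c') (simp add: bd_mapping_cone d_smooth_add ps_add algebra_simps)
  qed
  show "bd mcone (n - 1) (bd mcone n c) = \<one>\<^bsub>cgrp mcone (n - 1 - 1)\<^esub>" if "c \<in> carrier (cgrp mcone n)" for c n
  proof (cases c)
    case (Pair s t)
    then have "s \<in> CX n" "t \<in> CA (n - 1)"
      using that by (simp_all add: carrier_mapping_cone)
    then show ?thesis
      using Pair d_smooth_d[of t A "n - 1"]
      by (simp add: bd_mapping_cone d_smooth_add d_smooth_uminus d_smooth_d ps_uminus dX_ps)
  qed
qed

lemma exact_atI:
  assumes G: "comm_group G" and H: "comm_group H" and K: "comm_group K" and f: "f \<in> hom G H" and g: "g \<in> hom H K"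
    and le: "\<And>a. a \<in> carrier G \<Longrightarrow> g (f a) = \<one>\<^bsub>K\<^esub>"
    and ge: "\<And>b. \<lbrakk>b \<in> carrier H; g b = \<one>\<^bsub>K\<^esub>\<rbrakk> \<Longrightarrow> \<exists>a\<in>carrier G. f a = b"
  shows "exact_at G f H g K"
proof -
  have "f ` carrier G = kernel H K g"
  proof (rule equalityI)
    show "f ` carrier G \<subseteq> kernel H K g"
      by (rule image_subsetI) (simp add: kernel_def le hom_in_carrier[OF f])
    show "kernel H K g \<subseteq> f ` carrier G"
    proof
      fix b assume "b \<in> kernel H K g"
      then show "b \<in> f ` carrier G"
        using ge[of b] by (auto simp: kernel_def)
    qed
  qed
  then show ?thesis
    using assms(1-5) by (simp only: exact_at_def simp_thms)
qed

locale smooth_mapping_coeff = smooth_mapping X A \<phi> + G: comm_group G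
  for X :: "'a dspace" and A :: "'b dspace" and \<phi> :: "'b \<Rightarrow> 'a" and G :: "'g monoid"

sublocale smooth_mapping_coeff \<subseteq> KX: cochain_cplx "smooth_cplx X" G
  by (simp add: cochain_cplx_def chain_cplx_smooth G.comm_group_axioms)

sublocale smooth_mapping_coeff \<subseteq> KA: cochain_cplx "smooth_cplx A" G
  by (simp add: cochain_cplx_def chain_cplx_smooth G.comm_group_axioms)

sublocale smooth_mapping_coeff \<subseteq> KC: cochain_cplx mcone G
  by (simp add: cochain_cplx_def chain_cplx_cone G.comm_group_axioms)

text \<open>The projection to chains of A commutes with the boundaries up to a sign, which is
  absorbed by the maps in the adjacent degrees.\<close>

lemma (in smooth_mapping_coeff) incl_chain_map:
  "chain_map_at mcone (smooth_cplx A) G n (n - 1) snd (\<lambda>c. - snd c) (\<lambda>c. - snd c)"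
proof (intro chain_map_at.intro chain_map_at_axioms.intro)
  show "snd \<in> hom (cgrp mcone n) (cgrp (smooth_cplx A) (n - 1))"
    by (intro homI) (auto simp: carrier_mapping_cone)
  show "(\<lambda>c. - snd c) \<in> hom (cgrp mcone (n - 1)) (cgrp (smooth_cplx A) (n - 1 - 1))"
    by (intro homI) (auto simp: carrier_mapping_cone uminus_smooth_cplx)
  show "dA (n - 1) (snd c) = - snd (bd mcone n c)" for c
    by (cases c) (simp add: bd_mapping_cone)
  show "- snd c \<in> CA (n - 1 + 1)" if "c \<in> carrier (cgrp mcone (n + 1))" for c
    using that by (cases c) (simp add: carrier_mapping_cone uminus_smooth_cplx)
  show "snd (bd mcone (n + 1) c) = dA (n - 1 + 1) (- snd c)" for c
    by (cases c) (simp add: bd_mapping_cone d_smooth_uminus)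
qed (fact KC.cochain_cplx_axioms KA.cochain_cplx_axioms)+

lemma (in smooth_mapping_coeff) restr_chain_map:
  "chain_map_at (smooth_cplx X) mcone G n n (\<lambda>s. (s, 0)) (\<lambda>s. (s, 0)) (\<lambda>s. (s, 0))"
proof (intro chain_map_at.intro chain_map_at_axioms.intro)
  have *: "(\<lambda>s. (s, 0)) \<in> hom (cgrp (smooth_cplx X) n) (cgrp mcone n)" for n
    by (intro homI) (auto simp: carrier_mapping_cone)
  show "(\<lambda>s. (s, 0)) \<in> hom (cgrp (smooth_cplx X) n) (cgrp mcone n)"
    "(\<lambda>s. (s, 0)) \<in> hom (cgrp (smooth_cplx X) (n - 1)) (cgrp mcone (n - 1))"
    by (rule *)+
qed (auto simp: bd_mapping_cone carrier_mapping_cone intro: KC.cochain_cplx_axioms KX.cochain_cplx_axioms)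

lemma (in smooth_mapping_coeff) pull_chain_map:
  "chain_map_at (smooth_cplx A) (smooth_cplx X) G n n (ps n) (ps (n - 1)) (ps (n + 1))"
proof (intro chain_map_at.intro chain_map_at_axioms.intro)
  show "ps n (dA (n + 1) c) = dX (n + 1) (ps (n + 1) c)" if "c \<in> CA (n + 1)" for c
    using dX_ps[OF that] by simp
qed (simp_all add: ps_hom dX_ps ps_in KA.cochain_cplx_axioms KX.cochain_cplx_axioms)

lemma (in smooth_mapping_coeff) cone_incl_cclass:
  "f \<in> cocycles (smooth_cplx A) G (n - 1) \<Longrightarrow> cone_incl \<phi> X A G n (cclass (smooth_cplx A) G (n - 1) f) =
     cclass mcone G n (\<lambda>c\<in>carrier (cgrp mcone n). f (snd c))"
  unfolding cone_incl_def by (rule chain_map_at.coh_pull_cclass[OF incl_chain_map])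

lemma (in smooth_mapping_coeff) cone_restr_cclass:
  "f \<in> cocycles mcone G n \<Longrightarrow> cone_restr X G n (cclass mcone G n f) =
     cclass (smooth_cplx X) G n (\<lambda>s\<in>CX n. f (s, 0))"
  unfolding cone_restr_def by (rule chain_map_at.coh_pull_cclass[OF restr_chain_map])

lemma (in smooth_mapping_coeff) space_pull_cclass:
  "f \<in> cocycles (smooth_cplx X) G n \<Longrightarrow> space_pull \<phi> A G n (cclass (smooth_cplx X) G n f) =
     cclass (smooth_cplx A) G n (\<lambda>t\<in>CA n. f (ps n t))"
  unfolding space_pull_def by (rule chain_map_at.coh_pull_cclass[OF pull_chain_map])

lemmas (in smooth_mapping_coeff) incl_cocycle = chain_map_at.pull_cocycle[OF incl_chain_map]
lemmas (in smooth_mapping_coeff) restr_cocycle = chain_map_at.pull_cocycle[OF restr_chain_map]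
lemmas (in smooth_mapping_coeff) pull_cocycle = chain_map_at.pull_cocycle[OF pull_chain_map]

lemma (in smooth_mapping_coeff) cone_incl_hom:
  "cone_incl \<phi> X A G n \<in> hom (H_smooth A G (n - 1)) (H_rel \<phi> X A G n)"
  unfolding cone_incl_def by (rule chain_map_at.coh_pull_hom[OF incl_chain_map])

lemma (in smooth_mapping_coeff) cone_restr_hom:
  "cone_restr X G n \<in> hom (H_rel \<phi> X A G n) (H_smooth X G n)"
  unfolding cone_restr_def by (rule chain_map_at.coh_pull_hom[OF restr_chain_map])

lemma (in smooth_mapping_coeff) space_pull_hom:
  "space_pull \<phi> A G n \<in> hom (H_smooth X G n) (H_smooth A G n)"
  unfolding space_pull_def by (rule chain_map_at.coh_pull_hom[OF pull_chain_map])

lemma (in smooth_mapping_coeff) cone_cochain: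
  assumes f: "f \<in> hom (cgrp mcone n) G"
  shows cone_cochain_split: "\<lbrakk>s \<in> CX n; t \<in> CA (n - 1)\<rbrakk> \<Longrightarrow> f (s, t) = f (s, 0) \<otimes>\<^bsub>G\<^esub> f (0, t)"
    and cone_cochain_fst: "(\<lambda>s. f (s, 0)) \<in> hom (cgrp (smooth_cplx X) n) G"
    and cone_cochain_snd: "(\<lambda>t. f (0, t)) \<in> hom (cgrp (smooth_cplx A) (n - 1)) G"
proof -
  have mult: "f (s + s', t + t') = f (s, t) \<otimes>\<^bsub>G\<^esub> f (s', t')"
    if "s \<in> CX n" "t \<in> CA (n - 1)" "s' \<in> CX n" "t' \<in> CA (n - 1)" for s t s' t'
    using hom_mult[OF f, of "(s, t)" "(s', t')"] that by (simp add: carrier_mapping_cone)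
  have closed: "f (s, t) \<in> carrier G" if "s \<in> CX n" "t \<in> CA (n - 1)" for s t
    using hom_in_carrier[OF f, of "(s, t)"] that by (simp add: carrier_mapping_cone)
  show "f (s, t) = f (s, 0) \<otimes>\<^bsub>G\<^esub> f (0, t)" if "s \<in> CX n" "t \<in> CA (n - 1)"
    using mult[OF that(1) zero_smooth_cplx zero_smooth_cplx that(2)] by simp
  show "(\<lambda>s. f (s, 0)) \<in> hom (cgrp (smooth_cplx X) n) G"
  proof (rule homI)
    show "f (x \<otimes>\<^bsub>cgrp (smooth_cplx X) n\<^esub> y, 0) = f (x, 0) \<otimes>\<^bsub>G\<^esub> f (y, 0)" if "x \<in> CX n" "y \<in> CX n" for x y
      using mult[OF that(1) zero_smooth_cplx that(2) zero_smooth_cplx] by simp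
  qed (simp add: closed)
  show "(\<lambda>t. f (0, t)) \<in> hom (cgrp (smooth_cplx A) (n - 1)) G"
  proof (rule homI)
    show "f (0, x \<otimes>\<^bsub>cgrp (smooth_cplx A) (n - 1)\<^esub> y) = f (0, x) \<otimes>\<^bsub>G\<^esub> f (0, y)"
      if "x \<in> CA (n - 1)" "y \<in> CA (n - 1)" for x y
      using mult[OF zero_smooth_cplx that(1) zero_smooth_cplx that(2)] by simp
  qed (simp add: closed)
qed

text \<open>The cocycle condition on the cone boundary of \<open>(0, t)\<close>: the restriction of
  \<open>f\<close> to X becomes a coboundary on A, with \<open>\<lambda>t. f (0, t)\<close> as
  primitive.\<close>

lemma (in smooth_mapping_coeff) cone_cocycle_boundary:
  assumes f: "f \<in> cocycles mcone G n" and t: "t \<in> CA n"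
  shows "f (ps n t, 0) = f (0, dA n t)"
proof -
  note snd_hom = hom_smooth_cplx[OF cone_cochain_snd[OF KC.cocycleD(2)[OF f]] G.is_group]
  note fst_hom = hom_smooth_cplx[OF cone_cochain_fst[OF KC.cocycleD(2)[OF f]] G.is_group]
  have dt: "dA n t \<in> CA (n - 1)"
    by (rule d_smooth_in[OF t])
  have "f (bd mcone (n + 1) (0, t)) = \<one>\<^bsub>G\<^esub>"
    using t by (intro KC.cocycleD(5)[OF f]) (simp add: carrier_mapping_cone)
  then have "f (ps n t, - dA n t) = \<one>\<^bsub>G\<^esub>"
    by (simp add: bd_mapping_cone)
  then have "f (ps n t, 0) \<otimes>\<^bsub>G\<^esub> f (0, - dA n t) = \<one>\<^bsub>G\<^esub>"
    using cone_cochain_split[OF KC.cocycleD(2)[OF f] ps_in[OF t] uminus_smooth_cplx[OF dt]] by simp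
  then have "f (ps n t, 0) \<otimes>\<^bsub>G\<^esub> inv\<^bsub>G\<^esub> f (0, dA n t) = \<one>\<^bsub>G\<^esub>"
    by (simp only: snd_hom(3)[OF dt])
  then show ?thesis
    using G.inv_equality[of "f (ps n t, 0)" "inv\<^bsub>G\<^esub> f (0, dA n t)"]
      fst_hom(4)[OF ps_in[OF t]] snd_hom(4)[OF dt] by simp
qed

lemma (in smooth_mapping_coeff) cone_exact_rel:
  "exact_at (H_smooth A G (n - 1)) (cone_incl \<phi> X A G n)
     (H_rel \<phi> X A G n) (cone_restr X G n) (H_smooth X G n)"
proof (rule exact_atI[OF KA.comm_group_cohomology KC.comm_group_cohomology KX.comm_group_cohomology
      cone_incl_hom cone_restr_hom])
  fix \<alpha> assume "\<alpha> \<in> carrier (H_smooth A G (n - 1))"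
  then obtain g where g: "g \<in> cocycles (smooth_cplx A) G (n - 1)" "\<alpha> = cclass (smooth_cplx A) G (n - 1) g"
    by (auto simp: KA.carrier_cohomology)
  have "g 0 = \<one>\<^bsub>G\<^esub>"
    by (rule hom_smooth_cplx(2)[OF KA.cocycleD(2)[OF g(1)] G.is_group])
  then have "(\<lambda>s\<in>CX n. (\<lambda>c\<in>carrier (cgrp mcone n). g (snd c)) (s, 0)) = (\<lambda>s\<in>CX n. \<one>\<^bsub>G\<^esub>)"
    by (intro restrict_ext) (simp add: carrier_mapping_cone)
  then show "cone_restr X G n (cone_incl \<phi> X A G n \<alpha>) = \<one>\<^bsub>H_smooth X G n\<^esub>"
    by (simp only: g(2) cone_incl_cclass[OF g(1)] cone_restr_cclass[OF incl_cocycle[OF g(1)]] KX.cclass_one)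
next
  fix \<beta> assume \<beta>: "\<beta> \<in> carrier (H_rel \<phi> X A G n)" "cone_restr X G n \<beta> = \<one>\<^bsub>H_smooth X G n\<^esub>"
  then obtain f where f: "f \<in> cocycles mcone G n" "\<beta> = cclass mcone G n f"
    by (auto simp: KC.carrier_cohomology)
  have "cclass (smooth_cplx X) G n (\<lambda>s\<in>CX n. f (s, 0)) = \<one>\<^bsub>H_smooth X G n\<^esub>"
    using \<beta>(2) by (simp only: f(2) cone_restr_cclass[OF f(1)])
  then obtain u where u: "u \<in> carrier (cochains (smooth_cplx X) G (n - 1))"
    "\<forall>s\<in>CX n. (\<lambda>s\<in>CX n. f (s, 0)) s = u (dX n s)"
    unfolding KX.cclass_eq_one_iff[OF restr_cocycle[OF f(1)]] by (elim bexE)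
  have uf: "f (s, 0) = u (dX n s)" if "s \<in> CX n" for s
    using u(2)[rule_format, OF that] that by simp
  have uh: "u \<in> hom (cgrp (smooth_cplx X) (n - 1)) G"
    using u(1) by (simp add: cochains_carrier_iff)
  note u_hom = hom_smooth_cplx[OF uh G.is_group]
  note f_snd = cone_cochain_snd[OF KC.cocycleD(2)[OF f(1)]]
  note f_hom = hom_smooth_cplx[OF f_snd G.is_group]
  \<comment> \<open>What remains of \<open>f\<close> after removing the coboundary of the cochain
    taking \<open>(s, t)\<close> to \<open>u s\<close>; this coboundary accounts for the whole first
    component.\<close>
  define g where "g = (\<lambda>t\<in>CA (n - 1). f (0, t) \<otimes>\<^bsub>G\<^esub> inv\<^bsub>G\<^esub> u (ps (n - 1) t))"
  have "(\<lambda>t. f (0, t) \<otimes>\<^bsub>G\<^esub> inv\<^bsub>G\<^esub> u (ps (n - 1) t)) \<in> hom (cgrp (smooth_cplx A) (n - 1)) G"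
    by (intro homI) (simp_all add: f_hom(1,4) u_hom(1,4) ps_in ps_add G.inv_mult G.m_ac)
  then have gc: "g \<in> carrier (cochains (smooth_cplx A) G (n - 1))"
    unfolding g_def by (rule KA.cochain_restrict)
  have g: "g \<in> cocycles (smooth_cplx A) G (n - 1)"
    unfolding KA.cocycle_iff
  proof (intro conjI gc ballI)
    fix t assume "t \<in> CA (n - 1 + 1)"
    then have t: "t \<in> CA n"
      by simp
    have "f (0, dA n t) = u (dX n (ps n t))"
      using cone_cocycle_boundary[OF f(1) t] uf[OF ps_in[OF t]] by simp
    then show "g (dA (n - 1 + 1) t) = \<one>\<^bsub>G\<^esub>"
      using d_smooth_in[OF t] dX_ps[OF t] u_hom(4)[OF ps_in[OF d_smooth_in[OF t]]]
      by (simp add: g_def)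
  qed
  have "cclass mcone G n f = cclass mcone G n (\<lambda>c\<in>carrier (cgrp mcone n). g (snd c))"
    unfolding KC.cclass_eq_iff[OF f(1) incl_cocycle[OF g]]
  proof (intro bexI ballI)
    have "(\<lambda>c. u (fst c)) \<in> hom (cgrp mcone (n - 1)) G"
      by (intro homI) (auto simp: carrier_mapping_cone u_hom(1,4))
    then show "(\<lambda>c\<in>carrier (cgrp mcone (n - 1)). u (fst c)) \<in> carrier (cochains mcone G (n - 1))"
      by (rule KC.cochain_restrict)
    fix c assume c: "c \<in> carrier (cgrp mcone n)"
    obtain s t where st: "c = (s, t)"
      by (cases c)
    have s: "s \<in> CX n" and t: "t \<in> CA (n - 1)"
      using c st by (simp_all add: carrier_mapping_cone)
    note ds = d_smooth_in[OF s] and pt = ps_in[OF t]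
    have "f c = u (dX n s) \<otimes>\<^bsub>G\<^esub> f (0, t)"
      using cone_cochain_split[OF KC.cocycleD(2)[OF f(1)] s t] uf[OF s] st by simp
    moreover have "(\<lambda>c\<in>carrier (cgrp mcone (n - 1)). u (fst c)) (bd mcone n c) = u (dX n s) \<otimes>\<^bsub>G\<^esub> u (ps (n - 1) t)"
      using KC.bd_in[OF c] u_hom(1)[OF ds pt] by (simp add: st bd_mapping_cone)
    moreover have "(\<lambda>c\<in>carrier (cgrp mcone n). g (snd c)) c = f (0, t) \<otimes>\<^bsub>G\<^esub> inv\<^bsub>G\<^esub> u (ps (n - 1) t)"
      using c t by (simp add: st g_def)
    moreover have "u (dX n s) \<otimes>\<^bsub>G\<^esub> f (0, t) =
        u (dX n s) \<otimes>\<^bsub>G\<^esub> u (ps (n - 1) t) \<otimes>\<^bsub>G\<^esub> (f (0, t) \<otimes>\<^bsub>G\<^esub> inv\<^bsub>G\<^esub> u (ps (n - 1) t))"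
    proof -
      have "u (ps (n - 1) t) \<otimes>\<^bsub>G\<^esub> (f (0, t) \<otimes>\<^bsub>G\<^esub> inv\<^bsub>G\<^esub> u (ps (n - 1) t)) = f (0, t)"
        using u_hom(4)[OF pt] f_hom(4)[OF t]
        by (simp add: G.m_assoc[symmetric] G.m_comm[of "u (ps (n - 1) t)"]) (simp add: G.m_assoc)
      then show ?thesis
        using u_hom(4)[OF pt] u_hom(4)[OF ds] f_hom(4)[OF t] by (simp add: G.m_assoc)
    qed
    ultimately show "f c = (\<lambda>c\<in>carrier (cgrp mcone (n - 1)). u (fst c)) (bd mcone n c) \<otimes>\<^bsub>G\<^esub>
        (\<lambda>c\<in>carrier (cgrp mcone n). g (snd c)) c"
      by simp
  qed
  then have "cone_incl \<phi> X A G n (cclass (smooth_cplx A) G (n - 1) g) = \<beta>"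
    by (simp only: cone_incl_cclass[OF g] f(2))
  then show "\<exists>\<alpha>\<in>carrier (H_smooth A G (n - 1)). cone_incl \<phi> X A G n \<alpha> = \<beta>"
    using KA.cclass_in[OF g] by (rule bexI)
qed

lemma (in smooth_mapping_coeff) cone_exact_X:
  "exact_at (H_rel \<phi> X A G n) (cone_restr X G n)
     (H_smooth X G n) (space_pull \<phi> A G n) (H_smooth A G n)"
proof (rule exact_atI[OF KC.comm_group_cohomology KX.comm_group_cohomology KA.comm_group_cohomology
      cone_restr_hom space_pull_hom])
  fix \<alpha> assume "\<alpha> \<in> carrier (H_rel \<phi> X A G n)"
  then obtain f where f: "f \<in> cocycles mcone G n" "\<alpha> = cclass mcone G n f"
    by (auto simp: KC.carrier_cohomology)
  note r = restr_cocycle[OF f(1)]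
  have "cclass (smooth_cplx A) G n (\<lambda>t\<in>CA n. (\<lambda>s\<in>CX n. f (s, 0)) (ps n t)) = \<one>\<^bsub>H_smooth A G n\<^esub>"
    unfolding KA.cclass_eq_one_iff[OF pull_cocycle[OF r]]
  proof (intro bexI ballI)
    show "(\<lambda>t\<in>CA (n - 1). f (0, t)) \<in> carrier (cochains (smooth_cplx A) G (n - 1))"
      by (rule KA.cochain_restrict[OF cone_cochain_snd[OF KC.cocycleD(2)[OF f(1)]]])
    show "(\<lambda>t\<in>CA n. (\<lambda>s\<in>CX n. f (s, 0)) (ps n t)) t = (\<lambda>t\<in>CA (n - 1). f (0, t)) (dA n t)" if t: "t \<in> CA n" for t
      using cone_cocycle_boundary[OF f(1) t] t ps_in[OF t] d_smooth_in[OF t] by simp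
  qed
  then show "space_pull \<phi> A G n (cone_restr X G n \<alpha>) = \<one>\<^bsub>H_smooth A G n\<^esub>"
    by (simp only: f(2) cone_restr_cclass[OF f(1)] space_pull_cclass[OF r])
next
  fix \<beta> assume \<beta>: "\<beta> \<in> carrier (H_smooth X G n)" "space_pull \<phi> A G n \<beta> = \<one>\<^bsub>H_smooth A G n\<^esub>"
  then obtain u where u: "u \<in> cocycles (smooth_cplx X) G n" "\<beta> = cclass (smooth_cplx X) G n u"
    by (auto simp: KX.carrier_cohomology)
  have "cclass (smooth_cplx A) G n (\<lambda>t\<in>CA n. u (ps n t)) = \<one>\<^bsub>H_smooth A G n\<^esub>"
    using \<beta>(2) by (simp only: u(2) space_pull_cclass[OF u(1)])
  then obtain v where v: "v \<in> carrier (cochains (smooth_cplx A) G (n - 1))"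
    "\<forall>t\<in>CA n. (\<lambda>t\<in>CA n. u (ps n t)) t = v (dA n t)"
    unfolding KA.cclass_eq_one_iff[OF pull_cocycle[OF u(1)]] by (elim bexE)
  have uv: "u (ps n t) = v (dA n t)" if "t \<in> CA n" for t
    using v(2)[rule_format, OF that] that by simp
  have vh: "v \<in> hom (cgrp (smooth_cplx A) (n - 1)) G"
    using v(1) by (simp add: cochains_carrier_iff)
  note v_hom = hom_smooth_cplx[OF vh G.is_group]
  note u_hom = hom_smooth_cplx[OF KX.cocycleD(2)[OF u(1)] G.is_group]
  \<comment> \<open>A cone cocycle is a cocycle on X together with a primitive of its pullback to
    A.\<close>
  define f where "f = (\<lambda>c\<in>carrier (cgrp mcone n). u (fst c) \<otimes>\<^bsub>G\<^esub> v (snd c))"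
  have "(\<lambda>c. u (fst c) \<otimes>\<^bsub>G\<^esub> v (snd c)) \<in> hom (cgrp mcone n) G"
    by (intro homI) (auto simp: carrier_mapping_cone u_hom(1,4) v_hom(1,4) G.m_ac)
  then have fc: "f \<in> carrier (cochains mcone G n)"
    unfolding f_def by (rule KC.cochain_restrict)
  have f: "f \<in> cocycles mcone G n"
    unfolding KC.cocycle_iff
  proof (intro conjI fc ballI)
    fix c assume c: "c \<in> carrier (cgrp mcone (n + 1))"
    obtain s t where st: "c = (s, t)"
      by (cases c)
    have s: "s \<in> CX (n + 1)" and t: "t \<in> CA n"
      using c st by (simp_all add: carrier_mapping_cone)
    have ds: "dX (n + 1) s \<in> CX n"
      using d_smooth_in[OF s] by simp
    note pt = ps_in[OF t] and dt = d_smooth_in[OF t]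
    have "f (bd mcone (n + 1) c) = u (dX (n + 1) s + ps n t) \<otimes>\<^bsub>G\<^esub> v (- dA n t)"
      using KC.bd_in_Suc[OF c] by (simp add: f_def st bd_mapping_cone)
    also have "\<dots> = u (ps n t) \<otimes>\<^bsub>G\<^esub> inv\<^bsub>G\<^esub> v (dA n t)"
      using u_hom(1)[OF ds pt] KX.cocycleD(5)[OF u(1) s] u_hom(4)[OF pt] v_hom(3)[OF dt] by simp
    also have "\<dots> = \<one>\<^bsub>G\<^esub>"
      using uv[OF t] v_hom(4)[OF dt] by simp
    finally show "f (bd mcone (n + 1) c) = \<one>\<^bsub>G\<^esub>" .
  qed
  have "(\<lambda>s\<in>CX n. f (s, 0)) = u"
  proof (rule extensionalityI[OF restrict_extensional KX.cocycleD(3)[OF u(1)]])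
    fix s assume s: "s \<in> CX n"
    then show "(\<lambda>s\<in>CX n. f (s, 0)) s = u s"
      using u_hom(4)[OF s] v_hom(2) by (simp add: f_def carrier_mapping_cone)
  qed
  then have "cone_restr X G n (cclass mcone G n f) = \<beta>"
    by (simp only: cone_restr_cclass[OF f] u(2))
  then show "\<exists>\<alpha>\<in>carrier (H_rel \<phi> X A G n). cone_restr X G n \<alpha> = \<beta>"
    using KC.cclass_in[OF f] by (rule bexI)
qed

lemma (in smooth_mapping_coeff) cone_exact_A:
  "exact_at (H_smooth X G n) (space_pull \<phi> A G n)
     (H_smooth A G n) (cone_incl \<phi> X A G (n + 1)) (H_rel \<phi> X A G (n + 1))"
proof (rule exact_atI[OF KX.comm_group_cohomology KA.comm_group_cohomology KC.comm_group_cohomology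
      space_pull_hom])
  show "cone_incl \<phi> X A G (n + 1) \<in> hom (H_smooth A G n) (H_rel \<phi> X A G (n + 1))"
    using cone_incl_hom[of "n + 1"] by simp
  have incl: "cone_incl \<phi> X A G (n + 1) (cclass (smooth_cplx A) G n f) =
      cclass mcone G (n + 1) (\<lambda>c\<in>carrier (cgrp mcone (n + 1)). f (snd c))"
    and incl_c: "(\<lambda>c\<in>carrier (cgrp mcone (n + 1)). f (snd c)) \<in> cocycles mcone G (n + 1)"
    if "f \<in> cocycles (smooth_cplx A) G n" for f
    using cone_incl_cclass[of f "n + 1"] incl_cocycle[of f "n + 1"] that by simp_all
  {
    fix \<alpha> assume "\<alpha> \<in> carrier (H_smooth X G n)"
    then obtain u where u: "u \<in> cocycles (smooth_cplx X) G n" "\<alpha> = cclass (smooth_cplx X) G n u"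
      by (auto simp: KX.carrier_cohomology)
    note u_hom = hom_smooth_cplx[OF KX.cocycleD(2)[OF u(1)] G.is_group]
    have "\<exists>w\<in>carrier (cochains mcone G n). \<forall>c\<in>carrier (cgrp mcone (n + 1)).
        (\<lambda>c\<in>carrier (cgrp mcone (n + 1)). (\<lambda>t\<in>CA n. u (ps n t)) (snd c)) c = w (bd mcone (n + 1) c)"
    proof (intro bexI ballI)
      have "(\<lambda>c. u (fst c)) \<in> hom (cgrp mcone n) G"
        by (intro homI) (auto simp: carrier_mapping_cone u_hom(1,4))
      then show "(\<lambda>c\<in>carrier (cgrp mcone n). u (fst c)) \<in> carrier (cochains mcone G n)"
        by (rule KC.cochain_restrict)
      fix c assume c: "c \<in> carrier (cgrp mcone (n + 1))"
      obtain s t where st: "c = (s, t)"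
        by (cases c)
      have s: "s \<in> CX (n + 1)" and t: "t \<in> CA n"
        using c st by (simp_all add: carrier_mapping_cone)
      have ds: "dX (n + 1) s \<in> CX n"
        using d_smooth_in[OF s] by simp
      show "(\<lambda>c\<in>carrier (cgrp mcone (n + 1)). (\<lambda>t\<in>CA n. u (ps n t)) (snd c)) c =
          (\<lambda>c\<in>carrier (cgrp mcone n). u (fst c)) (bd mcone (n + 1) c)"
        using c t KC.bd_in_Suc[OF c] u_hom(1)[OF ds ps_in[OF t]] KX.cocycleD(5)[OF u(1) s]
          u_hom(4)[OF ps_in[OF t]]
        by (simp add: st bd_mapping_cone)
    qed
    then have "cclass mcone G (n + 1) (\<lambda>c\<in>carrier (cgrp mcone (n + 1)). (\<lambda>t\<in>CA n. u (ps n t)) (snd c)) =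
        \<one>\<^bsub>H_rel \<phi> X A G (n + 1)\<^esub>"
      unfolding KC.cclass_eq_one_iff[OF incl_c[OF pull_cocycle[OF u(1)]]] by simp
    then show "cone_incl \<phi> X A G (n + 1) (space_pull \<phi> A G n \<alpha>) = \<one>\<^bsub>H_rel \<phi> X A G (n + 1)\<^esub>"
      by (simp only: u(2) space_pull_cclass[OF u(1)] incl[OF pull_cocycle[OF u(1)]])
  }
  fix \<beta> assume \<beta>: "\<beta> \<in> carrier (H_smooth A G n)" "cone_incl \<phi> X A G (n + 1) \<beta> = \<one>\<^bsub>H_rel \<phi> X A G (n + 1)\<^esub>"
  then obtain v where v: "v \<in> cocycles (smooth_cplx A) G n" "\<beta> = cclass (smooth_cplx A) G n v"
    by (auto simp: KA.carrier_cohomology)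
  have "cclass mcone G (n + 1) (\<lambda>c\<in>carrier (cgrp mcone (n + 1)). v (snd c)) = \<one>\<^bsub>H_rel \<phi> X A G (n + 1)\<^esub>"
    using \<beta>(2) by (simp only: v(2) incl[OF v(1)])
  then have "\<exists>w\<in>carrier (cochains mcone G n). \<forall>c\<in>carrier (cgrp mcone (n + 1)).
      (\<lambda>c\<in>carrier (cgrp mcone (n + 1)). v (snd c)) c = w (bd mcone (n + 1) c)"
    unfolding KC.cclass_eq_one_iff[OF incl_c[OF v(1)]] by simp
  then obtain w where w: "w \<in> carrier (cochains mcone G n)" "\<forall>c\<in>carrier (cgrp mcone (n + 1)).
      (\<lambda>c\<in>carrier (cgrp mcone (n + 1)). v (snd c)) c = w (bd mcone (n + 1) c)"
    by (elim bexE)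
  have wh: "w \<in> hom (cgrp mcone n) G"
    using w(1) by (simp add: cochains_carrier_iff)
  have vw: "v t = w (dX (n + 1) s + ps n t, - dA n t)" if "s \<in> CX (n + 1)" "t \<in> CA n" for s t
    using w(2)[rule_format, of "(s, t)"] that by (simp add: carrier_mapping_cone bd_mapping_cone)
  note w_fst = hom_smooth_cplx[OF cone_cochain_fst[OF wh] G.is_group]
  note w_snd = hom_smooth_cplx[OF cone_cochain_snd[OF wh] G.is_group]
  note v_hom = hom_smooth_cplx[OF KA.cocycleD(2)[OF v(1)] G.is_group]
  \<comment> \<open>A cone cochain \<open>w\<close> with coboundary \<open>v \<circ> snd\<close>
    splits in two: on X it is a cocycle, and on A it is a primitive for the difference between the
    pullback of that cocycle and \<open>v\<close>.\<close>
  define u where "u = (\<lambda>s\<in>CX n. w (s, 0))"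
  have uc: "u \<in> carrier (cochains (smooth_cplx X) G n)"
    unfolding u_def by (rule KX.cochain_restrict[OF cone_cochain_fst[OF wh]])
  have u: "u \<in> cocycles (smooth_cplx X) G n"
    unfolding KX.cocycle_iff
  proof (intro conjI uc ballI)
    fix s assume s: "s \<in> CX (n + 1)"
    have "dX (n + 1) s \<in> CX n"
      using d_smooth_in[OF s] by simp
    then show "u (dX (n + 1) s) = \<one>\<^bsub>G\<^esub>"
      using vw[OF s zero_smooth_cplx] v_hom(2) by (simp add: u_def)
  qed
  have "cclass (smooth_cplx A) G n (\<lambda>t\<in>CA n. u (ps n t)) = cclass (smooth_cplx A) G n v"
    unfolding KA.cclass_eq_iff[OF pull_cocycle[OF u] v(1)]
  proof (intro bexI ballI)
    show "(\<lambda>t\<in>CA (n - 1). w (0, t)) \<in> carrier (cochains (smooth_cplx A) G (n - 1))"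
      by (rule KA.cochain_restrict[OF cone_cochain_snd[OF wh]])
    fix t assume t: "t \<in> CA n"
    note pt = ps_in[OF t] and dt = d_smooth_in[OF t]
    have "v t = w (ps n t, 0) \<otimes>\<^bsub>G\<^esub> inv\<^bsub>G\<^esub> w (0, dA n t)"
      using vw[OF zero_smooth_cplx t] cone_cochain_split[OF wh pt uminus_smooth_cplx[OF dt]] w_snd(3)[OF dt]
      by simp
    then have "w (0, dA n t) \<otimes>\<^bsub>G\<^esub> v t = w (ps n t, 0)"
      using w_fst(4)[OF pt] w_snd(4)[OF dt]
      by (simp add: G.m_comm[of "w (0, dA n t)"] G.m_assoc)
    then show "(\<lambda>t\<in>CA n. u (ps n t)) t = (\<lambda>t\<in>CA (n - 1). w (0, t)) (dA n t) \<otimes>\<^bsub>G\<^esub> v t"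
      using t pt dt by (simp add: u_def)
  qed
  then have "space_pull \<phi> A G n (cclass (smooth_cplx X) G n u) = \<beta>"
    by (simp only: space_pull_cclass[OF u] v(2))
  then show "\<exists>\<alpha>\<in>carrier (H_smooth X G n). space_pull \<phi> A G n \<alpha> = \<beta>"
    using KX.cclass_in[OF u] by (rule bexI)
qed

section \<open>Differential characters\<close>

lemma smooth_spaceD:
  assumes "smooth_space X"
  shows "differential_space X" "de_rham_theorem X"
  using assms by (simp_all only: smooth_space_def)

lemma stokes:
  assumes "de_rham_theorem X" "\<omega> \<in> forms X k" "c \<in> carrier (cgrp (smooth_cplx X) (int (Suc k)))"
  shows "chain_integral (Suc k) (ext_deriv X k \<omega>) c = chain_integral k \<omega> (chain_boundary (Suc k) c)"
  using assms unfolding de_rham_theorem_def by blast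

lemma keys_smooth_cplx:
  "c \<in> carrier (cgrp (smooth_cplx X) n) \<Longrightarrow> Poly_Mapping.keys c \<subseteq> smooth_simplices (nat n) X"
  by (simp add: carrier_smooth_cplx split: if_splits)

lemma chain_integral_hom: "chain_integral k \<omega> \<in> hom (cgrp (smooth_cplx X) n) real_group"
  by (intro homI) (simp_all add: chain_integral_chain_add)

text \<open>The version for integer degrees. As \<theta> has degree \<open>k - 1\<close>, which must
  be positive for the contraction argument, \<open>2 \<le> k\<close> is assumed.\<close>

lemma integral_cochain_eq:
  assumes X: "differential_space X" and k: "2 \<le> k"
    and \<eta>: "\<eta> \<in> forms X (nat k)" and \<theta>: "\<theta> \<in> forms X (nat (k - 1))"
    and Z: "\<And>c. c \<in> carrier (cgrp (smooth_cplx X) k) \<Longrightarrow>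
      chain_integral (nat k) \<eta> c - chain_integral (nat (k - 1)) \<theta> (bd (smooth_cplx X) k c) \<in> \<int>"
    and c: "c \<in> carrier (cgrp (smooth_cplx X) k)"
  shows "chain_integral (nat k) \<eta> c = chain_integral (nat (k - 1)) \<theta> (bd (smooth_cplx X) k c)"
proof -
  define m where "m = nat (k - 1)"
  have km: "nat k = Suc m" "nat (k - 1) = m" "0 < m"
    using k by (simp_all add: m_def nat_diff_distrib)
  have "chain_integral (Suc m) \<eta> c = chain_integral m \<theta> (chain_boundary (Suc m) c)"
  proof (rule integral_cochain_zero[OF X _ _ km(3)])
    show "chain_integral (Suc m) \<eta> (frag_of \<tau>) - chain_integral m \<theta> (chain_boundary (Suc m) (frag_of \<tau>)) \<in> \<int>"
      if "\<tau> \<in> smooth_simplices (Suc m) X" for \<tau>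
      using Z[of "frag_of \<tau>"] that k by (simp add: km carrier_smooth_cplx bd_smooth_cplx)
  qed (use \<eta> \<theta> km keys_smooth_cplx[OF c] in simp_all)
  then show ?thesis
    by (simp add: km bd_smooth_cplx)
qed

text \<open>Comparison with the zero form on boundaries turns integer integrals into vanishing ones,
  and integrals determine the form.\<close>

lemma integral_zero:
  assumes X: "differential_space X" and k: "2 \<le> k" and \<eta>: "\<eta> \<in> forms X (nat k)"
    and Z: "\<And>c. c \<in> carrier (cgrp (smooth_cplx X) k) \<Longrightarrow> chain_integral (nat k) \<eta> c \<in> \<int>"
  shows "\<eta> = (\<lambda>_ _. 0)"
proof (rule form_eq_zero[OF X \<eta>])
  fix \<tau> assume "\<tau> \<in> smooth_simplices (nat k) X"
  then have "frag_of \<tau> \<in> carrier (cgrp (smooth_cplx X) k)"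
    using k by (simp add: carrier_smooth_cplx)
  then have "chain_integral (nat k) \<eta> (frag_of \<tau>) = 0"
    using integral_cochain_eq[OF X k \<eta> forms_0] Z by simp
  then show "simplex_integral (nat k) (\<eta> \<tau>) = 0"
    by (simp add: chain_integral_frag_of)
qed

lemma cycles_smooth_iff:
  "z \<in> cycles (smooth_cplx X) n \<longleftrightarrow> z \<in> carrier (cgrp (smooth_cplx X) n) \<and> bd (smooth_cplx X) n z = 0"
  by (simp add: cycles_def)

lemma cycles_smoothI:
  shows cycles_smooth_add: "\<lbrakk>z \<in> cycles (smooth_cplx X) n; w \<in> cycles (smooth_cplx X) n\<rbrakk> \<Longrightarrow> z + w \<in> cycles (smooth_cplx X) n"
    and cycles_smooth_uminus: "z \<in> cycles (smooth_cplx X) n \<Longrightarrow> - z \<in> cycles (smooth_cplx X) n"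
    and cycles_smooth_0 [simp]: "0 \<in> cycles (smooth_cplx X) n"
    and cycles_smooth_bd: "c \<in> carrier (cgrp (smooth_cplx X) n) \<Longrightarrow> bd (smooth_cplx X) n c \<in> cycles (smooth_cplx X) (n - 1)"
  by (simp_all add: cycles_smooth_iff add_smooth_cplx uminus_smooth_cplx d_smooth_add d_smooth_uminus
      d_smooth_in d_smooth_d)

lemma comm_group_cycle_group:
  assumes "chain_cplx K"
  shows "comm_group (cycle_group K n)"
proof -
  interpret chain_cplx K
    by fact
  interpret C: comm_group "cgrp K n"
    by (rule grp)
  show ?thesis
    by (rule group.group_comm_groupI[OF group_cycle_group]) (simp add: cycles_carrier C.m_comm)
qed

lemma group_cycle_group_smooth: "group (cycle_group (smooth_cplx X) n)"
  by (rule chain_cplx.group_cycle_group[OF chain_cplx_smooth])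

lemma cycle_hom_U1:
  assumes h: "h \<in> hom (cycle_group (smooth_cplx X) n) U1"
  shows "\<lbrakk>z \<in> cycles (smooth_cplx X) n; w \<in> cycles (smooth_cplx X) n\<rbrakk> \<Longrightarrow> h (z + w) = h z * h w"
    and "h 0 = 1"
    and "z \<in> cycles (smooth_cplx X) n \<Longrightarrow> norm (h z) = 1"
    and "z \<in> cycles (smooth_cplx X) n \<Longrightarrow> h (- z) = inverse (h z)"
proof -
  interpret h: group_hom "cycle_group (smooth_cplx X) n" U1 h
    using h group_cycle_group_smooth group_U1 by (simp add: group_hom_def group_hom_axioms_def)
  show mult: "\<lbrakk>z \<in> cycles (smooth_cplx X) n; w \<in> cycles (smooth_cplx X) n\<rbrakk> \<Longrightarrow> h (z + w) = h z * h w" for z w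
    using h.hom_mult[of z w] by simp
  show one: "h 0 = 1"
    using h.hom_one by simp
  show "z \<in> cycles (smooth_cplx X) n \<Longrightarrow> norm (h z) = 1"
    using h.hom_closed[of z] by simp
  show "h (- z) = inverse (h z)" if z: "z \<in> cycles (smooth_cplx X) n"
    using inverse_unique[of "h z" "h (- z)"] mult[OF z cycles_smooth_uminus[OF z]] one by simp
qed

lemma diff_char_carrier_iff:
  "h \<in> carrier (diff_char X k) \<longleftrightarrow> h \<in> hom (cycle_group (smooth_cplx X) (k - 1)) U1 \<and>
     h \<in> extensional (cycles (smooth_cplx X) (k - 1)) \<and> (\<exists>\<omega>. is_curv X k h \<omega>)"
  by (auto simp: diff_char_def hom_group_def)

lemma diff_char_mult:
  "h \<otimes>\<^bsub>diff_char X k\<^esub> g = (\<lambda>z\<in>cycles (smooth_cplx X) (k - 1). h z * g z)"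
  by (simp add: diff_char_def hom_group_def)

lemma diff_char_one: "\<one>\<^bsub>diff_char X k\<^esub> = (\<lambda>z\<in>cycles (smooth_cplx X) (k - 1). 1)"
  by (simp add: diff_char_def hom_group_def)

lemma comm_group_subgroup:
  assumes "comm_group G" "subgroup S G"
  shows "comm_group (G\<lparr>carrier := S\<rparr>)"
proof -
  interpret G: comm_group G
    by fact
  show ?thesis
    by (rule group.group_comm_groupI[OF subgroup.subgroup_is_group[OF assms(2) G.is_group]])
      (simp add: G.m_comm subgroup.mem_carrier[OF assms(2)])
qed

lemma comm_group_diff_char:
  assumes X: "differential_space X"
  shows "comm_group (diff_char X k)"
proof -
  let ?K = "smooth_cplx X"
  let ?H = "hom_group (cycle_group ?K (k - 1)) U1"
  interpret H: comm_group ?H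
    by (rule comm_group_hom_group[OF group_cycle_group_smooth comm_group_U1])
  have bdc: "bd ?K k c \<in> cycles ?K (k - 1)" if "c \<in> carrier (cgrp ?K k)" for c
    by (rule cycles_smooth_bd[OF that])
  let ?S = "{h \<in> carrier ?H. \<exists>\<omega>. is_curv X k h \<omega>}"
  have "subgroup ?S ?H"
  proof (rule H.subgroupI)
    show "?S \<subseteq> carrier ?H"
      by blast
    have "is_curv X k \<one>\<^bsub>?H\<^esub> (\<lambda>_ _. 0)"
      by (simp add: is_curv_def forms_0 bdc hom_group_def)
    then show "?S \<noteq> {}"
      using H.one_closed by (auto intro!: exI[of _ "\<one>\<^bsub>?H\<^esub>"])
    show "inv\<^bsub>?H\<^esub> h \<in> ?S" if hS: "h \<in> ?S" for h
    proof -
      obtain \<omega> where h: "h \<in> carrier ?H" and \<omega>: "is_curv X k h \<omega>"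
        using hS by blast
      have hh: "h \<in> hom (cycle_group ?K (k - 1)) U1"
        using h by (simp add: hom_group_def)
      have "is_curv X k (inv\<^bsub>?H\<^esub> h) (\<lambda>\<sigma> t. - \<omega> \<sigma> t)"
        using \<omega> bdc cycle_hom_U1(3)[OF hh]
        by (simp add: is_curv_def forms_uminus[OF X] inv_hom_group[OF group_cycle_group_smooth comm_group_U1 h]
            chain_integral_form_uminus expU_uminus inv_U1)
      then show ?thesis
        using H.inv_closed[OF h] by blast
    qed
    show "h \<otimes>\<^bsub>?H\<^esub> g \<in> ?S" if hS: "h \<in> ?S" and gS: "g \<in> ?S" for h g
    proof -
      obtain \<omega> where h: "h \<in> carrier ?H" and \<omega>: "is_curv X k h \<omega>"
        using hS by blast
      obtain \<eta> where g: "g \<in> carrier ?H" and \<eta>: "is_curv X k g \<eta>"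
        using gS by blast
      have "is_curv X k (h \<otimes>\<^bsub>?H\<^esub> g) (\<lambda>\<sigma> t. \<omega> \<sigma> t + \<eta> \<sigma> t)"
        using \<omega> \<eta> bdc
        by (simp add: is_curv_def forms_add hom_group_def expU_add
            chain_integral_form_add[OF X _ _ keys_smooth_cplx])
      then show ?thesis
        using H.m_closed[OF h g] by blast
    qed
  qed
  from comm_group_subgroup[OF H.comm_group_axioms this] show ?thesis
    by (simp only: diff_char_def)
qed

text \<open>The integrals of two curvature forms of one character differ by integers on every chain,
  not only on cycles, so the difference of the forms is 0.\<close>

lemma curv_eq:
  assumes X: "differential_space X" and k: "2 \<le> k" and \<omega>: "is_curv X k h \<omega>"
  shows "curv X k h = \<omega>"
  unfolding curv_def
proof (rule the_equality[where P = "is_curv X k h", OF \<omega>])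
  fix \<eta> assume \<eta>: "is_curv X k h \<eta>"
  have f: "\<omega> \<in> forms X (nat k)" "\<eta> \<in> forms X (nat k)"
    using \<omega> \<eta> by (simp_all add: is_curv_def)
  have f': "(\<lambda>\<sigma> t. \<eta> \<sigma> t + - \<omega> \<sigma> t) \<in> forms X (nat k)"
    by (rule forms_add[OF f(2) forms_uminus[OF X f(1)]])
  have "(\<lambda>\<sigma> t. \<eta> \<sigma> t + - \<omega> \<sigma> t) = (\<lambda>_ _. 0)"
  proof (rule integral_zero[OF X k f'])
    fix c assume c: "c \<in> carrier (cgrp (smooth_cplx X) k)"
    have "expU (chain_integral (nat k) \<eta> c - chain_integral (nat k) \<omega> c) = 1"
      using \<omega> \<eta> c by (simp add: is_curv_def expU_diff) (metis norm_expU norm_zero divide_self zero_neq_one)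
    then show "chain_integral (nat k) (\<lambda>\<sigma> t. \<eta> \<sigma> t + - \<omega> \<sigma> t) c \<in> \<int>"
      using chain_integral_form_add[OF X f(2) forms_uminus[OF X f(1)] keys_smooth_cplx[OF c]]
      by (simp add: expU_eq_1_iff chain_integral_form_uminus)
  qed
  then show "\<eta> = \<omega>"
    by (simp add: fun_eq_iff)
qed

text \<open>A boundary has boundary 0, where the character is 1; so these integrals of \<omega> are
  integers, and the contraction argument with the zero form in degree \<open>k + 1\<close> makes
  them 0. Degree 1 is included because \<omega> itself plays the part of the lower form.\<close>

lemma curvature_boundary_integral:
  assumes X: "differential_space X" and k: "1 \<le> k" and \<omega>: "is_curv X k h \<omega>"
    and h: "h \<in> hom (cycle_group (smooth_cplx X) (k - 1)) U1"
    and c: "c \<in> carrier (cgrp (smooth_cplx X) (k + 1))"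
  shows "chain_integral (nat k) \<omega> (bd (smooth_cplx X) (k + 1) c) = 0"
proof -
  have f: "\<omega> \<in> forms X (nat (k + 1 - 1))"
    using \<omega> by (simp add: is_curv_def)
  have "chain_integral (nat (k + 1)) (\<lambda>_ _. 0) c = chain_integral (nat (k + 1 - 1)) \<omega> (bd (smooth_cplx X) (k + 1) c)"
  proof (rule integral_cochain_eq[OF X _ forms_0 f _ c])
    fix c assume c: "c \<in> carrier (cgrp (smooth_cplx X) (k + 1))"
    have dc: "bd (smooth_cplx X) (k + 1) c \<in> carrier (cgrp (smooth_cplx X) k)"
      using d_smooth_in[OF c] by simp
    have "expU (chain_integral (nat k) \<omega> (bd (smooth_cplx X) (k + 1) c)) = h (bd (smooth_cplx X) k (bd (smooth_cplx X) (k + 1) c))"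
      using \<omega> dc by (simp add: is_curv_def)
    also have "bd (smooth_cplx X) k (bd (smooth_cplx X) (k + 1) c) = 0"
      using d_smooth_d[OF c] by simp
    finally have "chain_integral (nat k) \<omega> (bd (smooth_cplx X) (k + 1) c) \<in> \<int>"
      by (simp add: cycle_hom_U1(2)[OF h] expU_eq_1_iff)
    then show "chain_integral (nat (k + 1)) (\<lambda>_ _. 0) c -
        chain_integral (nat (k + 1 - 1)) \<omega> (bd (smooth_cplx X) (k + 1) c) \<in> \<int>"
      by simp
  qed (use k in simp)
  then show ?thesis
    by simp
qed

text \<open>By Stokes, integrals of the exterior derivative are integrals of \<omega> over
  boundaries, and a form with vanishing integrals is 0.\<close>

lemma curvature_closed:
  assumes X: "smooth_space X" and k: "1 \<le> k" and \<omega>: "is_curv X k h \<omega>"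
    and h: "h \<in> hom (cycle_group (smooth_cplx X) (k - 1)) U1"
  shows "\<omega> \<in> closed_forms X (nat k)"
proof -
  note dX = smooth_spaceD(1)[OF X]
  have f: "\<omega> \<in> forms X (nat k)"
    using \<omega> by (simp add: is_curv_def)
  have "ext_deriv X (nat k) \<omega> = (\<lambda>_ _. 0)"
  proof (rule form_eq_zero[OF dX ext_deriv_in_forms[OF dX f]])
    fix \<tau> assume "\<tau> \<in> smooth_simplices (Suc (nat k)) X"
    moreover have k1: "nat (k + 1) = Suc (nat k)" "int (Suc (nat k)) = k + 1" "\<not> k + 1 < 0"
      using k by simp_all
    ultimately have \<tau>: "frag_of \<tau> \<in> carrier (cgrp (smooth_cplx X) (k + 1))"
      by (simp only: carrier_smooth_cplx if_False k1) simp
    have "chain_integral (Suc (nat k)) (ext_deriv X (nat k) \<omega>) (frag_of \<tau>) = 0"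
      using stokes[OF smooth_spaceD(2)[OF X] f, of "frag_of \<tau>"] curvature_boundary_integral[OF dX k \<omega> h \<tau>] \<tau>
      by (simp only: bd_smooth_cplx k1)
    then show "simplex_integral (Suc (nat k)) (ext_deriv X (nat k) \<omega> \<tau>) = 0"
      by (simp add: chain_integral_frag_of)
  qed
  with f show ?thesis
    by (simp add: closed_forms_def)
qed

lemma int_cochain_real:
  assumes "\<mu> \<in> hom G integer_group"
  shows "(\<lambda>c. real_of_int (\<mu> c)) \<in> hom G real_group"
  using hom_mult[OF assms] by (intro homI) simp_all

text \<open>Computes the class from an arbitrary lift and so justifies the definite description. The
  cochains of two lifts differ by the coboundary of an integer-valued function \<open>d\<close>
  given on cycles only; the substance is to extend \<open>d\<close> to an integral cochain.\<close>

lemma char_class_eq: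
  assumes X: "differential_space X" and k: "2 \<le> k" and h: "h \<in> carrier (diff_char X k)" and \<omega>: "is_curv X k h \<omega>"
    and h': "h' \<in> hom (cycle_group (smooth_cplx X) (k - 1)) real_group"
      "\<And>z. z \<in> cycles (smooth_cplx X) (k - 1) \<Longrightarrow> h z = expU (h' z)"
    and \<mu>: "\<mu> \<in> carrier (cochains (smooth_cplx X) integer_group k)"
      "\<And>x. x \<in> carrier (cgrp (smooth_cplx X) k) \<Longrightarrow>
        of_int (\<mu> x) = chain_integral (nat k) \<omega> x - h' (bd (smooth_cplx X) k x)"
  shows "\<mu> \<in> cocycles (smooth_cplx X) integer_group k"
    and "char_class X k h = cclass (smooth_cplx X) integer_group k \<mu>"
proof -
  let ?K = "smooth_cplx X"
  interpret KZ: cochain_cplx ?K integer_group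
    by (simp add: cochain_cplx_def chain_cplx_smooth abelian_integer_group)
  have hh: "h \<in> hom (cycle_group ?K (k - 1)) U1"
    using h by (simp add: diff_char_carrier_iff)
  have zero: "h' 0 = 0" if "h' \<in> hom (cycle_group ?K (k - 1)) real_group" for h'
    using hom_mult[OF that, of 0 0] by simp
  have cocycle: "\<mu> \<in> cocycles ?K integer_group k"
    if h': "h' \<in> hom (cycle_group ?K (k - 1)) real_group"
      and \<mu>: "\<mu> \<in> carrier (cochains ?K integer_group k)"
        "\<And>x. x \<in> carrier (cgrp ?K k) \<Longrightarrow> of_int (\<mu> x) = chain_integral (nat k) \<omega> x - h' (bd ?K k x)" for h' \<mu>
    unfolding KZ.cocycle_iff
  proof (intro conjI \<mu>(1) ballI)
    fix c assume c: "c \<in> carrier (cgrp ?K (k + 1))"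
    have dc: "bd ?K (k + 1) c \<in> carrier (cgrp ?K k)"
      using d_smooth_in[OF c] by simp
    have "bd ?K k (bd ?K (k + 1) c) = 0"
      using d_smooth_d[OF c] by simp
    then have "real_of_int (\<mu> (bd ?K (k + 1) c)) = 0"
      using \<mu>(2)[OF dc] curvature_boundary_integral[OF X _ \<omega> hh c] zero[OF h'] k by simp
    then show "\<mu> (bd ?K (k + 1) c) = \<one>\<^bsub>integer_group\<^esub>"
      by simp
  qed
  show \<mu>c: "\<mu> \<in> cocycles ?K integer_group k"
    by (rule cocycle[OF h'(1) \<mu>])
  define P where "P = (\<lambda>\<alpha>. \<exists>h' \<mu>. h' \<in> hom (cycle_group ?K (k - 1)) real_group \<and>
        (\<forall>z \<in> cycles ?K (k - 1). h z = expU (h' z)) \<and>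
        \<mu> \<in> carrier (cochains ?K integer_group k) \<and>
        (\<forall>x \<in> carrier (cgrp ?K k).
           of_int (\<mu> x) = chain_integral (nat k) \<omega> x - h' (bd ?K k x)) \<and>
        \<alpha> = cclass ?K integer_group k \<mu>)"
  have P: "P (cclass ?K integer_group k \<mu>)"
    unfolding P_def by (intro exI[of _ h'] exI[of _ \<mu>] conjI ballI h' \<mu> refl)
  have "\<alpha> = cclass ?K integer_group k \<mu>" if "P \<alpha>" for \<alpha>
  proof -
    obtain h'' \<mu>'' where h'': "h'' \<in> hom (cycle_group ?K (k - 1)) real_group"
      "\<And>z. z \<in> cycles ?K (k - 1) \<Longrightarrow> h z = expU (h'' z)"
      and \<mu>'': "\<mu>'' \<in> carrier (cochains ?K integer_group k)"
        "\<And>x. x \<in> carrier (cgrp ?K k) \<Longrightarrow> of_int (\<mu>'' x) = chain_integral (nat k) \<omega> x - h'' (bd ?K k x)"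
      and \<alpha>: "\<alpha> = cclass ?K integer_group k \<mu>''"
      using \<open>P \<alpha>\<close> unfolding P_def by blast
    define d where "d = (\<lambda>z. h' z - h'' z)"
    have d: "d \<in> hom (cycle_group ?K (k - 1)) real_group"
      unfolding d_def using hom_mult[OF h'(1)] hom_mult[OF h''(1)] by (intro homI) simp_all
    have dZ: "d z \<in> \<int>" if "z \<in> cycles ?K (k - 1)" for z
    proof -
      have "expU (h' z) = expU (h'' z)"
        using h'(2)[OF that] h''(2)[OF that] by simp
      moreover have "expU (h'' z) \<noteq> 0"
        using norm_expU[of "h'' z"] by (metis norm_zero zero_neq_one)
      ultimately show ?thesis
        by (simp add: d_def expU_diff flip: expU_eq_1_iff)
    qed
    text \<open>The integer-valued \<open>d\<close> extends to an integer-valued cochain: extend it to a real cochain,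
      and correct this by a coboundary lifting its reduction modulo the integers.\<close>
    obtain D where D: "D \<in> hom (cgrp ?K (k - 1)) real_group" "\<And>z. z \<in> cycles ?K (k - 1) \<Longrightarrow> D z = d z"
    proof (rule divisible_group_extension[OF comm_group_smooth_cplx[of X "k - 1"] divisible_group_real
          group_cycle_group_smooth[of X "k - 1"], of "\<lambda>z. z" d])
      show "(\<lambda>z. z) \<in> hom (cycle_group ?K (k - 1)) (cgrp ?K (k - 1))"
        by (intro homI) (simp_all add: cycles_smooth_iff)
      show "d p = \<one>\<^bsub>real_group\<^esub>" if "p = \<one>\<^bsub>cgrp ?K (k - 1)\<^esub>" for p
        using that zero[OF d] by simp
    qed (use d in auto)
    obtain E where E: "E \<in> hom (cgrp ?K (k - 2)) U1" "\<And>c. c \<in> carrier (cgrp ?K (k - 1)) \<Longrightarrow> E (bd ?K (k - 1) c) = expU (D c)"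
    proof (rule divisible_group_extension[OF comm_group_smooth_cplx[of X "k - 2"] divisible_group_U1
          group_smooth_cplx[of X "k - 1"], of "bd ?K (k - 1)" "\<lambda>c. expU (D c)"])
      show "bd ?K (k - 1) \<in> hom (cgrp ?K (k - 1)) (cgrp ?K (k - 2))"
        using chain_cplx.bd_hom[OF chain_cplx_smooth, of X "k - 1"] by simp
      show "(\<lambda>c. expU (D c)) \<in> hom (cgrp ?K (k - 1)) U1"
        by (rule hom_expU[OF D(1)])
      show "expU (D c) = \<one>\<^bsub>U1\<^esub>" if "c \<in> carrier (cgrp ?K (k - 1))" "bd ?K (k - 1) c = \<one>\<^bsub>cgrp ?K (k - 2)\<^esub>" for c
      proof -
        have "c \<in> cycles ?K (k - 1)"
          using that by (simp add: cycles_smooth_iff)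
        then show ?thesis
          using D(2) dZ by (simp add: expU_eq_1_iff)
      qed
    qed (use that in blast)
    obtain e where e: "e \<in> hom (cgrp ?K (k - 2)) real_group" "\<And>c. c \<in> carrier (cgrp ?K (k - 2)) \<Longrightarrow> E c = expU (e c)"
      using free_Abelian_group_lift[OF E(1)[unfolded cgrp_smooth_cplx]] unfolding cgrp_smooth_cplx by blast
    \<comment> \<open>On cycles the correction \<open>e (bd ?K (k - 1) c)\<close> vanishes, so
      \<open>w\<close> agrees there with \<open>d\<close>; modulo the integers it cancels
      \<open>D\<close>, so \<open>w\<close> is integral on all chains.\<close>
    define w where "w = (\<lambda>c. D c - e (bd ?K (k - 1) c))"
    have bd1: "bd ?K (k - 1) c \<in> carrier (cgrp ?K (k - 2))" if "c \<in> carrier (cgrp ?K (k - 1))" for c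
      using d_smooth_in[OF that] by simp
    have wZ: "w c \<in> \<int>" if c: "c \<in> carrier (cgrp ?K (k - 1))" for c
    proof -
      have "expU (e (bd ?K (k - 1) c)) = expU (D c)"
        using E(2)[OF c] e(2)[OF bd1[OF c]] by simp
      moreover have "expU (D c) \<noteq> 0"
        using norm_expU[of "D c"] by (metis norm_zero zero_neq_one)
      ultimately show ?thesis
        by (simp add: w_def expU_diff flip: expU_eq_1_iff)
    qed
    \<comment> \<open>The floor merely turns a real number known to be integral into an
      \<open>int\<close>.\<close>
    have w_floor: "real_of_int \<lfloor>w c\<rfloor> = w c" if "c \<in> carrier (cgrp ?K (k - 1))" for c
      using wZ[OF that] by (auto simp: Ints_def)
    have w_add: "w (c + c') = w c + w c'"
      if "c \<in> carrier (cgrp ?K (k - 1))" "c' \<in> carrier (cgrp ?K (k - 1))" for c c'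
      using hom_mult[OF D(1), of c c'] hom_mult[OF e(1) bd1 bd1, of c c'] that
      by (simp add: w_def d_smooth_add)
    have "(\<lambda>c. \<lfloor>w c\<rfloor>) \<in> hom (cgrp ?K (k - 1)) integer_group"
    proof (rule homI)
      fix c c' assume c: "c \<in> carrier (cgrp ?K (k - 1))" "c' \<in> carrier (cgrp ?K (k - 1))"
      have "real_of_int \<lfloor>w (c + c')\<rfloor> = real_of_int (\<lfloor>w c\<rfloor> + \<lfloor>w c'\<rfloor>)"
        using w_floor[OF c(1)] w_floor[OF c(2)] w_floor[OF add_smooth_cplx[OF c]] w_add[OF c]
        by (simp only: of_int_add)
      then show "\<lfloor>w (c \<otimes>\<^bsub>cgrp ?K (k - 1)\<^esub> c')\<rfloor> = \<lfloor>w c\<rfloor> \<otimes>\<^bsub>integer_group\<^esub> \<lfloor>w c'\<rfloor>"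
        by (simp only: of_int_eq_iff mult_smooth_cplx mult_integer_group)
    qed simp
    then have wc: "(\<lambda>c\<in>carrier (cgrp ?K (k - 1)). \<lfloor>w c\<rfloor>) \<in> carrier (cochains ?K integer_group (k - 1))"
      by (rule KZ.cochain_restrict)
    have "\<mu>'' x = (\<lambda>c\<in>carrier (cgrp ?K (k - 1)). \<lfloor>w c\<rfloor>) (bd ?K k x) \<otimes>\<^bsub>integer_group\<^esub> \<mu> x"
      if x: "x \<in> carrier (cgrp ?K k)" for x
    proof -
      note dx = d_smooth_in[OF x] and cx = cycles_smooth_bd[OF x]
      have "bd ?K (k - 1) (bd ?K k x) = 0"
        by (rule d_smooth_d[OF x])
      moreover have "e 0 = 0"
        using hom_mult[OF e(1), of 0 0] by simp
      ultimately have "w (bd ?K k x) = h' (bd ?K k x) - h'' (bd ?K k x)"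
        using D(2)[OF cx] by (simp add: w_def d_def)
      then have "real_of_int (\<mu>'' x) = w (bd ?K k x) + real_of_int (\<mu> x)"
        using \<mu>(2)[OF x] \<mu>''(2)[OF x] by simp
      then have "real_of_int (\<mu>'' x) = real_of_int (\<lfloor>w (bd ?K k x)\<rfloor> + \<mu> x)"
        by (simp only: of_int_add w_floor[OF dx])
      then show ?thesis
        using dx by (simp only: of_int_eq_iff restrict_apply' mult_integer_group)
    qed
    moreover have "\<mu>'' \<in> cocycles ?K integer_group k"
      by (rule cocycle[OF h''(1) \<mu>''])
    ultimately have "cclass ?K integer_group k \<mu>'' = cclass ?K integer_group k \<mu>"
      using KZ.cclass_eq_iff[OF _ \<mu>c, of \<mu>''] wc by blast
    then show ?thesis
      by (simp add: \<alpha>)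
  qed
  with P have "(THE \<alpha>. P \<alpha>) = cclass ?K integer_group k \<mu>"
    by (rule the_equality)
  then show "char_class X k h = cclass ?K integer_group k \<mu>"
    unfolding char_class_def curv_eq[OF X k \<omega>] P_def .
qed

text \<open>Divisibility of U(1) extends the character to all chains, and freeness of the chain
  group then allows a real lift. Being defined on chains, the lift is a real cochain, to which the
  de Rham theorem can be applied.\<close>

lemma char_class_lift:
  assumes X: "differential_space X" and h: "h \<in> carrier (diff_char X k)" and \<omega>: "is_curv X k h \<omega>"
  obtains H \<mu> where "H \<in> hom (cgrp (smooth_cplx X) (k - 1)) real_group"
    "\<And>z. z \<in> cycles (smooth_cplx X) (k - 1) \<Longrightarrow> h z = expU (H z)"
    "\<mu> \<in> carrier (cochains (smooth_cplx X) integer_group k)"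
    "\<And>x. x \<in> carrier (cgrp (smooth_cplx X) k) \<Longrightarrow>
        of_int (\<mu> x) = chain_integral (nat k) \<omega> x - H (bd (smooth_cplx X) k x)"
proof -
  let ?K = "smooth_cplx X"
  have hh: "h \<in> hom (cycle_group ?K (k - 1)) U1"
    using h by (simp add: diff_char_carrier_iff)
  obtain E where E: "E \<in> hom (cgrp ?K (k - 1)) U1" "\<And>z. z \<in> cycles ?K (k - 1) \<Longrightarrow> E z = h z"
  proof (rule divisible_group_extension[OF comm_group_smooth_cplx[of X "k - 1"] divisible_group_U1
        group_cycle_group_smooth[of X "k - 1"], of "\<lambda>z. z" h])
    show "(\<lambda>z. z) \<in> hom (cycle_group ?K (k - 1)) (cgrp ?K (k - 1))"
      by (intro homI) (simp_all add: cycles_smooth_iff)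
    show "h p = \<one>\<^bsub>U1\<^esub>" if "p = \<one>\<^bsub>cgrp ?K (k - 1)\<^esub>" for p
      using that cycle_hom_U1(2)[OF hh] by simp
  qed (use hh in auto)
  obtain H where H: "H \<in> hom (cgrp ?K (k - 1)) real_group" "\<And>c. c \<in> carrier (cgrp ?K (k - 1)) \<Longrightarrow> E c = expU (H c)"
    using free_Abelian_group_lift[OF E(1)[unfolded cgrp_smooth_cplx]] unfolding cgrp_smooth_cplx by blast
  have hH: "h z = expU (H z)" if "z \<in> cycles ?K (k - 1)" for z
    using E(2)[OF that] H(2)[of z] that by (simp add: cycles_smooth_iff)
  define w where "w = (\<lambda>x. chain_integral (nat k) \<omega> x - H (bd ?K k x))"
  have w_floor: "real_of_int \<lfloor>w x\<rfloor> = w x" if x: "x \<in> carrier (cgrp ?K k)" for x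
  proof -
    have "expU (H (bd ?K k x)) = expU (chain_integral (nat k) \<omega> x)"
      using hH[OF cycles_smooth_bd[OF x]] \<omega> x by (simp add: is_curv_def)
    moreover have "expU (chain_integral (nat k) \<omega> x) \<noteq> 0"
      using norm_expU[of "chain_integral (nat k) \<omega> x"] by (metis norm_zero zero_neq_one)
    ultimately have "w x \<in> \<int>"
      by (simp add: w_def expU_diff flip: expU_eq_1_iff)
    then show ?thesis
      by (auto simp: Ints_def)
  qed
  have "(\<lambda>x. \<lfloor>w x\<rfloor>) \<in> hom (cgrp ?K k) integer_group"
  proof (rule homI)
    fix c c' assume c: "c \<in> carrier (cgrp ?K k)" "c' \<in> carrier (cgrp ?K k)"
    have "w (c + c') = w c + w c'"
      using hom_mult[OF H(1) d_smooth_in[OF c(1)] d_smooth_in[OF c(2)]]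
      by (simp add: w_def d_smooth_add chain_integral_chain_add)
    then have "real_of_int \<lfloor>w (c + c')\<rfloor> = real_of_int (\<lfloor>w c\<rfloor> + \<lfloor>w c'\<rfloor>)"
      using w_floor[OF c(1)] w_floor[OF c(2)] w_floor[OF add_smooth_cplx[OF c]] by (simp only: of_int_add)
    then show "\<lfloor>w (c \<otimes>\<^bsub>cgrp ?K k\<^esub> c')\<rfloor> = \<lfloor>w c\<rfloor> \<otimes>\<^bsub>integer_group\<^esub> \<lfloor>w c'\<rfloor>"
      by (simp only: of_int_eq_iff mult_smooth_cplx mult_integer_group)
  qed simp
  then have "(\<lambda>x\<in>carrier (cgrp ?K k). \<lfloor>w x\<rfloor>) \<in> hom (cgrp ?K k) integer_group"
    by (rule group.hom_restrict[OF group_smooth_cplx])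
  then have "(\<lambda>x\<in>carrier (cgrp ?K k). \<lfloor>w x\<rfloor>) \<in> carrier (cochains ?K integer_group k)"
    by (simp add: cochains_carrier_iff)
  moreover have "of_int ((\<lambda>x\<in>carrier (cgrp ?K k). \<lfloor>w x\<rfloor>) x) = chain_integral (nat k) \<omega> x - H (bd ?K k x)"
    if "x \<in> carrier (cgrp ?K k)" for x
    using w_floor[OF that] that by (simp add: w_def)
  ultimately show ?thesis
    using that H(1) hH by blast
qed

lemma real_hom_cycles:
  "H \<in> hom (cgrp (smooth_cplx X) n) real_group \<Longrightarrow> H \<in> hom (cycle_group (smooth_cplx X) n) real_group"
  by (rule chain_cplx.hom_cycle_group_restrict[OF chain_cplx_smooth])

text \<open>For a product of characters, the sums of the curvature forms, lifts and integral
  cochains serve as the corresponding data.\<close>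

lemma char_class_hom:
  assumes X: "differential_space X" and k: "2 \<le> k"
  shows "char_class X k \<in> hom (diff_char X k) (H_smooth X integer_group k)"
proof -
  let ?K = "smooth_cplx X"
  interpret KZ: cochain_cplx ?K integer_group
    by (simp add: cochain_cplx_def chain_cplx_smooth abelian_integer_group)
  interpret C: comm_group "cochains ?K integer_group k"
    by (rule KZ.comm_group_cochains)
  interpret DC: comm_group "diff_char X k"
    by (rule comm_group_diff_char[OF X])
  show ?thesis
  proof (rule homI)
    fix h assume h: "h \<in> carrier (diff_char X k)"
    then obtain \<omega> where \<omega>: "is_curv X k h \<omega>"
      by (auto simp: diff_char_carrier_iff)
    obtain H \<mu> where H: "H \<in> hom (cgrp ?K (k - 1)) real_group" "\<And>z. z \<in> cycles ?K (k - 1) \<Longrightarrow> h z = expU (H z)"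
      "\<mu> \<in> carrier (cochains ?K integer_group k)"
      "\<And>x. x \<in> carrier (cgrp ?K k) \<Longrightarrow> of_int (\<mu> x) = chain_integral (nat k) \<omega> x - H (bd ?K k x)"
      using char_class_lift[OF X h \<omega>] by blast
    note cc = char_class_eq[OF X k h \<omega> real_hom_cycles[OF H(1)] H(2,3,4)]
    show "char_class X k h \<in> carrier (H_smooth X integer_group k)"
      using KZ.cclass_in[OF cc(1)] by (simp only: cc(2))
    fix g assume g: "g \<in> carrier (diff_char X k)"
    then obtain \<eta> where \<eta>: "is_curv X k g \<eta>"
      by (auto simp: diff_char_carrier_iff)
    obtain H' \<mu>' where H': "H' \<in> hom (cgrp ?K (k - 1)) real_group" "\<And>z. z \<in> cycles ?K (k - 1) \<Longrightarrow> g z = expU (H' z)"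
      "\<mu>' \<in> carrier (cochains ?K integer_group k)"
      "\<And>x. x \<in> carrier (cgrp ?K k) \<Longrightarrow> of_int (\<mu>' x) = chain_integral (nat k) \<eta> x - H' (bd ?K k x)"
      using char_class_lift[OF X g \<eta>] by blast
    note cc' = char_class_eq[OF X k g \<eta> real_hom_cycles[OF H'(1)] H'(2,3,4)]
    have curv: "is_curv X k (h \<otimes>\<^bsub>diff_char X k\<^esub> g) (\<lambda>\<sigma> t. \<omega> \<sigma> t + \<eta> \<sigma> t)"
      using \<omega> \<eta> cycles_smooth_bd[where X = X and n = k]
      by (simp add: is_curv_def forms_add diff_char_mult expU_add
            chain_integral_form_add[OF X _ _ keys_smooth_cplx])
    have "(\<lambda>z. H z + H' z) \<in> hom (cycle_group ?K (k - 1)) real_group"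
      using hom_mult[OF real_hom_cycles[OF H(1)]] hom_mult[OF real_hom_cycles[OF H'(1)]]
      by (intro homI) simp_all
    moreover have "(h \<otimes>\<^bsub>diff_char X k\<^esub> g) z = expU (H z + H' z)" if "z \<in> cycles ?K (k - 1)" for z
      using that by (simp add: diff_char_mult expU_add H(2) H'(2))
    moreover have "of_int ((\<mu> \<otimes>\<^bsub>cochains ?K integer_group k\<^esub> \<mu>') x) =
        chain_integral (nat k) (\<lambda>\<sigma> t. \<omega> \<sigma> t + \<eta> \<sigma> t) x - (H (bd ?K k x) + H' (bd ?K k x))"
      if x: "x \<in> carrier (cgrp ?K k)" for x
    proof -
      have "\<omega> \<in> forms X (nat k)" "\<eta> \<in> forms X (nat k)"
        using \<omega> \<eta> by (simp_all add: is_curv_def)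
      then show ?thesis
        using x H(4)[OF x] H'(4)[OF x]
        by (simp add: cochains_mult chain_integral_form_add[OF X _ _ keys_smooth_cplx[OF x]])
    qed
    ultimately have "char_class X k (h \<otimes>\<^bsub>diff_char X k\<^esub> g) =
        cclass ?K integer_group k (\<mu> \<otimes>\<^bsub>cochains ?K integer_group k\<^esub> \<mu>')"
      using char_class_eq(2)[OF X k DC.m_closed[OF h g] curv] C.m_closed[OF H(3) H'(3)] by blast
    then show "char_class X k (h \<otimes>\<^bsub>diff_char X k\<^esub> g) =
        char_class X k h \<otimes>\<^bsub>H_smooth X integer_group k\<^esub> char_class X k g"
      by (simp only: cc(2) cc'(2) KZ.cclass_mult[OF cc(1) cc'(1)])
  qed
qed

section \<open>The de Rham isomorphism and flat characters\<close>

lemma cochain_cplx_smooth: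
  "cochain_cplx (smooth_cplx X) U1" "cochain_cplx (smooth_cplx X) integer_group"
  "cochain_cplx (smooth_cplx X) real_group"
  by (simp_all add: cochain_cplx_def chain_cplx_smooth comm_group_U1 abelian_integer_group comm_group_real_group)

text \<open>Meant for the inclusion of flat classes: following the second map by an injective
  homomorphism does not change its kernel.\<close>

lemma exact_at_mono:
  assumes e: "exact_at G f H g K" and L: "comm_group L" and h: "h \<in> hom K L"
    and inj: "\<And>x. \<lbrakk>x \<in> carrier K; h x = \<one>\<^bsub>L\<^esub>\<rbrakk> \<Longrightarrow> x = \<one>\<^bsub>K\<^esub>"
  shows "exact_at G f H (h \<circ> g) L"
proof -
  have g: "comm_group G" "comm_group H" "comm_group K" "f \<in> hom G H" "g \<in> hom H K" "f ` carrier G = kernel H K g"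
    using e by (simp_all only: exact_at_def)
  have "h \<one>\<^bsub>K\<^esub> = \<one>\<^bsub>L\<^esub>"
    using h g(3) L by (intro hom_one) (simp_all add: comm_group_def)
  then have "kernel H L (h \<circ> g) = kernel H K g"
    using inj hom_in_carrier[OF g(5)] by (auto simp: kernel_def)
  with g L hom_compose[OF g(5) h] show ?thesis
    by (simp only: exact_at_def)
qed

text \<open>Meant for the characteristic class: preceding the first map by a surjective homomorphism
  does not change its image.\<close>

lemma exact_at_epi:
  assumes e: "exact_at G f H g K" and L: "comm_group L" and h: "h \<in> hom L G" "h ` carrier L = carrier G"
    and f': "\<And>x. x \<in> carrier L \<Longrightarrow> f' x = f (h x)" "f' \<in> hom L H"
  shows "exact_at L f' H g K"
proof -
  have "f' ` carrier L = f ` carrier G"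
    unfolding h(2)[symmetric] by (simp add: image_image f'(1) cong: image_cong)
  with e L f'(2) show ?thesis
    by (simp only: exact_at_def)
qed

lemma closed_form_integral_boundary:
  assumes X: "smooth_space X" and \<omega>: "\<omega> \<in> closed_forms X m"
    and c: "c \<in> carrier (cgrp (smooth_cplx X) (int (Suc m)))"
  shows "chain_integral m \<omega> (bd (smooth_cplx X) (int (Suc m)) c) = 0"
  using stokes[OF smooth_spaceD(2)[OF X] _ c, of \<omega>] \<omega>
  by (simp add: closed_forms_def bd_smooth_cplx del: of_nat_Suc)

lemma integration_cochain_cocycle:
  assumes X: "smooth_space X" and \<omega>: "\<omega> \<in> closed_forms X m"
  shows "integration_cochain X m \<omega> \<in> cocycles (smooth_cplx X) real_group (int m)"
proof -
  interpret R: cochain_cplx "smooth_cplx X" real_group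
    by (rule cochain_cplx_smooth)
  have *: "int m + 1 = int (Suc m)"
    by simp
  show ?thesis
    unfolding R.cocycle_iff integration_cochain_def
  proof (intro conjI ballI R.cochain_restrict chain_integral_hom)
    fix c assume c: "c \<in> carrier (cgrp (smooth_cplx X) (int m + 1))"
    then show "(\<lambda>c\<in>carrier (cgrp (smooth_cplx X) (int m)). chain_integral m \<omega> c) (bd (smooth_cplx X) (int m + 1) c) = \<one>\<^bsub>real_group\<^esub>"
      using R.bd_in_Suc[OF c] closed_form_integral_boundary[OF assms, of c] by (simp add: *)
  qed
qed

abbreviation "closed_form_group X k \<equiv>
  \<lparr>carrier = closed_forms X k, monoid.mult = (\<lambda>\<omega> \<eta> \<sigma> t. \<omega> \<sigma> t + \<eta> \<sigma> t), one = (\<lambda>_ _. 0)\<rparr>"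

abbreviation "integral_class X k a \<equiv>
  the_elem ((\<lambda>\<omega>. cclass (smooth_cplx X) real_group (int k) (integration_cochain X k \<omega>)) ` a)"

text \<open>By Stokes an exact form integrates to a coboundary, so every form in the coset yields
  the same class and \<open>the_elem\<close> returns it.\<close>

lemma integral_class_coset:
  assumes X: "smooth_space X" and \<omega>: "\<omega> \<in> closed_forms X (Suc m)"
  shows "integral_class X (Suc m) (exact_forms X (Suc m) #>\<^bsub>closed_form_group X (Suc m)\<^esub> \<omega>) =
     cclass (smooth_cplx X) real_group (int (Suc m)) (integration_cochain X (Suc m) \<omega>)"
proof -
  interpret R: cochain_cplx "smooth_cplx X" real_group
    by (rule cochain_cplx_smooth)
  note dX = smooth_spaceD(1)[OF X]
  let ?C = "\<lambda>\<omega>. cclass (smooth_cplx X) real_group (int (Suc m)) (integration_cochain X (Suc m) \<omega>)"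
  let ?a = "exact_forms X (Suc m) #>\<^bsub>closed_form_group X (Suc m)\<^esub> \<omega>"
  have mem: "\<omega>' \<in> ?a \<longleftrightarrow> (\<exists>\<xi>\<in>forms X m. \<omega>' = (\<lambda>\<sigma> t. ext_deriv X m \<xi> \<sigma> t + \<omega> \<sigma> t))" for \<omega>'
    by (auto simp: r_coset_def exact_forms_def)
  have nonempty: "\<omega> \<in> ?a"
    unfolding mem by (rule bexI[OF _ forms_0]) (simp add: ext_deriv_0[OF dX])
  have const: "?C \<omega>' = ?C \<omega>" if \<omega>': "\<omega>' \<in> ?a" for \<omega>'
  proof -
    obtain \<xi> where \<xi>: "\<xi> \<in> forms X m" and eq: "\<omega>' = (\<lambda>\<sigma> t. ext_deriv X m \<xi> \<sigma> t + \<omega> \<sigma> t)"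
      using \<omega>' unfolding mem by (elim bexE)
    have f: "\<omega> \<in> forms X (Suc m)"
      using \<omega> by (simp add: closed_forms_def)
    have int: "chain_integral (Suc m) \<omega>' c = chain_integral m \<xi> (bd (smooth_cplx X) (int (Suc m)) c) + chain_integral (Suc m) \<omega> c"
      if c: "c \<in> carrier (cgrp (smooth_cplx X) (int (Suc m)))" for c
      using chain_integral_form_add[OF dX ext_deriv_in_forms[OF dX \<xi>] f, of c] keys_smooth_cplx[OF c]
        stokes[OF smooth_spaceD(2)[OF X] \<xi> c]
      by (simp add: eq bd_smooth_cplx del: of_nat_Suc)
    have coc: "integration_cochain X (Suc m) \<omega> \<in> cocycles (smooth_cplx X) real_group (int (Suc m))"
      by (rule integration_cochain_cocycle[OF X \<omega>])
    have coc': "integration_cochain X (Suc m) \<omega>' \<in> cocycles (smooth_cplx X) real_group (int (Suc m))"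
      unfolding R.cocycle_iff integration_cochain_def
    proof (intro conjI ballI R.cochain_restrict chain_integral_hom)
      fix c assume c: "c \<in> carrier (cgrp (smooth_cplx X) (int (Suc m) + 1))"
      then have "c \<in> carrier (cgrp (smooth_cplx X) (int (Suc (Suc m))))"
        by (simp add: add.commute)
      from closed_form_integral_boundary[OF X \<omega> this]
      have "chain_integral (Suc m) \<omega> (bd (smooth_cplx X) (int (Suc m) + 1) c) = 0"
        by (simp add: add.commute)
      then show "(\<lambda>c\<in>carrier (cgrp (smooth_cplx X) (int (Suc m))). chain_integral (Suc m) \<omega>' c)
          (bd (smooth_cplx X) (int (Suc m) + 1) c) = \<one>\<^bsub>real_group\<^esub>"
        using R.bd_in_Suc[OF c] int[OF R.bd_in_Suc[OF c]] R.bd_bd_Suc[OF c] by (simp del: of_nat_Suc)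
    qed
    show ?thesis
      unfolding R.cclass_eq_iff[OF coc' coc]
    proof (intro bexI ballI)
      show "(\<lambda>c\<in>carrier (cgrp (smooth_cplx X) (int (Suc m) - 1)). chain_integral m \<xi> c)
          \<in> carrier (cochains (smooth_cplx X) real_group (int (Suc m) - 1))"
        by (rule R.cochain_restrict[OF chain_integral_hom])
      fix c assume c: "c \<in> carrier (cgrp (smooth_cplx X) (int (Suc m)))"
      then show "integration_cochain X (Suc m) \<omega>' c =
          (\<lambda>c\<in>carrier (cgrp (smooth_cplx X) (int (Suc m) - 1)). chain_integral m \<xi> c) (bd (smooth_cplx X) (int (Suc m)) c)
            \<otimes>\<^bsub>real_group\<^esub> integration_cochain X (Suc m) \<omega> c"
        using int[OF c] R.bd_in[OF c] by (simp add: integration_cochain_def del: of_nat_Suc)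
    qed
  qed
  show ?thesis
    by (rule the_elem_image_unique[where f = ?C, OF _ const]) (use nonempty in blast)
qed

text \<open>Surjectivity of the de Rham map unfolded to representatives: characters are constructed
  from the form and the cochain \<open>u\<close> themselves, not from an equality of
  classes.\<close>

lemma de_rham_surj:
  assumes X: "smooth_space X" and k: "1 \<le> k" and f: "f \<in> cocycles (smooth_cplx X) real_group k"
  obtains \<omega> u where "\<omega> \<in> closed_forms X (nat k)" "u \<in> hom (cgrp (smooth_cplx X) (k - 1)) real_group"
    "\<And>c. c \<in> carrier (cgrp (smooth_cplx X) k) \<Longrightarrow> chain_integral (nat k) \<omega> c = u (bd (smooth_cplx X) k c) + f c"
proof -
  interpret R: cochain_cplx "smooth_cplx X" real_group
    by (rule cochain_cplx_smooth)
  define m where "m = nat (k - 1)"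
  have km: "k = int (Suc m)" "nat k = Suc m"
    using k by (simp_all add: m_def nat_diff_distrib)
  have "integral_class X (Suc m) \<in> iso (de_rham X (Suc m)) (cohomology (smooth_cplx X) real_group (int (Suc m)))"
    using smooth_spaceD(2)[OF X] unfolding de_rham_theorem_def by blast
  then have "integral_class X (Suc m) ` carrier (de_rham X (Suc m)) = carrier (cohomology (smooth_cplx X) real_group (int (Suc m)))"
    by (simp only: iso_iff)
  moreover have "cclass (smooth_cplx X) real_group (int (Suc m)) f \<in> carrier (cohomology (smooth_cplx X) real_group (int (Suc m)))"
    using R.cclass_in[OF f] by (simp only: km)
  ultimately have "cclass (smooth_cplx X) real_group (int (Suc m)) f \<in> integral_class X (Suc m) ` carrier (de_rham X (Suc m))"
    by simp
  then obtain a where a: "a \<in> carrier (de_rham X (Suc m))"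
    "cclass (smooth_cplx X) real_group (int (Suc m)) f = integral_class X (Suc m) a"
    by (elim imageE)
  obtain \<omega> where \<omega>: "\<omega> \<in> closed_forms X (Suc m)" "a = exact_forms X (Suc m) #>\<^bsub>closed_form_group X (Suc m)\<^esub> \<omega>"
    using a(1) by (auto simp: de_rham_def FactGroup_def RCOSETS_def)
  have coc: "integration_cochain X (Suc m) \<omega> \<in> cocycles (smooth_cplx X) real_group (int (Suc m))"
    by (rule integration_cochain_cocycle[OF X \<omega>(1)])
  have f': "f \<in> cocycles (smooth_cplx X) real_group (int (Suc m))"
    using f by (simp only: km)
  have "cclass (smooth_cplx X) real_group (int (Suc m)) (integration_cochain X (Suc m) \<omega>) =
      cclass (smooth_cplx X) real_group (int (Suc m)) f"
    using a(2) by (simp only: \<omega>(2) integral_class_coset[OF X \<omega>(1)])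
  then obtain u where u: "u \<in> carrier (cochains (smooth_cplx X) real_group (int (Suc m) - 1))"
    "\<forall>c\<in>carrier (cgrp (smooth_cplx X) (int (Suc m))).
       integration_cochain X (Suc m) \<omega> c = u (bd (smooth_cplx X) (int (Suc m)) c) \<otimes>\<^bsub>real_group\<^esub> f c"
    unfolding R.cclass_eq_iff[OF coc f'] by (elim bexE)
  show ?thesis
  proof (rule that)
    show "\<omega> \<in> closed_forms X (nat k)"
      using \<omega>(1) by (simp only: km(2))
    show "u \<in> hom (cgrp (smooth_cplx X) (k - 1)) real_group"
      using u(1) unfolding km(1) by (simp only: cochains_carrier_iff)
    show "chain_integral (nat k) \<omega> c = u (bd (smooth_cplx X) k c) + f c"
      if "c \<in> carrier (cgrp (smooth_cplx X) k)" for c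
      using u(2)[rule_format, of c] that unfolding km(2) by (simp add: km(1) integration_cochain_def del: of_nat_Suc)
  qed
qed

text \<open>Injectivity of the de Rham map on representatives: if the integration cochain is a
  coboundary, the form lies in the coset of 0, which consists of exact forms.\<close>

lemma de_rham_exact:
  assumes X: "smooth_space X" and k: "1 \<le> k" and \<omega>: "\<omega> \<in> closed_forms X (nat k)"
    and u: "u \<in> hom (cgrp (smooth_cplx X) (k - 1)) real_group"
    and eq: "\<And>c. c \<in> carrier (cgrp (smooth_cplx X) k) \<Longrightarrow> chain_integral (nat k) \<omega> c = u (bd (smooth_cplx X) k c)"
  shows "\<exists>\<theta>\<in>forms X (nat (k - 1)). ext_deriv X (nat (k - 1)) \<theta> = \<omega>"
proof -
  interpret R: cochain_cplx "smooth_cplx X" real_group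
    by (rule cochain_cplx_smooth)
  note dX = smooth_spaceD(1)[OF X]
  define m where "m = nat (k - 1)"
  have km: "k = int (Suc m)" "nat k = Suc m"
    using k by (simp_all add: m_def nat_diff_distrib)
  have \<omega>: "\<omega> \<in> closed_forms X (Suc m)"
    using \<omega> by (simp only: km(2))
  have zero: "(\<lambda>_ _. 0) \<in> closed_forms X (Suc m)"
    by (simp add: closed_forms_def forms_0 ext_deriv_0[OF dX])
  let ?coset = "\<lambda>\<omega>. exact_forms X (Suc m) #>\<^bsub>closed_form_group X (Suc m)\<^esub> \<omega>"
  have one: "cclass (smooth_cplx X) real_group (int (Suc m)) (integration_cochain X (Suc m) \<eta>) =
      \<one>\<^bsub>cohomology (smooth_cplx X) real_group (int (Suc m))\<^esub>"
    if \<eta>: "\<eta> \<in> closed_forms X (Suc m)" and w: "w \<in> hom (cgrp (smooth_cplx X) (int (Suc m) - 1)) real_group"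
      and int: "\<And>c. c \<in> carrier (cgrp (smooth_cplx X) (int (Suc m))) \<Longrightarrow> chain_integral (Suc m) \<eta> c = w (bd (smooth_cplx X) (int (Suc m)) c)"
    for \<eta> w
    unfolding R.cclass_eq_one_iff[OF integration_cochain_cocycle[OF X \<eta>]]
  proof (intro bexI ballI)
    show "(\<lambda>c\<in>carrier (cgrp (smooth_cplx X) (int (Suc m) - 1)). w c) \<in> carrier (cochains (smooth_cplx X) real_group (int (Suc m) - 1))"
      by (rule R.cochain_restrict[OF w])
    show "integration_cochain X (Suc m) \<eta> c =
        (\<lambda>c\<in>carrier (cgrp (smooth_cplx X) (int (Suc m) - 1)). w c) (bd (smooth_cplx X) (int (Suc m)) c)"
      if "c \<in> carrier (cgrp (smooth_cplx X) (int (Suc m)))" for c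
      using int[OF that] that R.bd_in[OF that] by (simp add: integration_cochain_def del: of_nat_Suc)
  qed
  have "integral_class X (Suc m) \<in> iso (de_rham X (Suc m)) (cohomology (smooth_cplx X) real_group (int (Suc m)))"
    using smooth_spaceD(2)[OF X] unfolding de_rham_theorem_def by blast
  then have inj: "inj_on (integral_class X (Suc m)) (carrier (de_rham X (Suc m)))"
    by (simp only: iso_iff)
  have carr: "?coset \<eta> \<in> carrier (de_rham X (Suc m))" if "\<eta> \<in> closed_forms X (Suc m)" for \<eta>
    using that by (auto simp: de_rham_def FactGroup_def RCOSETS_def)
  have "(\<lambda>_. 0) \<in> hom (cgrp (smooth_cplx X) (int (Suc m) - 1)) real_group"
    by (intro homI) simp_all
  from one[OF zero this]
  have "integral_class X (Suc m) (?coset (\<lambda>_ _. 0)) = \<one>\<^bsub>cohomology (smooth_cplx X) real_group (int (Suc m))\<^esub>"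
    unfolding integral_class_coset[OF X zero] by simp
  moreover have "integral_class X (Suc m) (?coset \<omega>) = \<one>\<^bsub>cohomology (smooth_cplx X) real_group (int (Suc m))\<^esub>"
    unfolding integral_class_coset[OF X \<omega>]
  proof (rule one[OF \<omega>])
    show "u \<in> hom (cgrp (smooth_cplx X) (int (Suc m) - 1)) real_group"
      using u by (simp only: km)
    show "chain_integral (Suc m) \<omega> c = u (bd (smooth_cplx X) (int (Suc m)) c)"
      if "c \<in> carrier (cgrp (smooth_cplx X) (int (Suc m)))" for c
      using eq[of c] that by (simp only: km(2)) (simp only: km(1))
  qed
  ultimately have "?coset \<omega> = ?coset (\<lambda>_ _. 0)"
    by (intro inj_onD[OF inj _ carr[OF \<omega>] carr[OF zero]]) simp
  moreover have "\<omega> \<in> ?coset \<omega>"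
  proof -
    have "(\<lambda>_ _. 0) \<in> exact_forms X (Suc m)"
      using image_eqI[of "\<lambda>_ _. 0" "ext_deriv X m", OF ext_deriv_0[OF dX, symmetric] forms_0]
      by (simp add: exact_forms_def)
    then show ?thesis
      by (auto simp: r_coset_def intro!: bexI[of _ "\<lambda>_ _. 0"])
  qed
  ultimately have "\<omega> \<in> ?coset (\<lambda>_ _. 0)"
    by simp
  then show ?thesis
    by (auto simp: r_coset_def exact_forms_def m_def[symmetric])
qed

text \<open>U(1)-valued coboundaries are 1 on cycles, so all representatives restrict to the same
  character.\<close>

lemma flat_incl_cclass:
  assumes f: "f \<in> cocycles (smooth_cplx X) U1 (k - 1)"
  shows "flat_incl X k (cclass (smooth_cplx X) U1 (k - 1) f) = (\<lambda>z\<in>cycles (smooth_cplx X) (k - 1). f z)"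
proof -
  interpret U: cochain_cplx "smooth_cplx X" U1
    by (rule cochain_cplx_smooth)
  show ?thesis
    unfolding flat_incl_def
  proof (rule U.the_elem_cclass[where F = "\<lambda>f. \<lambda>z\<in>cycles (smooth_cplx X) (k - 1). f z", OF f])
    fix g assume g: "g \<in> cocycles (smooth_cplx X) U1 (k - 1)"
      and eq: "cclass (smooth_cplx X) U1 (k - 1) g = cclass (smooth_cplx X) U1 (k - 1) f"
    obtain u where u: "u \<in> carrier (cochains (smooth_cplx X) U1 (k - 1 - 1))"
      "\<forall>c\<in>carrier (cgrp (smooth_cplx X) (k - 1)). g c = u (bd (smooth_cplx X) (k - 1) c) \<otimes>\<^bsub>U1\<^esub> f c"
      using eq unfolding U.cclass_eq_iff[OF g f] by (elim bexE)
    have "u 0 = 1"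
      using hom_smooth_cplx(2)[OF _ group_U1, of u X "k - 1 - 1"] u(1) by (simp add: cochains_carrier_iff)
    then show "(\<lambda>z\<in>cycles (smooth_cplx X) (k - 1). g z) = (\<lambda>z\<in>cycles (smooth_cplx X) (k - 1). f z)"
      using u(2) by (intro restrict_ext) (simp add: cycles_smooth_iff)
  qed
qed

lemma flat_incl_hom:
  assumes X: "differential_space X"
  shows "flat_incl X k \<in> hom (H_smooth X U1 (k - 1)) (diff_char X k)"
proof -
  interpret U: cochain_cplx "smooth_cplx X" U1
    by (rule cochain_cplx_smooth)
  show ?thesis
  proof (rule U.cohomology_homI[where F' = "\<lambda>f. \<lambda>z\<in>cycles (smooth_cplx X) (k - 1). f z", OF flat_incl_cclass])
    fix f assume f: "f \<in> cocycles (smooth_cplx X) U1 (k - 1)"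
    have "(\<lambda>z\<in>cycles (smooth_cplx X) (k - 1). f z) \<in> hom (cycle_group (smooth_cplx X) (k - 1)) U1"
      using group.hom_restrict[OF group_cycle_group_smooth U.hom_cycle_group_restrict[OF U.cocycleD(2)[OF f]]]
      by simp
    moreover have "is_curv X k (\<lambda>z\<in>cycles (smooth_cplx X) (k - 1). f z) (\<lambda>_ _. 0)"
      using U.cocycleD(5)[OF f] cycles_smooth_bd[where X = X and n = k]
      by (simp add: is_curv_def forms_0)
    ultimately show "(\<lambda>z\<in>cycles (smooth_cplx X) (k - 1). f z) \<in> carrier (diff_char X k)"
      by (auto simp: diff_char_carrier_iff)
    fix g assume g: "g \<in> cocycles (smooth_cplx X) U1 (k - 1)"
    show "(\<lambda>z\<in>cycles (smooth_cplx X) (k - 1). (f \<otimes>\<^bsub>cochains (smooth_cplx X) U1 (k - 1)\<^esub> g) z) =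
        (\<lambda>z\<in>cycles (smooth_cplx X) (k - 1). f z) \<otimes>\<^bsub>diff_char X k\<^esub> (\<lambda>z\<in>cycles (smooth_cplx X) (k - 1). g z)"
      unfolding diff_char_mult by (intro restrict_ext) (simp add: cochains_mult cycles_smooth_iff)
  qed
qed

text \<open>A cocycle that is 1 on cycles factors through the boundary operator. Divisibility of
  U(1) extends the factor from the boundaries to all chains, and this is a primitive.\<close>

lemma flat_incl_eq_one:
  assumes \<alpha>: "\<alpha> \<in> carrier (H_smooth X U1 (k - 1))" "flat_incl X k \<alpha> = \<one>\<^bsub>diff_char X k\<^esub>"
  shows "\<alpha> = \<one>\<^bsub>H_smooth X U1 (k - 1)\<^esub>"
proof -
  interpret U: cochain_cplx "smooth_cplx X" U1
    by (rule cochain_cplx_smooth)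
  obtain f where f: "f \<in> cocycles (smooth_cplx X) U1 (k - 1)" "\<alpha> = cclass (smooth_cplx X) U1 (k - 1) f"
    using \<alpha>(1) by (auto simp: U.carrier_cohomology)
  have f1: "f z = 1" if "z \<in> cycles (smooth_cplx X) (k - 1)" for z
    using fun_cong[OF \<alpha>(2), of z] that by (simp add: f(2) flat_incl_cclass[OF f(1)] diff_char_one)
  obtain u where u: "u \<in> hom (cgrp (smooth_cplx X) (k - 1 - 1)) U1"
    "\<And>c. c \<in> carrier (cgrp (smooth_cplx X) (k - 1)) \<Longrightarrow> u (bd (smooth_cplx X) (k - 1) c) = f c"
  proof (rule divisible_group_extension[OF U.grp divisible_group_U1 U.group_cgrp U.bd_hom U.cocycleD(2)[OF f(1)]])
    show "f c = \<one>\<^bsub>U1\<^esub>" if "c \<in> carrier (cgrp (smooth_cplx X) (k - 1))"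
      "bd (smooth_cplx X) (k - 1) c = \<one>\<^bsub>cgrp (smooth_cplx X) (k - 1 - 1)\<^esub>" for c
      using f1[of c] that by (simp add: cycles_smooth_iff)
  qed (use that in blast)
  show ?thesis
    unfolding f(2) U.cclass_eq_one_iff[OF f(1)]
  proof (intro bexI[OF _ U.cochain_restrict[OF u(1)]] ballI)
    show "f c = (\<lambda>c\<in>carrier (cgrp (smooth_cplx X) (k - 1 - 1)). u c) (bd (smooth_cplx X) (k - 1) c)"
      if "c \<in> carrier (cgrp (smooth_cplx X) (k - 1))" for c
      using u(2)[OF that] U.bd_in[OF that] by simp
  qed
qed

text \<open>The integral cocycle \<mu>, seen as a real one, is represented by a closed form up to
  the coboundary of \<open>u\<close>. Then \<open>u\<close> on cycles, taken modulo the integers, is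
  a character with this form as curvature and \<open>u\<close> as lift, and its integral cochain is
  \<mu> itself.\<close>

lemma char_class_surj:
  assumes X: "smooth_space X" and k: "2 \<le> k"
  shows "char_class X k ` carrier (diff_char X k) = carrier (H_smooth X integer_group k)"
proof (rule equalityI)
  let ?K = "smooth_cplx X"
  note dX = smooth_spaceD(1)[OF X]
  interpret KZ: cochain_cplx ?K integer_group
    by (rule cochain_cplx_smooth)
  interpret KR: cochain_cplx ?K real_group
    by (rule cochain_cplx_smooth)
  show "char_class X k ` carrier (diff_char X k) \<subseteq> carrier (H_smooth X integer_group k)"
    by (rule image_subsetI) (rule hom_in_carrier[OF char_class_hom[OF dX k]])
  show "carrier (H_smooth X integer_group k) \<subseteq> char_class X k ` carrier (diff_char X k)"
  proof
    fix \<alpha> assume "\<alpha> \<in> carrier (H_smooth X integer_group k)"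
    then obtain \<mu> where \<mu>: "\<mu> \<in> cocycles ?K integer_group k" "\<alpha> = cclass ?K integer_group k \<mu>"
      by (auto simp: KZ.carrier_cohomology)
    have real: "(\<lambda>c\<in>carrier (cgrp ?K k). real_of_int (\<mu> c)) \<in> cocycles ?K real_group k"
      unfolding KR.cocycle_iff
    proof (intro conjI ballI KR.cochain_restrict int_cochain_real KZ.cocycleD(2)[OF \<mu>(1)])
      show "(\<lambda>c\<in>carrier (cgrp ?K k). real_of_int (\<mu> c)) (bd ?K (k + 1) c) = \<one>\<^bsub>real_group\<^esub>"
        if "c \<in> carrier (cgrp ?K (k + 1))" for c
        using KZ.cocycleD(5)[OF \<mu>(1) that] KZ.bd_in_Suc[OF that] by simp
    qed
    have k1: "1 \<le> k"
      using k by simp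
    obtain \<omega> u where \<omega>: "\<omega> \<in> closed_forms X (nat k)" and u: "u \<in> hom (cgrp ?K (k - 1)) real_group"
      "\<And>c. c \<in> carrier (cgrp ?K k) \<Longrightarrow>
        chain_integral (nat k) \<omega> c = u (bd ?K k c) + (\<lambda>c\<in>carrier (cgrp ?K k). real_of_int (\<mu> c)) c"
      by (rule de_rham_surj[OF X k1 real]) (rule that)
    have int: "chain_integral (nat k) \<omega> c = u (bd ?K k c) + of_int (\<mu> c)" if "c \<in> carrier (cgrp ?K k)" for c
      using u(2)[OF that] that by simp
    let ?h = "\<lambda>z\<in>cycles ?K (k - 1). expU (u z)"
    have "(\<lambda>z. expU (u z)) \<in> hom (cycle_group ?K (k - 1)) U1"
      by (rule hom_expU[OF real_hom_cycles[OF u(1)]])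
    then have "?h \<in> hom (cycle_group ?K (k - 1)) U1"
      using group.hom_restrict[OF group_cycle_group_smooth, of _ X "k - 1" U1] by simp
    moreover have curv: "is_curv X k ?h \<omega>"
      using \<omega> cycles_smooth_bd[where X = X and n = k]
      by (simp add: is_curv_def closed_forms_def int expU_add expU_of_int)
    ultimately have h: "?h \<in> carrier (diff_char X k)"
      by (auto simp: diff_char_carrier_iff)
    have "char_class X k ?h = \<alpha>"
      unfolding \<mu>(2)
    proof (rule char_class_eq(2)[OF dX k h curv real_hom_cycles[OF u(1)] _ KZ.cocycleD(1)[OF \<mu>(1)]])
      show "of_int (\<mu> x) = chain_integral (nat k) \<omega> x - u (bd ?K k x)" if "x \<in> carrier (cgrp ?K k)" for x
        using int[OF that] by simp
    qed simp
    with h show "\<alpha> \<in> char_class X k ` carrier (diff_char X k)"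
      by blast
  qed
qed

section \<open>Relative differential characters\<close>

lemma (in smooth_mapping) cone_cycle_iff:
  "(s, t) \<in> cycles mcone n \<longleftrightarrow>
     s \<in> CX n \<and> t \<in> CA (n - 1) \<and> dX n s + ps (n - 1) t = 0 \<and> dA (n - 1) t = 0"
  by (auto simp: cycles_def carrier_mapping_cone bd_mapping_cone)

lemma (in smooth_mapping) group_cone_cycle_group: "group (cycle_group mcone n)"
  by (rule chain_cplx.group_cycle_group[OF chain_cplx_cone])

lemma (in smooth_mapping) cone_cycle_hom_U1:
  assumes f: "f \<in> hom (cycle_group mcone n) U1"
  shows "\<lbrakk>(s, t) \<in> cycles mcone n; (s', t') \<in> cycles mcone n\<rbrakk> \<Longrightarrow> f (s + s', t + t') = f (s, t) * f (s', t')"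
    and "f (0, 0) = 1"
    and "c \<in> cycles mcone n \<Longrightarrow> norm (f c) = 1"
proof -
  interpret f: group_hom "cycle_group mcone n" U1 f
    using f group_cone_cycle_group group_U1 by (simp add: group_hom_def group_hom_axioms_def)
  show "\<lbrakk>(s, t) \<in> cycles mcone n; (s', t') \<in> cycles mcone n\<rbrakk> \<Longrightarrow> f (s + s', t + t') = f (s, t) * f (s', t')"
    using f.hom_mult[of "(s, t)" "(s', t')"] by simp
  show "f (0, 0) = 1"
    using f.hom_one by simp
  show "c \<in> cycles mcone n \<Longrightarrow> norm (f c) = 1"
    using f.hom_closed[of c] by simp
qed

lemma (in smooth_mapping) cone_cycles_bd:
  "\<lbrakk>x \<in> CX n; y \<in> CA (n - 1)\<rbrakk> \<Longrightarrow> bd mcone n (x, y) \<in> cycles mcone (n - 1)"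
  using chain_cplx.bd_in_cycles[OF chain_cplx_cone, of "(x, y)" "n - 1"]
  by (simp add: carrier_mapping_cone)

text \<open>Names the pair of forms of a relative character and writes cone chains by components, in
  parallel to \<open>is_curv\<close>.\<close>

definition is_rel_curv ::
    "('b \<Rightarrow> 'a) \<Rightarrow> 'a dspace \<Rightarrow> 'b dspace \<Rightarrow> int \<Rightarrow> ('a chain \<times> 'b chain \<Rightarrow> complex)
      \<Rightarrow> 'a form \<Rightarrow> 'b form \<Rightarrow> bool" where
  "is_rel_curv \<phi> X A k f \<omega> \<theta> \<longleftrightarrow> \<omega> \<in> forms X (nat k) \<and> \<theta> \<in> forms A (nat (k - 1)) \<and>
     (\<forall>x \<in> carrier (cgrp (smooth_cplx X) k). \<forall>y \<in> carrier (cgrp (smooth_cplx A) (k - 1)).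
        f (bd (mapping_cone \<phi> X A) k (x, y)) =
          expU (chain_integral (nat k) \<omega> x + chain_integral (nat (k - 1)) \<theta> y))"

lemma rel_diff_char_eq:
  "rel_diff_char \<phi> X A k = (hom_group (cycle_group (mapping_cone \<phi> X A) (k - 1)) U1)
     \<lparr>carrier := {f \<in> carrier (hom_group (cycle_group (mapping_cone \<phi> X A) (k - 1)) U1).
        \<exists>\<omega> \<theta>. is_rel_curv \<phi> X A k f \<omega> \<theta>}\<rparr>"
proof -
  have "(\<exists>\<omega> \<in> forms X (nat k). \<exists>\<theta> \<in> forms A (nat (k - 1)).
          \<forall>(x, y) \<in> carrier (cgrp (mapping_cone \<phi> X A) k).
            f (bd (mapping_cone \<phi> X A) k (x, y))
              = expU (chain_integral (nat k) \<omega> x + chain_integral (nat (k - 1)) \<theta> y)) \<longleftrightarrow>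
        (\<exists>\<omega> \<theta>. is_rel_curv \<phi> X A k f \<omega> \<theta>)" for f
    unfolding is_rel_curv_def carrier_mapping_cone by fast
  then show ?thesis
    by (simp only: rel_diff_char_def)
qed

lemma rel_diff_char_carrier_iff:
  "f \<in> carrier (rel_diff_char \<phi> X A k) \<longleftrightarrow> f \<in> hom (cycle_group (mapping_cone \<phi> X A) (k - 1)) U1 \<and>
     f \<in> extensional (cycles (mapping_cone \<phi> X A) (k - 1)) \<and> (\<exists>\<omega> \<theta>. is_rel_curv \<phi> X A k f \<omega> \<theta>)"
  by (simp add: rel_diff_char_eq hom_group_def)

lemma rel_diff_char_mult:
  "f \<otimes>\<^bsub>rel_diff_char \<phi> X A k\<^esub> g = (\<lambda>z\<in>cycles (mapping_cone \<phi> X A) (k - 1). f z * g z)"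
  by (simp add: rel_diff_char_def hom_group_def)

lemma rel_diff_char_one:
  "\<one>\<^bsub>rel_diff_char \<phi> X A k\<^esub> = (\<lambda>z\<in>cycles (mapping_cone \<phi> X A) (k - 1). 1)"
  by (simp add: rel_diff_char_def hom_group_def)

lemma (in smooth_mapping) comm_group_rel_diff_char: "comm_group (rel_diff_char \<phi> X A k)"
proof -
  let ?H = "hom_group (cycle_group mcone (k - 1)) U1"
  interpret H: comm_group ?H
    by (rule comm_group_hom_group[OF group_cone_cycle_group comm_group_U1])
  note bdc = cone_cycles_bd[where n = k]
  let ?S = "{f \<in> carrier ?H. \<exists>\<omega> \<theta>. is_rel_curv \<phi> X A k f \<omega> \<theta>}"
  have "subgroup ?S ?H"
  proof (rule H.subgroupI)
    show "?S \<subseteq> carrier ?H"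
      by blast
    have "is_rel_curv \<phi> X A k \<one>\<^bsub>?H\<^esub> (\<lambda>_ _. 0) (\<lambda>_ _. 0)"
      by (simp add: is_rel_curv_def forms_0 bdc hom_group_def)
    then show "?S \<noteq> {}"
      using H.one_closed by (auto intro!: exI[of _ "\<one>\<^bsub>?H\<^esub>"])
    show "inv\<^bsub>?H\<^esub> f \<in> ?S" if fS: "f \<in> ?S" for f
    proof -
      obtain \<omega> \<theta> where f: "f \<in> carrier ?H" and \<omega>: "is_rel_curv \<phi> X A k f \<omega> \<theta>"
        using fS by blast
      have ff: "f \<in> hom (cycle_group mcone (k - 1)) U1"
        using f by (simp add: hom_group_def)
      have "is_rel_curv \<phi> X A k (inv\<^bsub>?H\<^esub> f) (\<lambda>\<sigma> t. - \<omega> \<sigma> t) (\<lambda>\<sigma> t. - \<theta> \<sigma> t)"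
        using \<omega> bdc cone_cycle_hom_U1(3)[OF ff]
        by (simp add: is_rel_curv_def forms_uminus X A inv_hom_group[OF group_cone_cycle_group comm_group_U1 f]
            chain_integral_form_uminus expU_uminus expU_add expU_diff inv_U1 divide_inverse norm_mult)
      then show ?thesis
        using H.inv_closed[OF f] by blast
    qed
    show "f \<otimes>\<^bsub>?H\<^esub> g \<in> ?S" if fS: "f \<in> ?S" and gS: "g \<in> ?S" for f g
    proof -
      obtain \<omega> \<theta> where f: "f \<in> carrier ?H" and \<omega>: "is_rel_curv \<phi> X A k f \<omega> \<theta>"
        using fS by blast
      obtain \<omega>' \<theta>' where g: "g \<in> carrier ?H" and \<omega>': "is_rel_curv \<phi> X A k g \<omega>' \<theta>'"
        using gS by blast
      have "is_rel_curv \<phi> X A k (f \<otimes>\<^bsub>?H\<^esub> g) (\<lambda>\<sigma> t. \<omega> \<sigma> t + \<omega>' \<sigma> t) (\<lambda>\<sigma> t. \<theta> \<sigma> t + \<theta>' \<sigma> t)"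
        using \<omega> \<omega>' bdc
        by (simp add: is_rel_curv_def forms_add hom_group_def expU_add
            chain_integral_form_add[OF X _ _ keys_smooth_cplx] chain_integral_form_add[OF A _ _ keys_smooth_cplx])
      then show ?thesis
        using H.m_closed[OF f g] by blast
    qed
  qed
  from comm_group_subgroup[OF H.comm_group_axioms this] show ?thesis
    by (simp only: rel_diff_char_eq)
qed

lemma (in smooth_mapping) ps_cycles:
  "z \<in> cycles (smooth_cplx A) n \<Longrightarrow> ps n z \<in> cycles (smooth_cplx X) n"
  using ps_in[of z n] dX_ps[of z n] by (simp add: cycles_smooth_iff)

lemma (in smooth_mapping) char_pull_curv:
  assumes \<omega>: "is_curv X k h \<omega>"
  shows "is_curv A k (char_pull \<phi> A k h) (form_pull \<phi> A (nat k) \<omega>)"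
  unfolding is_curv_def
proof (intro conjI ballI)
  show "form_pull \<phi> A (nat k) \<omega> \<in> forms A (nat k)"
    using form_pull_in_forms[OF A X \<phi>] \<omega> by (simp add: is_curv_def)
  fix c assume c: "c \<in> CA k"
  have "h (dX k (ps k c)) = expU (chain_integral (nat k) \<omega> (ps k c))"
    using \<omega> ps_in[OF c] by (simp add: is_curv_def)
  then show "char_pull \<phi> A k h (dA k c) = expU (chain_integral (nat k) (form_pull \<phi> A (nat k) \<omega>) c)"
    using cycles_smooth_bd[OF c] chain_integral_form_pull[OF keys_smooth_cplx[OF c], of \<phi> \<omega>]
    by (simp add: char_pull_def dX_ps[OF c])
qed

lemma (in smooth_mapping) char_pull_hom: "char_pull \<phi> A k \<in> hom (diff_char X k) (diff_char A k)"
proof (rule homI)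
  fix h assume h: "h \<in> carrier (diff_char X k)"
  then have hh: "h \<in> hom (cycle_group (smooth_cplx X) (k - 1)) U1"
    by (simp add: diff_char_carrier_iff)
  have "(\<lambda>z. h (ps (k - 1) z)) \<in> hom (cycle_group (smooth_cplx A) (k - 1)) U1"
    by (intro homI) (simp_all add: ps_add ps_cycles cycle_hom_U1[OF hh])
  then have "char_pull \<phi> A k h \<in> hom (cycle_group (smooth_cplx A) (k - 1)) U1"
    using group.hom_restrict[OF group_cycle_group_smooth, of "\<lambda>z. h (ps (k - 1) z)" A "k - 1" U1]
    by (simp add: char_pull_def)
  then show "char_pull \<phi> A k h \<in> carrier (diff_char A k)"
    using h char_pull_curv by (auto simp: diff_char_carrier_iff) (simp add: char_pull_def)
  fix g assume g: "g \<in> carrier (diff_char X k)"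
  show "char_pull \<phi> A k (h \<otimes>\<^bsub>diff_char X k\<^esub> g) = char_pull \<phi> A k h \<otimes>\<^bsub>diff_char A k\<^esub> char_pull \<phi> A k g"
    unfolding diff_char_mult char_pull_def by (intro restrict_ext) (simp add: ps_cycles)
qed

text \<open>Form, real lift and integral cochain can all be pulled back compatibly, so the cochain
  of the pulled back character is the pullback of that of \<open>h\<close>.\<close>

lemma (in smooth_mapping) char_class_pull:
  assumes k: "2 \<le> k" and h: "h \<in> carrier (diff_char X k)"
  shows "char_class A k (char_pull \<phi> A k h) = space_pull \<phi> A integer_group k (char_class X k h)"
proof -
  interpret Z: smooth_mapping_coeff X A \<phi> integer_group
    by (intro smooth_mapping_coeff.intro smooth_mapping_axioms abelian_integer_group)
  obtain \<omega> where \<omega>: "is_curv X k h \<omega>"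
    using h by (auto simp: diff_char_carrier_iff)
  obtain H \<mu> where H: "H \<in> hom (cgrp (smooth_cplx X) (k - 1)) real_group"
    "\<And>z. z \<in> cycles (smooth_cplx X) (k - 1) \<Longrightarrow> h z = expU (H z)"
    "\<mu> \<in> carrier (cochains (smooth_cplx X) integer_group k)"
    "\<And>x. x \<in> CX k \<Longrightarrow> of_int (\<mu> x) = chain_integral (nat k) \<omega> x - H (dX k x)"
    using char_class_lift[OF X h \<omega>] by blast
  note cc = char_class_eq[OF X k h \<omega> real_hom_cycles[OF H(1)] H(2,3,4)]
  have "(\<lambda>z. H (ps (k - 1) z)) \<in> hom (cgrp (smooth_cplx A) (k - 1)) real_group"
    using hom_mult[OF H(1) ps_in ps_in] by (intro homI) (simp_all add: ps_add)
  note HA = real_hom_cycles[OF this]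
  have "char_class A k (char_pull \<phi> A k h) = cclass (smooth_cplx A) integer_group k (\<lambda>t\<in>CA k. \<mu> (ps k t))"
  proof (rule char_class_eq(2)[OF A k hom_in_carrier[OF char_pull_hom h] char_pull_curv[OF \<omega>] HA])
    show "char_pull \<phi> A k h z = expU (H (ps (k - 1) z))" if "z \<in> cycles (smooth_cplx A) (k - 1)" for z
      using that H(2)[OF ps_cycles[OF that]] by (simp add: char_pull_def)
    show "(\<lambda>t\<in>CA k. \<mu> (ps k t)) \<in> carrier (cochains (smooth_cplx A) integer_group k)"
      by (rule Z.KA.cocycleD(1)[OF Z.pull_cocycle[OF cc(1)]])
    show "of_int ((\<lambda>t\<in>CA k. \<mu> (ps k t)) x) =
        chain_integral (nat k) (form_pull \<phi> A (nat k) \<omega>) x - H (ps (k - 1) (dA k x))" if x: "x \<in> CA k" for x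
      using x H(4)[OF ps_in[OF x]] chain_integral_form_pull[OF keys_smooth_cplx[OF x], of \<phi> \<omega>] dX_ps[OF x]
      by simp
  qed
  then show ?thesis
    by (simp only: cc(2) Z.space_pull_cclass[OF cc(1)])
qed

lemma (in smooth_mapping) i_map_apply: "(s, t) \<in> cycles mcone (k - 1) \<Longrightarrow> i_map \<phi> X A k g (s, t) = g t"
  by (simp add: i_map_def)

lemma (in smooth_mapping) cone_cycle_snd:
  "(s, t) \<in> cycles mcone n \<Longrightarrow> t \<in> cycles (smooth_cplx A) (n - 1)"
  by (simp add: cone_cycle_iff cycles_smooth_iff)

lemma (in smooth_mapping) cone_cycle_fst:
  "(s, 0) \<in> cycles mcone n \<longleftrightarrow> s \<in> cycles (smooth_cplx X) n"
  by (simp add: cone_cycle_iff cycles_smooth_iff)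

text \<open>If \<open>g\<close> has curvature \<eta>, its image has the zero form on X and the
  negative of \<eta> on A; the sign is that of the second component of the cone boundary.\<close>

lemma (in smooth_mapping) i_map_hom:
  "i_map \<phi> X A k \<in> hom (diff_char A (k - 1)) (rel_diff_char \<phi> X A k)"
proof (rule homI)
  fix g assume g: "g \<in> carrier (diff_char A (k - 1))"
  then have gh: "g \<in> hom (cycle_group (smooth_cplx A) (k - 1 - 1)) U1"
    by (simp add: diff_char_carrier_iff)
  obtain \<eta> where \<eta>: "is_curv A (k - 1) g \<eta>"
    using g by (auto simp: diff_char_carrier_iff)
  have "i_map \<phi> X A k g \<in> hom (cycle_group mcone (k - 1)) U1"
  proof (rule homI)
    fix p assume p: "p \<in> carrier (cycle_group mcone (k - 1))"
    obtain s t where st: "p = (s, t)"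
      by (cases p)
    have pc: "(s, t) \<in> cycles mcone (k - 1)"
      using p st by simp
    show "i_map \<phi> X A k g p \<in> carrier U1"
      using cycle_hom_U1(3)[OF gh cone_cycle_snd[OF pc]] by (simp add: st i_map_apply[OF pc])
    fix q assume q: "q \<in> carrier (cycle_group mcone (k - 1))"
    obtain s' t' where st': "q = (s', t')"
      by (cases q)
    have qc: "(s', t') \<in> cycles mcone (k - 1)"
      using q st' by simp
    have "p \<otimes>\<^bsub>cycle_group mcone (k - 1)\<^esub> q \<in> cycles mcone (k - 1)"
      using monoid.m_closed[OF group.is_monoid[OF group_cone_cycle_group] p q] by simp
    then have pq: "(s + s', t + t') \<in> cycles mcone (k - 1)"
      by (simp add: st st')
    show "i_map \<phi> X A k g (p \<otimes>\<^bsub>cycle_group mcone (k - 1)\<^esub> q) = i_map \<phi> X A k g p \<otimes>\<^bsub>U1\<^esub> i_map \<phi> X A k g q"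
      using cycle_hom_U1(1)[OF gh cone_cycle_snd[OF pc] cone_cycle_snd[OF qc]]
      by (simp add: st st' i_map_apply[OF pc] i_map_apply[OF qc] i_map_apply[OF pq])
  qed
  moreover have "is_rel_curv \<phi> X A k (i_map \<phi> X A k g) (\<lambda>_ _. 0) (\<lambda>\<sigma> t. - \<eta> \<sigma> t)"
    unfolding is_rel_curv_def
  proof (intro conjI ballI forms_0 forms_uminus[OF A])
    show "\<eta> \<in> forms A (nat (k - 1))"
      using \<eta> by (simp add: is_curv_def)
    fix x y assume x: "x \<in> CX k" and y: "y \<in> CA (k - 1)"
    have "i_map \<phi> X A k g (bd mcone k (x, y)) = g (- dA (k - 1) y)"
      using cone_cycles_bd[OF x y] by (simp add: bd_mapping_cone i_map_apply)
    also have "\<dots> = inverse (g (dA (k - 1) y))"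
      by (rule cycle_hom_U1(4)[OF gh cycles_smooth_bd[OF y]])
    also have "g (dA (k - 1) y) = expU (chain_integral (nat (k - 1)) \<eta> y)"
      using \<eta> y by (simp add: is_curv_def)
    finally show "i_map \<phi> X A k g (bd mcone k (x, y)) =
        expU (chain_integral (nat k) (\<lambda>_ _. 0) x + chain_integral (nat (k - 1)) (\<lambda>\<sigma> t. - \<eta> \<sigma> t) y)"
      by (simp add: chain_integral_form_uminus expU_uminus)
  qed
  moreover have "i_map \<phi> X A k g \<in> extensional (cycles mcone (k - 1))"
    unfolding i_map_def by (rule restrict_extensional)
  ultimately show "i_map \<phi> X A k g \<in> carrier (rel_diff_char \<phi> X A k)"
    unfolding rel_diff_char_carrier_iff by (intro conjI exI)
  fix g' assume g': "g' \<in> carrier (diff_char A (k - 1))"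
  show "i_map \<phi> X A k (g \<otimes>\<^bsub>diff_char A (k - 1)\<^esub> g') = i_map \<phi> X A k g \<otimes>\<^bsub>rel_diff_char \<phi> X A k\<^esub> i_map \<phi> X A k g'"
    unfolding rel_diff_char_mult
  proof (rule extensionalityI[OF _ restrict_extensional])
    show "i_map \<phi> X A k (g \<otimes>\<^bsub>diff_char A (k - 1)\<^esub> g') \<in> extensional (cycles mcone (k - 1))"
      unfolding i_map_def by (rule restrict_extensional)
    fix p assume p: "p \<in> cycles mcone (k - 1)"
    obtain s t where st: "p = (s, t)"
      by (cases p)
    have pc: "(s, t) \<in> cycles mcone (k - 1)"
      using p st by simp
    show "i_map \<phi> X A k (g \<otimes>\<^bsub>diff_char A (k - 1)\<^esub> g') p =
        (\<lambda>z\<in>cycles mcone (k - 1). i_map \<phi> X A k g z * i_map \<phi> X A k g' z) p"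
      using pc cone_cycle_snd[OF pc] by (simp add: st i_map_apply[OF pc] diff_char_mult)
  qed
qed

lemma (in smooth_mapping) p_map_hom: "p_map X k \<in> hom (rel_diff_char \<phi> X A k) (diff_char X k)"
proof (rule homI)
  fix f assume f: "f \<in> carrier (rel_diff_char \<phi> X A k)"
  then have fh: "f \<in> hom (cycle_group mcone (k - 1)) U1"
    by (simp add: rel_diff_char_carrier_iff)
  obtain \<omega> \<theta> where \<omega>: "is_rel_curv \<phi> X A k f \<omega> \<theta>"
    using f by (auto simp: rel_diff_char_carrier_iff)
  have "(\<lambda>z. f (z, 0)) \<in> hom (cycle_group (smooth_cplx X) (k - 1)) U1"
    using cone_cycle_hom_U1(1)[OF fh, of _ 0 _ 0] cone_cycle_hom_U1(3)[OF fh]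
    by (intro homI) (simp_all add: cone_cycle_fst)
  then have "p_map X k f \<in> hom (cycle_group (smooth_cplx X) (k - 1)) U1"
    using group.hom_restrict[OF group_cycle_group_smooth, of "\<lambda>z. f (z, 0)" X "k - 1" U1]
    by (simp add: p_map_def)
  moreover have "is_curv X k (p_map X k f) \<omega>"
    unfolding is_curv_def
  proof (intro conjI ballI)
    show "\<omega> \<in> forms X (nat k)"
      using \<omega> by (simp add: is_rel_curv_def)
    fix c assume c: "c \<in> CX k"
    have "f (bd mcone k (c, 0)) = expU (chain_integral (nat k) \<omega> c + chain_integral (nat (k - 1)) \<theta> 0)"
      using \<omega> c zero_smooth_cplx unfolding is_rel_curv_def by blast
    then show "p_map X k f (dX k c) = expU (chain_integral (nat k) \<omega> c)"
      using cycles_smooth_bd[OF c] by (simp add: p_map_def bd_mapping_cone)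
  qed
  moreover have "p_map X k f \<in> extensional (cycles (smooth_cplx X) (k - 1))"
    unfolding p_map_def by (rule restrict_extensional)
  ultimately show "p_map X k f \<in> carrier (diff_char X k)"
    unfolding diff_char_carrier_iff by (intro conjI exI)
  fix g assume g: "g \<in> carrier (rel_diff_char \<phi> X A k)"
  show "p_map X k (f \<otimes>\<^bsub>rel_diff_char \<phi> X A k\<^esub> g) = p_map X k f \<otimes>\<^bsub>diff_char X k\<^esub> p_map X k g"
    unfolding diff_char_mult p_map_def by (intro restrict_ext) (simp add: rel_diff_char_mult cone_cycle_fst)
qed

section \<open>Exactness at the five groups where characters meet cohomology\<close>

lemma (in smooth_mapping) exact_flat_X:
  "exact_at (H_rel \<phi> X A U1 (k - 2)) (cone_restr X U1 (k - 2))
     (H_smooth X U1 (k - 2)) (flat_incl A (k - 1) \<circ> space_pull \<phi> A U1 (k - 2)) (diff_char A (k - 1))"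
proof (rule exact_at_mono)
  interpret U: smooth_mapping_coeff X A \<phi> U1
    by (intro smooth_mapping_coeff.intro smooth_mapping_axioms comm_group_U1)
  show "exact_at (H_rel \<phi> X A U1 (k - 2)) (cone_restr X U1 (k - 2))
     (H_smooth X U1 (k - 2)) (space_pull \<phi> A U1 (k - 2)) (H_smooth A U1 (k - 2))"
    by (rule U.cone_exact_X)
  show "comm_group (diff_char A (k - 1))"
    by (rule comm_group_diff_char[OF A])
  show "flat_incl A (k - 1) \<in> hom (H_smooth A U1 (k - 2)) (diff_char A (k - 1))"
    using flat_incl_hom[OF A, of "k - 1"] by simp
  show "\<alpha> = \<one>\<^bsub>H_smooth A U1 (k - 2)\<^esub>"
    if "\<alpha> \<in> carrier (H_smooth A U1 (k - 2))" "flat_incl A (k - 1) \<alpha> = \<one>\<^bsub>diff_char A (k - 1)\<^esub>" for \<alpha>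
    using flat_incl_eq_one[of \<alpha> A "k - 1"] that by simp
qed

lemma (in smooth_mapping) exact_diff_char_A:
  "exact_at (H_smooth X U1 (k - 2)) (flat_incl A (k - 1) \<circ> space_pull \<phi> A U1 (k - 2))
     (diff_char A (k - 1)) (i_map \<phi> X A k) (rel_diff_char \<phi> X A k)"
proof -
  interpret U: smooth_mapping_coeff X A \<phi> U1
    by (intro smooth_mapping_coeff.intro smooth_mapping_axioms comm_group_U1)
  have k2: "k - 1 - 1 = k - 2" "k - 2 + 1 = k - 1"
    by simp_all
  have flat: "flat_incl A (k - 1) \<in> hom (H_smooth A U1 (k - 2)) (diff_char A (k - 1))"
    using flat_incl_hom[OF A, of "k - 1"] by simp
  have flat_eq: "(flat_incl A (k - 1) \<circ> space_pull \<phi> A U1 (k - 2)) (cclass (smooth_cplx X) U1 (k - 2) u) =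
      (\<lambda>z\<in>cycles (smooth_cplx A) (k - 2). u (ps (k - 2) z))"
    if u: "u \<in> cocycles (smooth_cplx X) U1 (k - 2)" for u
  proof -
    have "(flat_incl A (k - 1) \<circ> space_pull \<phi> A U1 (k - 2)) (cclass (smooth_cplx X) U1 (k - 2) u) =
        (\<lambda>z\<in>cycles (smooth_cplx A) (k - 2). (\<lambda>t\<in>CA (k - 2). u (ps (k - 2) t)) z)"
      using flat_incl_cclass[of "\<lambda>t\<in>CA (k - 2). u (ps (k - 2) t)" A "k - 1"] U.pull_cocycle[OF u]
      by (simp only: o_apply U.space_pull_cclass[OF u] k2)
    also have "\<dots> = (\<lambda>z\<in>cycles (smooth_cplx A) (k - 2). u (ps (k - 2) z))"
      by (rule restrict_ext) (simp add: cycles_smooth_iff)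
    finally show ?thesis .
  qed
  show ?thesis
  proof (rule exact_atI[OF U.KX.comm_group_cohomology comm_group_diff_char[OF A] comm_group_rel_diff_char
        hom_compose[OF U.space_pull_hom flat] i_map_hom])
    fix \<alpha> assume "\<alpha> \<in> carrier (H_smooth X U1 (k - 2))"
    then obtain u where u: "u \<in> cocycles (smooth_cplx X) U1 (k - 2)" "\<alpha> = cclass (smooth_cplx X) U1 (k - 2) u"
      by (auto simp: U.KX.carrier_cohomology)
    note u_hom = hom_smooth_cplx[OF U.KX.cocycleD(2)[OF u(1)] group_U1]
    show "i_map \<phi> X A k ((flat_incl A (k - 1) \<circ> space_pull \<phi> A U1 (k - 2)) \<alpha>) = \<one>\<^bsub>rel_diff_char \<phi> X A k\<^esub>"
      unfolding u(2) flat_eq[OF u(1)] rel_diff_char_one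
    proof (rule extensionalityI[OF _ restrict_extensional])
      show "i_map \<phi> X A k (\<lambda>z\<in>cycles (smooth_cplx A) (k - 2). u (ps (k - 2) z)) \<in> extensional (cycles mcone (k - 1))"
        unfolding i_map_def by (rule restrict_extensional)
      fix p assume p: "p \<in> cycles mcone (k - 1)"
      obtain s t where st: "p = (s, t)"
        by (cases p)
      have pc: "(s, t) \<in> cycles mcone (k - 1)"
        using p st by simp
      \<comment> \<open>For a cone cycle \<open>(s, t)\<close> the image of \<open>t\<close> in X is
        minus the boundary of \<open>s\<close>, and cocycles are 1 on boundaries.\<close>
      have s: "s \<in> CX (k - 1)" and eq: "dX (k - 1) s + ps (k - 2) t = 0"
        using pc by (simp_all add: cone_cycle_iff)
      have "t \<in> cycles (smooth_cplx A) (k - 2)"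
        using cone_cycle_snd[OF pc] by simp
      moreover have "ps (k - 2) t = - dX (k - 1) s"
        using eq by (simp add: eq_neg_iff_add_eq_0 add.commute)
      moreover have "u (dX (k - 1) s) = 1"
        using U.KX.cocycleD(5)[OF u(1)] s by simp
      moreover have "dX (k - 1) s \<in> CX (k - 2)"
        using d_smooth_in[OF s] by simp
      ultimately show "i_map \<phi> X A k (\<lambda>z\<in>cycles (smooth_cplx A) (k - 2). u (ps (k - 2) z)) p =
          (\<lambda>z\<in>cycles mcone (k - 1). 1) p"
        using p u_hom(3)[of "dX (k - 1) s"] by (simp add: st i_map_apply[OF pc] inv_U1)
    qed
  next
    fix g assume g: "g \<in> carrier (diff_char A (k - 1))" "i_map \<phi> X A k g = \<one>\<^bsub>rel_diff_char \<phi> X A k\<^esub>"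
    have gh: "g \<in> hom (cycle_group (smooth_cplx A) (k - 2)) U1" and ge: "g \<in> extensional (cycles (smooth_cplx A) (k - 2))"
      using g(1) by (simp_all add: diff_char_carrier_iff)
    have g1: "g t = 1" if "(s, t) \<in> cycles mcone (k - 1)" for s t
      using fun_cong[OF g(2), of "(s, t)"] that by (simp add: i_map_apply rel_diff_char_one)
    \<comment> \<open>\<open>u\<close> is prescribed to be \<open>g\<close> on images of cycles of A
      and 1 on boundaries in X, which makes it a cocycle. A relation between the two, the image of
      \<open>t\<close> plus the boundary of \<open>x\<close> being 0, is a cone cycle
      \<open>(x, t)\<close>, and there \<open>g t\<close> is 1 by assumption.\<close>
    let ?P = "cycle_group (smooth_cplx A) (k - 2) \<times>\<times> cgrp (smooth_cplx X) (k - 1)"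
    obtain u where u: "u \<in> hom (cgrp (smooth_cplx X) (k - 2)) U1"
      "\<And>p. p \<in> carrier ?P \<Longrightarrow> u ((\<lambda>(t, x). ps (k - 2) t + dX (k - 1) x) p) = (\<lambda>(t, x). g t) p"
    proof (rule divisible_group_extension[OF comm_group_smooth_cplx[of X "k - 2"] divisible_group_U1
          DirProd_group[OF group_cycle_group_smooth[of A "k - 2"] group_smooth_cplx[of X "k - 1"]],
          of "\<lambda>(t, x). ps (k - 2) t + dX (k - 1) x" "\<lambda>(t, x). g t"])
      have dx: "dX (k - 1) x \<in> CX (k - 2)" if "x \<in> CX (k - 1)" for x
        using d_smooth_in[OF that] by simp
      show "(\<lambda>(t, x). ps (k - 2) t + dX (k - 1) x) \<in> hom ?P (cgrp (smooth_cplx X) (k - 2))"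
        by (intro homI) (auto simp: cycles_smooth_iff add_smooth_cplx ps_in dx ps_add d_smooth_add)
      show "(\<lambda>(t, x). g t) \<in> hom ?P U1"
        by (intro homI) (auto simp: cycle_hom_U1(1,3)[OF gh])
      show "(\<lambda>(t, x). g t) p = \<one>\<^bsub>U1\<^esub>"
        if p: "p \<in> carrier ?P" "(\<lambda>(t, x). ps (k - 2) t + dX (k - 1) x) p = \<one>\<^bsub>cgrp (smooth_cplx X) (k - 2)\<^esub>" for p
      proof -
        obtain t x where tx: "p = (t, x)"
          by (cases p)
        have "(x, t) \<in> cycles mcone (k - 1)"
          using p by (simp add: tx cone_cycle_iff cycles_smooth_iff add.commute)
        then show ?thesis
          using g1 by (simp add: tx)
      qed
    qed (use that in blast)
    have u_ps: "u (ps (k - 2) t) = g t" if "t \<in> cycles (smooth_cplx A) (k - 2)" for t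
      using u(2)[of "(t, 0)"] that by simp
    have u_dX: "u (dX (k - 1) x) = 1" if "x \<in> CX (k - 1)" for x
      using u(2)[of "(0, x)"] that cycle_hom_U1(2)[OF gh] by simp
    have uc: "(\<lambda>s\<in>CX (k - 2). u s) \<in> cocycles (smooth_cplx X) U1 (k - 2)"
      unfolding U.KX.cocycle_iff
    proof (intro conjI ballI U.KX.cochain_restrict u(1))
      fix c assume "c \<in> CX (k - 2 + 1)"
      then have c: "c \<in> CX (k - 1)"
        by simp
      show "(\<lambda>s\<in>CX (k - 2). u s) (dX (k - 2 + 1) c) = \<one>\<^bsub>U1\<^esub>"
        using d_smooth_in[OF c] u_dX[OF c] by simp
    qed
    have "(flat_incl A (k - 1) \<circ> space_pull \<phi> A U1 (k - 2)) (cclass (smooth_cplx X) U1 (k - 2) (\<lambda>s\<in>CX (k - 2). u s)) = g"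
      unfolding flat_eq[OF uc]
    proof (rule extensionalityI[OF restrict_extensional ge])
      show "(\<lambda>z\<in>cycles (smooth_cplx A) (k - 2). (\<lambda>s\<in>CX (k - 2). u s) (ps (k - 2) z)) t = g t"
        if "t \<in> cycles (smooth_cplx A) (k - 2)" for t
        using that u_ps[OF that] ps_in[of t "k - 2"] by (simp add: cycles_smooth_iff)
    qed
    then show "\<exists>\<alpha>\<in>carrier (H_smooth X U1 (k - 2)). (flat_incl A (k - 1) \<circ> space_pull \<phi> A U1 (k - 2)) \<alpha> = g"
      using U.KX.cclass_in[OF uc] by (rule bexI)
  qed
qed

lemma (in smooth_mapping) exact_rel_diff_char:
  "exact_at (diff_char A (k - 1)) (i_map \<phi> X A k) (rel_diff_char \<phi> X A k) (p_map X k) (diff_char X k)"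
proof (rule exact_atI[OF comm_group_diff_char[OF A] comm_group_rel_diff_char comm_group_diff_char[OF X]
      i_map_hom p_map_hom])
  fix g assume g: "g \<in> carrier (diff_char A (k - 1))"
  then have "g 0 = 1"
    using cycle_hom_U1(2) by (auto simp: diff_char_carrier_iff)
  then show "p_map X k (i_map \<phi> X A k g) = \<one>\<^bsub>diff_char X k\<^esub>"
    unfolding p_map_def diff_char_one by (intro restrict_ext) (simp add: i_map_apply cone_cycle_fst)
next
  fix f assume f: "f \<in> carrier (rel_diff_char \<phi> X A k)" "p_map X k f = \<one>\<^bsub>diff_char X k\<^esub>"
  have fh: "f \<in> hom (cycle_group mcone (k - 1)) U1" and fe: "f \<in> extensional (cycles mcone (k - 1))"
    using f(1) by (simp_all add: rel_diff_char_carrier_iff)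
  obtain \<omega> \<theta> where \<omega>: "is_rel_curv \<phi> X A k f \<omega> \<theta>"
    using f(1) by (auto simp: rel_diff_char_carrier_iff)
  have f1: "f (z, 0) = 1" if "z \<in> cycles (smooth_cplx X) (k - 1)" for z
    using fun_cong[OF f(2), of z] that by (simp add: p_map_def diff_char_one)
  \<comment> \<open>The value \<open>f (s, t)\<close> does not depend on \<open>s\<close>, because
    \<open>f\<close> is 1 on cycles of X. This defines \<open>g\<close> on the cycles of A whose
    image in X bounds; divisibility gives the rest.\<close>
  obtain g where g: "g \<in> hom (cycle_group (smooth_cplx A) (k - 1 - 1)) U1"
    "\<And>p. p \<in> carrier (cycle_group mcone (k - 1)) \<Longrightarrow> g (snd p) = f p"
  proof (rule divisible_group_extension[OF comm_group_cycle_group[OF chain_cplx_smooth[of A], of "k - 1 - 1"] divisible_group_U1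
        group_cone_cycle_group[of "k - 1"], of snd f])
    show "snd \<in> hom (cycle_group mcone (k - 1)) (cycle_group (smooth_cplx A) (k - 1 - 1))"
      by (intro homI) (auto dest: cone_cycle_snd)
    show "f p = \<one>\<^bsub>U1\<^esub>" if p: "p \<in> carrier (cycle_group mcone (k - 1))" "snd p = \<one>\<^bsub>cycle_group (smooth_cplx A) (k - 1 - 1)\<^esub>" for p
    proof -
      have p0: "p = (fst p, 0)"
        using p(2) by (simp add: prod_eq_iff)
      with p(1) have "(fst p, 0) \<in> cycles mcone (k - 1)"
        by (metis carrier_cycle_group)
      then have "f (fst p, 0) = 1"
        by (intro f1) (simp only: cone_cycle_fst)
      with p0 show ?thesis
        by (metis one_U1)
    qed
  qed (use fh that in auto)
  have gf: "g t = f (s, t)" if "(s, t) \<in> cycles mcone (k - 1)" for s t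
    using g(2)[of "(s, t)"] that by simp
  let ?g = "\<lambda>z\<in>cycles (smooth_cplx A) (k - 1 - 1). g z"
  have "?g \<in> hom (cycle_group (smooth_cplx A) (k - 1 - 1)) U1"
    using group.hom_restrict[OF group_cycle_group_smooth g(1)] by simp
  moreover have "is_curv A (k - 1) ?g (\<lambda>\<sigma> t. - \<theta> \<sigma> t)"
    unfolding is_curv_def
  proof (intro conjI ballI forms_uminus[OF A])
    show "\<theta> \<in> forms A (nat (k - 1))"
      using \<omega> by (simp add: is_rel_curv_def)
    fix y assume y: "y \<in> CA (k - 1)"
    \<comment> \<open>The curvature condition only concerns boundaries, where \<open>g\<close> is
      determined by \<open>f\<close>: the boundary of \<open>y\<close> is the second component of
      the cone boundary of \<open>(0, - y)\<close>.\<close>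
    have "f (bd mcone k (0, - y)) = expU (chain_integral (nat k) \<omega> 0 + chain_integral (nat (k - 1)) \<theta> (- y))"
      using \<omega> uminus_smooth_cplx[OF y] zero_smooth_cplx unfolding is_rel_curv_def by blast
    moreover have "g (dA (k - 1) y) = f (bd mcone k (0, - y))"
      using gf[of "ps (k - 1) (- y)" "dA (k - 1) y"] cone_cycles_bd[OF zero_smooth_cplx uminus_smooth_cplx[OF y]]
      by (simp add: bd_mapping_cone d_smooth_uminus)
    ultimately show "?g (dA (k - 1) y) = expU (chain_integral (nat (k - 1)) (\<lambda>\<sigma> t. - \<theta> \<sigma> t) y)"
      using cycles_smooth_bd[OF y] by (simp add: chain_integral_form_uminus chain_integral_chain_uminus)
  qed
  ultimately have gc: "?g \<in> carrier (diff_char A (k - 1))"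
    unfolding diff_char_carrier_iff by (intro conjI exI restrict_extensional)
  have "i_map \<phi> X A k ?g = f"
  proof (rule extensionalityI[OF _ fe])
    show "i_map \<phi> X A k ?g \<in> extensional (cycles mcone (k - 1))"
      unfolding i_map_def by (rule restrict_extensional)
    fix p assume p: "p \<in> cycles mcone (k - 1)"
    obtain s t where st: "p = (s, t)"
      by (cases p)
    have pc: "(s, t) \<in> cycles mcone (k - 1)"
      using p st by simp
    show "i_map \<phi> X A k ?g p = f p"
      using gf[OF pc] cone_cycle_snd[OF pc] by (simp add: st i_map_apply[OF pc])
  qed
  then show "\<exists>g\<in>carrier (diff_char A (k - 1)). i_map \<phi> X A k g = f"
    using gc by (rule bexI)
qed

text \<open>For a cycle \<open>z\<close> of A the cone boundary of \<open>(0, z)\<close> is the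
  image of \<open>z\<close> in X, paired with 0. So integration of \<theta> is a real lift of the
  pulled back character, and for this lift the integral cochain is a difference of integrals of
  forms, hence 0.\<close>

lemma (in smooth_mapping) p_map_char_class_eq_one:
  assumes k: "2 \<le> k" and f: "f \<in> carrier (rel_diff_char \<phi> X A k)"
  shows "char_class A k (char_pull \<phi> A k (p_map X k f)) = \<one>\<^bsub>H_smooth A integer_group k\<^esub>"
proof -
  interpret Z: cochain_cplx "smooth_cplx A" integer_group
    by (rule cochain_cplx_smooth)
  have fh: "f \<in> hom (cycle_group mcone (k - 1)) U1"
    using f by (simp add: rel_diff_char_carrier_iff)
  obtain \<omega> \<theta> where \<omega>: "is_rel_curv \<phi> X A k f \<omega> \<theta>"
    using f by (auto simp: rel_diff_char_carrier_iff)
  have \<theta>: "\<theta> \<in> forms A (nat (k - 1))"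
    using \<omega> by (simp add: is_rel_curv_def)
  let ?h = "char_pull \<phi> A k (p_map X k f)"
  have h: "?h \<in> carrier (diff_char A k)"
    by (rule hom_in_carrier[OF char_pull_hom hom_in_carrier[OF p_map_hom f]])
  obtain \<eta> where \<eta>: "is_curv A k ?h \<eta>"
    using h by (auto simp: diff_char_carrier_iff)
  have \<eta>f: "\<eta> \<in> forms A (nat k)"
    using \<eta> by (simp add: is_curv_def)
  have lift: "?h z = expU (chain_integral (nat (k - 1)) \<theta> z)" if z: "z \<in> cycles (smooth_cplx A) (k - 1)" for z
  proof -
    have zc: "z \<in> CA (k - 1)" "dA (k - 1) z = 0"
      using z by (simp_all add: cycles_smooth_iff)
    have "f (bd mcone k (0, z)) = expU (chain_integral (nat k) \<omega> 0 + chain_integral (nat (k - 1)) \<theta> z)"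
      using \<omega> zc(1) zero_smooth_cplx unfolding is_rel_curv_def by blast
    then show ?thesis
      using z ps_cycles[OF z] zc(2) by (simp add: char_pull_def p_map_def bd_mapping_cone)
  qed
  have int: "chain_integral (nat k) \<eta> c = chain_integral (nat (k - 1)) \<theta> (dA k c)" if c: "c \<in> CA k" for c
  proof (rule integral_cochain_eq[OF A k \<eta>f \<theta> _ c])
    fix c assume c: "c \<in> CA k"
    have "expU (chain_integral (nat k) \<eta> c) = expU (chain_integral (nat (k - 1)) \<theta> (dA k c))"
      using lift[OF cycles_smooth_bd[OF c]] \<eta> c by (simp add: is_curv_def)
    moreover have "expU (chain_integral (nat (k - 1)) \<theta> (dA k c)) \<noteq> 0"
      using norm_expU[of "chain_integral (nat (k - 1)) \<theta> (dA k c)"] by (metis norm_zero zero_neq_one)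
    ultimately show "chain_integral (nat k) \<eta> c - chain_integral (nat (k - 1)) \<theta> (dA k c) \<in> \<int>"
      by (simp add: expU_diff flip: expU_eq_1_iff)
  qed
  have "char_class A k ?h = cclass (smooth_cplx A) integer_group k (\<lambda>c\<in>CA k. \<one>\<^bsub>integer_group\<^esub>)"
  proof (rule char_class_eq(2)[OF A k h \<eta> real_hom_cycles[OF chain_integral_hom] lift])
    show "(\<lambda>c\<in>CA k. \<one>\<^bsub>integer_group\<^esub>) \<in> carrier (cochains (smooth_cplx A) integer_group k)"
      by (rule Z.cocycleD(1)[OF Z.one_cocycle])
    show "of_int ((\<lambda>c\<in>CA k. \<one>\<^bsub>integer_group\<^esub>) x) = chain_integral (nat k) \<eta> x - chain_integral (nat (k - 1)) \<theta> (dA k x)"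
      if "x \<in> CA k" for x
      using int[OF that] that by simp
  qed
  then show ?thesis
    by (simp only: Z.cclass_one)
qed

lemma (in smooth_mapping) trivialising_form:
  assumes sA: "smooth_space A" and k: "2 \<le> k" and h: "h \<in> carrier (diff_char A k)"
    and one: "char_class A k h = \<one>\<^bsub>H_smooth A integer_group k\<^esub>"
  shows "\<exists>\<theta>\<in>forms A (nat (k - 1)). \<forall>z\<in>cycles (smooth_cplx A) (k - 1). h z = expU (chain_integral (nat (k - 1)) \<theta> z)"
proof -
  let ?K = "smooth_cplx A"
  interpret Z: cochain_cplx ?K integer_group
    by (rule cochain_cplx_smooth)
  interpret R: cochain_cplx ?K real_group
    by (rule cochain_cplx_smooth)
  have k1: "1 \<le> k" "1 \<le> k - 1"
    using k by simp_all
  have hh: "h \<in> hom (cycle_group ?K (k - 1)) U1"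
    using h by (simp add: diff_char_carrier_iff)
  obtain \<omega> where \<omega>: "is_curv A k h \<omega>"
    using h by (auto simp: diff_char_carrier_iff)
  obtain H \<mu> where H: "H \<in> hom (cgrp ?K (k - 1)) real_group"
    "\<And>z. z \<in> cycles ?K (k - 1) \<Longrightarrow> h z = expU (H z)"
    "\<mu> \<in> carrier (cochains ?K integer_group k)"
    "\<And>x. x \<in> CA k \<Longrightarrow> of_int (\<mu> x) = chain_integral (nat k) \<omega> x - H (dA k x)"
    using char_class_lift[OF A h \<omega>] by blast
  note cc = char_class_eq[OF A k h \<omega> real_hom_cycles[OF H(1)] H(2,3,4)]
  have "cclass ?K integer_group k \<mu> = \<one>\<^bsub>H_smooth A integer_group k\<^esub>"
    using one by (simp only: cc(2))
  moreover have "\<mu> \<in> cocycles ?K integer_group k"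
    by (rule char_class_eq(1)[OF A k h \<omega> real_hom_cycles[OF H(1)] H(2,3,4)])
  ultimately have "\<exists>\<nu>\<in>carrier (cochains ?K integer_group (k - 1)). \<forall>c\<in>CA k. \<mu> c = \<nu> (dA k c)"
    using Z.cclass_eq_one_iff[of \<mu> k] by simp
  then obtain \<nu> where \<nu>: "\<nu> \<in> carrier (cochains ?K integer_group (k - 1))" "\<forall>c\<in>CA k. \<mu> c = \<nu> (dA k c)"
    by (elim bexE)
  have \<nu>h: "\<nu> \<in> hom (cgrp ?K (k - 1)) integer_group"
    using \<nu>(1) by (simp add: cochains_carrier_iff)
  \<comment> \<open>Adding an integral cochain does not change \<open>expU\<close>, so \<rho> still
    lifts \<open>h\<close> on cycles; now the curvature integrates to the coboundary of \<rho>
    without an integral remainder.\<close>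
  define \<rho> where "\<rho> = (\<lambda>c. H c + of_int (\<nu> c))"
  have \<rho>: "\<rho> \<in> hom (cgrp ?K (k - 1)) real_group"
    using hom_mult[OF H(1)] hom_mult[OF \<nu>h] unfolding \<rho>_def by (intro homI) simp_all
  have "\<exists>\<theta>\<in>forms A (nat (k - 1)). ext_deriv A (nat (k - 1)) \<theta> = \<omega>"
  proof (rule de_rham_exact[OF sA k1(1) curvature_closed[OF sA k1(1) \<omega> hh] \<rho>])
    show "chain_integral (nat k) \<omega> c = \<rho> (dA k c)" if "c \<in> CA k" for c
      using H(4)[OF that] \<nu>(2) that by (simp add: \<rho>_def)
  qed
  then obtain \<theta>0 where \<theta>0: "\<theta>0 \<in> forms A (nat (k - 1))" "ext_deriv A (nat (k - 1)) \<theta>0 = \<omega>"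
    by (elim bexE)
  have stokes0: "chain_integral (nat (k - 1)) \<theta>0 (dA k c) = \<rho> (dA k c)" if c: "c \<in> CA k" for c
  proof -
    have "nat k = Suc (nat (k - 1))" "int (Suc (nat (k - 1))) = k"
      using k by simp_all
    then have "chain_integral (nat k) \<omega> c = chain_integral (nat (k - 1)) \<theta>0 (dA k c)"
      using stokes[OF smooth_spaceD(2)[OF sA] \<theta>0(1), of c] c by (simp only: \<theta>0(2) bd_smooth_cplx)
    then show ?thesis
      using H(4)[OF c] \<nu>(2) c by (simp add: \<rho>_def)
  qed
  \<comment> \<open>\<rho> and the integral of \<open>\<theta>0\<close> have the same coboundary.
    Their difference is a real cocycle, which a closed form absorbs up to a coboundary, and the
    latter disappears on cycles.\<close>
  define \<kappa> where "\<kappa> = (\<lambda>c\<in>CA (k - 1). \<rho> c - chain_integral (nat (k - 1)) \<theta>0 c)"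
  have "(\<lambda>c. \<rho> c - chain_integral (nat (k - 1)) \<theta>0 c) \<in> hom (cgrp ?K (k - 1)) real_group"
    using hom_mult[OF \<rho>] by (intro homI) (simp_all add: chain_integral_chain_add)
  then have \<kappa>c: "\<kappa> \<in> carrier (cochains ?K real_group (k - 1))"
    unfolding \<kappa>_def by (rule R.cochain_restrict)
  have \<kappa>: "\<kappa> \<in> cocycles ?K real_group (k - 1)"
    unfolding R.cocycle_iff
  proof (intro conjI \<kappa>c ballI)
    fix c assume "c \<in> CA (k - 1 + 1)"
    then have c: "c \<in> CA k"
      by simp
    show "\<kappa> (dA (k - 1 + 1) c) = \<one>\<^bsub>real_group\<^esub>"
      using stokes0[OF c] d_smooth_in[OF c] by (simp add: \<kappa>_def)
  qed
  obtain \<theta>1 u where \<theta>1: "\<theta>1 \<in> closed_forms A (nat (k - 1))" and u: "u \<in> hom (cgrp ?K (k - 1 - 1)) real_group"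
    "\<And>c. c \<in> CA (k - 1) \<Longrightarrow> chain_integral (nat (k - 1)) \<theta>1 c = u (dA (k - 1) c) + \<kappa> c"
    by (rule de_rham_surj[OF sA k1(2) \<kappa>]) (rule that)
  have \<theta>1f: "\<theta>1 \<in> forms A (nat (k - 1))"
    using \<theta>1 by (simp add: closed_forms_def)
  show ?thesis
  proof (intro bexI ballI)
    show "(\<lambda>\<sigma> t. \<theta>0 \<sigma> t + \<theta>1 \<sigma> t) \<in> forms A (nat (k - 1))"
      by (rule forms_add[OF \<theta>0(1) \<theta>1f])
    fix z assume z: "z \<in> cycles ?K (k - 1)"
    have zc: "z \<in> CA (k - 1)" "dA (k - 1) z = 0"
      using z by (simp_all add: cycles_smooth_iff)
    have "u 0 = 0"
      using hom_mult[OF u(1), of 0 0] by simp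
    then have "chain_integral (nat (k - 1)) (\<lambda>\<sigma> t. \<theta>0 \<sigma> t + \<theta>1 \<sigma> t) z = \<rho> z"
      using u(2)[OF zc(1)] zc chain_integral_form_add[OF A \<theta>0(1) \<theta>1f keys_smooth_cplx[OF zc(1)]]
      by (simp add: \<kappa>_def)
    then show "h z = expU (chain_integral (nat (k - 1)) (\<lambda>\<sigma> t. \<theta>0 \<sigma> t + \<theta>1 \<sigma> t) z)"
      using H(2)[OF z] by (simp add: \<rho>_def expU_add expU_of_int)
  qed
qed

lemma (in smooth_mapping) p_map_lift:
  assumes h: "h \<in> carrier (diff_char X k)" and \<theta>: "\<theta> \<in> forms A (nat (k - 1))"
    and eq: "\<And>z. z \<in> cycles (smooth_cplx A) (k - 1) \<Longrightarrow> h (ps (k - 1) z) = expU (chain_integral (nat (k - 1)) \<theta> z)"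
  shows "\<exists>f\<in>carrier (rel_diff_char \<phi> X A k). p_map X k f = h"
proof -
  have hh: "h \<in> hom (cycle_group (smooth_cplx X) (k - 1)) U1" and he: "h \<in> extensional (cycles (smooth_cplx X) (k - 1))"
    using h by (simp_all add: diff_char_carrier_iff)
  obtain \<omega> where \<omega>: "is_curv X k h \<omega>"
    using h by (auto simp: diff_char_carrier_iff)
  note h_hom = cycle_hom_U1[OF hh]
  \<comment> \<open>The relative character is prescribed by \<open>h\<close> on cycles of X and by
    the pair of forms on cone boundaries. A relation between these forces the boundary of
    \<open>y\<close> to be 0, and then the hypothesis on \<theta> gives the value of
    \<open>h\<close> on the image of \<open>y\<close>, so that the prescriptions agree.\<close>
  define a where "a = (\<lambda>(z, x, y). (z + (dX k x + ps (k - 1) y), - dA (k - 1) y))"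
  define b where "b = (\<lambda>(z, x, y). h z * expU (chain_integral (nat k) \<omega> x + chain_integral (nat (k - 1)) \<theta> y))"
  let ?P = "cycle_group (smooth_cplx X) (k - 1) \<times>\<times> cgrp mcone k"
  have P_iff: "(z, x, y) \<in> carrier ?P \<longleftrightarrow> z \<in> cycles (smooth_cplx X) (k - 1) \<and> x \<in> CX k \<and> y \<in> CA (k - 1)" for z x y
    by (simp add: carrier_mapping_cone)
  have a_in: "a (z, x, y) \<in> cycles mcone (k - 1)"
    if z: "z \<in> cycles (smooth_cplx X) (k - 1)" and x: "x \<in> CX k" and y: "y \<in> CA (k - 1)" for z x y
    using cone_cycles_bd[OF x y] z
    by (simp add: a_def bd_mapping_cone cone_cycle_iff cycles_smooth_iff add_smooth_cplx d_smooth_add add.assoc)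
  obtain f where f: "f \<in> hom (cycle_group mcone (k - 1)) U1" "\<And>p. p \<in> carrier ?P \<Longrightarrow> f (a p) = b p"
  proof (rule divisible_group_extension[OF comm_group_cycle_group[OF chain_cplx_cone, of "k - 1"] divisible_group_U1
        DirProd_group[OF group_cycle_group_smooth[of X "k - 1"] chain_cplx.group_cgrp[OF chain_cplx_cone, of k]], of a b])
    show "a \<in> hom ?P (cycle_group mcone (k - 1))"
    proof (rule homI)
      fix p assume p: "p \<in> carrier ?P"
      obtain z x y where zxy: "p = (z, x, y)"
        by (cases p)
      have pc: "z \<in> cycles (smooth_cplx X) (k - 1)" "x \<in> CX k" "y \<in> CA (k - 1)"
        using p unfolding zxy P_iff by simp_all
      show "a p \<in> carrier (cycle_group mcone (k - 1))"
        using a_in[OF pc] by (simp add: zxy)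
      fix q assume q: "q \<in> carrier ?P"
      obtain z' x' y' where zxy': "q = (z', x', y')"
        by (cases q)
      show "a (p \<otimes>\<^bsub>?P\<^esub> q) = a p \<otimes>\<^bsub>cycle_group mcone (k - 1)\<^esub> a q"
        by (simp add: zxy zxy' a_def d_smooth_add ps_add)
    qed
    show "b \<in> hom ?P U1"
    proof (rule homI)
      fix p assume p: "p \<in> carrier ?P"
      obtain z x y where zxy: "p = (z, x, y)"
        by (cases p)
      have pc: "z \<in> cycles (smooth_cplx X) (k - 1)"
        using p unfolding zxy P_iff by simp
      show "b p \<in> carrier U1"
        using h_hom(3)[OF pc] by (simp add: zxy b_def norm_mult)
      fix q assume q: "q \<in> carrier ?P"
      obtain z' x' y' where zxy': "q = (z', x', y')"
        by (cases q)
      have qc: "z' \<in> cycles (smooth_cplx X) (k - 1)"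
        using q unfolding zxy' P_iff by simp
      show "b (p \<otimes>\<^bsub>?P\<^esub> q) = b p \<otimes>\<^bsub>U1\<^esub> b q"
        by (simp add: zxy zxy' b_def h_hom(1)[OF pc qc] chain_integral_chain_add expU_add)
    qed
    fix p assume p: "p \<in> carrier ?P" "a p = \<one>\<^bsub>cycle_group mcone (k - 1)\<^esub>"
    obtain z x y where zxy: "p = (z, x, y)"
      by (cases p)
    have z: "z \<in> cycles (smooth_cplx X) (k - 1)" and x: "x \<in> CX k" and y: "y \<in> CA (k - 1)"
      using p(1) unfolding zxy P_iff by simp_all
    have eqs: "z + (dX k x + ps (k - 1) y) = 0" "dA (k - 1) y = 0"
      using p(2) by (simp_all add: zxy a_def)
    have yc: "y \<in> cycles (smooth_cplx A) (k - 1)"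
      using y eqs(2) by (simp add: cycles_smooth_iff)
    note dx = cycles_smooth_bd[OF x] and py = ps_cycles[OF yc]
    have "h z * (h (dX k x) * h (ps (k - 1) y)) = h (z + (dX k x + ps (k - 1) y))"
      by (simp only: h_hom(1)[OF z cycles_smooth_add[OF dx py]] h_hom(1)[OF dx py])
    also have "\<dots> = 1"
      by (simp only: eqs h_hom(2))
    also have "h (dX k x) = expU (chain_integral (nat k) \<omega> x)"
      using \<omega> x by (simp add: is_curv_def)
    finally show "b p = \<one>\<^bsub>U1\<^esub>"
      by (simp add: zxy b_def eq[OF yc] expU_add)
  qed (use that in blast)
  let ?f = "\<lambda>c\<in>cycles mcone (k - 1). f c"
  have f_ab: "?f (a (z, x, y)) = b (z, x, y)"
    if "z \<in> cycles (smooth_cplx X) (k - 1)" "x \<in> CX k" "y \<in> CA (k - 1)" for z x y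
    using f(2)[of "(z, x, y)"] a_in[OF that] that unfolding P_iff by simp
  have "?f \<in> hom (cycle_group mcone (k - 1)) U1"
    using group.hom_restrict[OF group_cone_cycle_group f(1)] by simp
  moreover have "is_rel_curv \<phi> X A k ?f \<omega> \<theta>"
    unfolding is_rel_curv_def
  proof (intro conjI ballI \<theta>)
    show "\<omega> \<in> forms X (nat k)"
      using \<omega> by (simp add: is_curv_def)
    show "?f (bd mcone k (x, y)) = expU (chain_integral (nat k) \<omega> x + chain_integral (nat (k - 1)) \<theta> y)"
      if "x \<in> CX k" "y \<in> CA (k - 1)" for x y
    proof -
      have "bd mcone k (x, y) = a (0, x, y)"
        by (simp add: a_def bd_mapping_cone)
      then show ?thesis
        by (simp only: f_ab[OF cycles_smooth_0 that]) (simp add: b_def h_hom(2))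
    qed
  qed
  ultimately have fc: "?f \<in> carrier (rel_diff_char \<phi> X A k)"
    unfolding rel_diff_char_carrier_iff by (intro conjI exI restrict_extensional)
  have "p_map X k ?f = h"
  proof (rule extensionalityI[OF _ he])
    show "p_map X k ?f \<in> extensional (cycles (smooth_cplx X) (k - 1))"
      unfolding p_map_def by (rule restrict_extensional)
    fix z assume z: "z \<in> cycles (smooth_cplx X) (k - 1)"
    have "(z, 0) = a (z, 0, 0)"
      by (simp add: a_def)
    then have "?f (z, 0) = h z"
      by (simp only: f_ab[OF z zero_smooth_cplx zero_smooth_cplx]) (simp add: b_def)
    then show "p_map X k ?f z = h z"
      using z by (simp only: p_map_def restrict_apply')
  qed
  then show ?thesis
    using fc by (rule bexI)
qed

text \<open>The form that trivialises the pulled back character on A becomes the second component of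
  the pair belonging to the relative character.\<close>

lemma (in smooth_mapping) exact_diff_char_X:
  assumes sA: "smooth_space A" and k: "2 \<le> k"
  shows "exact_at (rel_diff_char \<phi> X A k) (p_map X k)
     (diff_char X k) (char_class A k \<circ> char_pull \<phi> A k) (H_smooth A integer_group k)"
proof -
  interpret Z: cochain_cplx "smooth_cplx A" integer_group
    by (rule cochain_cplx_smooth)
  show ?thesis
  proof (rule exact_atI[OF comm_group_rel_diff_char comm_group_diff_char[OF X] Z.comm_group_cohomology
        p_map_hom hom_compose[OF char_pull_hom char_class_hom[OF A k]]])
    show "(char_class A k \<circ> char_pull \<phi> A k) (p_map X k f) = \<one>\<^bsub>H_smooth A integer_group k\<^esub>"
      if "f \<in> carrier (rel_diff_char \<phi> X A k)" for f
      using p_map_char_class_eq_one[OF k that] by simp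
    fix h assume h: "h \<in> carrier (diff_char X k)"
      "(char_class A k \<circ> char_pull \<phi> A k) h = \<one>\<^bsub>H_smooth A integer_group k\<^esub>"
    have "char_class A k (char_pull \<phi> A k h) = \<one>\<^bsub>H_smooth A integer_group k\<^esub>"
      using h(2) by simp
    from trivialising_form[OF sA k hom_in_carrier[OF char_pull_hom h(1)] this]
    obtain \<theta> where \<theta>: "\<theta> \<in> forms A (nat (k - 1))"
      "\<forall>z\<in>cycles (smooth_cplx A) (k - 1). char_pull \<phi> A k h z = expU (chain_integral (nat (k - 1)) \<theta> z)"
      by (elim bexE)
    show "\<exists>f\<in>carrier (rel_diff_char \<phi> X A k). p_map X k f = h"
    proof (rule p_map_lift[OF h(1) \<theta>(1)])
      show "h (ps (k - 1) z) = expU (chain_integral (nat (k - 1)) \<theta> z)" if "z \<in> cycles (smooth_cplx A) (k - 1)" for z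
        using \<theta>(2)[rule_format, OF that] that by (simp add: char_pull_def)
    qed
  qed
qed

text \<open>By naturality the first map is the characteristic class on X followed by the pullback.
  The former is surjective, so the image is that of the pullback in the mapping cone
  sequence.\<close>

lemma (in smooth_mapping) exact_H_smooth_A:
  assumes sX: "smooth_space X" and k: "2 \<le> k"
  shows "exact_at (diff_char X k) (char_class A k \<circ> char_pull \<phi> A k)
     (H_smooth A integer_group k) (cone_incl \<phi> X A integer_group (k + 1)) (H_rel \<phi> X A integer_group (k + 1))"
proof (rule exact_at_epi)
  interpret Z: smooth_mapping_coeff X A \<phi> integer_group
    by (intro smooth_mapping_coeff.intro smooth_mapping_axioms abelian_integer_group)
  show "exact_at (H_smooth X integer_group k) (space_pull \<phi> A integer_group k)
     (H_smooth A integer_group k) (cone_incl \<phi> X A integer_group (k + 1)) (H_rel \<phi> X A integer_group (k + 1))"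
    by (rule Z.cone_exact_A)
  show "comm_group (diff_char X k)"
    by (rule comm_group_diff_char[OF X])
  show "char_class X k \<in> hom (diff_char X k) (H_smooth X integer_group k)"
    by (rule char_class_hom[OF X k])
  show "char_class X k ` carrier (diff_char X k) = carrier (H_smooth X integer_group k)"
    by (rule char_class_surj[OF sX k])
  show "(char_class A k \<circ> char_pull \<phi> A k) h = space_pull \<phi> A integer_group k (char_class X k h)"
    if "h \<in> carrier (diff_char X k)" for h
    using char_class_pull[OF k that] by simp
  show "char_class A k \<circ> char_pull \<phi> A k \<in> hom (diff_char X k) (H_smooth A integer_group k)"
    by (rule hom_compose[OF char_pull_hom char_class_hom[OF A k]])
qed

text \<open>One exactness statement for each group of the sequence. The ranges of \<open>n\<close>
  stop where a neighbouring map of the mapping cone sequence is replaced by one into or out of a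
  group of characters; degrees are integers, and the cohomology groups of negative degree are
  trivial.\<close>

theorem corollary8p8:
  fixes X :: "'a dspace" and A :: "'b dspace" and \<phi> :: "'b \<Rightarrow> 'a" and k :: int
  assumes "smooth_space A" and "smooth_space X" and "smooth_map A X \<phi>" and "2 \<le> k"
  shows
    "(\<forall>n \<le> k - 2.
        exact_at (H_smooth A U1 (n - 1)) (cone_incl \<phi> X A U1 n)
          (H_rel \<phi> X A U1 n) (cone_restr X U1 n) (H_smooth X U1 n)) \<and>
     (\<forall>n < k - 2.
        exact_at (H_rel \<phi> X A U1 n) (cone_restr X U1 n)
          (H_smooth X U1 n) (space_pull \<phi> A U1 n) (H_smooth A U1 n)) \<and>
     (\<forall>n < k - 2.
        exact_at (H_smooth X U1 n) (space_pull \<phi> A U1 n)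
          (H_smooth A U1 n) (cone_incl \<phi> X A U1 (n + 1)) (H_rel \<phi> X A U1 (n + 1))) \<and>
     exact_at (H_rel \<phi> X A U1 (k - 2)) (cone_restr X U1 (k - 2))
       (H_smooth X U1 (k - 2)) (flat_incl A (k - 1) \<circ> space_pull \<phi> A U1 (k - 2))
       (diff_char A (k - 1)) \<and>
     exact_at (H_smooth X U1 (k - 2)) (flat_incl A (k - 1) \<circ> space_pull \<phi> A U1 (k - 2))
       (diff_char A (k - 1)) (i_map \<phi> X A k)
       (rel_diff_char \<phi> X A k) \<and>
     exact_at (diff_char A (k - 1)) (i_map \<phi> X A k)
       (rel_diff_char \<phi> X A k) (p_map X k)
       (diff_char X k) \<and>
     exact_at (rel_diff_char \<phi> X A k) (p_map X k)
       (diff_char X k) (char_class A k \<circ> char_pull \<phi> A k)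
       (H_smooth A integer_group k) \<and>
     exact_at (diff_char X k) (char_class A k \<circ> char_pull \<phi> A k)
       (H_smooth A integer_group k) (cone_incl \<phi> X A integer_group (k + 1))
       (H_rel \<phi> X A integer_group (k + 1)) \<and>
     (\<forall>n > k.
        exact_at (H_smooth A integer_group (n - 1)) (cone_incl \<phi> X A integer_group n)
          (H_rel \<phi> X A integer_group n) (cone_restr X integer_group n)
          (H_smooth X integer_group n)) \<and>
     (\<forall>n > k.
        exact_at (H_rel \<phi> X A integer_group n) (cone_restr X integer_group n)
          (H_smooth X integer_group n) (space_pull \<phi> A integer_group n)
          (H_smooth A integer_group n)) \<and>
     (\<forall>n > k.
        exact_at (H_smooth X integer_group n) (space_pull \<phi> A integer_group n)
          (H_smooth A integer_group n) (cone_incl \<phi> X A integer_group (n + 1))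
          (H_rel \<phi> X A integer_group (n + 1)))"
proof -
  have X: "differential_space X" and A: "differential_space A"
    using assms(1,2) by (simp_all only: smooth_spaceD(1))
  interpret smooth_mapping X A \<phi>
    by (rule smooth_mapping.intro[OF X A assms(3)])
  interpret U: smooth_mapping_coeff X A \<phi> U1
    by (intro smooth_mapping_coeff.intro smooth_mapping_axioms comm_group_U1)
  interpret Z: smooth_mapping_coeff X A \<phi> integer_group
    by (intro smooth_mapping_coeff.intro smooth_mapping_axioms abelian_integer_group)
  show ?thesis
    by (intro conjI allI impI U.cone_exact_rel U.cone_exact_X U.cone_exact_A exact_flat_X exact_diff_char_A
        exact_rel_diff_char exact_diff_char_X[OF assms(1,4)] exact_H_smooth_A[OF assms(2,4)]
        Z.cone_exact_rel Z.cone_exact_X Z.cone_exact_A)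
qed

end
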